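(* The class of n-slender groups is contained in the class of inverse limit slender groups, the class of inverse limit slender groups is contained in the class of slender groups, and the class of slender groups is contained in the class of lch-slender groups. All three containments are strict. Furthermore, among abelian groups the classes of n-slender groups, inverse limit slender groups and slender groups coincide.
   Context: Groups need not be abelian. Slender: a group $G$ is slender if every homomorphism $\varphi\colon\mathbb{Z}^{\mathbb{N}}\to G$ factors through some projection $\mathrm{pr}_n\colon\mathbb{Z}^{\mathbb{N}}\to\mathbb{Z}^n$ onto the first $n$ factors, i.e. $\varphi=\varphi'\circ\mathrm{pr}_n$ for some $n\in\mathbb N$ and some homomorphism $\varphi'\colon\mathbb{Z}^n\to G$. Inverse limit slender: an inverse sequence of groups $(H_i,p_i^j)$ (homomorphisms $p_i^j\colon H_j\to H_i$ for $i<j$ with $p_i^jp_j^k=p_i^k$) satisfies the Mittag-Leffler condition if for every $i$ there is $j>i$ with $p_i^k(H_k)=p_i^j(H_j)$ for all $k\ge j$. A group $G$ is inverse limit slender if for every such Mittag-Leffler inverse sequence and every homomorphism $\varphi\colon\varprojlim H_i\to G$ there exist $i$ and a homomorphism $\overline\varphi\colon H_i\to G$ with $\varphi=\overline\varphi\circ p_i$, where $p_i\colon\varprojlim H_i\to H_i$ is the projection. n-slender: let $\mathbb{H}$ be the free complete product of countably many infinite cyclic groups, i.e. the fundamental group of the Hawaiian earring (a countable one-point union of circles in the plane whose radii decrease to zero), and let $\mathbb{H}\to F_n$ be the projection to the free group on $n$ letters induced by the map collapsing all but the first $n$ circles to the base point. A group $G$ is n-slender if every homomorphism $\mathbb{H}\to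 G$ factors through some projection $\mathbb{H}\to F_n$. lch-slender: a (discrete) group $G$ is lch-slender if every abstract group homomorphism from a locally compact Hausdorff topological group to $G$ has open kernel. *)

theory Defs
  imports "HOL-Analysis.Analysis" "HOL-Algebra.Product_Groups"
begin

section \<open>The fundamental group of the Hawaiian earring\<close>

definition loops :: "'a::topological_space set \<Rightarrow> 'a \<Rightarrow> (real \<Rightarrow> 'a) set" where
  "loops S x = {p. path p \<and> path_image p \<subseteq> S \<and> pathstart p = x \<and> pathfinish p = x}"

definition path_class :: "'a::topological_space set \<Rightarrow> (real \<Rightarrow> 'a) \<Rightarrow> (real \<Rightarrow> 'a) set" where
  "path_class S p = {q. homotopic_paths S p q}"

definition fundamental_group :: "'a::topological_space set \<Rightarrow> 'a \<Rightarrow> (real \<Rightarrow> 'a) set monoid" where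
  "fundamental_group S x =
     \<lparr>carrier = path_class S ` loops S x,
      mult = (\<lambda>A B. \<Union>p\<in>A. \<Union>q\<in>B. path_class S (p +++ q)),
      one = path_class S (\<lambda>_. x)\<rparr>"

definition induced_map :: "'b::topological_space set \<Rightarrow> ('a::topological_space \<Rightarrow> 'b)
    \<Rightarrow> (real \<Rightarrow> 'a) set \<Rightarrow> (real \<Rightarrow> 'b) set" where
  "induced_map T f A = (\<Union>p\<in>A. path_class T (f \<circ> p))"

text \<open>The circle of radius \<open>1 / (n + 1)\<close> that touches the imaginary axis at the base point \<open>0\<close>.\<close>

definition earring_circle :: "nat \<Rightarrow> complex set" where
  "earring_circle n = sphere (of_real (1 / (real n + 1))) (1 / (real n + 1))"

definition hawaiian_earring :: "complex set" where
  "hawaiian_earring = (\<Union>n. earring_circle n)"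

text \<open>The base point is inserted so that the bouquet of no circles is a point.\<close>

definition bouquet :: "nat \<Rightarrow> complex set" where
  "bouquet n = insert 0 (\<Union>i<n. earring_circle i)"

definition collapse :: "nat \<Rightarrow> complex \<Rightarrow> complex" where
  "collapse n z = (if z \<in> bouquet n then z else 0)"

abbreviation earring_group :: "(real \<Rightarrow> complex) set monoid" where
  "earring_group \<equiv> fundamental_group hawaiian_earring 0"

text \<open>The free group on \<open>n\<close> letters enters as the fundamental group of the bouquet of the first
  \<open>n\<close> circles, which is the codomain of the homomorphism induced by \<open>collapse n\<close>.\<close>

abbreviation bouquet_group :: "nat \<Rightarrow> (real \<Rightarrow> complex) set monoid" where
  "bouquet_group n \<equiv> fundamental_group (bouquet n) 0"

abbreviation earring_proj :: "nat \<Rightarrow> (real \<Rightarrow> complex) set \<Rightarrow> (real \<Rightarrow> complex) set" where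
  "earring_proj n \<equiv> induced_map (bouquet n) (collapse n)"


section \<open>Inverse sequences\<close>

text \<open>\<open>p i j\<close> is the bonding map from \<open>H j\<close> to \<open>H i\<close>, constrained only for \<open>i < j\<close>.\<close>

definition inverse_sequence :: "(nat \<Rightarrow> 'h monoid) \<Rightarrow> (nat \<Rightarrow> nat \<Rightarrow> 'h \<Rightarrow> 'h) \<Rightarrow> bool" where
  "inverse_sequence H p \<longleftrightarrow>
     (\<forall>i. group (H i)) \<and>
     (\<forall>i j. i < j \<longrightarrow> p i j \<in> hom (H j) (H i)) \<and>
     (\<forall>i j k. i < j \<longrightarrow> j < k \<longrightarrow> (\<forall>x\<in>carrier (H k). p i j (p j k x) = p i k x))"

definition mittag_leffler :: "(nat \<Rightarrow> 'h monoid) \<Rightarrow> (nat \<Rightarrow> nat \<Rightarrow> 'h \<Rightarrow> 'h) \<Rightarrow> bool" where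
  "mittag_leffler H p \<longleftrightarrow>
     (\<forall>i. \<exists>j>i. \<forall>k\<ge>j. p i k ` carrier (H k) = p i j ` carrier (H j))"

definition inverse_limit :: "(nat \<Rightarrow> 'h monoid) \<Rightarrow> (nat \<Rightarrow> nat \<Rightarrow> 'h \<Rightarrow> 'h) \<Rightarrow> (nat \<Rightarrow> 'h) monoid" where
  "inverse_limit H p = (product_group UNIV H)
     \<lparr>carrier := {x \<in> carrier (product_group UNIV H). \<forall>i j. i < j \<longrightarrow> p i j (x j) = x i}\<rparr>"


section \<open>Locally compact Hausdorff topological groups\<close>

definition topological_group :: "'l monoid \<Rightarrow> 'l topology \<Rightarrow> bool" where
  "topological_group L X \<longleftrightarrow>
     group L \<and> topspace X = carrier L \<and>
     continuous_map (prod_topology X X) X (\<lambda>(x, y). x \<otimes>\<^bsub>L\<^esub> y) \<and>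
     continuous_map X X (\<lambda>x. inv\<^bsub>L\<^esub> x)"

definition lch_group :: "'l monoid \<Rightarrow> 'l topology \<Rightarrow> bool" where
  "lch_group L X \<longleftrightarrow> topological_group L X \<and> locally_compact_space X \<and> Hausdorff_space X"


section \<open>The four classes of groups\<close>

definition n_slender :: "'g monoid \<Rightarrow> bool" where
  "n_slender G \<longleftrightarrow> group G \<and>
     (\<forall>\<phi> \<in> hom earring_group G. \<exists>n. \<exists>\<psi> \<in> hom (bouquet_group n) G.
        \<forall>x \<in> carrier earring_group. \<phi> x = \<psi> (earring_proj n x))"

definition slender :: "'g monoid \<Rightarrow> bool" where
  "slender G \<longleftrightarrow> group G \<and>
     (\<forall>\<phi> \<in> hom (product_group (UNIV :: nat set) (\<lambda>_. integer_group)) G.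
        \<exists>n. \<exists>\<psi> \<in> hom (product_group {..<n} (\<lambda>_. integer_group)) G.
          \<forall>x \<in> carrier (product_group UNIV (\<lambda>_. integer_group)). \<phi> x = \<psi> (restrict x {..<n}))"

text \<open>A definition cannot quantify over all types, so the test objects of the remaining two
  notions live in a type that is passed as a parameter. The choice is immaterial: by
  \<open>inverse_limit_slender_type_independent\<close> below, all infinite types \<open>'h\<close> give the same notion, and by
  \<open>lch_slender_type_independent\<close>, \<open>lch_slender TYPE(nat set set)\<close> implies \<open>lch_slender TYPE('l)\<close>
  for every type \<open>'l\<close>.\<close>

definition inverse_limit_slender :: "'h itself \<Rightarrow> 'g monoid \<Rightarrow> bool" where
  "inverse_limit_slender (_ :: 'h itself) G \<longleftrightarrow> group G \<and>
     (\<forall>(H :: nat \<Rightarrow> 'h monoid) p. inverse_sequence H p \<longrightarrow> mittag_leffler H p \<longrightarrow>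
        (\<forall>\<phi> \<in> hom (inverse_limit H p) G. \<exists>i. \<exists>\<psi> \<in> hom (H i) G.
           \<forall>x \<in> carrier (inverse_limit H p). \<phi> x = \<psi> (x i)))"

definition lch_slender :: "'l itself \<Rightarrow> 'g monoid \<Rightarrow> bool" where
  "lch_slender (_ :: 'l itself) G \<longleftrightarrow> group G \<and>
     (\<forall>(L :: 'l monoid) X. lch_group L X \<longrightarrow>
        (\<forall>\<phi> \<in> hom L G. openin X (kernel L G \<phi>)))"


section \<open>The projections of the earring group are homomorphisms\<close>

lemma loopsD:
  assumes "p \<in> loops S x"
  shows "path p" "path_image p \<subseteq> S" "pathstart p = x" "pathfinish p = x" "homotopic_paths S p p"
  using assms by (auto simp: loops_def)

lemma loops_homotopic: "p \<in> loops S x \<Longrightarrow> homotopic_paths S p q \<Longrightarrow> q \<in> loops S x"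
  by (simp add: loops_def homotopic_paths_imp_pathstart[symmetric]
      homotopic_paths_imp_pathfinish[symmetric])
    (use homotopic_paths_imp_path homotopic_paths_imp_subset in blast)

lemma path_class_eq: "homotopic_paths S p q \<Longrightarrow> path_class S p = path_class S q"
  unfolding path_class_def using homotopic_paths_sym homotopic_paths_trans by blast

lemma loops_join: "p \<in> loops S x \<Longrightarrow> q \<in> loops S x \<Longrightarrow> p +++ q \<in> loops S x"
  by (auto simp: loops_def path_image_join)

lemma loops_reverse: "p \<in> loops S x \<Longrightarrow> reversepath p \<in> loops S x"
  by (auto simp: loops_def)

lemma loops_const: "x \<in> S \<Longrightarrow> (\<lambda>_. x) \<in> loops S x"
  by (auto simp: loops_def path_def path_image_def pathstart_def pathfinish_def)

lemma fundamental_group_mult: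
  assumes p: "p \<in> loops S x" and q: "q \<in> loops S x"
  shows "path_class S p \<otimes>\<^bsub>fundamental_group S x\<^esub> path_class S q = path_class S (p +++ q)"
proof -
  have "path_class S (p' +++ q') = path_class S (p +++ q)"
    if "homotopic_paths S p p'" "homotopic_paths S q q'" for p' q'
    using homotopic_paths_join[OF that] loopsD[OF p] loopsD[OF q]
    by (intro path_class_eq[symmetric]) simp
  hence "path_class S (p' +++ q') = path_class S (p +++ q)"
    if "p' \<in> path_class S p" "q' \<in> path_class S q" for p' q'
    using that by (simp add: path_class_def)
  moreover have "p \<in> path_class S p" "q \<in> path_class S q"
    using p q loopsD(5) by (auto simp: path_class_def)
  ultimately have "(\<Union>p'\<in>path_class S p. \<Union>q'\<in>path_class S q. path_class S (p' +++ q')) =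
      path_class S (p +++ q)" by blast
  thus ?thesis by (simp add: fundamental_group_def)
qed

lemma group_fundamental_group:
  fixes x :: "'a::real_normed_vector"
  assumes "x \<in> S"
  shows "group (fundamental_group S x)"
proof (rule groupI)
  let ?P = "fundamental_group S x"
  have c: "carrier ?P = path_class S ` loops S x" and o: "\<one>\<^bsub>?P\<^esub> = path_class S (\<lambda>_. x)"
    by (auto simp: fundamental_group_def)
  note m = fundamental_group_mult
  show "\<one>\<^bsub>?P\<^esub> \<in> carrier ?P" using loops_const[OF assms] by (auto simp: c o)
  show "a \<otimes>\<^bsub>?P\<^esub> b \<in> carrier ?P" if "a \<in> carrier ?P" "b \<in> carrier ?P" for a b
    using that by (auto simp: c m loops_join)
  fix a assume "a \<in> carrier ?P"
  then obtain p where p: "p \<in> loops S x" "a = path_class S p" by (auto simp: c)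
  have "homotopic_paths S (linepath x x +++ p) p"
    using loopsD[OF p(1)] by (intro homotopic_paths_lid') simp_all
  thus "\<one>\<^bsub>?P\<^esub> \<otimes>\<^bsub>?P\<^esub> a = a"
    using p assms loops_const[of x S] by (simp add: o m path_class_eq linepath_refl)
  have "path_class S (reversepath p) \<otimes>\<^bsub>?P\<^esub> a = path_class S (reversepath p +++ p)"
    by (simp only: p(2) m[OF loops_reverse[OF p(1)] p(1)])
  also have "\<dots> = \<one>\<^bsub>?P\<^esub>"
    unfolding o using p(1) homotopic_paths_linv[of p S] loopsD[OF p(1)]
    by (intro path_class_eq) (simp add: linepath_refl)
  finally show "\<exists>b\<in>carrier ?P. b \<otimes>\<^bsub>?P\<^esub> a = \<one>\<^bsub>?P\<^esub>"
    using loops_reverse[OF p(1)] by (auto simp: c)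
  fix b d assume "b \<in> carrier ?P" "d \<in> carrier ?P"
  then obtain q r where q: "q \<in> loops S x" "b = path_class S q" "r \<in> loops S x" "d = path_class S r"
    by (auto simp: c)
  have "homotopic_paths S (p +++ (q +++ r)) ((p +++ q) +++ r)"
    using loopsD[OF p(1)] loopsD[OF q(1)] loopsD[OF q(3)] by (intro homotopic_paths_assoc) simp_all
  thus "a \<otimes>\<^bsub>?P\<^esub> b \<otimes>\<^bsub>?P\<^esub> d = a \<otimes>\<^bsub>?P\<^esub> (b \<otimes>\<^bsub>?P\<^esub> d)"
    using p q by (simp add: m loops_join path_class_eq)
qed

lemma induced_map_path_class:
  assumes f: "continuous_on S f" "f ` S \<subseteq> T" and p: "p \<in> loops S x"
  shows "induced_map T f (path_class S p) = path_class T (f \<circ> p)"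
proof -
  have "path_class T (f \<circ> q) = path_class T (f \<circ> p)" if "homotopic_paths S p q" for q
    using homotopic_paths_continuous_image[OF that f(1)] f(2)
    by (intro path_class_eq[symmetric]) auto
  hence "path_class T (f \<circ> q) = path_class T (f \<circ> p)" if "q \<in> path_class S p" for q
    using that by (simp add: path_class_def)
  moreover have "p \<in> path_class S p" using p loopsD(5) by (auto simp: path_class_def)
  ultimately show ?thesis unfolding induced_map_def by blast
qed

lemma induced_map_hom:
  assumes f: "continuous_on S f" "f ` S \<subseteq> T"
  shows "induced_map T f \<in> hom (fundamental_group S x) (fundamental_group T (f x))"
proof (rule homI)
  have c: "carrier (fundamental_group S x) = path_class S ` loops S x" for S :: "'z::topological_space set" and x
    by (auto simp: fundamental_group_def)
  have l: "f \<circ> p \<in> loops T (f x)" if "p \<in> loops S x" for p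
  proof -
    note p = loopsD[OF that]
    have "path (f \<circ> p)" by (rule path_continuous_image[OF p(1) continuous_on_subset[OF f(1) p(2)]])
    moreover have "path_image (f \<circ> p) \<subseteq> T" using p(2) f(2) by (auto simp: path_image_compose)
    ultimately show ?thesis
      using p(3,4) by (simp add: loops_def pathstart_compose pathfinish_compose)
  qed
  fix a assume "a \<in> carrier (fundamental_group S x)"
  then obtain p where p: "p \<in> loops S x" "a = path_class S p" by (auto simp: c)
  show "induced_map T f a \<in> carrier (fundamental_group T (f x))"
    using l[OF p(1)] by (simp add: c p(2) induced_map_path_class[OF f p(1)])
  fix b assume "b \<in> carrier (fundamental_group S x)"
  then obtain q where q: "q \<in> loops S x" "b = path_class S q" by (auto simp: c)
  show "induced_map T f (a \<otimes>\<^bsub>fundamental_group S x\<^esub> b) =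
      induced_map T f a \<otimes>\<^bsub>fundamental_group T (f x)\<^esub> induced_map T f b"
    by (simp add: p(2) q(2) fundamental_group_mult[OF p(1) q(1)] path_compose_join
        fundamental_group_mult[OF l[OF p(1)] l[OF q(1)]] induced_map_path_class[OF f p(1)]
        induced_map_path_class[OF f q(1)] induced_map_path_class[OF f loops_join[OF p(1) q(1)]])
qed

lemma mem_earring_circle: "z \<in> earring_circle n \<longleftrightarrow> (real n + 1) * (norm z)\<^sup>2 = 2 * Re z"
proof -
  define r where "r = 1 / (real n + 1)"
  have "z \<in> earring_circle n \<longleftrightarrow> (cmod (of_real r - z))\<^sup>2 = r\<^sup>2"
    by (simp add: earring_circle_def r_def dist_norm)
  also have "(cmod (of_real r - z))\<^sup>2 = r\<^sup>2 - 2 * r * Re z + (norm z)\<^sup>2"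
    by (simp add: cmod_power2 power2_diff)
  also have "\<dots> = r\<^sup>2 \<longleftrightarrow> (norm z)\<^sup>2 = 2 * r * Re z" by linarith
  also have "\<dots> \<longleftrightarrow> (real n + 1) * (norm z)\<^sup>2 = 2 * Re z"
    by (simp add: r_def field_simps)
  finally show ?thesis .
qed

lemma continuous_collapse: "continuous_on hawaiian_earring (collapse n)"
proof -
  define R where "R = {z. (real n + 1) * (norm z)\<^sup>2 \<le> 2 * Re z}"
  let ?H = hawaiian_earring
  have B: "bouquet n \<subseteq> ?H"
    by (auto simp: bouquet_def hawaiian_earring_def mem_earring_circle)
  have "closed (earring_circle i)" for i by (simp add: earring_circle_def)
  hence clB: "closed (bouquet n)" unfolding bouquet_def by (intro closed_insert closed_UN) auto
  have clR: "closed R" unfolding R_def by (intro closed_Collect_le continuous_intros)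
  have BR: "z = 0" if "z \<in> bouquet n" "z \<in> R" for z
  proof (rule ccontr)
    assume z: "z \<noteq> 0"
    then obtain i where i: "i < n" "(real i + 1) * (norm z)\<^sup>2 = 2 * Re z"
      using \<open>z \<in> bouquet n\<close> by (auto simp: bouquet_def mem_earring_circle)
    have "(real i + 1) * (norm z)\<^sup>2 < (real n + 1) * (norm z)\<^sup>2" using i(1) z by simp
    thus False using \<open>z \<in> R\<close> i(2) by (simp add: R_def)
  qed
  have HR: "z \<in> R" if "z \<in> ?H" "z \<notin> bouquet n" for z
  proof -
    obtain i where i: "(real i + 1) * (norm z)\<^sup>2 = 2 * Re z" "\<not> i < n"
      using \<open>z \<in> ?H\<close> \<open>z \<notin> bouquet n\<close>
      by (auto simp: bouquet_def hawaiian_earring_def mem_earring_circle)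
    have "(real n + 1) * (norm z)\<^sup>2 \<le> (real i + 1) * (norm z)\<^sup>2"
      using i(2) by (intro mult_right_mono) auto
    thus ?thesis using i(1) by (simp add: R_def)
  qed
  have "continuous_on (bouquet n \<union> ?H \<inter> R) (\<lambda>z. if z \<in> bouquet n then z else 0)"
  proof (rule continuous_on_cases_local)
    show "closedin (top_of_set (bouquet n \<union> ?H \<inter> R)) (bouquet n)"
      using clB by (intro closed_subset) auto
    have "?H \<inter> R = (bouquet n \<union> ?H \<inter> R) \<inter> R"
      using BR B by auto
    thus "closedin (top_of_set (bouquet n \<union> ?H \<inter> R)) (?H \<inter> R)"
      using closedin_closed_Int[OF clR, of "bouquet n \<union> ?H \<inter> R"] by simp
  qed (use BR in \<open>auto intro: continuous_intros\<close>)
  moreover have "bouquet n \<union> ?H \<inter> R = ?H" using B HR by auto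
  ultimately show ?thesis by (simp add: collapse_def[abs_def])
qed

lemma earring_proj_hom: "earring_proj n \<in> hom earring_group (bouquet_group n)"
proof -
  have "collapse n ` hawaiian_earring \<subseteq> bouquet n" "collapse n 0 = 0"
    by (auto simp: collapse_def bouquet_def)
  with induced_map_hom[OF continuous_collapse this(1), of 0] show ?thesis by simp
qed


section \<open>Inverse limit slenderness does not depend on the type of the test groups\<close>

text \<open>If a homomorphism on an inverse limit does not factor, then neither does its restriction to
  the inverse limit of suitable countable subgroups.\<close>

definition transport_group :: "('a \<Rightarrow> 'b) \<Rightarrow> 'a monoid \<Rightarrow> 'b monoid" where
  "transport_group f L = \<lparr>carrier = f ` carrier L,
     mult = (\<lambda>a b. f (inv_into (carrier L) f a \<otimes>\<^bsub>L\<^esub> inv_into (carrier L) f b)), one = f \<one>\<^bsub>L\<^esub>\<rparr>"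

lemma transport_group:
  assumes "group L" "inj_on f (carrier L)"
  shows "group (transport_group f L)" "f \<in> hom L (transport_group f L)"
    "inv_into (carrier L) f \<in> hom (transport_group f L) L"
    "carrier (transport_group f L) = f ` carrier L"
    "\<one>\<^bsub>transport_group f L\<^esub> = f \<one>\<^bsub>L\<^esub>"
proof -
  interpret L: group L by fact
  show f: "f \<in> hom L (transport_group f L)"
    using assms(2) by (auto simp: hom_def transport_group_def)
  have "group ((transport_group f L)\<lparr>carrier := f ` carrier L, one := f \<one>\<^bsub>L\<^esub>\<rparr>)"
    using L.hom_imp_img_group[OF f] .
  thus "group (transport_group f L)" by (simp add: transport_group_def)
  show "inv_into (carrier L) f \<in> hom (transport_group f L) L"
    using assms(2) by (auto simp: hom_def transport_group_def)
qed (auto simp: transport_group_def)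

lemma carrier_inverse_limit:
  "x \<in> carrier (inverse_limit H p) \<longleftrightarrow>
     (\<forall>i. x i \<in> carrier (H i)) \<and> (\<forall>i j. i < j \<longrightarrow> p i j (x j) = x i)"
  by (auto simp: inverse_limit_def PiE_UNIV_domain)

lemma mult_inverse_limit [simp]: "x \<otimes>\<^bsub>inverse_limit H p\<^esub> y = (\<lambda>i. x i \<otimes>\<^bsub>H i\<^esub> y i)"
  and one_inverse_limit [simp]: "\<one>\<^bsub>inverse_limit H p\<^esub> = (\<lambda>i. \<one>\<^bsub>H i\<^esub>)"
  by (auto simp: inverse_limit_def)

lemma group_inverse_limit:
  assumes "inverse_sequence H p"
  shows "group (inverse_limit H p)"
proof -
  have g: "group (H i)" for i using assms by (auto simp: inverse_sequence_def)
  have h: "i < j \<Longrightarrow> group_hom (H j) (H i) (p i j)" for i j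
    using assms g by (auto simp: inverse_sequence_def group_hom_def group_hom_axioms_def)
  show ?thesis
  proof (rule groupI)
    fix x assume x: "x \<in> carrier (inverse_limit H p)"
    show "\<exists>y\<in>carrier (inverse_limit H p). y \<otimes>\<^bsub>inverse_limit H p\<^esub> x = \<one>\<^bsub>inverse_limit H p\<^esub>"
      by (rule bexI[of _ "\<lambda>i. inv\<^bsub>H i\<^esub> x i"])
        (use x g group_hom.hom_inv[OF h] in
          \<open>auto simp: carrier_inverse_limit group.l_inv group.inv_closed\<close>)
  qed (use g group_hom.hom_one[OF h] group_hom.hom_mult[OF h] in
        \<open>auto simp: carrier_inverse_limit group.is_monoid monoid.m_closed monoid.m_assoc\<close>)
qed

lemma mittag_leffler_lift:
  assumes H: "inverse_sequence H p" "mittag_leffler H p"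
  obtains j where "i < j"
    "\<And>y. y \<in> carrier (H j) \<Longrightarrow> \<exists>x\<in>carrier (inverse_limit H p). x i = p i j y"
proof -
  have hc: "i < j \<Longrightarrow> y \<in> carrier (H j) \<Longrightarrow> p i j y \<in> carrier (H i)" for i j y
    using H(1) by (auto simp: inverse_sequence_def hom_def)
  have comp: "i < j \<Longrightarrow> j < k \<Longrightarrow> y \<in> carrier (H k) \<Longrightarrow> p i j (p j k y) = p i k y" for i j k y
    using H(1) by (auto simp: inverse_sequence_def)
  define S where "S i = (\<Inter>k\<in>{i<..}. p i k ` carrier (H k))" for i
  have Sc: "a \<in> carrier (H i)" if "a \<in> S i" for a i
    using that hc[of i "Suc i"] by (force simp: S_def)
  have stable: "\<exists>j>i. \<forall>k\<ge>j. p i k ` carrier (H k) = S i" for i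
  proof -
    obtain j where j: "j > i" "\<And>k. k \<ge> j \<Longrightarrow> p i k ` carrier (H k) = p i j ` carrier (H j)"
      using H(2) unfolding mittag_leffler_def by blast
    have "p i j ` carrier (H j) \<subseteq> p i k ` carrier (H k)" if k: "i < k" for k
    proof (cases "k < j")
      case True
      have "p i j y = p i k (p k j y)" if "y \<in> carrier (H j)" for y
        using comp[OF k True that] by simp
      thus ?thesis using hc[OF True] by blast
    qed (use j(2)[of k] in auto)
    moreover have "S i \<subseteq> p i j ` carrier (H j)" using j(1) by (auto simp: S_def)
    ultimately have "p i j ` carrier (H j) = S i" by (auto simp: S_def)
    thus ?thesis using j by blast
  qed
  have step: "\<exists>b. b \<in> S (Suc m) \<and> p m (Suc m) b = a" if "a \<in> S m" for a m
  proof -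
    obtain j where j: "j > Suc m" "\<And>k. k \<ge> j \<Longrightarrow> p (Suc m) k ` carrier (H k) = S (Suc m)"
      using stable[of "Suc m"] by blast
    obtain y where y: "y \<in> carrier (H j)" "a = p m j y"
    proof -
      have "m < j" using j(1) by simp
      thus ?thesis using that \<open>a \<in> S m\<close> by (auto simp: S_def)
    qed
    have "p (Suc m) j y \<in> S (Suc m)" using j(2)[of j] y by auto
    moreover have "p m (Suc m) (p (Suc m) j y) = a" using comp[of m "Suc m" j y] j(1) y by simp
    ultimately show ?thesis by blast
  qed
  have lift: "\<exists>x\<in>carrier (inverse_limit H p). x i = a" if a: "a \<in> S i" for a
  proof -
    define P where "P n b \<longleftrightarrow> b \<in> S (i + n) \<and> (n = 0 \<longrightarrow> b = a)" for n b
    obtain s where s: "\<And>n. P n (s n)" "\<And>n. p (i + n) (Suc (i + n)) (s (Suc n)) = s n"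
    proof -
      have "\<exists>s. \<forall>n. P n (s n) \<and> p (i + n) (Suc (i + n)) (s (Suc n)) = s n"
      proof (rule dependent_nat_choice)
        show "\<exists>b. P 0 b" using a by (auto simp: P_def)
        show "\<exists>c. P (Suc n) c \<and> p (i + n) (Suc (i + n)) c = b" if "P n b" for b n
          using step[of b "i + n"] that by (auto simp: P_def)
      qed
      thus ?thesis using that by blast
    qed
    define x where "x m = (if m < i then p m i a else s (m - i))" for m
    have xc: "x m \<in> carrier (H m)" for m
      using s(1)[of "m - i"] Sc[of _ m] hc[of m i a] Sc[OF a] by (auto simp: x_def P_def)
    have up: "p m (m + Suc d) (x (m + Suc d)) = x m" if "i \<le> m" for m d
    proof (induction d)
      case 0
      show ?case using s(2)[of "m - i"] that by (simp add: x_def Suc_diff_le)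
    next
      case (Suc d)
      have "p m (m + Suc (Suc d)) (x (m + Suc (Suc d))) =
          p m (m + Suc d) (p (m + Suc d) (m + Suc (Suc d)) (x (m + Suc (Suc d))))"
        using comp[of m "m + Suc d" "m + Suc (Suc d)"] xc by simp
      also have "p (m + Suc d) (m + Suc (Suc d)) (x (m + Suc (Suc d))) = x (m + Suc d)"
        using s(2)[of "m + Suc d - i"] that by (simp add: x_def Suc_diff_le)
      finally show ?case using Suc by simp
    qed
    have xi: "x i = a" using s(1)[of 0] by (simp add: x_def P_def)
    have up': "p m k (x k) = x m" if "i \<le> m" "m < k" for m k
      using up[OF that(1), of "k - Suc m"] that by simp
    have "p m k (x k) = x m" if mk: "m < k" for m k
    proof -
      consider "i \<le> m" | "m < i" "k < i" | "m < i" "k = i" | "m < i" "i < k" by linarith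
      thus ?thesis
      proof cases
        case 1 thus ?thesis using up' mk by simp
      next
        case 2 thus ?thesis using comp[of m k i a] mk Sc[OF a] by (simp add: x_def)
      next
        case 3 thus ?thesis using xi by (simp add: x_def)
      next
        case 4
        have "p m k (x k) = p m i (p i k (x k))" using comp[of m i k] 4 xc by simp
        also have "\<dots> = x m" using up'[of i k] 4 xi by (simp add: x_def)
        finally show ?thesis .
      qed
    qed
    thus ?thesis using xc xi by (auto simp: carrier_inverse_limit)
  qed
  obtain j where "j > i" "\<And>k. k \<ge> j \<Longrightarrow> p i k ` carrier (H k) = S i"
    using stable[of i] by blast
  thus ?thesis using that[of j] lift by blast
qed

lemma countable_generate:
  fixes s :: "nat \<Rightarrow> 'a"
  assumes "group L" "range s \<subseteq> carrier L"
  shows "countable (generate L (range s))"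
proof -
  interpret group L by fact
  have sc: "s n \<in> carrier L" for n using assms(2) by auto
  define ev where "ev = (\<lambda>w. foldr (\<lambda>(b, n) a. (if b then s n else inv\<^bsub>L\<^esub> s n) \<otimes>\<^bsub>L\<^esub> a) w \<one>\<^bsub>L\<^esub>)"
  have evc: "ev w \<in> carrier L" for w
    by (induction w) (auto simp: ev_def sc)
  have app: "ev (v @ w) = ev v \<otimes>\<^bsub>L\<^esub> ev w" for v w
  proof (induction v)
    case Nil
    show ?case using evc[of w] by (simp add: ev_def)
  next
    case (Cons c v)
    thus ?case using evc[of v] evc[of w] sc by (cases c) (auto simp: ev_def m_assoc)
  qed
  have "h \<in> range ev" if "h \<in> generate L (range s)" for h
    using that
  proof induction
    case one
    show ?case by (rule range_eqI[of _ _ "[]"]) (simp add: ev_def)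
  next
    case (incl h)
    then obtain n where "h = s n" by auto
    thus ?case by (intro range_eqI[of _ _ "[(True, n)]"]) (simp add: ev_def sc)
  next
    case (inv h)
    then obtain n where "h = s n" by auto
    thus ?case by (intro range_eqI[of _ _ "[(False, n)]"]) (simp add: ev_def sc)
  next
    case (eng h1 h2)
    then obtain v w where "h1 = ev v" "h2 = ev w" by auto
    thus ?case by (intro range_eqI[of _ _ "v @ w"]) (simp add: app)
  qed
  hence "generate L (range s) \<subseteq> range ev" by blast
  thus ?thesis by (rule countable_subset) simp
qed

lemma inverse_limit_slenderD:
  fixes H :: "nat \<Rightarrow> 'h monoid"
  assumes "inverse_limit_slender TYPE('h) G" "inverse_sequence H p" "mittag_leffler H p"
    "\<phi> \<in> hom (inverse_limit H p) G"
  shows "\<exists>i. \<exists>\<psi>\<in>hom (H i) G. \<forall>x\<in>carrier (inverse_limit H p). \<phi> x = \<psi> (x i)"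
proof -
  have "\<forall>(H :: nat \<Rightarrow> 'h monoid) p. inverse_sequence H p \<longrightarrow> mittag_leffler H p \<longrightarrow>
        (\<forall>\<phi> \<in> hom (inverse_limit H p) G. \<exists>i. \<exists>\<psi> \<in> hom (H i) G.
           \<forall>x \<in> carrier (inverse_limit H p). \<phi> x = \<psi> (x i))"
    using assms(1) unfolding inverse_limit_slender_def by (rule conjunct2)
  from this[rule_format, OF assms(2,3,4)] show ?thesis .
qed

theorem inverse_limit_slender_type_independent:
  assumes inf: "infinite (UNIV :: 'h set)" and G: "inverse_limit_slender TYPE('h) G"
  shows "inverse_limit_slender TYPE('k) G"
  unfolding inverse_limit_slender_def
proof (intro conjI allI impI ballI)
  show "group G" using G by (simp add: inverse_limit_slender_def)
next
  fix H :: "nat \<Rightarrow> 'k monoid" and p \<phi>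
  assume H: "inverse_sequence H p" "mittag_leffler H p" and \<phi>: "\<phi> \<in> hom (inverse_limit H p) G"
  have gG: "group G" using G by (simp add: inverse_limit_slender_def)
  let ?L = "inverse_limit H p"
  have gH: "group (H i)" for i using H(1) by (auto simp: inverse_sequence_def)
  interpret L: group ?L by (rule group_inverse_limit[OF H(1)])
  interpret \<phi>: group_hom ?L G \<phi> using \<phi> gG by (simp add: group_hom_def group_hom_axioms_def)
  have hc: "i < j \<Longrightarrow> y \<in> carrier (H j) \<Longrightarrow> p i j y \<in> carrier (H i)" for i j y
    using H(1) by (auto simp: inverse_sequence_def hom_def)
  have comp: "i < j \<Longrightarrow> j < k \<Longrightarrow> y \<in> carrier (H k) \<Longrightarrow> p i j (p j k y) = p i k y" for i j k y
    using H(1) by (auto simp: inverse_sequence_def)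
  have hh: "i < j \<Longrightarrow> group_hom (H j) (H i) (p i j)" for i j
    using H(1) gH by (auto simp: inverse_sequence_def group_hom_def group_hom_axioms_def)
  show "\<exists>i. \<exists>\<psi>\<in>hom (H i) G. \<forall>x\<in>carrier ?L. \<phi> x = \<psi> (x i)"
  proof (rule ccontr)
    assume nofac: "\<not> ?thesis"
    have "\<exists>x\<in>carrier ?L. x i = \<one>\<^bsub>H i\<^esub> \<and> \<phi> x \<noteq> \<one>\<^bsub>G\<^esub>" for i
    proof (rule ccontr)
      assume c: "\<not> ?thesis"
      have eq: "\<phi> x = \<phi> y" if xy: "x \<in> carrier ?L" "y \<in> carrier ?L" "x i = y i" for x y
      proof -
        have "x \<otimes>\<^bsub>?L\<^esub> inv\<^bsub>?L\<^esub> y \<in> carrier ?L" by (rule L.m_closed[OF xy(1) L.inv_closed[OF xy(2)]])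
        moreover have "(x \<otimes>\<^bsub>?L\<^esub> inv\<^bsub>?L\<^esub> y) i = (y \<otimes>\<^bsub>?L\<^esub> inv\<^bsub>?L\<^esub> y) i" using xy by simp
        hence "(x \<otimes>\<^bsub>?L\<^esub> inv\<^bsub>?L\<^esub> y) i = \<one>\<^bsub>H i\<^esub>" using fun_cong[OF L.r_inv[OF xy(2)], of i] by simp
        ultimately have "\<phi> (x \<otimes>\<^bsub>?L\<^esub> inv\<^bsub>?L\<^esub> y) = \<one>\<^bsub>G\<^esub>" using c by blast
        hence "\<phi> x \<otimes>\<^bsub>G\<^esub> inv\<^bsub>G\<^esub> \<phi> y = \<one>\<^bsub>G\<^esub>" using xy by (metis L.inv_closed \<phi>.hom_mult \<phi>.hom_inv)
        thus ?thesis using xy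
          by (metis \<phi>.H.inv_closed \<phi>.H.inv_equality \<phi>.H.inv_inv \<phi>.hom_closed)
      qed
      obtain j where j: "i < j"
        "\<And>y. y \<in> carrier (H j) \<Longrightarrow> \<exists>x\<in>carrier ?L. x i = p i j y"
        using mittag_leffler_lift[OF H] by blast
      define lf where "lf y = (SOME x. x \<in> carrier ?L \<and> x i = p i j y)" for y
      have lf: "lf y \<in> carrier ?L" "lf y i = p i j y" if "y \<in> carrier (H j)" for y
        using someI_ex[of "\<lambda>x. x \<in> carrier ?L \<and> x i = p i j y"] j(2)[OF that]
        by (auto simp: lf_def)
      have "(\<lambda>y. \<phi> (lf y)) \<in> hom (H j) G"
      proof (rule homI)
        fix x y assume xy: "x \<in> carrier (H j)" "y \<in> carrier (H j)"
        have xy': "x \<otimes>\<^bsub>H j\<^esub> y \<in> carrier (H j)" using xy gH by (simp add: group.is_monoid monoid.m_closed)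
        have "\<phi> (lf (x \<otimes>\<^bsub>H j\<^esub> y)) = \<phi> (lf x \<otimes>\<^bsub>?L\<^esub> lf y)"
        proof (rule eq)
          show "lf x \<otimes>\<^bsub>?L\<^esub> lf y \<in> carrier ?L" using lf xy L.m_closed by blast
          show "lf (x \<otimes>\<^bsub>H j\<^esub> y) i = (lf x \<otimes>\<^bsub>?L\<^esub> lf y) i"
            using lf xy xy' group_hom.hom_mult[OF hh[OF j(1)]] by simp
        qed (use lf xy' in auto)
        also have "\<dots> = \<phi> (lf x) \<otimes>\<^bsub>G\<^esub> \<phi> (lf y)" by (rule \<phi>.hom_mult) (use lf xy in auto)
        finally show "\<phi> (lf (x \<otimes>\<^bsub>H j\<^esub> y)) = \<phi> (lf x) \<otimes>\<^bsub>G\<^esub> \<phi> (lf y)" .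
      qed (use lf in auto)
      moreover have "\<phi> x = \<phi> (lf (x j))" if x: "x \<in> carrier ?L" for x
      proof -
        have "x j \<in> carrier (H j)" "p i j (x j) = x i"
          using x j(1) by (auto simp: carrier_inverse_limit)
        thus ?thesis using x lf[of "x j"] eq[of x "lf (x j)"] by simp
      qed
      ultimately have "\<exists>\<psi>\<in>hom (H j) G. \<forall>x\<in>carrier ?L. \<phi> x = \<psi> (x j)"
        by (intro bexI[of _ "\<lambda>y. \<phi> (lf y)"] ballI)
      hence "\<exists>i. \<exists>\<psi>\<in>hom (H i) G. \<forall>x\<in>carrier ?L. \<phi> x = \<psi> (x i)" by (rule exI)
      with nofac show False by (rule notE)
    qed
    then obtain s where s: "\<And>n. s n \<in> carrier ?L" "\<And>n. s n n = \<one>\<^bsub>H n\<^esub>" "\<And>n. \<phi> (s n) \<noteq> \<one>\<^bsub>G\<^esub>"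
      by metis
    define K where "K i = generate (H i) (range (\<lambda>n. s n i))" for i
    have sH: "range (\<lambda>n. s n i) \<subseteq> carrier (H i)" for i
      using s(1) by (auto simp: carrier_inverse_limit)
    have Ksub: "subgroup (K i) (H i)" for i
      unfolding K_def by (rule group.generate_is_subgroup[OF gH sH])
    have Kc: "K i \<subseteq> carrier (H i)" for i using Ksub by (rule subgroup.subset)
    have pK: "p i j ` K j = K i" if "i < j" for i j
    proof -
      have "p i j ` K j = generate (H i) (p i j ` range (\<lambda>n. s n j))"
        unfolding K_def by (rule group_hom.generate_img[OF hh[OF that] sH, symmetric])
      also have "p i j ` range (\<lambda>n. s n j) = range (\<lambda>n. s n i)"
        using s(1) that by (auto simp: carrier_inverse_limit image_image)
      finally show ?thesis by (simp add: K_def)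
    qed
    obtain \<iota> :: "nat \<Rightarrow> 'h" where \<iota>: "inj \<iota>" using inf infinite_countable_subset by blast
    define f where "f i = \<iota> \<circ> to_nat_on (K i)" for i
    have fi: "inj_on (f i) (K i)" for i
      unfolding f_def K_def
      using countable_generate[OF gH sH] \<iota>
      by (metis comp_inj_on inj_on_subset inj_on_to_nat_on subset_UNIV)
    let ?KG = "\<lambda>i. (H i)\<lparr>carrier := K i\<rparr>"
    have gK: "group (?KG i)" for i using group.subgroup_imp_group[OF gH Ksub] .
    define T where "T i = transport_group (f i) (?KG i)" for i
    define g where "g i = inv_into (K i) (f i)" for i
    have T: "group (T i)" "f i \<in> hom (?KG i) (T i)" "g i \<in> hom (T i) (?KG i)"
      "carrier (T i) = f i ` K i" "\<one>\<^bsub>T i\<^esub> = f i \<one>\<^bsub>H i\<^esub>" for i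
      using transport_group[OF gK, of "f i" i] fi by (auto simp: T_def g_def)
    have gf: "g i (f i x) = x" if "x \<in> K i" for i x
      using that fi by (simp add: g_def)
    have fg: "f i (g i x) = x" if "x \<in> carrier (T i)" for i x
      using that T by (auto simp: gf)
    have gK': "g i x \<in> K i" if "x \<in> carrier (T i)" for i x
      using that T by (auto simp: gf)
    define q where "q i j x = f i (p i j (g j x))" for i j x
    have qim: "q i j ` carrier (T j) = carrier (T i)" if "i < j" for i j
    proof -
      have "q i j ` carrier (T j) = f i ` p i j ` K j"
        by (auto simp: q_def T(4) image_image gf)
      thus ?thesis using pK[OF that] T(4) by simp
    qed
    have seq: "inverse_sequence T q"
      unfolding inverse_sequence_def
    proof (intro conjI allI impI ballI)
      fix i j :: nat assume ij: "i < j"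
      have "p i j \<in> hom (?KG j) (?KG i)"
        using hh[OF ij] pK[OF ij] Kc[of j]
        by (auto simp: hom_def group_hom.hom_mult subset_iff)
      hence "f i \<circ> p i j \<circ> g j \<in> hom (T j) (T i)" using T(2,3) by (metis hom_compose)
      thus "q i j \<in> hom (T j) (T i)" by (simp add: q_def[abs_def] comp_def)
    next
      fix i j k :: nat and x assume ij: "i < j" "j < k" and x: "x \<in> carrier (T k)"
      have "p j k (g k x) \<in> K j" using pK[OF ij(2)] gK'[OF x] by blast
      thus "q i j (q j k x) = q i k x"
        using comp[OF ij, of "g k x"] gK'[OF x] Kc[of k] by (auto simp: q_def gf)
    qed (rule T)
    have ml: "mittag_leffler T q"
      unfolding mittag_leffler_def using qim by (metis Suc_le_lessD lessI)
    let ?M = "inverse_limit T q"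
    define \<theta> where "\<theta> x = (\<lambda>i. g i (x i))" for x
    have \<theta>c: "\<theta> x \<in> carrier ?L" if "x \<in> carrier ?M" for x
    proof -
      have xT: "x i \<in> carrier (T i)" for i using that by (auto simp: carrier_inverse_limit)
      have "p i j (g j (x j)) = g i (x i)" if ij: "i < j" for i j
      proof -
        have "p i j (g j (x j)) \<in> K i" using pK[OF ij] gK'[OF xT] by blast
        moreover have "x i = q i j (x j)" using \<open>x \<in> carrier ?M\<close> ij by (simp add: carrier_inverse_limit)
        ultimately show ?thesis by (simp add: q_def gf)
      qed
      thus ?thesis using subsetD[OF Kc gK'[OF xT]] by (auto simp: \<theta>_def carrier_inverse_limit)
    qed
    have "(\<lambda>x. \<phi> (\<theta> x)) \<in> hom ?M G"
    proof (rule homI)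
      fix x y assume xy: "x \<in> carrier ?M" "y \<in> carrier ?M"
      have "\<theta> (x \<otimes>\<^bsub>?M\<^esub> y) = \<theta> x \<otimes>\<^bsub>?L\<^esub> \<theta> y"
        using xy hom_mult[OF T(3)] by (auto simp: \<theta>_def carrier_inverse_limit)
      thus "\<phi> (\<theta> (x \<otimes>\<^bsub>?M\<^esub> y)) = \<phi> (\<theta> x) \<otimes>\<^bsub>G\<^esub> \<phi> (\<theta> y)"
        using \<theta>c xy by (metis \<phi>.hom_mult)
    qed (use \<theta>c in auto)
    from inverse_limit_slenderD[OF G seq ml this]
    obtain i \<psi> where \<psi>: "\<psi> \<in> hom (T i) G" "\<And>x. x \<in> carrier ?M \<Longrightarrow> \<phi> (\<theta> x) = \<psi> (x i)"
      by (elim exE bexE) simp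
    have sK: "s i k \<in> K k" for k unfolding K_def by (rule generate.incl) auto
    define z where "z = (\<lambda>k. f k (s i k))"
    have z: "z \<in> carrier ?M"
      using s(1)[of i] sK by (auto simp: z_def carrier_inverse_limit T(4) q_def gf)
    have "\<theta> z = s i" by (simp add: \<theta>_def z_def gf sK)
    hence "\<phi> (s i) = \<psi> \<one>\<^bsub>T i\<^esub>" using \<psi>(2)[OF z] T(5)[of i] by (simp add: z_def s(2))
    also have "\<dots> = \<one>\<^bsub>G\<^esub>" using hom_one[OF \<psi>(1) T(1) gG] .
    finally show False using s(3) by blast
  qed
qed


section \<open>Large types add nothing to lch-slenderness\<close>

text \<open>If some homomorphism on a locally compact Hausdorff group \<open>L\<close> has a kernel that is not open,
  then so does one on a closed separable subgroup of \<open>L\<close>, which has at most \<open>2 ^ 2 ^ \<omega>\<close> elements,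
  or one on a countable power of a finite group.\<close>

lemma lch_slenderD:
  fixes L :: "'l monoid"
  assumes "lch_slender TYPE('l) G" "lch_group L X" "\<phi> \<in> hom L G"
  shows "openin X (kernel L G \<phi>)"
proof -
  have "\<forall>(L :: 'l monoid) X. lch_group L X \<longrightarrow> (\<forall>\<phi> \<in> hom L G. openin X (kernel L G \<phi>))"
    using assms(1) unfolding lch_slender_def by (rule conjunct2)
  from this[rule_format, OF assms(2,3)] show ?thesis .
qed

lemma lch_slender_embed:
  fixes f :: "'l \<Rightarrow> 'c"
  assumes G: "lch_slender TYPE('c) G" and L: "lch_group L X"
    and f: "inj_on f (carrier L)" and \<phi>: "\<phi> \<in> hom L G"
  shows "openin X (kernel L G \<phi>)"
proof -
  have gL: "group L" and top: "topspace X = carrier L"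
    and cm: "continuous_map (prod_topology X X) X (\<lambda>(x, y). x \<otimes>\<^bsub>L\<^esub> y)"
    and ci: "continuous_map X X (\<lambda>x. inv\<^bsub>L\<^esub> x)"
    and lc: "locally_compact_space X" and hd: "Hausdorff_space X"
    using L by (auto simp: lch_group_def topological_group_def)
  define g where "g = inv_into (carrier L) f"
  have gf: "g (f x) = x" if "x \<in> carrier L" for x using that f by (simp add: g_def)
  define T where "T = transport_group f L"
  have T: "group T" "f \<in> hom L T" "g \<in> hom T L" "carrier T = f ` carrier L"
    using transport_group[OF gL f] by (simp_all add: T_def g_def)
  have fg: "f (g x) = x" if "x \<in> carrier T" for x using that T(4) by (auto simp: gf)
  define Y where "Y = pullback_topology (f ` carrier L) g X"
  have topY: "topspace Y = carrier T"
    unfolding Y_def topspace_pullback_topology top T(4) by (auto simp: gf)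
  have cg: "continuous_map Y X g"
    using continuous_map_pullback[OF continuous_map_id, of "f ` carrier L" g X] by (simp add: Y_def)
  have "continuous_map X X (g \<circ> f)"
    by (rule continuous_map_eq[OF continuous_map_id]) (simp add: top gf)
  hence cf: "continuous_map X Y f"
    unfolding Y_def by (rule continuous_map_pullback') (auto simp: top)
  have hom: "homeomorphic_maps X Y f g"
    unfolding homeomorphic_maps_def using cf cg fg gf by (simp add: top topY)
  have mult: "f (g a \<otimes>\<^bsub>L\<^esub> g b) = a \<otimes>\<^bsub>T\<^esub> b" if "a \<in> carrier T" "b \<in> carrier T" for a b
  proof -
    have "a \<otimes>\<^bsub>T\<^esub> b \<in> carrier T" using that T(1) by (simp add: group.is_monoid monoid.m_closed)
    thus ?thesis using fg hom_mult[OF T(3) that] by metis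
  qed
  have inv: "f (inv\<^bsub>L\<^esub> (g a)) = inv\<^bsub>T\<^esub> a" if a: "a \<in> carrier T" for a
  proof -
    interpret f: group_hom L T f using T gL by (simp add: group_hom_def group_hom_axioms_def)
    have "g a \<in> carrier L" using a T(4) by (auto simp: gf)
    thus ?thesis using fg[OF a] by simp
  qed
  have "topological_group T Y"
    unfolding topological_group_def
  proof (intro conjI T topY)
    have c1: "continuous_map (prod_topology Y Y) (prod_topology X X) (\<lambda>z. (g (fst z), g (snd z)))"
      by (intro continuous_map_pairedI continuous_map_compose[OF _ cg, unfolded comp_def]
          continuous_map_fst continuous_map_snd)
    have "continuous_map (prod_topology Y Y) Y
        (f \<circ> (\<lambda>(x, y). x \<otimes>\<^bsub>L\<^esub> y) \<circ> (\<lambda>z. (g (fst z), g (snd z))))"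
      by (rule continuous_map_compose[OF c1 continuous_map_compose[OF cm cf]])
    thus "continuous_map (prod_topology Y Y) Y (\<lambda>(x, y). x \<otimes>\<^bsub>T\<^esub> y)"
      by (rule continuous_map_eq) (auto simp: topY mult)
    have "continuous_map Y Y (f \<circ> (\<lambda>x. inv\<^bsub>L\<^esub> x) \<circ> g)"
      by (rule continuous_map_compose[OF cg continuous_map_compose[OF ci cf]])
    thus "continuous_map Y Y (\<lambda>x. inv\<^bsub>T\<^esub> x)"
      by (rule continuous_map_eq) (auto simp: topY inv)
  qed
  moreover have "locally_compact_space Y" "Hausdorff_space Y"
    using lc hd homeomorphic_maps_imp_homeomorphic_space[OF hom]
      homeomorphic_locally_compact_space homeomorphic_Hausdorff_space by blast+
  ultimately have "lch_group T Y" by (simp add: lch_group_def)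
  moreover have "(\<phi> \<circ> g) \<in> hom T G" using T(3) \<phi> by (rule hom_compose)
  ultimately have "openin Y (kernel T G (\<phi> \<circ> g))" by (rule lch_slenderD[OF G])
  hence "openin X {x \<in> topspace X. f x \<in> kernel T G (\<phi> \<circ> g)}"
    by (rule openin_continuous_map_preimage[OF cf])
  also have "{x \<in> topspace X. f x \<in> kernel T G (\<phi> \<circ> g)} = kernel L G \<phi>"
    using inj_onD[OF f] by (fastforce simp: kernel_def top T(4) gf)
  finally show ?thesis .
qed

lemma compactin_cluster:
  fixes s :: "nat \<Rightarrow> 'a"
  assumes C: "compactin X C" and s: "\<And>n. s n \<in> C"
  obtains x where "x \<in> C" "\<And>W. openin X W \<Longrightarrow> x \<in> W \<Longrightarrow> infinite {n. s n \<in> W}"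
proof (rule ccontr)
  assume "\<not> thesis"
  hence "\<forall>x\<in>C. \<exists>W. openin X W \<and> x \<in> W \<and> finite {n. s n \<in> W}" using that by blast
  then obtain W where W: "\<And>x. x \<in> C \<Longrightarrow> openin X (W x) \<and> x \<in> W x \<and> finite {n. s n \<in> W x}"
    by metis
  have "\<exists>\<F>. finite \<F> \<and> \<F> \<subseteq> W ` C \<and> C \<subseteq> \<Union>\<F>"
  proof (rule compactinD[OF C])
    show "C \<subseteq> \<Union>(W ` C)" using W by blast
  qed (use W in auto)
  then obtain \<F> where F: "finite \<F>" "\<F> \<subseteq> W ` C" "C \<subseteq> \<Union>\<F>" by blast
  have "(UNIV :: nat set) \<subseteq> (\<Union>U\<in>\<F>. {n. s n \<in> U})" using s F(3) by blast
  moreover have "finite (\<Union>U\<in>\<F>. {n. s n \<in> U})" using F W by auto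
  ultimately show False using finite_subset infinite_UNIV_nat by blast
qed

lemma separable_embed:
  fixes d :: "nat \<Rightarrow> 'a"
  assumes "Hausdorff_space X"
  shows "\<exists>f :: 'a \<Rightarrow> nat set set. inj_on f (X closure_of range d)"
proof
  define f where "f x = {{n. d n \<in> U} | U. openin X U \<and> x \<in> U}" for x
  show "inj_on f (X closure_of range d)"
  proof (rule inj_onI, rule ccontr)
    fix x y assume x: "x \<in> X closure_of range d" and y: "y \<in> X closure_of range d"
      and eq: "f x = f y" and ne: "x \<noteq> y"
    have "x \<in> topspace X" "y \<in> topspace X" using x y by (auto simp: in_closure_of)
    then obtain U V where U: "openin X U" "x \<in> U" and V: "openin X V" "y \<in> V" and d: "disjnt U V"
      using assms ne unfolding Hausdorff_space_def by metis
    have "{n. d n \<in> U} \<in> f x" using U by (auto simp: f_def)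
    then obtain W where W: "openin X W" "y \<in> W" "{n. d n \<in> U} = {n. d n \<in> W}"
      unfolding eq by (auto simp: f_def)
    have "openin X (W \<inter> V)" "y \<in> W \<inter> V" using W V by auto
    then obtain n where "d n \<in> W \<inter> V" using y unfolding in_closure_of by blast
    thus False using W(3) d by (auto simp: disjnt_iff)
  qed
qed

lemma closure_of_meets:
  assumes "x \<in> X closure_of S" "openin X T" "x \<in> T"
  obtains y where "y \<in> S" "y \<in> T"
  using assms by (auto simp: in_closure_of)

lemma lch_slender_no_finite_subgroup:
  assumes G: "lch_slender TYPE(nat set set) G" and F: "subgroup F G" "finite F"
  shows "F = {\<one>\<^bsub>G\<^esub>}"
proof (rule ccontr)
  assume ne: "F \<noteq> {\<one>\<^bsub>G\<^esub>}"
  have gG: "group G" using G by (simp add: lch_slender_def)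
  interpret G: group G by fact
  let ?F = "G\<lparr>carrier := F\<rparr>"
  interpret F: group ?F by (rule G.subgroup_imp_group[OF F(1)])
  have invF: "inv\<^bsub>?F\<^esub> x = inv\<^bsub>G\<^esub> x" if "x \<in> F" for x
    using G.m_inv_consistent[OF F(1) that] .
  have one: "\<one>\<^bsub>G\<^esub> \<in> F" using F(1) by (rule subgroup.one_closed)
  obtain a where a: "a \<in> F" "a \<noteq> \<one>\<^bsub>G\<^esub>" using ne one by blast
  define P where "P = product_group (UNIV :: nat set) (\<lambda>_. ?F)"
  define X where "X = product_topology (\<lambda>_ :: nat. discrete_topology F) UNIV"
  have gP: "group P" unfolding P_def by (rule product_group) (rule F.is_group)
  have cP: "carrier P = {x. \<forall>i. x i \<in> F}" by (auto simp: P_def PiE_UNIV_domain)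
  have topX: "topspace X = carrier P" by (auto simp: X_def cP PiE_UNIV_domain)
  have multP: "x \<otimes>\<^bsub>P\<^esub> y = (\<lambda>i. x i \<otimes>\<^bsub>G\<^esub> y i)" for x y by (simp add: P_def restrict_def)
  have invP: "inv\<^bsub>P\<^esub> x = (\<lambda>i. inv\<^bsub>G\<^esub> (x i))" if "x \<in> carrier P" for x
    using that F.is_group unfolding P_def
    by (subst inv_product_group) (auto simp: invF fun_eq_iff PiE_UNIV_domain Pi_iff)
  have proj: "continuous_map X (discrete_topology F) (\<lambda>x. x i)" for i
    unfolding X_def by (rule continuous_map_product_projection) simp
  have lchP: "lch_group P X"
    unfolding lch_group_def topological_group_def
  proof (intro conjI gP topX)
    have "continuous_map (prod_topology X X) (discrete_topology F) (\<lambda>z. fst z i \<otimes>\<^bsub>G\<^esub> snd z i)" for i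
    proof -
      have c1: "continuous_map (prod_topology X X)
          (prod_topology (discrete_topology F) (discrete_topology F)) (\<lambda>z. (fst z i, snd z i))"
        by (intro continuous_map_pairedI continuous_map_compose[OF _ proj, unfolded comp_def]
          continuous_map_fst continuous_map_snd)
      have c2: "continuous_map (prod_topology (discrete_topology F) (discrete_topology F))
          (discrete_topology F) (\<lambda>(x, y). x \<otimes>\<^bsub>G\<^esub> y)"
        using F(1) by (auto simp: prod_topology_discrete_topology[symmetric] subgroup.m_closed)
      show ?thesis using continuous_map_compose[OF c1 c2] by (simp add: comp_def)
    qed
    hence "continuous_map (prod_topology X X) X (\<lambda>z i. fst z i \<otimes>\<^bsub>G\<^esub> snd z i)"
      unfolding X_def continuous_map_componentwise_UNIV by (simp add: X_def[symmetric])
    thus "continuous_map (prod_topology X X) X (\<lambda>(x, y). x \<otimes>\<^bsub>P\<^esub> y)"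
      by (simp add: multP case_prod_unfold)
    have c3: "continuous_map (discrete_topology F) (discrete_topology F) (\<lambda>x. inv\<^bsub>G\<^esub> x)"
      using F(1) by (auto simp: subgroup.m_inv_closed)
    have "continuous_map X (discrete_topology F) (\<lambda>z. inv\<^bsub>G\<^esub> (z i))" for i
      using continuous_map_compose[OF proj c3] by (simp add: comp_def)
    hence "continuous_map X X (\<lambda>z i. inv\<^bsub>G\<^esub> (z i))"
      unfolding X_def continuous_map_componentwise_UNIV by (simp add: X_def[symmetric])
    thus "continuous_map X X (\<lambda>x. inv\<^bsub>P\<^esub> x)"
      by (rule continuous_map_eq) (simp add: topX invP)
    show "locally_compact_space X"
      unfolding X_def by (simp add: locally_compact_space_product_topology
          locally_compact_space_discrete_topology compact_space_discrete_topology F(2))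
    show "Hausdorff_space X"
      unfolding X_def by (simp add: Hausdorff_space_product_topology)
  qed
  define Y where "Y = product_topology (\<lambda>_. discrete_topology F) (carrier P)"
  define s where "s n = (\<lambda>x\<in>carrier P. x n)" for n :: nat
  have "compact_space Y"
    using F(2) by (simp add: Y_def compact_space_product_topology compact_space_discrete_topology)
  hence "compactin Y (topspace Y)" by (simp add: compact_space_def)
  moreover have sY: "s n \<in> topspace Y" for n by (auto simp: Y_def s_def cP)
  ultimately obtain \<Lambda> where \<Lambda>: "\<Lambda> \<in> topspace Y"
    "\<And>W. openin Y W \<Longrightarrow> \<Lambda> \<in> W \<Longrightarrow> infinite {n. s n \<in> W}"
    using compactin_cluster[of Y "topspace Y" s] by metis
  have \<Lambda>F: "\<Lambda> x \<in> F" if "x \<in> carrier P" for x using \<Lambda>(1) that by (auto simp: Y_def)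
  have agree: "infinite {n. \<forall>x\<in>J. x n = \<Lambda> x}" if J: "finite J" "J \<subseteq> carrier P" for J
  proof -
    let ?W = "\<Pi>\<^sub>E x\<in>carrier P. if x \<in> J then {\<Lambda> x} else F"
    have "finite {i \<in> carrier P. (if i \<in> J then {\<Lambda> i} else F) \<noteq> F}"
      by (rule finite_subset[OF _ J(1)]) auto
    hence "openin Y ?W" unfolding Y_def openin_PiE_gen using \<Lambda>F J by auto
    moreover have "\<Lambda> \<in> ?W" using \<Lambda>(1) by (auto simp: Y_def PiE_iff)
    ultimately have "infinite {n. s n \<in> ?W}" by (rule \<Lambda>(2))
    moreover have "{n. s n \<in> ?W} \<subseteq> {n. \<forall>x\<in>J. x n = \<Lambda> x}"
      using J by (fastforce simp: s_def PiE_iff)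
    ultimately show ?thesis using finite_subset by blast
  qed
  have "\<Lambda> \<in> hom P G"
  proof (rule homI)
    fix x y assume xy: "x \<in> carrier P" "y \<in> carrier P"
    have "infinite {n. \<forall>z\<in>{x, y, x \<otimes>\<^bsub>P\<^esub> y}. z n = \<Lambda> z}"
      using xy gP by (intro agree) (auto simp: group.is_monoid monoid.m_closed)
    then obtain n where "x n = \<Lambda> x" "y n = \<Lambda> y" "(x \<otimes>\<^bsub>P\<^esub> y) n = \<Lambda> (x \<otimes>\<^bsub>P\<^esub> y)"
      using not_finite_existsD by force
    thus "\<Lambda> (x \<otimes>\<^bsub>P\<^esub> y) = \<Lambda> x \<otimes>\<^bsub>G\<^esub> \<Lambda> y" by (simp add: multP)
  qed (use \<Lambda>F F(1) in \<open>auto dest: subgroup.subset\<close>)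
  moreover have "\<exists>f :: (nat \<Rightarrow> 'a) \<Rightarrow> nat set set. inj_on f (carrier P)"
  proof -
    obtain e :: "'a \<Rightarrow> nat" where e: "inj_on e F" using F(2) finite_imp_inj_to_nat_seg by blast
    have "inj_on (\<lambda>x. {{prod_encode (n, e (x n)) | n. True}}) (carrier P)"
    proof (rule inj_onI, rule ext)
      fix x y n assume xy: "x \<in> carrier P" "y \<in> carrier P"
        "{{prod_encode (n, e (x n)) | n. True}} = {{prod_encode (n, e (y n)) | n. True}}"
      have "prod_encode (n, e (x n)) \<in> {prod_encode (n, e (y n)) | n. True}"
        using xy(3) by blast
      hence "e (x n) = e (y n)" by (auto simp: prod_encode_eq)
      thus "x n = y n" using e xy by (auto simp: cP inj_on_eq_iff)
    qed
    thus ?thesis by blast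
  qed
  ultimately have "openin X (kernel P G \<Lambda>)" using lch_slender_embed[OF G lchP] by blast
  moreover have "\<one>\<^bsub>P\<^esub> \<in> kernel P G \<Lambda>"
    using hom_one[OF \<open>\<Lambda> \<in> hom P G\<close> gP gG] gP by (simp add: kernel_def group.is_monoid)
  ultimately obtain B where B: "\<one>\<^bsub>P\<^esub> \<in> Pi\<^sub>E UNIV B" "finite {i. B i \<noteq> F}" "Pi\<^sub>E UNIV B \<subseteq> kernel P G \<Lambda>"
    unfolding X_def by (force simp: openin_product_topology_alt)
  define z where "z i = (if B i = F then a else \<one>\<^bsub>G\<^esub>)" for i
  have zB: "z \<in> Pi\<^sub>E UNIV B" using B(1) a by (auto simp: z_def P_def PiE_iff)
  hence "z \<in> carrier P" "\<Lambda> z = \<one>\<^bsub>G\<^esub>" using B(3) by (auto simp: kernel_def)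
  moreover have "{n. z n = \<Lambda> z} \<subseteq> {i. B i \<noteq> F}" using a \<open>\<Lambda> z = \<one>\<^bsub>G\<^esub>\<close> by (auto simp: z_def)
  ultimately show False using agree[of "{z}"] finite_subset[OF _ B(2)] by auto
qed

theorem lch_slender_type_independent:
  assumes G: "lch_slender TYPE(nat set set) G"
  shows "lch_slender TYPE('l) G"
  unfolding lch_slender_def
proof (intro conjI allI impI ballI)
  show gG: "group G" using G by (simp add: lch_slender_def)
  fix L :: "'l monoid" and X \<phi>
  assume L: "lch_group L X" and \<phi>: "\<phi> \<in> hom L G"
  have gL: "group L" and top: "topspace X = carrier L"
    and cm: "continuous_map (prod_topology X X) X (\<lambda>(x, y). x \<otimes>\<^bsub>L\<^esub> y)"
    and ci: "continuous_map X X (\<lambda>x. inv\<^bsub>L\<^esub> x)"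
    and lc: "locally_compact_space X" and hd: "Hausdorff_space X"
    using L by (auto simp: lch_group_def topological_group_def)
  interpret L: group L by fact
  interpret \<phi>: group_hom L G \<phi> using \<phi> gG gL by (simp add: group_hom_def group_hom_axioms_def)
  have translate: "openin X {w \<in> carrier L. inv\<^bsub>L\<^esub> a \<otimes>\<^bsub>L\<^esub> w \<in> U}"
    if "openin X U" "a \<in> carrier L" for U a
  proof -
    have "continuous_map X (prod_topology X X) (\<lambda>w. (inv\<^bsub>L\<^esub> a, w))"
      using that(2) by (intro continuous_map_pairedI) (auto simp: top)
    from continuous_map_compose[OF this cm]
    have "continuous_map X X (\<lambda>w. inv\<^bsub>L\<^esub> a \<otimes>\<^bsub>L\<^esub> w)" by (simp add: comp_def)
    from openin_continuous_map_preimage[OF this that(1)] show ?thesis by (simp add: top)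
  qed
  have eq: "\<phi> w = \<phi> a" if "w \<in> carrier L" "a \<in> carrier L" "\<phi> (inv\<^bsub>L\<^esub> a \<otimes>\<^bsub>L\<^esub> w) = \<one>\<^bsub>G\<^esub>" for w a
  proof -
    have "inv\<^bsub>G\<^esub> (\<phi> a) \<otimes>\<^bsub>G\<^esub> \<phi> w = \<one>\<^bsub>G\<^esub>" using that by simp
    hence "inv\<^bsub>G\<^esub> (inv\<^bsub>G\<^esub> (\<phi> a)) = \<phi> w" using that
      by (intro \<phi>.H.inv_equality) (auto intro: \<phi>.H.inv_comm)
    thus ?thesis using that by simp
  qed
  show "openin X (kernel L G \<phi>)"
  proof (rule ccontr)
    assume nopen: "\<not> openin X (kernel L G \<phi>)"
    have escape: "\<exists>x\<in>U. \<phi> x \<noteq> \<one>\<^bsub>G\<^esub>" if U: "openin X U" "\<one>\<^bsub>L\<^esub> \<in> U" for U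
    proof (rule ccontr)
      assume "\<not> ?thesis"
      hence triv: "\<phi> x = \<one>\<^bsub>G\<^esub>" if "x \<in> U" for x using that by blast
      have "\<exists>T. openin X T \<and> a \<in> T \<and> T \<subseteq> kernel L G \<phi>" if a: "a \<in> kernel L G \<phi>" for a
      proof (intro exI conjI)
        show "openin X {w \<in> carrier L. inv\<^bsub>L\<^esub> a \<otimes>\<^bsub>L\<^esub> w \<in> U}"
          using a by (intro translate[OF U(1)]) (simp add: kernel_def)
        show "a \<in> {w \<in> carrier L. inv\<^bsub>L\<^esub> a \<otimes>\<^bsub>L\<^esub> w \<in> U}" using a U(2) by (simp add: kernel_def)
        show "{w \<in> carrier L. inv\<^bsub>L\<^esub> a \<otimes>\<^bsub>L\<^esub> w \<in> U} \<subseteq> kernel L G \<phi>"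
        proof
          fix w assume "w \<in> {w \<in> carrier L. inv\<^bsub>L\<^esub> a \<otimes>\<^bsub>L\<^esub> w \<in> U}"
          hence w: "w \<in> carrier L" "\<phi> (inv\<^bsub>L\<^esub> a \<otimes>\<^bsub>L\<^esub> w) = \<one>\<^bsub>G\<^esub>" using triv by blast+
          have "a \<in> carrier L" "\<phi> a = \<one>\<^bsub>G\<^esub>" using a by (simp_all add: kernel_def)
          with eq[OF w(1) this(1) w(2)] show "w \<in> kernel L G \<phi>" using w(1) by (simp add: kernel_def)
        qed
      qed
      hence "openin X (kernel L G \<phi>)" by (subst openin_subopen) blast
      with nopen show False by contradiction
    qed
    obtain U0 C where U0: "openin X U0" "compactin X C" "\<one>\<^bsub>L\<^esub> \<in> U0" "U0 \<subseteq> C"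
      using lc unfolding locally_compact_space_def top by (metis L.one_closed)
    define P where "P (n :: nat) U \<longleftrightarrow> openin X U \<and> \<one>\<^bsub>L\<^esub> \<in> U \<and> U \<subseteq> U0" for n U
    have "\<exists>U. \<forall>n. P n (U n) \<and> (\<forall>x\<in>U (Suc n). \<forall>y\<in>U (Suc n). x \<otimes>\<^bsub>L\<^esub> inv\<^bsub>L\<^esub> y \<in> U n)"
    proof (rule dependent_nat_choice)
      show "\<exists>U. P 0 U" using U0 by (auto simp: P_def)
      fix U and n :: nat assume U: "P n U"
      have "continuous_map (prod_topology X X) (prod_topology X X) (\<lambda>z. (fst z, inv\<^bsub>L\<^esub> snd z))"
        by (intro continuous_map_pairedI continuous_map_compose[OF _ ci, unfolded comp_def]
            continuous_map_fst continuous_map_snd)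
      from continuous_map_compose[OF this cm]
      have "continuous_map (prod_topology X X) X (\<lambda>z. fst z \<otimes>\<^bsub>L\<^esub> inv\<^bsub>L\<^esub> snd z)" by (simp add: comp_def)
      from openin_continuous_map_preimage[OF this] U
      have "openin (prod_topology X X)
          {z \<in> topspace (prod_topology X X). fst z \<otimes>\<^bsub>L\<^esub> inv\<^bsub>L\<^esub> snd z \<in> U}" (is "openin _ ?Z")
        by (simp add: P_def)
      moreover have "(\<one>\<^bsub>L\<^esub>, \<one>\<^bsub>L\<^esub>) \<in> ?Z" using U by (simp add: P_def top)
      ultimately have "\<exists>V W. openin X V \<and> openin X W \<and> \<one>\<^bsub>L\<^esub> \<in> V \<and> \<one>\<^bsub>L\<^esub> \<in> W \<and> V \<times> W \<subseteq> ?Z"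
        by (rule openin_prod_topology_alt[THEN iffD1, rule_format])
      then obtain V W where VW: "openin X V" "openin X W" "\<one>\<^bsub>L\<^esub> \<in> V" "\<one>\<^bsub>L\<^esub> \<in> W" "V \<times> W \<subseteq> ?Z"
        by (elim exE conjE)
      hence "P (Suc n) (V \<inter> W \<inter> U)" "\<forall>x\<in>V \<inter> W \<inter> U. \<forall>y\<in>V \<inter> W \<inter> U. x \<otimes>\<^bsub>L\<^esub> inv\<^bsub>L\<^esub> y \<in> U"
        using U by (auto simp: P_def)
      thus "\<exists>V. P (Suc n) V \<and> (\<forall>x\<in>V. \<forall>y\<in>V. x \<otimes>\<^bsub>L\<^esub> inv\<^bsub>L\<^esub> y \<in> U)" by blast
    qed
    then obtain U where *: "\<forall>n. P n (U n) \<and> (\<forall>x\<in>U (Suc n). \<forall>y\<in>U (Suc n). x \<otimes>\<^bsub>L\<^esub> inv\<^bsub>L\<^esub> y \<in> U n)"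
      by (elim exE)
    have U: "\<And>n. openin X (U n)" "\<And>n. \<one>\<^bsub>L\<^esub> \<in> U n" "\<And>n. U n \<subseteq> U0"
      and UU: "\<And>n x y. x \<in> U (Suc n) \<Longrightarrow> y \<in> U (Suc n) \<Longrightarrow> x \<otimes>\<^bsub>L\<^esub> inv\<^bsub>L\<^esub> y \<in> U n"
      using * unfolding P_def by blast+
    have UL: "U n \<subseteq> carrier L" for n using U(1) openin_subset top by blast
    have "U (Suc n) \<subseteq> U n" for n
      using UU[of _ n "\<one>\<^bsub>L\<^esub>"] U(2) UL[of "Suc n"] by force
    hence Umono: "m \<le> n \<Longrightarrow> U n \<subseteq> U m" for m n by (rule lift_Suc_antimono_le)
    have Ucl: "X closure_of U (Suc n) \<subseteq> U n" for n
    proof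
      fix z assume z: "z \<in> X closure_of U (Suc n)"
      hence zL: "z \<in> carrier L" by (auto simp: in_closure_of top)
      let ?W = "{w \<in> carrier L. inv\<^bsub>L\<^esub> z \<otimes>\<^bsub>L\<^esub> w \<in> U (Suc n)}"
      have "openin X ?W" "z \<in> ?W" using translate[OF U(1) zL] zL U(2) by auto
      then obtain w where w: "w \<in> U (Suc n)" "w \<in> ?W" by (rule closure_of_meets[OF z])
      have "w \<otimes>\<^bsub>L\<^esub> inv\<^bsub>L\<^esub> (inv\<^bsub>L\<^esub> z \<otimes>\<^bsub>L\<^esub> w) \<in> U n" using UU w by simp
      also have "w \<otimes>\<^bsub>L\<^esub> inv\<^bsub>L\<^esub> (inv\<^bsub>L\<^esub> z \<otimes>\<^bsub>L\<^esub> w) = z"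
        using w zL by (simp add: L.inv_mult_group L.m_assoc[symmetric])
      finally show "z \<in> U n" .
    qed
    define N where "N = (\<Inter>n. X closure_of U n)"
    have N_eq: "N = (\<Inter>n. U n)"
    proof
      show "N \<subseteq> (\<Inter>n. U n)" unfolding N_def using Ucl by blast
      have "U n \<subseteq> X closure_of U n" for n using UL by (intro closure_of_subset) (simp add: top)
      thus "(\<Inter>n. U n) \<subseteq> N" unfolding N_def by blast
    qed
    have Ncl: "closedin X N" unfolding N_def by (intro closedin_Inter) auto
    have NC: "N \<subseteq> C" using N_eq U(3) U0(4) by blast
    have N_sub: "x \<otimes>\<^bsub>L\<^esub> inv\<^bsub>L\<^esub> y \<in> N" if "x \<in> N" "y \<in> N" for x y
      unfolding N_eq using that[unfolded N_eq] by (intro INT_I UU) blast+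
    obtain s where s: "\<And>n. s n \<in> U n" "\<And>n. \<phi> (s n) \<noteq> \<one>\<^bsub>G\<^esub>"
      using escape[OF U(1,2)] by metis
    have sL: "range s \<subseteq> carrier L" using s(1) UL by blast
    define D where "D = generate L (range s)"
    have Dsub: "subgroup D L" unfolding D_def by (rule L.generate_is_subgroup[OF sL])
    have "countable D" unfolding D_def by (rule countable_generate[OF gL sL])
    moreover have "D \<noteq> {}" using Dsub subgroup.one_closed by blast
    ultimately obtain d :: "nat \<Rightarrow> 'l" where d: "D = range d"
      using range_from_nat_into by metis
    define M where "M = X closure_of D"
    have DM: "D \<subseteq> M"
      unfolding M_def using Dsub subgroup.subset top by (metis closure_of_subset)
    have MsL: "M \<subseteq> carrier L" unfolding M_def using closure_of_subset_topspace top by metis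
    have Mcl: "closedin X M" by (simp add: M_def)
    have Msub: "subgroup M L"
    proof (rule L.subgroupI)
      show "M \<subseteq> carrier L" by (rule MsL)
      show "M \<noteq> {}" using \<open>D \<noteq> {}\<close> DM by blast
      fix x assume x: "x \<in> M"
      have "(\<lambda>x. inv\<^bsub>L\<^esub> x) ` D \<subseteq> D" using Dsub by (auto simp: subgroup.m_inv_closed)
      hence "(\<lambda>x. inv\<^bsub>L\<^esub> x) ` M \<subseteq> M"
        using continuous_map_image_closure_subset[OF ci, of D] closure_of_mono[of _ D X]
        unfolding M_def by blast
      thus "inv\<^bsub>L\<^esub> x \<in> M" using x by blast
      fix y assume y: "y \<in> M"
      have "(\<lambda>(x, y). x \<otimes>\<^bsub>L\<^esub> y) ` (D \<times> D) \<subseteq> D" using Dsub by (auto simp: subgroup.m_closed)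
      hence "(\<lambda>(x, y). x \<otimes>\<^bsub>L\<^esub> y) ` (M \<times> M) \<subseteq> M"
        using continuous_map_image_closure_subset[OF cm, of "D \<times> D"] closure_of_mono[of _ D X]
        unfolding M_def closure_of_Times by blast
      thus "x \<otimes>\<^bsub>L\<^esub> y \<in> M" using x y by auto
    qed
    let ?M = "L\<lparr>carrier := M\<rparr>" and ?X = "subtopology X M"
    have gM: "group ?M" by (rule L.subgroup_imp_group[OF Msub])
    have topM: "topspace ?X = M" using MsL top by auto
    have "lch_group ?M ?X"
      unfolding lch_group_def topological_group_def
    proof (intro conjI gM)
      show "topspace ?X = carrier ?M" by (simp only: topM) simp
      have "continuous_map (prod_topology ?X ?X) X (\<lambda>(x, y). x \<otimes>\<^bsub>L\<^esub> y)"
        unfolding subtopology_Times[symmetric] by (rule continuous_map_from_subtopology[OF cm])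
      thus "continuous_map (prod_topology ?X ?X) ?X (\<lambda>(x, y). x \<otimes>\<^bsub>?M\<^esub> y)"
        using Msub by (auto simp: continuous_map_in_subtopology topM subgroup.m_closed)
      have "continuous_map ?X X (\<lambda>x. inv\<^bsub>L\<^esub> x)" by (rule continuous_map_from_subtopology[OF ci])
      hence "continuous_map ?X ?X (\<lambda>x. inv\<^bsub>L\<^esub> x)"
        using Msub by (auto simp: continuous_map_in_subtopology topM subgroup.m_inv_closed)
      thus "continuous_map ?X ?X (\<lambda>x. inv\<^bsub>?M\<^esub> x)"
        by (rule continuous_map_eq) (simp only: topM L.m_inv_consistent[OF Msub])
      show "locally_compact_space ?X" by (rule locally_compact_space_closed_subset[OF lc Mcl])
      show "Hausdorff_space ?X" by (rule Hausdorff_space_subtopology[OF hd])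
    qed
    moreover obtain f :: "'l \<Rightarrow> nat set set" where "inj_on f M"
      using separable_embed[OF hd, of d] unfolding M_def d by blast
    hence "inj_on f (carrier ?M)" by simp
    moreover have "\<phi> \<in> hom ?M G" using MsL by (intro homI) (auto simp: subset_iff)
    ultimately have "openin ?X (kernel ?M G \<phi>)" by (rule lch_slender_embed[OF G])
    then obtain V where V: "openin X V" "kernel ?M G \<phi> = V \<inter> M"
      unfolding openin_subtopology by blast
    have V1: "\<phi> x = \<one>\<^bsub>G\<^esub> \<longleftrightarrow> x \<in> V" if "x \<in> M" for x
      using V(2) that by (auto simp: kernel_def)
    have Mdiff: "inv\<^bsub>L\<^esub> x \<otimes>\<^bsub>L\<^esub> y \<in> M" if "x \<in> M" "y \<in> M" for x y
      using that Msub by (simp add: subgroup.m_closed subgroup.m_inv_closed)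
    have VM1: "\<one>\<^bsub>L\<^esub> \<in> V" using V1[of "\<one>\<^bsub>L\<^esub>"] Msub by (simp add: subgroup.one_closed)
    have coset: "\<phi> w = \<phi> a" if "a \<in> M" "w \<in> M" "inv\<^bsub>L\<^esub> a \<otimes>\<^bsub>L\<^esub> w \<in> V" for a w
      using that MsL V1[OF Mdiff[OF that(1,2)]] by (intro eq) blast+
    have nbhd: "openin X {w \<in> carrier L. inv\<^bsub>L\<^esub> a \<otimes>\<^bsub>L\<^esub> w \<in> V}"
      "a \<in> {w \<in> carrier L. inv\<^bsub>L\<^esub> a \<otimes>\<^bsub>L\<^esub> w \<in> V}" if "a \<in> M" for a
      using that MsL translate[OF V(1), of a] VM1 by auto
    have sM: "s n \<in> M" for n using DM unfolding D_def by (blast intro: generate.incl)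
    obtain x where x: "x \<in> C" "\<And>W. openin X W \<Longrightarrow> x \<in> W \<Longrightarrow> infinite {n. s n \<in> W}"
      using compactin_cluster[OF U0(2), of s] s(1) U(3) U0(4) by blast
    have hit: "\<exists>k\<ge>n. s k \<in> W" if "openin X W" "x \<in> W" for W n
      using x(2)[OF that] by (auto simp: infinite_nat_iff_unbounded_le)
    have xX: "x \<in> topspace X" using x(1) U0(2) compactin_subset_topspace by blast
    have xN: "x \<in> N"
      unfolding N_def
    proof (intro INT_I)
      fix n
      have "\<exists>y. y \<in> U n \<and> y \<in> W" if "openin X W" "x \<in> W" for W
        using hit[OF that, of n] s(1) Umono by blast
      thus "x \<in> X closure_of U n" using xX by (simp add: in_closure_of)
    qed
    have xM: "x \<in> M"
    proof -
      have "\<exists>y. y \<in> M \<and> y \<in> W" if "openin X W" "x \<in> W" for W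
        using hit[OF that, of 0] sM by blast
      hence "x \<in> X closure_of M" using xX by (simp add: in_closure_of)
      thus ?thesis using Mcl by (simp add: closure_of_closedin)
    qed
    have x_ne: "\<phi> x \<noteq> \<one>\<^bsub>G\<^esub>"
    proof -
      obtain k where "s k \<in> {w \<in> carrier L. inv\<^bsub>L\<^esub> x \<otimes>\<^bsub>L\<^esub> w \<in> V}" using hit[OF nbhd[OF xM], of 0] by blast
      hence "\<phi> (s k) = \<phi> x" using coset xM sM by blast
      thus ?thesis using s(2) by metis
    qed
    define K where "K = N \<inter> M"
    have Ksub: "subgroup K L"
    proof (rule L.subgroupI)
      have oneN: "\<one>\<^bsub>L\<^esub> \<in> N" using U(2) by (simp add: N_eq)
      have NL: "N \<subseteq> carrier L" using UL by (auto simp: N_eq)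
      show "K \<subseteq> carrier L" using MsL by (auto simp: K_def)
      show "K \<noteq> {}" using xN xM by (auto simp: K_def)
      have invN: "inv\<^bsub>L\<^esub> a \<in> N" if "a \<in> N" for a
        using N_sub[OF oneN that] NL that by auto
      show "inv\<^bsub>L\<^esub> a \<in> K" if "a \<in> K" for a
        using that invN Msub by (auto simp: K_def subgroup.m_inv_closed)
      show "a \<otimes>\<^bsub>L\<^esub> b \<in> K" if "a \<in> K" "b \<in> K" for a b
        using that N_sub[of a "inv\<^bsub>L\<^esub> b"] invN NL Msub by (auto simp: K_def subgroup.m_closed)
    qed
    have "closedin X K" unfolding K_def using Ncl Mcl by (rule closedin_Int)
    moreover have "K \<subseteq> C" using NC by (auto simp: K_def)
    ultimately have Kcomp: "compactin X K" by (intro closed_compactin[OF U0(2)])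
    let ?B = "\<lambda>a. {w \<in> carrier L. inv\<^bsub>L\<^esub> a \<otimes>\<^bsub>L\<^esub> w \<in> V}"
    have "\<exists>\<F>. finite \<F> \<and> \<F> \<subseteq> ?B ` K \<and> K \<subseteq> \<Union>\<F>"
    proof (rule compactinD[OF Kcomp])
      show "openin X W" if "W \<in> ?B ` K" for W
        using that nbhd(1) by (auto simp: K_def)
      have "a \<in> ?B a" if "a \<in> K" for a using that nbhd(2)[of a] unfolding K_def by blast
      thus "K \<subseteq> \<Union> (?B ` K)" by blast
    qed
    then obtain \<F> where \<F>: "finite \<F>" "\<F> \<subseteq> ?B ` K" "K \<subseteq> \<Union>\<F>" by (elim exE conjE)
    obtain A where A: "A \<subseteq> K" "finite A" "\<F> = ?B ` A"
      using finite_subset_image[OF \<F>(1,2)] by (elim exE conjE)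
    have "\<phi> ` K \<subseteq> \<phi> ` A"
    proof
      fix y assume "y \<in> \<phi> ` K"
      then obtain w where w: "w \<in> K" "y = \<phi> w" by blast
      have "w \<in> \<Union>(?B ` A)" using w(1) \<F>(3) A(3) by blast
      then obtain a where a: "a \<in> A" "inv\<^bsub>L\<^esub> a \<otimes>\<^bsub>L\<^esub> w \<in> V" by (elim UN_E) simp
      have "a \<in> M" "w \<in> M" using a(1) w(1) A(1) by (auto simp: K_def)
      from coset[OF this a(2)] show "y \<in> \<phi> ` A" using a(1) w(2) by blast
    qed
    hence "finite (\<phi> ` K)" by (rule finite_subset) (use A(2) in simp)
    with \<phi>.subgroup_img_is_subgroup[OF Ksub] have "\<phi> ` K = {\<one>\<^bsub>G\<^esub>}"
      by (rule lch_slender_no_finite_subgroup[OF G])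
    thus False using x_ne xN xM by (auto simp: K_def)
  qed
qed

end

theory Submission
  imports Defs
begin

text \<open>By \<open>mittag_leffler_factor\<close>, if a homomorphism on the limit of a Mittag-Leffler sequence does not factor,
  there are \<open>s n\<close> in the limit that are not killed and have trivial \<open>n\<close>th coordinate. The earring group maps
  to the limit with the \<open>n\<close>th circle going to \<open>s n\<close>, so n-slender groups are inverse limit slender; these
  are slender because \<open>\<int>\<^sup>\<nat>\<close> is the limit of the \<open>\<int>\<^sup>n\<close>.

  A slender group contains no nontrivial image of a compact group (ultralimits extend \<open>e\<^sub>n \<mapsto> x\<close> to \<open>\<int>\<^sup>\<nat>\<close>)
  or of \<open>\<rat>\<close>. The Gleason-Yamabe argument reduces a locally compact group to one without small subgroups, where
  the elements near \<open>1\<close> are built from finitely many one-parameter subgroups, all of which are killed.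

  Strictness is witnessed by the subgroup of the limit of the free groups in which every letter occurs
  boundedly often, by that limit, and by \<open>\<int>\<^sup>\<nat>\<close>. Over a slender abelian group the value of a loop is the product of
  its values on the first \<open>n\<close> circles and on the tail. If loops in the tails had nontrivial values \<open>y\<^sub>n\<close>, infinite
  concatenations solving \<open>z\<^sub>n = a\<^sub>n y\<^sub>n + (n + 1) z\<^sub>n\<^sub>+\<^sub>1\<close> would give a homomorphism \<open>a \<mapsto> z\<^sub>0\<close> on \<open>\<int>\<^sup>\<nat>\<close> that kills no
  unit vector.\<close>

text \<open>Analysis is confined to continuous functions: the Haar integral is a positive functional
  on those of compact support, and the eigenfunctions that separate points of a compact group are
  found among continuous functions.

  Homomorphisms out of the earring group are obtained by lifting loops to locally constant functions
  with prescribed jumps at the antipodes of the base point. At each stage of an inverse limit only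
  finitely many jumps are nontrivial.

  For words the mechanism is growth: powers of a nontrivial word, and conjugates of a second word by
  them, become long. This contradicts commutation in one case and boundedness in the other.

  The factors \<open>n + 1\<close> in the abelian equations serve uniqueness: two different
  solutions would give a nontrivial image of the rationals, so the solution is unique and therefore
  additive in \<open>a\<close>.\<close>

no_notation matrix_matrix_mult (infixl "**" 70) and vector_matrix_mult (infixl "v*" 70)
notation mult (infixl "**\<index>" 70)

lemmas group_homI = group_hom.intro[OF _ _ group_hom_axioms.intro]

section \<open>Ultrafilters\<close>

definition ultra :: "'a filter => bool" where
	"ultra U \<longleftrightarrow> U ~= bot & (ALL P. eventually P U | eventually (%x. ~ P x) U)"

text \<open>Zorn's lemma on the proper filters below \<open>F\<close>, finer filters being larger. A
  nonempty chain is a base of its infimum, so the infimum is proper. A maximal element decides every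
  \<open>P\<close>, since otherwise its meet with \<open>P\<close> would be a strictly finer proper
  filter.\<close>

lemma ultra_exists:
	fixes F :: "'a filter"
	assumes "F ~= bot"
	obtains U where "U <= F" "ultra U"
proof -
	define A where "A = {G. G ~= bot & G <= F}"
	have "EX m:A. ALL a:A. m >= a --> a = m"
	proof(rule predicate_Zorn[of A "%x y. y <= x"])
			show "partial_order_on A (relation_of (%x y. y <= x) A)"
				by(auto simp: partial_order_on_def preorder_on_def relation_of_def refl_on_def trans_def antisym_def)
			fix C assume C: "C : Chains (relation_of (%x y. y <= x) A)"
			show "EX u:A. ALL a:C. u <= a"
			proof(cases "C = {}")
				case True
				thus ?thesis using assms by(auto simp: A_def)
			next
				case False
				have CA: "C <= A" using C by(auto simp: Chains_def relation_of_def)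
				have ch: "x <= y | y <= x" if "x : C" "y : C" for x y
					using C that by(auto simp: Chains_def relation_of_def)
				have "Inf C ~= bot"
				proof -
					have "(ALL P. eventually P (Inf C) \<longleftrightarrow> (EX b:C. eventually P b))"
						by(rule allI, rule eventually_Inf_base[OF False], metis ch inf.absorb1 inf.absorb2 order_refl)
					thus ?thesis using CA by(auto simp: trivial_limit_def A_def)
				qed
				moreover have "Inf C <= F" using False CA by(auto simp: A_def intro: Inf_lower2)
				ultimately show ?thesis by(intro bexI[of _ "Inf C"]) (auto simp: A_def Inf_lower)
			qed
		qed
	then obtain m where m: "m : A" "!!a. a : A ==> a <= m ==> a = m" by blast
	have "eventually P m | eventually (%x. ~ P x) m" for P
	proof(rule ccontr)
		assume c: "~ ?thesis"
		let ?G = "inf m (principal {x. P x})"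
		have "?G ~= bot"
			using c by(auto simp: trivial_limit_def eventually_inf_principal)
		hence "?G : A" using m(1) by(auto simp: A_def le_infI1)
		hence "?G = m" using m(2) by simp
		moreover have "eventually P ?G" by(simp add: eventually_inf_principal)
		ultimately show False using c by simp
	qed
	thus ?thesis using that[of m] m(1) by(auto simp: A_def ultra_def)
qed

lemma ultra_not: "ultra U ==> ~ eventually P U ==> eventually (%x. ~ P x) U"
	by(auto simp: ultra_def)

lemma ultra_ex: "ultra U ==> eventually P U ==> EX x. P x"
	by(auto simp: ultra_def dest: eventually_happens)

text \<open>If no point of \<open>K\<close> were a limit, each would have an open neighbourhood that
  is missed eventually along \<open>U\<close>, and finitely many of these cover \<open>K\<close>.
  This stands in for convergent subsequences, as no countability is assumed.\<close>

lemma ultra_compactin: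
	assumes U: "ultra U" and K: "compactin X K" and ev: "eventually (%i. f i : K) U"
	obtains l where "l : K" "limitin X f l U"
proof -
	have sub: "K <= topspace X" using K compactin_subset_topspace by blast
	have "EX l:K. ALL W. openin X W --> l : W --> eventually (%i. f i : W) U"
	proof(rule ccontr)
		assume "~ ?thesis"
		hence "ALL l:K. EX W. openin X W & l : W & eventually (%i. f i ~: W) U"
			using ultra_not[OF U] by blast
		then obtain W where W: "!!l. l : K ==> openin X (W l) & l : W l & eventually (%i. f i ~: W l) U"
			by metis
		have "EX G. finite G & G <= W ` K & K <= \<Union>G"
			using W by(intro compactinD[OF K]) auto
		then obtain G where F: "finite G" "G <= W ` K" "K <= \<Union>G" by blast
		have "eventually (%i. ALL S:G. f i ~: S) U"
			using F W by(intro eventually_ball_finite) auto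
		hence "eventually (%i. False) U" using ev by eventually_elim (use F in blast)
		thus False using U by(simp add: ultra_def)
	qed
	thus ?thesis using that sub by(auto simp: limitin_def)
qed

lemma ultra_real:
	fixes f :: "'i => real"
	assumes "ultra U" "eventually (%i. a <= f i & f i <= b) U"
	obtains l where "a <= l" "l <= b" "(f \<longlongrightarrow> l) U"
	using ultra_compactin[OF assms(1), of euclidean "{a..b}" f] assms(2) by force

lemma limitin_in_closed:
	assumes "limitin X f l U" "closedin X K" "ultra U" "eventually (%i. f i : K) U"
	shows "l : K"
proof(rule ccontr)
	assume "l ~: K"
	hence "eventually (%i. f i : topspace X - K) U"
		using assms(1,2) limitin_topspace[OF assms(1)] by(intro limitinD[OF assms(1)]) auto
	hence "eventually (%i. False) U" using assms(4) by eventually_elim auto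
	thus False using assms(3) by(simp add: ultra_def)
qed

section \<open>Locally compact groups\<close>

locale lch_grp = group L for L (structure) +
	fixes X :: "'a topology"
	assumes lch: "lch_group L X"
begin

lemma topspace: "topspace X = carrier L"
	and continuous_mult: "continuous_map (prod_topology X X) X (%(x, y). x**y)"
	and continuous_inv: "continuous_map X X (%x. inv x)"
	and locally_compact: "locally_compact_space X"
	and Hausdorff: "Hausdorff_space X"
	using lch by(auto simp: lch_group_def topological_group_def)

lemma continuous_mult':
	assumes "continuous_map Z X f" "continuous_map Z X g"
	shows "continuous_map Z X (%z. f z**g z)"
	using continuous_map_compose[OF continuous_map_pairedI[OF assms] continuous_mult] by(simp add: comp_def)

lemma continuous_inv':
	assumes "continuous_map Z X f"
	shows "continuous_map Z X (%z. inv (f z))"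
	using continuous_map_compose[OF assms continuous_inv] by(simp add: comp_def)

lemma continuous_const: "c : carrier L ==> continuous_map Z X (%z. c)"
	by(simp add: topspace)

lemma continuous_fst: "continuous_map (prod_topology X X) X (%z. fst z)"
	and continuous_snd: "continuous_map (prod_topology X X) X (%z. snd z)"
	by(simp_all add: continuous_map_fst continuous_map_snd)

lemma continuous_ident: "continuous_map X X (%z. z)"
	using continuous_map_id[of X] by(simp add: id_def)

lemmas cont_intros = continuous_mult' continuous_inv' continuous_const continuous_fst continuous_snd continuous_ident

lemma compactinD_carrier: "compactin X K ==> x : K ==> x : carrier L"
	using compactin_subset_topspace[of X K] by(auto simp: topspace)

lemma openinD_carrier: "openin X K ==> x : K ==> x : carrier L"
	using openin_subset[of X K] by(auto simp: topspace)

definition nb :: "'a set => bool" where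
	"nb V \<longleftrightarrow> openin X V & \<one> : V"

lemma nbD: "nb V ==> openin X V" "nb V ==> \<one> : V" "nb V ==> x : V ==> x : carrier L"
	using openinD_carrier by(auto simp: nb_def)

lemma nb_Int: "nb V ==> nb W ==> nb (V Int W)"
	by(auto simp: nb_def)

lemma nb_carrier: "nb (carrier L)"
	using openin_topspace[of X] by(simp add: nb_def topspace)

text \<open>The tube lemma around \<open>K \<times> {\<one>}\<close>. It is the source of uniformity
  over parameters from a compact set: conjugation, translation and uniform continuity are instances
  with a suitable \<open>f\<close>.\<close>

lemma tube:
	assumes K: "compactin X K" and O: "openin Y O'"
		and f: "continuous_map (prod_topology X X) Y (%z. f (fst z) (snd z))"
		and 1: "!!k. k : K ==> f k \<one> : O'"
	obtains W where "nb W" "!!k w. k : K ==> w : W ==> f k w : O'"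
proof -
	let ?Z = "{z : topspace (prod_topology X X). f (fst z) (snd z) : O'}"
	have op: "openin (prod_topology X X) ?Z" by(rule openin_continuous_map_preimage[OF f O])
	have sub: "K \<times> {\<one>} <= ?Z"
		using 1 compactin_subset_topspace[OF K] by(auto simp: topspace)
	have c: "compactin X {\<one>}" by(simp add: topspace)
	obtain U V where "openin X U" "openin X V" "K <= U" "{\<one>} <= V" "U \<times> V <= ?Z"
		by(rule Wallace_theorem_prod_topology[OF K c op sub])
	thus ?thesis by(intro that[of V]) (auto simp: nb_def, force)
qed

lemma nb_sym:
	assumes "nb V"
	obtains W where "nb W" "W <= V" "!!x. x : W ==> inv x : W"
proof -
	let ?W = "{x : carrier L. inv x : V}"
	have "openin X ?W"
		using openin_continuous_map_preimage[OF continuous_inv nbD(1)[OF assms]] by(simp add: topspace)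
	hence "nb (V Int ?W)" using nbD[OF assms] by(auto simp: nb_def)
	thus ?thesis by(intro that[of "V Int ?W"]) (use nbD[OF assms] in auto)
qed

lemma nb_mult:
	assumes "nb V"
	obtains W where "nb W" "W <= V" "!!x. x : W ==> inv x : W" "!!x y. x : W ==> y : W ==> x**y : V"
proof -
	let ?Z = "{z : topspace (prod_topology X X). fst z**snd z : V}"
	have op: "openin (prod_topology X X) ?Z"
		by(rule openin_continuous_map_preimage[OF _ nbD(1)[OF assms]]) (intro cont_intros)
	have sub: "{\<one>} \<times> {\<one>} <= ?Z" using nbD[OF assms] by(auto simp: topspace)
	have c: "compactin X {\<one>}" by(simp add: topspace)
	obtain A B where AB: "openin X A" "openin X B" "{\<one>} <= A" "{\<one>} <= B" "A \<times> B <= ?Z"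
		by(rule Wallace_theorem_prod_topology[OF c c op sub])
	hence n: "nb (A Int B Int V)" using assms by(auto simp: nb_def)
	obtain W where W: "nb W" "W <= A Int B Int V" "!!x. x : W ==> inv x : W" using nb_sym[OF n] by metis
	have "x**y : V" if "x : W" "y : W" for x y
	proof -
		have "(x, y) : ?Z" using AB(5) W(2) that by blast
		thus ?thesis by simp
	qed
	thus ?thesis using W by(intro that[of W]) auto
qed

lemma nb_conj:
	assumes K: "compactin X K" and V: "nb V"
	obtains W where "nb W" "!!k w. k : K ==> w : W ==> k**w**inv k : V"
		"!!k w. k : K ==> w : W ==> inv k**w**k : V"
proof -
	have KL: "k : carrier L" if "k : K" for k using compactinD_carrier[OF K that] .
	have one: "k**\<one>**inv k : V" "inv k**\<one>**k : V" if "k : K" for k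
		using KL[OF that] nbD(2)[OF V] by simp_all
	have c: "continuous_map (prod_topology X X) X (%z. fst z**snd z**inv (fst z))"
		"continuous_map (prod_topology X X) X (%z. inv (fst z)**snd z**fst z)" by(intro cont_intros)+
	obtain W1 where W1: "nb W1" "!!k w. k : K ==> w : W1 ==> k**w**inv k : V"
		using tube[OF K nbD(1)[OF V] c(1)] one by blast
	obtain W2 where W2: "nb W2" "!!k w. k : K ==> w : W2 ==> inv k**w**k : V"
		using tube[OF K nbD(1)[OF V] c(2)] one by blast
	show ?thesis using W1 W2 by(intro that[of "W1 Int W2"]) (auto intro: nb_Int)
qed

lemma nb_around:
	assumes K: "compactin X K" and O: "openin X O'" "K <= O'"
	obtains W where "nb W" "!!k w. k : K ==> w : W ==> w**k : O'" "!!k w. k : K ==> w : W ==> k**w : O'"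
proof -
	have KL: "k : carrier L" if "k : K" for k using compactinD_carrier[OF K that] .
	have one: "k**\<one> : O'" "\<one>**k : O'" if "k : K" for k
		using KL[OF that] O(2) that by auto
	have c: "continuous_map (prod_topology X X) X (%z. fst z**snd z)"
		"continuous_map (prod_topology X X) X (%z. snd z**fst z)" by(intro cont_intros)+
	obtain W1 where W1: "nb W1" "!!k w. k : K ==> w : W1 ==> w**k : O'"
		using tube[OF K O(1) c(2)] one by blast
	obtain W2 where W2: "nb W2" "!!k w. k : K ==> w : W2 ==> k**w : O'"
		using tube[OF K O(1) c(1)] one by blast
	show ?thesis using W1 W2 by(intro that[of "W1 Int W2"]) (auto intro: nb_Int)
qed

lemma openin_translate:
	assumes "openin X V" "a : carrier L"
	shows "openin X {x : carrier L. a**x : V}" "openin X {x : carrier L. x**a : V}"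
proof -
	have "continuous_map X X (%x. a**x)" "continuous_map X X (%x. x**a)"
		using assms by(intro cont_intros; simp)+
	thus "openin X {x : carrier L. a**x : V}" "openin X {x : carrier L. x**a : V}"
		using openin_continuous_map_preimage assms(1) unfolding topspace[symmetric] by blast+
qed

lemma nb_compact:
	assumes "nb V"
	obtains W C where "nb W" "W <= C" "compactin X C" "C <= V"
proof -
	have "neighbourhood_base_of (compactin X) X"
		using locally_compact Hausdorff locally_compact_space_neighbourhood_base by blast
	then obtain W C where "openin X W" "compactin X C" "\<one> : W" "W <= C" "C <= V"
		using assms unfolding neighbourhood_base_of nb_def by meson
	thus ?thesis by(intro that[of W C]) (auto simp: nb_def)
qed

lemma compactin_mult:
	assumes "compactin X A" "compactin X B"
	shows "compactin X {a**b | a b. a : A & b : B}"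
proof -
	have "compactin X ((%(x, y). x**y) ` (A \<times> B))"
		by(rule image_compactin[OF _ continuous_mult]) (use assms in "simp add: compactin_Times")
	also have "(%(x, y). x**y) ` (A \<times> B) = {a**b | a b. a : A & b : B}" by force
	finally show ?thesis .
qed

lemma compactin_inv: "compactin X A ==> compactin X ((%x. inv x) ` A)"
	by(rule image_compactin[OF _ continuous_inv])

lemma closed_of_compact: "compactin X A ==> closedin X A"
	by(rule compactin_imp_closedin[OF Hausdorff])

lemma limit_unique: "ultra U ==> limitin X f l U ==> limitin X f m U ==> l = m"
	using limitin_Hausdorff_unique[of X f l U m] Hausdorff unfolding ultra_def by blast

lemma limitin_map:
	assumes "limitin X f l U" "continuous_map X Y g"
	shows "limitin Y (%i. g (f i)) (g l) U"
	using continuous_map_limit[OF assms(2,1)] by(simp add: comp_def)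

lemma limit_mult:
	assumes "limitin X f l U" "limitin X g m U"
	shows "limitin X (%i. f i**g i) (l**m) U"
proof -
	have "limitin (prod_topology X X) (%i. (f i, g i)) (l, m) U"
		unfolding limitin_pairwise comp_def fst_conv snd_conv using assms by blast
	from continuous_map_limit[OF continuous_mult this] show ?thesis by(simp add: comp_def)
qed

lemma limit_inv: "limitin X f l U ==> limitin X (%i. inv (f i)) (inv l) U"
	using limitin_map[OF _ continuous_inv] .

lemma limit_carrier: "limitin X f l U ==> l : carrier L"
	using limitin_topspace[of X f l U] unfolding topspace .

lemma limit_one: "(!!V. nb V ==> eventually (%i. f i : V) U) ==> limitin X f \<one> U"
	unfolding limitin_def nb_def topspace using one_closed by blast

subsection \<open>Compactly supported functions\<close>

abbreviation cont :: "('a => real) => bool" where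
	"cont \<equiv> continuous_map X euclideanreal"

definition Cc :: "('a => real) set" where
	"Cc = {f. cont f & (EX K. compactin X K & (ALL x:carrier L - K. f x = 0))}"

lemma CcD: "f : Cc ==> cont f"
	by(simp add: Cc_def)

lemma bump:
	assumes "nb V"
	obtains t K where "cont t" "t \<one> = 1" "!!x. x : carrier L ==> 0 <= t x"
		"!!x. x : carrier L ==> t x <= 1" "compactin X K" "K <= V" "!!x. x : carrier L - K ==> t x = 0"
proof -
	obtain W C where W: "nb W" "W <= C" "compactin X C" "C <= V" using nb_compact[OF assms] by metis
	have "completely_regular_space X"
		using locally_compact Hausdorff by(metis locally_compact_regular_imp_completely_regular_space)
	moreover have "closedin X (carrier L - W)" using nbD(1)[OF W(1)] topspace by(metis openin_closedin_eq)
	moreover have "\<one> : topspace X - (carrier L - W)" using nbD(2)[OF W(1)] topspace by auto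
	ultimately obtain f where f: "continuous_map X (top_of_set {0..1::real}) f" "f \<one> = 0" "f ` (carrier L - W) <= {1}"
		unfolding completely_regular_space_def by metis
	have f1: "cont f" "!!x. x : carrier L ==> f x : {0..1}"
		using f(1) topspace by(auto simp: continuous_map_in_subtopology)
	show ?thesis
	proof(rule that[of "%x. 1 - f x" C])
		show "cont (%x. 1 - f x)" by(intro continuous_intros f1)
		show "1 - f x = 0" if "x : carrier L - C" for x using f(3) that W(2) by auto
		show "1 - f \<one> = 1" using f(2) by simp
		show "0 <= 1 - f x" "1 - f x <= 1" if "x : carrier L" for x using f1(2)[OF that] by auto
	qed (fact W)+
qed

lemma unif_cont:
	assumes f: "f : Cc" and e: "e > 0"
	obtains W where "nb W" "!!w x. w : W ==> x : carrier L ==> abs (f (w**x) - f x) < e"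
		"!!w x. w : W ==> x : carrier L ==> abs (f (x**w) - f x) < e"
proof -
	obtain K where K: "compactin X K" "!!x. x : carrier L - K ==> f x = 0" using f by(auto simp: Cc_def)
	obtain V0 C0 where V0: "nb V0" "V0 <= C0" "compactin X C0" using nb_compact[OF nb_carrier] by metis
	obtain V where V: "nb V" "V <= V0" "!!x. x : V ==> inv x : V" using nb_sym[OF V0(1)] by blast
	let ?K1 = "{a**b | a b. a : C0 & b : K}" and ?K2 = "{a**b | a b. a : K & b : C0}"
	have K1: "compactin X ?K1" and K2: "compactin X ?K2" using compactin_mult K(1) V0(3) by blast+
	have op: "openin euclideanreal {-e<..<e}" by simp
	have cf: "continuous_map (prod_topology X X) euclideanreal (%z. f (g z))"
		if "continuous_map (prod_topology X X) X g" for g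
		using continuous_map_compose[OF that CcD[OF f]] by(simp add: comp_def)
	have c: "continuous_map (prod_topology X X) euclideanreal (%z. f (snd z**fst z) - f (fst z))"
		"continuous_map (prod_topology X X) euclideanreal (%z. f (fst z**snd z) - f (fst z))"
		by(intro continuous_map_diff cf cont_intros)+
	have one: "f (\<one>**k) - f k : {-e<..<e}" "f (k**\<one>) - f k : {-e<..<e}" if "k : carrier L" for k
		using that e by simp_all
	obtain W1 where W1: "nb W1" "!!k w. k : ?K1 ==> w : W1 ==> f (w**k) - f k : {-e<..<e}"
		using tube[OF K1 op c(1), OF one(1)[OF compactinD_carrier[OF K1]]] by blast
	obtain W2 where W2: "nb W2" "!!k w. k : ?K2 ==> w : W2 ==> f (k**w) - f k : {-e<..<e}"
		using tube[OF K2 op c(2), OF one(2)[OF compactinD_carrier[OF K2]]] by blast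
	show ?thesis
	proof(rule that[of "W1 Int W2 Int V"])
		show "nb (W1 Int W2 Int V)" by(intro nb_Int W1 W2 V)
		fix w x assume w: "w : W1 Int W2 Int V" and x: "x : carrier L"
		have wc: "w : carrier L" "inv w : C0" using w V V0 nbD(3)[OF V(1)] by auto
		show "abs (f (w**x) - f x) < e"
		proof(cases "x : ?K1")
			case True
			have "f (w**x) - f x : {-e<..<e}" using w by(intro W1(2)[OF True]) blast
			thus ?thesis unfolding greaterThanLessThan_iff abs_less_iff by linarith
		next
			case False
			have "w**x ~: K"
			proof
				assume "w**x : K"
				hence "inv w**(w**x) : ?K1" using wc by blast
				thus False using False wc x by(simp add: m_assoc[symmetric])
			qed
			moreover have "x ~: K"
			proof
				assume "x : K"
				hence "\<one>**x : ?K1" using V0(2) nbD(2)[OF V0(1)] by blast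
				thus False using False x by simp
			qed
			ultimately show ?thesis using K(2) x wc e by simp
		qed
		show "abs (f (x**w) - f x) < e"
		proof(cases "x : ?K2")
			case True
			have "f (x**w) - f x : {-e<..<e}" using w by(intro W2(2)[OF True]) blast
			thus ?thesis unfolding greaterThanLessThan_iff abs_less_iff by linarith
		next
			case False
			have "x**w ~: K"
			proof
				assume "x**w : K"
				hence "(x**w)**inv w : ?K2" using wc by blast
				thus False using False wc x by(simp add: m_assoc)
			qed
			moreover have "x ~: K"
			proof
				assume "x : K"
				hence "x**\<one> : ?K2" using V0(2) nbD(2)[OF V0(1)] by blast
				thus False using False x by simp
			qed
			ultimately show ?thesis using K(2) x wc e by simp
		qed
	qed
qed

lemma Cc_add: "f : Cc ==> g : Cc ==> (%x. f x + g x) : Cc"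
proof -
	assume "f : Cc" "g : Cc"
	then obtain K K' where "compactin X K" "ALL x:carrier L - K. f x = 0" "compactin X K'" "ALL x:carrier L - K'. g x = 0"
		"cont f" "cont g" by(auto simp: Cc_def)
	thus ?thesis unfolding Cc_def mem_Collect_eq
		by(intro conjI continuous_map_add exI[of _ "K Un K'"]) (simp_all add: compactin_Un)
qed

lemma Cc_mult: "f : Cc ==> cont g ==> (%x. f x * g x) : Cc"
	unfolding Cc_def by(auto intro!: continuous_map_real_mult)

lemma Cc_mult': "f : Cc ==> cont g ==> (%x. g x * f x) : Cc"
	unfolding Cc_def by(auto intro!: continuous_map_real_mult)

lemma Cc_cmult: "f : Cc ==> (%x. c * f x) : Cc"
	by(rule Cc_mult') auto

lemma Cc_diff: "f : Cc ==> g : Cc ==> (%x. f x - g x) : Cc"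
	using Cc_add[OF _ Cc_cmult[of g "-1"], of f] by simp

lemma Cc_zero: "(%x. 0) : Cc"
	unfolding Cc_def by(auto intro!: exI[of _ "{}"])

lemma Cc_translate:
	assumes f: "f : Cc" and a: "a : carrier L"
	shows "(%x. f (a**x)) : Cc"
proof -
	obtain K where K: "compactin X K" "!!x. x : carrier L - K ==> f x = 0" using f by(auto simp: Cc_def)
	have "cont (%x. f (a**x))"
		using continuous_map_compose[OF continuous_mult'[OF continuous_const[OF a] continuous_ident] CcD[OF f]]
		by(simp add: comp_def)
	moreover have "compactin X ((%x. inv a**x) ` K)"
		by(rule image_compactin[OF K(1)]) (use a in "auto intro!: cont_intros")
	moreover have "f (a**x) = 0" if "x : carrier L" "x ~: (%x. inv a**x) ` K" for x
	proof(rule K(2))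
		have "x = inv a**(a**x)" using a that by(simp add: m_assoc[symmetric])
		thus "a**x : carrier L - K" using that a by blast
	qed
	ultimately show ?thesis unfolding Cc_def by blast
qed

lemma Cc_bounded:
	assumes "f : Cc"
	obtains B where "B > 0" "!!x. x : carrier L ==> abs (f x) <= B"
proof -
	obtain K where K: "compactin X K" "!!x. x : carrier L - K ==> f x = 0" using assms by(auto simp: Cc_def)
	have "compact (f ` K)" using image_compactin[OF K(1) CcD[OF assms]] by simp
	hence "bounded (f ` K)" by(rule compact_imp_bounded)
	then obtain B where "!!x. x : K ==> abs (f x) <= B"
		unfolding bounded_iff by auto
	hence "abs (f x) <= max B 1" if "x : carrier L" for x
		using K(2)[of x] that by(cases "x : K") (simp_all add: le_max_iff_disj)
	thus ?thesis using that[of "max B 1"] by auto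
qed

end

section \<open>The Haar integral\<close>

definition haar_integral :: "'a monoid => 'a topology => (('a => real) => real) => bool" where
	"haar_integral L X I \<longleftrightarrow>
		 (ALL f:lch_grp.Cc L X. ALL g:lch_grp.Cc L X. I (%x. f x + g x) = I f + I g) &
		 (ALL f:lch_grp.Cc L X. ALL c. I (%x. c * f x) = c * I f) &
		 (ALL f:lch_grp.Cc L X. (ALL x:carrier L. 0 <= f x) --> 0 <= I f) &
		 (ALL f:lch_grp.Cc L X. (ALL x:carrier L. 0 <= f x) --> (EX x:carrier L. 0 < f x) --> 0 < I f) &
		 (ALL f:lch_grp.Cc L X. ALL a:carrier L. I (%x. f (a **\<^bsub>L\<^esub> x)) = I f)"

context lch_grp
begin

section \<open>Haar's covering indices\<close>

definition Cp :: "('a => real) set" where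
	"Cp = {f : Cc. ALL x:carrier L. 0 <= f x}"

definition Cpp :: "('a => real) set" where
	"Cpp = {f : Cp. EX x:carrier L. 0 < f x}"

lemma Cpp_Cp: "f : Cpp ==> f : Cp" and Cp_Cc: "f : Cp ==> f : Cc"
	and Cp_nonneg: "f : Cp ==> x : carrier L ==> 0 <= f x"
	by(auto simp: Cpp_def Cp_def)

lemma Cp_add: "f : Cp ==> g : Cp ==> (%x. f x + g x) : Cp"
	using Cc_add[of f g] by(simp add: Cp_def)

lemma Cp_cmult: "f : Cp ==> 0 <= c ==> (%x. c * f x) : Cp"
	using Cc_cmult[of f c] by(simp add: Cp_def)

lemma Cp_translate: "f : Cp ==> a : carrier L ==> (%x. f (a**x)) : Cp"
	using Cc_translate[of f a] by(simp add: Cp_def)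

lemma bump_Cpp:
	assumes "nb V"
	obtains q where "q : Cpp" "q \<one> = 1" "!!x. x : carrier L ==> q x <= 1" "!!x. x : carrier L ==> q x ~= 0 ==> x : V"
proof -
	obtain q K where t: "cont q" "q \<one> = 1" "!!x. x : carrier L ==> 0 <= q x"
		"!!x. x : carrier L ==> q x <= 1" "compactin X K" "K <= V" "!!x. x : carrier L - K ==> q x = 0"
		using bump[OF assms] by blast
	have "q : Cc" unfolding Cc_def using t by blast
	hence "q : Cpp" unfolding Cpp_def Cp_def using t(2,3) one_closed zero_less_one by force
	thus ?thesis using that[of q] t by blast
qed

abbreviation weight :: "(real \<times> 'a) list => real" where "weight l \<equiv> \<Sum>(c, s)\<leftarrow>l. c"

definition covers :: "('a => real) => ('a => real) => (real \<times> 'a) list => bool" where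
	"covers f g l \<longleftrightarrow> (ALL (c, s):set l. 0 <= c & s : carrier L) &
		 (ALL x:carrier L. f x <= (\<Sum>(c, s)\<leftarrow>l. c * g (s**x)))"

text \<open>Haar's covering index (f : g) in the functional form due to Weil. As the support of
  \<open>g\<close> shrinks to the identity, quotients of such indices approximate quotients of
  integrals.\<close>

definition idx :: "('a => real) => ('a => real) => real" where
	"idx f g = Inf {weight l | l. covers f g l}"

lemma coversD:
	assumes "covers f g l" "(c, s) : set l"
	shows "0 <= c" "s : carrier L"
	using assms unfolding covers_def by auto

text \<open>Finitely many translates of the open set where \<open>g\<close> exceeds
  \<open>g a / 2\<close> cover the support of \<open>f\<close>; weight \<open>2 * B / g a\<close> on
  each of them lifts the sum above the bound \<open>B\<close> of \<open>f\<close>.\<close>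

lemma covers_exists:
	assumes f: "f : Cp" and g: "g : Cpp"
	shows "EX l. covers f g l"
proof -
	obtain K where K: "compactin X K" "!!x. x : carrier L - K ==> f x = 0"
		using Cp_Cc[OF f] by(auto simp: Cc_def)
	obtain B where B: "B > 0" "!!x. x : carrier L ==> abs (f x) <= B" using Cc_bounded[OF Cp_Cc[OF f]] by blast
	obtain a where a: "a : carrier L" "0 < g a" using g by(auto simp: Cpp_def)
	have gp: "g : Cp" using g by(rule Cpp_Cp)
	note g0 = Cp_nonneg[OF gp]
	define O' where "O' k = {x : carrier L. g a / 2 < g (a**inv k**x)}" for k
	have op: "openin X (O' k)" "k : O' k" if "k : K" for k
	proof -
		have k: "k : carrier L" using compactinD_carrier[OF K(1) that] .
		have "cont (%x. g (a**inv k**x))"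
			using CcD[OF Cc_translate[OF Cp_Cc[OF gp]]] a k by simp
		from openin_continuous_map_preimage[OF this, of "{g a / 2<..}"]
		show "openin X (O' k)" by(simp add: O'_def topspace)
		show "k : O' k" using a k by(simp add: O'_def m_assoc)
	qed
	have "EX F. finite F & F <= O' ` K & K <= \<Union>F"
		using op by(intro compactinD[OF K(1)]) auto
	then obtain F where "finite F" "F <= O' ` K" "K <= \<Union>F" by blast
	then obtain A where A: "finite A" "A <= K" "K <= \<Union>(O' ` A)" by(metis finite_subset_image)
	obtain ks where ks: "set ks = A" using finite_list[OF A(1)] by blast
	have kc: "k : carrier L" if "k : set ks" for k using that ks A(2) compactinD_carrier[OF K(1)] by blast
	define c where "c = 2 * B / g a"
	have c: "c > 0" using B a by(simp add: c_def)
	have "covers f g (map (%k. (c, a**inv k)) ks)"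
		unfolding covers_def
	proof(intro conjI ballI)
		fix x assume x: "x : carrier L"
		have nn: "0 <= c * g (a**inv k**x)" if "k : set ks" for k
			using c a kc[OF that] x g0 by simp
		have "f x <= (\<Sum>k\<leftarrow>ks. c * g (a**inv k**x))"
		proof(cases "x : K")
			case True
			then obtain k where k: "k : set ks" "x : O' k" using A(3) ks by blast
			have "f x <= B" using B(2)[OF x] by simp
			also have "B = c * (g a / 2)" using a by(simp add: c_def)
			also have "... <= c * g (a**inv k**x)" using k(2) c by(simp add: O'_def)
			also have "... <= (\<Sum>k\<leftarrow>ks. c * g (a**inv k**x))"
				using k(1) nn by(intro member_le_sum_list) auto
			finally show ?thesis .
		next
			case False
			thus ?thesis using K(2) x nn by(auto intro!: sum_list_nonneg)
		qed
		thus "f x <= (\<Sum>(c, s)\<leftarrow>map (%k. (c, a**inv k)) ks. c * g (s**x))" by(simp add: comp_def)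
	qed (use c a kc in auto)
	thus ?thesis by blast
qed

lemma covers_sum_nonneg: "covers f g l ==> 0 <= weight l"
	unfolding covers_def by(intro sum_list_nonneg) auto

lemma idx_le: "covers f g l ==> idx f g <= weight l"
	unfolding idx_def by(intro cInf_lower bdd_belowI[of _ 0]) (auto dest: covers_sum_nonneg)

lemma idx_ge:
	assumes "f : Cp" "g : Cpp" "!!l. covers f g l ==> b <= weight l"
	shows "b <= idx f g"
	unfolding idx_def using covers_exists[OF assms(1,2)] assms(3) by(intro cInf_greatest) auto

lemma idx_nonneg: "f : Cp ==> g : Cpp ==> 0 <= idx f g"
	by(rule idx_ge) (auto dest: covers_sum_nonneg)

lemma idx_add:
	assumes "f : Cp" "f' : Cp" "g : Cpp"
	shows "idx (%x. f x + f' x) g <= idx f g + idx f' g"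
proof -
	have 1: "idx (%x. f x + f' x) g - weight l <= (\<Sum>(c, s)\<leftarrow>l'. c)"
		if "covers f g l" "covers f' g l'" for l l'
	proof -
		have "covers (%x. f x + f' x) g (l @ l')"
			using that unfolding covers_def by(auto intro: add_mono)
		from idx_le[OF this] show ?thesis by simp
	qed
	have 2: "idx (%x. f x + f' x) g - idx f' g <= weight l" if "covers f g l" for l
		using idx_ge[OF assms(2,3) 1[OF that]] by simp
	show ?thesis using idx_ge[OF assms(1,3) 2] by simp
qed

lemma idx_cmult_le:
	assumes "f : Cp" "g : Cpp" "c > 0"
	shows "idx (%x. c * f x) g <= c * idx f g"
proof -
	have "idx (%x. c * f x) g / c <= idx f g"
	proof(rule idx_ge[OF assms(1,2)])
		fix l assume l: "covers f g l"
		have "covers (%x. c * f x) g (map (%(d, s). (c * d, s)) l)"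
		proof -
			have "(\<Sum>(d, s)\<leftarrow>map (%(d, s). (c * d, s)) l. d * g (s**x)) = c * (\<Sum>(d, s)\<leftarrow>l. d * g (s**x))" for x
				by(simp add: comp_def case_prod_unfold sum_list_const_mult mult.assoc)
			thus ?thesis using l assms(3) unfolding covers_def by(auto intro: mult_left_mono)
		qed
		from idx_le[OF this] have "idx (%x. c * f x) g <= c * weight l"
			by(simp add: comp_def case_prod_unfold sum_list_const_mult)
		thus "idx (%x. c * f x) g / c <= weight l" using assms(3) by(simp add: field_simps)
	qed
	thus ?thesis using assms(3) by(simp add: field_simps)
qed

lemma idx_cmult:
	assumes "f : Cp" "g : Cpp" "c > 0"
	shows "idx (%x. c * f x) g = c * idx f g"
proof(rule antisym[OF idx_cmult_le[OF assms]])
	have "idx (%x. (1 / c) * (c * f x)) g <= (1 / c) * idx (%x. c * f x) g"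
		using assms by(intro idx_cmult_le Cp_cmult) auto
	thus "c * idx f g <= idx (%x. c * f x) g" using assms(3) by(simp add: field_simps)
qed

lemma idx_translate_le:
	assumes "f : Cp" "g : Cpp" "a : carrier L"
	shows "idx (%x. f (a**x)) g <= idx f g"
proof(rule idx_ge[OF assms(1,2)])
	fix l assume l: "covers f g l"
	have "covers (%x. f (a**x)) g (map (%(d, s). (d, s**a)) l)"
		unfolding covers_def
	proof(intro conjI ballI)
		fix x assume x: "x : carrier L"
		have "f (a**x) <= (\<Sum>(d, s)\<leftarrow>l. d * g (s**(a**x)))"
			using l assms(3) x by(simp add: covers_def)
		also have "(\<Sum>(d, s)\<leftarrow>l. d * g (s**(a**x))) = (\<Sum>(d, s)\<leftarrow>l. d * g (s**a**x))"
			using l assms(3) x by(intro arg_cong[of _ _ sum_list] map_cong) (auto simp: covers_def m_assoc)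
		finally show "f (a**x) <= (\<Sum>(d, s)\<leftarrow>map (%(d, s). (d, s**a)) l. d * g (s**x))"
			by(simp add: comp_def case_prod_unfold)
	qed (use l assms(3) in "auto simp: covers_def")
	from idx_le[OF this] show "idx (%x. f (a**x)) g <= weight l"
		by(simp add: comp_def case_prod_unfold)
qed

lemma idx_cong: "(!!x. x : carrier L ==> f x = f' x) ==> idx f g = idx f' g"
	unfolding idx_def covers_def by simp

lemma idx_translate:
	assumes "f : Cp" "g : Cpp" "a : carrier L"
	shows "idx (%x. f (a**x)) g = idx f g"
proof(rule antisym[OF idx_translate_le[OF assms]])
	have "idx (%x. f (a**(inv a**x))) g <= idx (%x. f (a**x)) g"
		using idx_translate_le[OF Cp_translate[OF assms(1,3)] assms(2), of "inv a"] assms(3) by simp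
	moreover have "idx (%x. f (a**(inv a**x))) g = idx f g"
		using assms(3) by(intro idx_cong) (simp add: m_assoc[symmetric])
	ultimately show "idx f g <= idx (%x. f (a**x)) g" by simp
qed

text \<open>A cover of \<open>g\<close> by translates of \<open>h\<close> is substituted into a
  cover of \<open>f\<close> by translates of \<open>g\<close>, and the weights multiply. Passing to
  the two infima one after the other means dividing by a weight or an index, hence the case splits
  on zero.\<close>

lemma idx_trans:
	assumes "f : Cp" "g : Cpp" "h : Cpp"
	shows "idx f h <= idx f g * idx g h"
proof -
	have 1: "idx f h <= weight l * (\<Sum>(c, s)\<leftarrow>l'. c)" if l: "covers f g l" and l': "covers g h l'" for l l'
	proof -
		define m where "m = concat (map (%(c, s). map (%(d, t). (c * d, t**s)) l') l)"
		have sum: "(\<Sum>(c, s)\<leftarrow>m. c * k s) = (\<Sum>(c, s)\<leftarrow>l. c * (\<Sum>(d, t)\<leftarrow>l'. d * k (t**s)))" for k :: "'a => real"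
			unfolding m_def
		proof(induction l)
			case (Cons p l)
			thus ?case by(simp add: comp_def case_prod_unfold sum_list_const_mult[symmetric] mult.assoc)
		qed simp
		have "covers f h m"
			unfolding covers_def
		proof(intro conjI ballI)
			show "case p of (c, s) => 0 <= c & s : carrier L" if "p : set m" for p
				using that by(auto simp: m_def coversD[OF l] coversD[OF l'])
			fix x assume x: "x : carrier L"
			have "f x <= (\<Sum>(c, s)\<leftarrow>l. c * g (s**x))" using l x by(simp add: covers_def)
			also have "... <= (\<Sum>(c, s)\<leftarrow>l. c * (\<Sum>(d, t)\<leftarrow>l'. d * h (t**(s**x))))"
				using l l' x by(intro sum_list_mono) (auto simp: covers_def intro!: mult_left_mono)
			also have "... = (\<Sum>(c, s)\<leftarrow>l. c * (\<Sum>(d, t)\<leftarrow>l'. d * h (t**s**x)))"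
				using l l' x by(intro arg_cong[of _ _ sum_list] map_cong refl)
					(auto simp: m_assoc coversD[OF l] coversD[OF l'] intro!: arg_cong[of _ _ "(*) _"] arg_cong[of _ _ sum_list] map_cong)
			also have "... = (\<Sum>(c, s)\<leftarrow>m. c * h (s**x))" using sum[of "%s. h (s**x)"] by simp
			finally show "f x <= (\<Sum>(c, s)\<leftarrow>m. c * h (s**x))" .
		qed
		from idx_le[OF this] show ?thesis
			using sum[of "%_. 1"] by(simp add: case_prod_unfold sum_list_mult_const)
	qed
	have 2: "idx f h <= weight l * idx g h" if l: "covers f g l" for l
	proof(cases "weight l = 0")
		case True
		obtain l' where "covers g h l'" using covers_exists[OF Cpp_Cp[OF assms(2)] assms(3)] by blast
		thus ?thesis using 1[OF l] True by simp
	next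
		case False
		hence p: "weight l > 0" using covers_sum_nonneg[OF l] by linarith
		have "idx f h / weight l <= idx g h"
			using 1[OF l] p by(intro idx_ge Cpp_Cp assms) (simp add: field_simps)
		thus ?thesis using p by(simp add: field_simps)
	qed
	show ?thesis
	proof(cases "idx g h = 0")
		case True
		obtain l where "covers f g l" using covers_exists[OF assms(1,2)] by blast
		thus ?thesis using 2 True by fastforce
	next
		case False
		hence p: "idx g h > 0" using idx_nonneg[OF Cpp_Cp[OF assms(2)] assms(3)] by linarith
		have "idx f h / idx g h <= idx f g"
			using 2 p by(intro idx_ge assms) (simp add: field_simps)
		thus ?thesis using p by(simp add: field_simps)
	qed
qed

lemma idx_pos:
	assumes "f : Cpp" "g : Cpp"
	shows "0 < idx f g"
proof -
	obtain B where B: "B > 0" "!!x. x : carrier L ==> abs (g x) <= B" using Cc_bounded[OF Cp_Cc[OF Cpp_Cp[OF assms(2)]]] by blast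
	obtain a where a: "a : carrier L" "0 < f a" using assms(1) by(auto simp: Cpp_def)
	have "f a / B <= idx f g"
	proof(rule idx_ge[OF Cpp_Cp[OF assms(1)] assms(2)])
		fix l assume l: "covers f g l"
		have "f a <= (\<Sum>(c, s)\<leftarrow>l. c * g (s**a))" using l a by(simp add: covers_def)
		also have "... <= (\<Sum>(c, s)\<leftarrow>l. c * B)"
			using l a B(2) by(intro sum_list_mono) (auto simp: covers_def abs_le_iff intro!: mult_left_mono)
		also have "... = weight l * B" by(simp add: case_prod_unfold sum_list_mult_const)
		finally show "f a / B <= weight l" using B(1) by(simp add: field_simps)
	qed
	moreover have "f a / B > 0" using a B by simp
	ultimately show ?thesis by linarith
qed

text \<open>A continuous substitute for the indicator function of a compact set; it turns pointwise
  bounds on \<open>K\<close> into bounds on indices and integrals.\<close>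

lemma dominate:
	assumes K: "compactin X K"
	obtains z where "z : Cp" "!!x. x : K ==> 1 <= z x"
proof -
	obtain q where t: "q : Cpp" "q \<one> = 1" using bump_Cpp[OF nb_carrier] by metis
	have tp: "q : Cp" using t(1) by(rule Cpp_Cp)
	define O' where "O' k = {x : carrier L. 1 / 2 < q (inv k**x)}" for k
	have op: "openin X (O' k)" "k : O' k" if "k : K" for k
	proof -
		have k: "k : carrier L" using compactinD_carrier[OF K that] .
		have "cont (%x. q (inv k**x))"
			using CcD[OF Cc_translate[OF Cp_Cc[OF tp]]] k by simp
		from openin_continuous_map_preimage[OF this, of "{1 / 2<..}"]
		show "openin X (O' k)" by(simp add: O'_def topspace)
		show "k : O' k" using k t(2) by(simp add: O'_def)
	qed
	have "EX F. finite F & F <= O' ` K & K <= \<Union>F"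
		using op by(intro compactinD[OF K]) auto
	then obtain F where "finite F" "F <= O' ` K" "K <= \<Union>F" by blast
	then obtain A where A: "finite A" "A <= K" "K <= \<Union>(O' ` A)" by(metis finite_subset_image)
	have kc: "k : carrier L" if "k : A" for k using that A(2) compactinD_carrier[OF K] by blast
	define z where "z x = (SUM k:A. 2 * q (inv k**x))" for x
	have "(%x. SUM k:B. 2 * q (inv k**x)) : Cp" if "finite B" "B <= A" for B
		using that
	proof(induction B)
		case empty
		show ?case using Cc_zero by(simp add: Cp_def)
	next
		case (insert k B)
		thus ?case using Cp_add[OF Cp_cmult[OF Cp_translate[OF tp, of "inv k"], of 2]] kc by simp
	qed
	hence "z : Cp" using A(1) by(simp add: z_def[abs_def])
	moreover have "1 <= z x" if x: "x : K" for x
	proof -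
		obtain k where k: "k : A" "x : O' k" using A(3) x by blast
		have "1 <= 2 * q (inv k**x)" using k(2) by(simp add: O'_def)
		also have "... <= z x" unfolding z_def
			using k(1) A(1) kc compactinD_carrier[OF K x] Cp_nonneg[OF tp] by(intro member_le_sum) auto
		finally show ?thesis .
	qed
	ultimately show ?thesis using that by blast
qed

text \<open>This makes the limit additive. A cover of \<open>F\<close> by \<open>g\<close> is split
  between \<open>f1\<close> and \<open>f2\<close> by multiplying the weight at \<open>s\<close> with
  the value of \<open>h i\<close> at \<open>inv s\<close>. Since \<open>h i\<close> hardly varies
  over the support of a translate of \<open>g\<close>, the error is at most \<open>r\<close> times
  the weights, and the two fractions add up to at most one. The fixed \<open>f0\<close> measures the
  error on a scale that survives normalisation.\<close>

lemma idx_superadditive: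
	assumes f: "f1 : Cp" "f2 : Cp" and f0: "f0 : Cpp" and e: "e > 0"
	obtains V where "nb V" "!!g. g : Cpp ==> (!!x. x : carrier L ==> g x ~= 0 ==> x : V) ==>
		 idx f1 g + idx f2 g <= idx (%x. f1 x + f2 x) g + e * idx f0 g"
proof -
	obtain K1 K2 where "compactin X K1" "!!x. x : carrier L - K1 ==> f1 x = 0" "compactin X K2" "!!x. x : carrier L - K2 ==> f2 x = 0"
		using Cp_Cc[OF f(1)] Cp_Cc[OF f(2)] by(auto simp: Cc_def)
	then obtain K where K: "compactin X K" "!!x. x : carrier L - K ==> f1 x = 0" "!!x. x : carrier L - K ==> f2 x = 0"
		using compactin_Un[of X K1 K2] by(metis Diff_iff UnI1 UnI2)
	obtain q where z: "q : Cp" "!!x. x : K ==> 1 <= q x" using dominate[OF K(1)] by blast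
	let ?f = "%x. f1 x + f2 x"
	have fp: "?f : Cp" using Cp_add[OF f] .
	define A where "A = idx ?f f0" 
	define Z where "Z = idx q f0"
	have AZ: "A >= 0" "Z >= 0" using idx_nonneg fp z f0 by(simp_all add: A_def Z_def)
	\<comment> \<open>\<open>A\<close> and \<open>Z\<close> bound the indices of \<open>?f\<close> and
	  \<open>q\<close> by multiples of \<open>idx f0 g\<close>. As \<open>r \<le> 1/2\<close>, the
	  error terms \<open>2 * r * A\<close> and \<open>(1 + 2 * r) * t * Z\<close> are at most
	  \<open>e / 2\<close> each.\<close>
	define t where "t = e / (4 * (Z + 1))"
	define r where "r = min (1/2) (e / (4 * (A + 1)))"
	have d: "t > 0" and "r > 0" using AZ e by(auto simp: t_def r_def)
	moreover have "r <= 1/2" unfolding r_def by(rule min.cobounded1)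
	ultimately have et: "r > 0" "r <= 1/2" by auto
	define F where "F x = ?f x + t * q x" for x
	have Fp: "F : Cp" unfolding F_def[abs_def] using Cp_add[OF fp Cp_cmult[OF z(1)]] d by simp
	\<comment> \<open>The summand \<open>t * q x\<close> in \<open>F\<close> and the maximum with
	  \<open>t\<close> keep the denominator away from zero, so the fractions are continuous; outside
	  \<open>K\<close> both numerators vanish.\<close>
	define h where "h i x = (if i then f1 x else f2 x) / max (F x) t" for i x
	have hCc: "h i : Cc" for i
	proof -
		have "cont (%x. 1 / max (F x) t)"
		proof(rule continuous_map_real_divide)
			show "cont (%x. max (F x) t)"
				using CcD[OF Cp_Cc[OF Fp]] by(intro continuous_map_real_max) auto
		qed (use d in "auto simp: max_def")
		moreover have "(%x. if i then f1 x else f2 x) : Cc" using Cp_Cc f by(cases i) auto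
		ultimately have "(%x. (if i then f1 x else f2 x) * (1 / max (F x) t)) : Cc" by(rule Cc_mult[rotated])
		thus ?thesis by(simp add: h_def[abs_def])
	qed
	have FK: "F x >= t" if "x : K" for x
	proof -
		have "x : carrier L" using compactinD_carrier[OF K(1) that] .
		hence "0 <= ?f x" using Cp_nonneg[OF fp] by simp
		moreover have "t * 1 <= t * q x" using z(2)[OF that] d by(intro mult_left_mono) auto
		ultimately show ?thesis by(simp add: F_def)
	qed
	have hF: "(if i then f1 x else f2 x) = F x * h i x" if "x : carrier L" for i x
	proof(cases "x : K")
		case True thus ?thesis using FK[OF True] d by(simp add: h_def)
	next
		case False thus ?thesis using K that by(simp add: h_def)
	qed
	have h0: "0 <= h i x" if "x : carrier L" for i x
		using Cp_nonneg[OF f(1) that] Cp_nonneg[OF f(2) that] d by(auto simp: h_def max_def)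
	have h1: "h True x + h False x <= 1" if "x : carrier L" for x
	proof -
		have "h True x + h False x = ?f x / max (F x) t" by(simp add: h_def add_divide_distrib)
		also have "... <= 1"
			using mult_nonneg_nonneg[OF less_imp_le[OF d] Cp_nonneg[OF z(1) that]] d by(auto simp: F_def max_def divide_le_eq)
		finally show ?thesis .
	qed
	obtain V1 where V1: "nb V1" "!!w x. w : V1 ==> x : carrier L ==> abs (h True (x**w) - h True x) < r"
		using unif_cont[OF hCc et(1)] by metis
	obtain V2 where V2: "nb V2" "!!w x. w : V2 ==> x : carrier L ==> abs (h False (x**w) - h False x) < r"
		using unif_cont[OF hCc et(1)] by metis
	have V: "abs (h i (x**w) - h i x) < r" if "w : V1 Int V2" "x : carrier L" for i w x
		using V1(2)[of w x] V2(2)[of w x] that by(cases i) auto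
	show ?thesis
	proof(rule that[of "V1 Int V2"])
		show "nb (V1 Int V2)" using V1 V2 by(intro nb_Int)
		fix g assume g: "g : Cpp" and supp: "!!x. x : carrier L ==> g x ~= 0 ==> x : V1 Int V2"
		note g0 = Cp_nonneg[OF Cpp_Cp[OF g]]
		have main: "(idx f1 g + idx f2 g) / (1 + 2 * r) <= weight l" if l: "covers F g l" for l
		proof -
			have "covers (%x. if i then f1 x else f2 x) g (map (%(c, s). (c * (h i (inv s) + r), s)) l)" for i
				unfolding covers_def
			proof(intro conjI ballI)
				show "case p of (c, s) => 0 <= c & s : carrier L"
					if "p : set (map (%(c, s). (c * (h i (inv s) + r), s)) l)" for p
					using that l h0 et by(auto simp: covers_def intro!: mult_nonneg_nonneg add_nonneg_nonneg)
				fix x assume x: "x : carrier L"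
				have st: "g (s**x) * h i x <= g (s**x) * (h i (inv s) + r)" if s: "s : carrier L" for s
				proof(cases "g (s**x) = 0")
					case False
					hence "s**x : V1 Int V2" using supp s x by blast
					from V[OF this, of "inv s" i] have "h i x <= h i (inv s) + r"
						using s x by(simp add: m_assoc[symmetric])
					thus ?thesis using g0 s x by(intro mult_left_mono) auto
				qed simp
				have "(if i then f1 x else f2 x) = F x * h i x" by(rule hF[OF x])
				also have "... <= (\<Sum>(c, s)\<leftarrow>l. c * g (s**x)) * h i x"
					using l x h0 by(intro mult_right_mono) (auto simp: covers_def)
				also have "... = (\<Sum>(c, s)\<leftarrow>l. c * (g (s**x) * h i x))"
					by(simp add: case_prod_unfold sum_list_mult_const[symmetric] mult.assoc)
				also have "... <= (\<Sum>(c, s)\<leftarrow>l. c * (g (s**x) * (h i (inv s) + r)))"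
					using coversD[OF l] st by(intro sum_list_mono) (auto simp del: mult_le_cancel_left intro!: mult_left_mono[OF st])
				also have "... = (\<Sum>(c, s)\<leftarrow>map (%(c, s). (c * (h i (inv s) + r), s)) l. c * g (s**x))"
					by(simp add: case_prod_unfold comp_def mult_ac)
				finally show "(if i then f1 x else f2 x) <= ..." .
			qed
			from idx_le[OF this] have "idx (%x. if i then f1 x else f2 x) g <= (\<Sum>(c, s)\<leftarrow>l. c * (h i (inv s) + r))" for i
				by(simp add: case_prod_unfold comp_def)
			from this[of True] this[of False]
			have "idx f1 g + idx f2 g <= (\<Sum>(c, s)\<leftarrow>l. c * (h True (inv s) + r)) + (\<Sum>(c, s)\<leftarrow>l. c * (h False (inv s) + r))"
				by simp
			also have "... = (\<Sum>(c, s)\<leftarrow>l. c * (h True (inv s) + h False (inv s) + 2 * r))"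
				by(simp only: case_prod_unfold sum_list_addf[symmetric] distrib_left) (simp add: algebra_simps)
			also have "... <= (\<Sum>(c, s)\<leftarrow>l. c * (1 + 2 * r))"
				using l h1 by(intro sum_list_mono) (auto simp: covers_def intro!: mult_left_mono)
			also have "... = weight l * (1 + 2 * r)" by(simp add: case_prod_unfold sum_list_mult_const)
			finally show ?thesis using et by(simp add: field_simps)
		qed
		have "(idx f1 g + idx f2 g) / (1 + 2 * r) <= idx F g" using main by(rule idx_ge[OF Fp g])
		hence "idx f1 g + idx f2 g <= (1 + 2 * r) * idx F g" using et by(simp add: field_simps)
		also have "idx F g <= idx ?f g + t * idx q g"
			using idx_add[OF fp Cp_cmult[OF z(1)] g, of t] idx_cmult[OF z(1) g d] d by(simp add: F_def[abs_def])
		also have "(1 + 2 * r) * (idx ?f g + t * idx q g) = idx ?f g + 2 * r * idx ?f g + (1 + 2 * r) * t * idx q g"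
			by(simp add: algebra_simps)
		also have "2 * r * idx ?f g <= (e / 2) * idx f0 g"
		proof -
			have "2 * r * idx ?f g <= 2 * r * (A * idx f0 g)"
				using idx_trans[OF fp f0 g] et by(intro mult_left_mono) (auto simp: A_def)
			also have "... = (2 * r * A) * idx f0 g" by simp
			also have "... <= (e / 2) * idx f0 g"
			proof(rule mult_right_mono[OF _ idx_nonneg[OF Cpp_Cp[OF f0] g]])
				have "2 * r * A <= 2 * (e / (4 * (A + 1))) * A" using AZ by(intro mult_right_mono) (auto simp: r_def)
				also have "... <= e / 2" using AZ e by(simp add: field_simps)
				finally show "2 * r * A <= e / 2" .
			qed
			finally show ?thesis .
		qed
		also have "(1 + 2 * r) * t * idx q g <= (e / 2) * idx f0 g"
		proof -
			have "(1 + 2 * r) * t * idx q g <= 2 * t * (Z * idx f0 g)"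
				using idx_trans[OF z(1) f0 g] et d idx_nonneg[OF z(1) g] by(intro mult_mono) (auto simp: Z_def)
			also have "... = (2 * t * Z) * idx f0 g" by simp
			also have "... <= (e / 2) * idx f0 g"
			proof(rule mult_right_mono[OF _ idx_nonneg[OF Cpp_Cp[OF f0] g]])
				show "2 * t * Z <= e / 2" using AZ e by(simp add: t_def field_simps)
			qed
			finally show ?thesis .
		qed
		finally show "idx f1 g + idx f2 g <= idx ?f g + e * idx f0 g" using et by simp
	qed
qed

text \<open>A filter on sets rather than points. An ultrafilter below it expresses that a
  neighbourhood shrinks to the identity, without a countable base.\<close>

definition nb_filter :: "'a set filter" where
	"nb_filter = (INF V\<in>{V. nb V}. principal {W. nb W & W <= V})"

lemma eventually_nb_filter: "eventually P nb_filter \<longleftrightarrow> (EX V. nb V & (ALL W. nb W --> W <= V --> P W))"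
proof -
	have "eventually P nb_filter \<longleftrightarrow> (EX V:{V. nb V}. eventually P (principal {W. nb W & W <= V}))"
		unfolding nb_filter_def
	proof(rule eventually_INF_base)
		show "{V. nb V} ~= {}" using nb_carrier by blast
		fix a b assume "a : {V. nb V}" "b : {V. nb V}"
		thus "EX x:{V. nb V}. principal {W. nb W & W <= x} <= inf (principal {W. nb W & W <= a}) (principal {W. nb W & W <= b})"
			by(intro bexI[of _ "a Int b"]) (auto simp: nb_Int)
	qed
	thus ?thesis by(auto simp: eventually_principal)
qed

lemma ultra_nb:
	obtains U where "ultra U" "!!V. nb V ==> eventually (%W. nb W & W <= V) U"
proof -
	have "nb_filter ~= bot" unfolding trivial_limit_def eventually_nb_filter by blast
	then obtain U where U: "U <= nb_filter" "ultra U" by(rule ultra_exists)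
	have "eventually (%W. nb W & W <= V) nb_filter" if "nb V" for V
		using that unfolding eventually_nb_filter by blast
	thus ?thesis using that[OF U(2)] U(1) by(blast intro: filter_leD)
qed

text \<open>The normalised index \<open>J f W\<close> lies between 0 and \<open>idx f f0\<close>, so
  it has a limit along an ultrafilter of shrinking \<open>W\<close>. It is subadditive for every
  \<open>W\<close> and superadditive up to any \<open>e\<close> for small \<open>W\<close>, hence
  additive in the limit; strict positivity survives because
  \<open>J f W \<ge> 1 / idx f0 f\<close>.\<close>

theorem haar_integral_exists: "EX I. haar_integral L X I"
proof -
	obtain f0 where f0: "f0 : Cpp" using bump_Cpp[OF nb_carrier] by metis
	obtain U where U: "ultra U" "!!V. nb V ==> eventually (%W. nb W & W <= V) U" using ultra_nb by blast
	have Unb: "U ~= bot" using U(1) by(simp add: ultra_def)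
	have "EX g. nb W --> g : Cpp & (ALL x:carrier L. g x ~= 0 --> x : W)" for W
		using bump_Cpp[of W] by metis
	then obtain g where g: "!!W. nb W ==> g W : Cpp" "!!W x. nb W ==> x : carrier L ==> g W x ~= 0 ==> x : W"
		by metis
	have ev: "eventually (%W. nb W) U" using U(2)[OF nb_carrier] by eventually_elim simp
	define J where "J f W = idx f (g W) / idx f0 (g W)" for f W
	define Ip where "Ip f = Lim U (J f)" for f
	have J0: "idx f0 (g W) > 0" if "nb W" for W using idx_pos[OF f0 g(1)[OF that]] .
	have lim: "(J f \<longlongrightarrow> Ip f) U" if f: "f : Cp" for f
	proof -
		have "eventually (%W. 0 <= J f W & J f W <= idx f f0) U"
			using ev
		proof eventually_elim
			case (elim W)
			show ?case using idx_nonneg[OF f g(1)[OF elim]] J0[OF elim] idx_trans[OF f f0 g(1)[OF elim]]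
				by(simp add: J_def field_simps)
		qed
		then obtain l where "(J f \<longlongrightarrow> l) U" using ultra_real[OF U(1)] by blast
		thus ?thesis unfolding Ip_def using tendsto_Lim[OF Unb] by metis
	qed
	have Ip_unique: "Ip f = l" if "f : Cp" "(J f \<longlongrightarrow> l) U" for f l
		using tendsto_unique[OF Unb lim[OF that(1)] that(2)] .
	have Ip_nonneg: "0 <= Ip f" if f: "f : Cp" for f
	proof(rule tendsto_lowerbound[OF lim[OF f] _ Unb])
		show "eventually (%W. 0 <= J f W) U"
			using ev
		proof eventually_elim
			case (elim W)
			show ?case using idx_nonneg[OF f g(1)[OF elim]] J0[OF elim] by(simp add: J_def)
		qed
	qed
	have Ip_pos: "0 < Ip f" if f: "f : Cpp" for f
	proof -
		have "1 / idx f0 f <= Ip f"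
		proof(rule tendsto_lowerbound[OF lim[OF Cpp_Cp[OF f]] _ Unb])
			show "eventually (%W. 1 / idx f0 f <= J f W) U"
				using ev
			proof eventually_elim
				case (elim W)
				show ?case using idx_trans[OF Cpp_Cp[OF f0] f g(1)[OF elim]] J0[OF elim] idx_pos[OF f0 f]
					by(simp add: J_def field_simps)
			qed
		qed
		thus ?thesis using idx_pos[OF f0 f] by(meson less_le_trans zero_less_divide_1_iff)
	qed
	have Ip_cmult: "Ip (%x. c * f x) = c * Ip f" if f: "f : Cp" and c: "0 < c" for c f
	proof(rule Ip_unique)
		show "(%x. c * f x) : Cp" using Cp_cmult[OF f] c by simp
		have "((%W. c * J f W) \<longlongrightarrow> c * Ip f) U" by(intro tendsto_intros lim f)
		thus "(J (%x. c * f x) \<longlongrightarrow> c * Ip f) U"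
		proof(rule Lim_transform_eventually)
			show "eventually (%W. c * J f W = J (%x. c * f x) W) U"
				using ev by eventually_elim (simp add: J_def idx_cmult[OF f g(1) c])
		qed
	qed
	have Ip_trans: "Ip (%x. f (a**x)) = Ip f" if f: "f : Cp" and a: "a : carrier L" for a f
	proof(rule Ip_unique)
		show "(%x. f (a**x)) : Cp" by(rule Cp_translate[OF f a])
		show "(J (%x. f (a**x)) \<longlongrightarrow> Ip f) U"
		proof(rule Lim_transform_eventually[OF lim[OF f]])
			show "eventually (%W. J f W = J (%x. f (a**x)) W) U"
				using ev by eventually_elim (simp add: J_def idx_translate[OF f g(1) a])
		qed
	qed
	have Ip_add: "Ip (%x. f x + f' x) = Ip f + Ip f'" if f: "f : Cp" "f' : Cp" for f f'
	proof(rule antisym)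
		let ?h = "%x. f x + f' x"
		have h: "?h : Cp" by(rule Cp_add[OF f])
		have sum: "((%W. J f W + J f' W) \<longlongrightarrow> Ip f + Ip f') U" by(intro tendsto_intros lim f)
		show "Ip ?h <= Ip f + Ip f'"
		proof(rule tendsto_le[OF Unb sum lim[OF h]])
			show "eventually (%W. J ?h W <= J f W + J f' W) U"
				using ev
			proof eventually_elim
				case (elim W)
				show ?case using idx_add[OF f g(1)[OF elim]] J0[OF elim]
					by(simp add: J_def add_divide_distrib[symmetric] divide_right_mono)
			qed
		qed
		have "Ip f + Ip f' <= Ip ?h + e" if e: "e > 0" for e
		proof -
			obtain V where V: "nb V" "!!g. g : Cpp ==> (!!x. x : carrier L ==> g x ~= 0 ==> x : V) ==>
				idx f g + idx f' g <= idx ?h g + e * idx f0 g"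
				using idx_superadditive[OF f f0 e] by blast
			have l: "((%W. J ?h W + e) \<longlongrightarrow> Ip ?h + e) U" by(intro tendsto_intros lim h)
			show ?thesis
			proof(rule tendsto_le[OF Unb l sum])
				show "eventually (%W. J f W + J f' W <= J ?h W + e) U"
					using U(2)[OF V(1)]
				proof eventually_elim
					case (elim W)
					have "idx f (g W) + idx f' (g W) <= idx ?h (g W) + e * idx f0 (g W)"
						using elim g by(intro V(2)) blast+
					hence "(idx f (g W) + idx f' (g W)) / idx f0 (g W) <= (idx ?h (g W) + e * idx f0 (g W)) / idx f0 (g W)"
						using J0[of W] elim by(intro divide_right_mono) auto
					thus ?case using J0[of W] elim by(simp add: J_def add_divide_distrib)
				qed
			qed
		qed
		thus "Ip f + Ip f' <= Ip ?h" by(rule field_le_epsilon)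
	qed
	\<comment> \<open>Additivity on the cone extends \<open>Ip\<close> to differences:
	  \<open>I_diff\<close> shows that every decomposition into nonnegative parts gives the same
	  value.\<close>
	define I where "I f = Ip (%x. max (f x) 0) - Ip (%x. max (- f x) 0)" for f
	have pos: "(%x. max (f x) 0) : Cp" if "f : Cc" for f
	proof -
		obtain K where "compactin X K" "!!x. x : carrier L - K ==> f x = 0" using `f : Cc` by(auto simp: Cc_def)
		moreover have "cont (%x. max (f x) 0)"
			using CcD[OF that] by(intro continuous_map_real_max) auto
		ultimately show ?thesis unfolding Cp_def Cc_def by auto
	qed
	have neg: "(%x. max (- f x) 0) : Cp" if "f : Cc" for f
		using pos[OF Cc_cmult[OF that, of "-1"]] by simp
	have Ip_zero: "Ip (%x. 0) = 0"
		using Ip_add[of "%x. 0" "%x. 0"] Cc_zero by(simp add: Cp_def)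
	have I_diff: "I f = Ip u - Ip v" if f: "f : Cc" and uv: "u : Cp" "v : Cp" and e: "!!x. f x = u x - v x" for f u v
	proof -
		have "Ip (%x. max (f x) 0 + v x) = Ip (%x. u x + max (- f x) 0)"
			by(rule arg_cong[of _ _ Ip]) (auto simp: e fun_eq_iff max_def)
		thus ?thesis using Ip_add[OF pos[OF f] uv(2)] Ip_add[OF uv(1) neg[OF f]] by(simp add: I_def)
	qed
	have I_add: "I (%x. f x + f' x) = I f + I f'" if f: "f : Cc" "f' : Cc" for f f'
	proof -
		have "I (%x. f x + f' x) = Ip (%x. max (f x) 0 + max (f' x) 0) - Ip (%x. max (- f x) 0 + max (- f' x) 0)"
			by(rule I_diff) (auto intro!: Cc_add Cp_add pos neg f)
		thus ?thesis using Ip_add[OF pos[OF f(1)] pos[OF f(2)]] Ip_add[OF neg[OF f(1)] neg[OF f(2)]]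
			by(simp add: I_def)
	qed
	have I_cmult: "I (%x. c * f x) = c * I f" if f: "f : Cc" for f c
	proof -
		consider "c = 0" | "c > 0" | "c < 0" by linarith
		thus ?thesis
		proof cases
			case 1 thus ?thesis by(simp add: I_def)
		next
			case 2
			have "I (%x. c * f x) = Ip (%x. c * max (f x) 0) - Ip (%x. c * max (- f x) 0)"
				using 2 by(intro I_diff Cc_cmult Cp_cmult pos neg f) (auto simp: max_def)
			thus ?thesis using Ip_cmult[OF pos[OF f] 2] Ip_cmult[OF neg[OF f] 2] by(simp add: I_def algebra_simps)
		next
			case 3
			have "I (%x. c * f x) = Ip (%x. (-c) * max (- f x) 0) - Ip (%x. (-c) * max (f x) 0)"
				using 3 by(intro I_diff Cc_cmult Cp_cmult pos neg f) (auto simp: max_def)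
			thus ?thesis using Ip_cmult[OF pos[OF f], of "-c"] Ip_cmult[OF neg[OF f], of "-c"] 3
				by(simp add: I_def algebra_simps)
		qed
	qed
	have I_Cp: "I f = Ip f" if f: "f : Cp" for f
		using I_diff[OF Cp_Cc[OF f] f, of "%x. 0"] Cc_zero Ip_zero by(simp add: Cp_def)
	have I_trans: "I (%x. f (a**x)) = I f" if f: "f : Cc" and a: "a : carrier L" for f a
		using Ip_trans[OF pos[OF f] a] Ip_trans[OF neg[OF f] a] by(simp add: I_def)
	have "haar_integral L X I"
		unfolding haar_integral_def
	proof(intro conjI ballI allI impI)
		fix f assume f: "f : Cc" "ALL x:carrier L. 0 <= f x"
		hence fp: "f : Cp" by(simp add: Cp_def)
		show "0 <= I f" using I_Cp[OF fp] Ip_nonneg[OF fp] by simp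
		show "0 < I f" if "EX x:carrier L. 0 < f x"
		proof -
			have "f : Cpp" using fp that by(simp add: Cpp_def)
			thus ?thesis using I_Cp[OF fp] Ip_pos by simp
		qed
	qed (use I_add I_cmult I_trans in auto)
	thus ?thesis by blast
qed

end

section \<open>Gleason's functions\<close>

context lch_grp
begin

lemma inv_cancel:
	assumes "a : carrier L" "x : carrier L"
	shows "inv a**(a**x) = x" "a**(inv a**x) = x"
	using assms by(simp_all add: m_assoc[symmetric])

lemma inv_mult_cancel:
	assumes "a : carrier L" "x : carrier L" "y : carrier L"
	shows "inv (a**y)**(a**x) = inv y**x"
	using assms by(simp add: inv_mult_group m_assoc inv_cancel)

primrec sprod :: "'a set => nat => 'a set" where
	"sprod Q 0 = {\<one>}"
| "sprod Q (Suc n) = {q**x | q x. q : Q & x : sprod Q n}"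

lemma sprod_carrier: "Q <= carrier L ==> sprod Q n <= carrier L"
	by(induction n) auto

lemma sprod_add:
	assumes Q: "Q <= carrier L" and x: "x : sprod Q m" and y: "y : sprod Q n"
	shows "x**y : sprod Q (m + n)"
	using x
proof(induction m arbitrary: x)
	case 0
	have "y : carrier L" using sprod_carrier[OF Q] y by blast
	thus ?case using 0 y by simp
next
	case (Suc m)
	then obtain q z where z: "x = q**z" "q : Q" "z : sprod Q m" by auto
	have "q : carrier L" "z : carrier L" "y : carrier L" using z y Q sprod_carrier[OF Q] by blast+
	hence "x**y = q**(z**y)" using z(1) by(simp add: m_assoc)
	thus ?case using Suc.IH[OF z(3)] z(2) by auto
qed

lemma sprod_mono:
	assumes Q: "Q <= carrier L" "\<one> : Q" and "m <= n"
	shows "sprod Q m <= sprod Q n"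
proof -
	have "sprod Q n <= sprod Q (Suc n)" for n
	proof
		fix x assume x: "x : sprod Q n"
		hence "x : carrier L" using sprod_carrier[OF Q(1)] by blast
		hence "x = \<one>**x" by simp
		thus "x : sprod Q (Suc n)" using x Q(2) by auto
	qed
	thus ?thesis using `m <= n` by(rule lift_Suc_mono_le)
qed

lemma sprod_one: "Q <= carrier L ==> sprod Q 1 = Q"
	by(auto simp: subset_iff) (metis r_one)

lemma sprod_inv:
	assumes Q: "Q <= carrier L" "!!q. q : Q ==> inv q : Q" and x: "x : sprod Q n"
	shows "inv x : sprod Q n"
	using x
proof(induction n arbitrary: x)
	case (Suc n)
	then obtain q z where z: "x = q**z" "q : Q" "z : sprod Q n" by auto
	have c: "q : carrier L" "z : carrier L" using z Q(1) sprod_carrier[OF Q(1)] by blast+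
	have "inv z**inv q : sprod Q (n + 1)"
		using sprod_add[OF Q(1) Suc.IH[OF z(3)], of "inv q" 1] Q(2)[OF z(2)] unfolding sprod_one[OF Q(1)] .
	thus ?case using z(1) c by(simp only: inv_mult_group Suc_eq_plus1)
qed simp

lemma sprod_subset: "Q <= Q' ==> sprod Q n <= sprod Q' n"
	by(induction n) (simp, simp, blast)

lemma continuous_of_unif:
	assumes "!!e. e > 0 ==> EX W. nb W & (ALL x:carrier L. ALL w:W. abs (f (x**w) - f x) < e)"
	shows "cont f"
proof -
	have "openin X {x : topspace X. f x : U}" if U: "open U" for U
	proof(subst openin_subopen, intro ballI)
		fix x assume "x : {x : topspace X. f x : U}"
		hence x: "x : carrier L" "f x : U" by(auto simp: topspace)
		obtain e where e: "e > 0" "ball (f x) e <= U" by(rule openE[OF U x(2)])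
		obtain W where "nb W & (ALL x:carrier L. ALL w:W. abs (f (x**w) - f x) < e)" using assms[OF e(1)] ..
		hence W: "nb W" "!!w. w : W ==> abs (f (x**w) - f x) < e" using x(1) by simp_all
		let ?T = "{y : carrier L. inv x**y : W}"
		have "openin X ?T" using openin_translate(1)[OF nbD(1)[OF W(1)]] x by simp
		moreover have "x : ?T" using x nbD(2)[OF W(1)] by simp
		moreover have "?T <= {x : topspace X. f x : U}"
		proof
			fix y assume "y : ?T"
			hence y: "y : carrier L" "inv x**y : W" by auto
			have "abs (f (x**(inv x**y)) - f x) < e" by(rule W(2)[OF y(2)])
			moreover have "x**(inv x**y) = y" using x y by(simp add: m_assoc[symmetric])
			ultimately have "f y : ball (f x) e" by(simp add: dist_real_def abs_minus_commute)
			thus "y : {x : topspace X. f x : U}" using e(2) y by(auto simp: topspace)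
		qed
		ultimately show "EX T. openin X T & x : T & T <= {x : topspace X. f x : U}" by blast
	qed
	thus ?thesis by(simp add: continuous_map)
qed

text \<open>Gleason's bump function in quantitative form: differences along \<open>Q\<close> have
  order \<open>1 / m\<close>, and a second difference along \<open>W e\<close> gains a factor
  \<open>e\<close>. In \<open>gleason\<close> the data \<open>c0\<close>, \<open>A\<close> and
  \<open>W\<close> are fixed before \<open>Q\<close> and \<open>m\<close>, so the estimates are
  uniform along sequences of sets \<open>Q\<close>.\<close>

abbreviation gleason_function where
	"gleason_function C V W A c0 Q m f \<equiv> c0 <= f \<one> & (ALL x:carrier L. f x ~= 0 --> (EX c:C. EX v:V. EX v':V. x = c**v**v')) &
		 (ALL g:Q. ALL x:carrier L. abs (f (g**x) - f x) <= A / real m) &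
		 (ALL e>0. ALL h:W e. ALL x:carrier L. abs (f (h**x) - f x) <= e) &
		 (ALL e>0. ALL h:W e. ALL g:Q. ALL x:carrier L. abs ((f (g**(h**x)) - f (h**x)) - (f (g**x) - f x)) <= e / real m)"

end

locale haar_grp = lch_grp +
	fixes I :: "('a => real) => real"
	assumes haar: "haar_integral L X I"
begin

lemma I_add: "f : Cc ==> g : Cc ==> I (%x. f x + g x) = I f + I g"
	and I_cmult: "f : Cc ==> I (%x. c * f x) = c * I f"
	and I_nonneg: "f : Cc ==> (!!x. x : carrier L ==> 0 <= f x) ==> 0 <= I f"
	and I_pos: "f : Cc ==> (!!x. x : carrier L ==> 0 <= f x) ==> a : carrier L ==> 0 < f a ==> 0 < I f"
	and I_trans: "f : Cc ==> a : carrier L ==> I (%x. f (a**x)) = I f"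
	using haar unfolding haar_integral_def by blast+

lemma I_diff: "f : Cc ==> g : Cc ==> I (%x. f x - g x) = I f - I g"
	using I_add[of f "%x. (-1) * g x"] I_cmult[of g "-1"] Cc_cmult[of g "-1"] by simp

lemma I_mono:
	assumes "f : Cc" "g : Cc" "!!x. x : carrier L ==> f x <= g x"
	shows "I f <= I g"
	using I_nonneg[OF Cc_diff[OF assms(2,1)]] I_diff[OF assms(2,1)] assms(3) by simp

lemma Cc_cong:
	assumes "f : Cc" "!!x. x : carrier L ==> f x = g x"
	shows "g : Cc"
	using assms continuous_map_eq[of X euclideanreal f g] unfolding Cc_def by(force simp: topspace)

lemma I_cong:
	assumes "f : Cc" "!!x. x : carrier L ==> f x = g x"
	shows "I f = I g"
	using I_mono[OF assms(1) Cc_cong[OF assms]] I_mono[OF Cc_cong[OF assms] assms(1)] assms(2)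
	by(intro antisym) auto

lemma I_abs:
	assumes "f : Cc" "z : Cc" "!!x. x : carrier L ==> abs (f x) <= c * z x"
	shows "abs (I f) <= c * I z"
proof -
	have "I f <= I (%x. c * z x)" using assms by(intro I_mono Cc_cmult) (auto simp: abs_le_iff)
	moreover have "I (%x. (- c) * z x) <= I f"
		using assms by(intro I_mono Cc_cmult) (auto simp: abs_le_iff minus_le_iff)
	ultimately show ?thesis unfolding I_cmult[OF assms(2)] by linarith
qed

text \<open>\<open>f\<close> is the convolution of a tent \<open>p\<close> with a bump
  \<open>u\<close>. By left invariance a difference of \<open>f\<close> along \<open>g\<close> falls
  on \<open>p\<close> and has order \<open>1 / m\<close>; a further difference along
  \<open>h\<close> falls on \<open>u\<close>, where it is small by uniform continuity. So the second
  difference is bounded by a product of two small factors although neither \<open>p\<close> nor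
  \<open>u\<close> is smooth.\<close>

lemma gleason:
	assumes C2: "compactin X C2" and V: "nb V" "V <= C0" "compactin X C0"
	obtains A c0 :: real and W :: "real => 'a set" where "A > 0" "c0 > 0" "!!e. e > 0 ==> nb (W e)"
		"!!Q m. Q <= V ==> \<one> : Q ==> (!!q. q : Q ==> inv q : Q) ==> 0 < m ==> sprod Q m <= C2 ==>
			EX f. gleason_function C2 V W A c0 Q m f"
proof -
	obtain u K where t: "cont u" "u \<one> = 1" "!!x. x : carrier L ==> 0 <= u x"
		"!!x. x : carrier L ==> u x <= 1" "compactin X K" "K <= V" "!!x. x : carrier L - K ==> u x = 0"
		using bump[OF V(1)] by blast
	have tC: "u : Cc" unfolding Cc_def using t by blast
	have VL: "V <= carrier L" using nbD(3)[OF V(1)] by blast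
	have C2L: "C2 <= carrier L" using compactinD_carrier[OF C2] by blast
	define K1 where "K1 = {a**b | a b. a : C2 & b : K}"
	have K1: "compactin X K1" unfolding K1_def by(rule compactin_mult[OF C2 t(5)])
	have K1L: "K1 <= carrier L" using compactinD_carrier[OF K1] by blast
	define K' where "K' = {a**b | a b. a : C0 & b : K1}"
	have K': "compactin X K'" unfolding K'_def by(rule compactin_mult[OF V(3) K1])
	have K'L: "K' <= carrier L" using compactinD_carrier[OF K'] by blast
	have K1K': "K1 <= K'"
	proof
		fix x assume x: "x : K1"
		hence "x = \<one>**x" using K1L by auto
		thus "x : K'" unfolding K'_def using x nbD(2)[OF V(1)] V(2) by blast
	qed
	\<comment> \<open>\<open>r\<close> dominates the indicator of a compact set that contains the
	  supports of the integrands estimated below, and \<open>A\<close> exceeds its integral.\<close>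
	obtain r where z: "r : Cp" "!!x. x : K' ==> 1 <= r x" using dominate[OF K'] by blast
	have zC: "r : Cc" and z0: "!!x. x : carrier L ==> 0 <= r x" using Cp_Cc Cp_nonneg z(1) by blast+
	define A where "A = I r + 1"
	have Iz: "0 <= I r" by(rule I_nonneg[OF zC z0])
	have A: "A > 0" "I r <= A" using Iz by(auto simp: A_def)
	have tinv: "cont (%y. u (inv y**x))" if "x : carrier L" for x
		using continuous_map_compose[OF continuous_mult'[OF continuous_inv continuous_const[OF that]] t(1)]
		by(simp add: comp_def)
	\<comment> \<open>Since \<open>p \<ge> u\<close>, this is a lower bound of \<open>f \<one>\<close>,
	  and it involves neither \<open>Q\<close> nor \<open>m\<close>.\<close>
	define c0 where "c0 = I (%y. u y * u (inv y**\<one>))"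
	have c0C: "(%y. u y * u (inv y**\<one>)) : Cc" by(rule Cc_mult[OF tC tinv]) simp
	have c0: "c0 > 0" unfolding c0_def by(rule I_pos[OF c0C, of \<one>]) (simp_all add: t)
	\<comment> \<open>Moving \<open>h\<close> past \<open>inv y\<close> turns it into its conjugate by
	  \<open>y\<close>. As \<open>y\<close> ranges over the compact set \<open>K'\<close>, all these
	  conjugates are close to the identity at once.\<close>
	define P where "P e W \<longleftrightarrow> nb W & (ALL h:W. ALL y:K'. ALL x:carrier L. abs (u (inv y**(h**x)) - u (inv y**x)) <= e / A)" for e W
	have "EX W. P e W" if e: "e > 0" for e
	proof -
		have "e / A > 0" using e A by simp
		then obtain W1 where W1: "nb W1" "!!w x. w : W1 ==> x : carrier L ==> abs (u (w**x) - u x) < e / A"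
			using unif_cont[OF tC] by metis
		obtain W2 where W2: "nb W2" "!!k w. k : K' ==> w : W2 ==> inv k**w**k : W1"
			using nb_conj[OF K' W1(1)] by metis
		have "abs (u (inv y**(h**x)) - u (inv y**x)) <= e / A" if "h : W2" "y : K'" "x : carrier L" for h y x
		proof -
			have c: "h : carrier L" "y : carrier L" using that nbD(3)[OF W2(1)] K'L by blast+
			have eq: "inv y**(h**x) = (inv y**h**y)**(inv y**x)"
				using c that(3) by(simp add: m_assoc inv_cancel)
			have "inv y**x : carrier L" using c that(3) by simp
			thus ?thesis unfolding eq using W1(2)[OF W2(2)[OF that(2,1)]] by(intro less_imp_le)
		qed
		hence "P e W2" unfolding P_def using W2(1) by blast
		thus ?thesis ..
	qed
	then obtain W where PW: "!!e. e > 0 ==> P e (W e)" by metis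
	have W: "nb (W e)" if "e > 0" for e using PW[OF that] unfolding P_def by(rule conjunct1)
	have W2: "abs (u (inv y**(h**x)) - u (inv y**x)) <= e / A"
		if "e > 0" "h : W e" "y : K'" "x : carrier L" for e h y x
		using PW[OF that(1)] that(2-) unfolding P_def by blast
	show ?thesis
	proof(rule that[of A c0 W, OF A(1) c0 W])
		fix Q and m :: nat
		assume Q: "Q <= V" "\<one> : Q" "!!q. q : Q ==> inv q : Q" and m: "0 < m" and Qm: "sprod Q m <= C2"
		have QL: "Q <= carrier L" using Q(1) VL by blast
		have sL: "sprod Q j <= carrier L" for j by(rule sprod_carrier[OF QL])
		\<comment> \<open>The supremum \<open>p\<close> is a tent that descends in \<open>m\<close>
		  levels: translates of \<open>u\<close> by \<open>j\<close>-fold products from \<open>Q\<close>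
		  carry the weight \<open>1 - j / m\<close>. Multiplication by one element of \<open>Q\<close>
		  changes the level by at most one, which gives the Lipschitz bound \<open>1 / m\<close>.\<close>
		define S where "S x = {(1 - real j / real m) * u (inv y**x) | j y. j <= m & y : sprod Q j}" for x
		have S_mem: "(1 - real j / real m) * u (inv y**x) : S x" if "j <= m" "y : sprod Q j" for j y x
			unfolding S_def using that by blast
		have S_cases: "EX j y. s = (1 - real j / real m) * u (inv y**x) & j <= m & y : sprod Q j" if "s : S x" for s x
			using that unfolding S_def by blast
		have frac: "0 <= 1 - real j / real m" "1 - real j / real m <= 1" if "j <= m" for j
			using that m by(auto simp: field_simps)
		have S01: "0 <= s & s <= 1" if s: "s : S x" and x: "x : carrier L" for s x
		proof -
			obtain j y where jy: "s = (1 - real j / real m) * u (inv y**x)" "j <= m" "y : sprod Q j"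
				using S_cases[OF s] by blast
			have "inv y**x : carrier L" using jy(3) sL x by blast
			thus ?thesis using t(3,4) frac[OF jy(2)] jy(1) by(simp add: mult_le_one)
		qed
		have Sbdd: "bdd_above (S x)" if "x : carrier L" for x using S01 that by(meson bdd_aboveI)
		have Sne: "u x : S x" if "x : carrier L" for x
			using S_mem[of 0 \<one> x] that by simp
		define p where "p x = Sup (S x)" for x
		have psi_ge: "u x <= p x" if "x : carrier L" for x
			unfolding p_def by(rule cSup_upper[OF Sne Sbdd]) (use that in auto)
		have psi0: "0 <= p x" if "x : carrier L" for x using psi_ge[OF that] t(3)[OF that] by linarith
		have psi1: "p x <= 1" if "x : carrier L" for x
			unfolding p_def using Sne[OF that] S01[OF _ that] by(intro cSup_least) auto
		have psi_le: "p x <= p x' + d" if xx': "x : carrier L" "x' : carrier L" "!!s. s : S x ==> EX s':S x'. s <= s' + d" for x x' d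
		proof -
			have "s <= p x' + d" if s: "s : S x" for s
			proof -
				obtain s' where s': "s' : S x'" "s <= s' + d" using xx'(3)[OF s] by blast
				moreover have "s' <= p x'" unfolding p_def by(rule cSup_upper[OF s'(1) Sbdd[OF xx'(2)]])
				ultimately show ?thesis by linarith
			qed
			thus ?thesis unfolding p_def[of x] using Sne[OF xx'(1)] by(intro cSup_least) auto
		qed
		have psi_Q1: "p x <= p (g**x) + 1 / real m" if g: "g : Q" and x: "x : carrier L" for g x
		proof(rule psi_le[OF x])
			have gL: "g : carrier L" using g QL by blast
			show "g**x : carrier L" using gL x by simp
			fix s assume s: "s : S x"
			obtain j y where jy: "s = (1 - real j / real m) * u (inv y**x)" "j <= m" "y : sprod Q j"
				using S_cases[OF s] by blast
			have yL: "y : carrier L" using jy(3) sL by blast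
			have th: "0 <= u (inv y**x)" "u (inv y**x) <= 1" using t(3,4) yL x by auto
			show "EX s':S (g**x). s <= s' + 1 / real m"
			proof(cases "j = m")
				case True
				hence "s = 0" using jy(1) m by simp
				moreover have "0 <= u (g**x)" using t(3) gL x by simp
				moreover have "u (g**x) : S (g**x)" using Sne gL x by simp
				ultimately show ?thesis by(intro bexI[of _ "u (g**x)"]) auto
			next
				case False
				have "inv (g**y)**(g**x) = inv y**x"
					using gL yL x by(intro inv_mult_cancel)
				moreover have "g**y : sprod Q (Suc j)" using g jy(3) by auto
				ultimately have "(1 - real (Suc j) / real m) * u (inv y**x) : S (g**x)"
					using S_mem[of "Suc j" "g**y" "g**x"] jy(2) False by simp
				moreover have "s = (1 - real (Suc j) / real m) * u (inv y**x) + (1 / real m) * u (inv y**x)"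
					using m by(simp add: jy(1) field_simps)
				moreover have "(1 / real m) * u (inv y**x) <= 1 / real m" using th m by(simp add: field_simps)
				ultimately show ?thesis by force
			qed
		qed
		have psi_Q: "abs (p (g**x) - p x) <= 1 / real m" if g: "g : Q" and x: "x : carrier L" for g x
		proof -
			have gL: "g : carrier L" using g QL by blast
			have "p (g**x) <= p (inv g**(g**x)) + 1 / real m" using psi_Q1[OF Q(3)[OF g]] gL x by simp
			moreover have "inv g**(g**x) = x" using gL x by(simp add: m_assoc[symmetric])
			ultimately show ?thesis using psi_Q1[OF g x] by(simp add: abs_le_iff)
		qed
		have psi_supp: "x : K1" if x: "x : carrier L" and n: "p x ~= 0" for x
		proof(rule ccontr)
			assume nK: "x ~: K1"
			have "s = 0" if s: "s : S x" for s
			proof -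
				obtain j y where jy: "s = (1 - real j / real m) * u (inv y**x)" "j <= m" "y : sprod Q j"
					using S_cases[OF s] by blast
				have yC: "y : C2" using jy(3) sprod_mono[OF QL Q(2) jy(2)] Qm by blast
				hence yL: "y : carrier L" using C2L by blast
				have "inv y**x ~: K"
				proof
					assume "inv y**x : K"
					hence "y**(inv y**x) : K1" unfolding K1_def using yC by blast
					thus False using nK yL x by(simp add: m_assoc[symmetric])
				qed
				thus ?thesis using t(7)[of "inv y**x"] jy(1) yL x by simp
			qed
			hence "S x <= {0}" by blast
			hence "S x = {0}" using Sne[OF x] unfolding subset_singleton_iff by blast
			thus False using n by(simp add: p_def)
		qed
		have psiC: "p : Cc"
		proof -
			have "cont p"
			proof(rule continuous_of_unif)
				fix e :: real assume e: "e > 0"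
				obtain W1 where W1: "nb W1" "!!w x. w : W1 ==> x : carrier L ==> abs (u (x**w) - u x) < e / 2"
					using unif_cont[OF tC half_gt_zero[OF e]] by metis
				obtain W2 where W2: "nb W2" "W2 <= W1" "!!x. x : W2 ==> inv x : W2" using nb_sym[OF W1(1)] by blast
				have le: "p x <= p (x**w) + e / 2" if x: "x : carrier L" and w: "w : W2" for x w
				proof(rule psi_le[OF x])
					have wL: "w : carrier L" using nbD(3)[OF W2(1)] w by blast
					show "x**w : carrier L" using x wL by simp
					fix s assume s: "s : S x"
					obtain j y where jy: "s = (1 - real j / real m) * u (inv y**x)" "j <= m" "y : sprod Q j"
						using S_cases[OF s] by blast
					have yL: "y : carrier L" using jy(3) sL by blast
					have w1: "w : W1" using w W2(2) by blast
					have "abs (u (inv y**x**w) - u (inv y**x)) < e / 2" by(rule W1(2)[OF w1]) (use yL x in simp)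
					hence "u (inv y**x) <= u (inv y**x**w) + e / 2" by linarith
					hence "u (inv y**x) <= u (inv y**(x**w)) + e / 2" using yL x wL by(simp add: m_assoc)
					hence "s <= (1 - real j / real m) * (u (inv y**(x**w)) + e / 2)"
						unfolding jy(1) using frac[OF jy(2)] by(intro mult_left_mono) auto
					also have "... <= (1 - real j / real m) * u (inv y**(x**w)) + e / 2"
						using frac[OF jy(2)] e by(simp add: distrib_left mult_le_cancel_right1)
					finally show "EX s':S (x**w). s <= s' + e / 2" by(rule bexI[OF _ S_mem[OF jy(2,3)]])
				qed
				have "abs (p (x**w) - p x) < e" if x: "x : carrier L" and w: "w : W2" for x w
				proof -
					have wL: "w : carrier L" using nbD(3)[OF W2(1)] w by blast
					have "p (x**w) <= p (x**w**inv w) + e / 2" using le[OF _ W2(3)[OF w]] x wL by simp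
					hence "p (x**w) <= p x + e / 2" using x wL by(simp add: m_assoc)
					thus ?thesis using le[OF x w] e by linarith
				qed
				thus "EX W. nb W & (ALL x:carrier L. ALL w:W. abs (p (x**w) - p x) < e)"
					by(intro exI[of _ W2] conjI ballI W2(1))
			qed
			thus ?thesis unfolding Cc_def using K1 psi_supp by blast
		qed
		define f where "f x = I (%y. p y * u (inv y**x))" for x
		have phC: "(%y. p y * u (inv y**x)) : Cc" if "x : carrier L" for x
			by(rule Cc_mult[OF psiC tinv[OF that]])
		have phC': "(%y. p (g**y) * u (inv y**x)) : Cc" if "g : carrier L" "x : carrier L" for g x
			by(rule Cc_mult[OF Cc_translate[OF psiC that(1)] tinv[OF that(2)]])
		have ph_trans: "f (g**x) = I (%y. p (g**y) * u (inv y**x))" if g: "g : carrier L" and x: "x : carrier L" for g x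
		proof -
			have "f (g**x) = I (%y. p (g**y) * u (inv (g**y)**(g**x)))"
				unfolding f_def using I_trans[OF phC g, of "g**x"] g x by simp
			also have "... = I (%y. p (g**y) * u (inv y**x))"
			proof(rule I_cong[symmetric, OF phC'[OF g x]])
				fix y assume "y : carrier L"
				hence "inv (g**y)**(g**x) = inv y**x"
					using g x by(intro inv_mult_cancel)
				thus "p (g**y) * u (inv y**x) = p (g**y) * u (inv (g**y)**(g**x))" by simp
			qed
			finally show ?thesis .
		qed
		have ph_diff: "f (g**x) - f x = I (%y. (p (g**y) - p y) * u (inv y**x))"
			if g: "g : carrier L" and x: "x : carrier L" for g x
			unfolding ph_trans[OF g x] unfolding f_def
			by(subst I_diff[symmetric, OF phC'[OF g x] phC[OF x]]) (simp add: left_diff_distrib)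
		have dC: "(%y. (p (g**y) - p y) * u (inv y**x)) : Cc" if "g : carrier L" "x : carrier L" for g x
			by(rule Cc_mult[OF Cc_diff[OF Cc_translate[OF psiC that(1)] psiC] tinv[OF that(2)]])
		have d_supp: "p (g**y) - p y = 0" if g: "g : Q" and y: "y : carrier L" "y ~: K'" for g y
		proof -
			have gL: "g : carrier L" using g QL by blast
			have "y ~: K1" using K1K' y by blast
			moreover have "g**y ~: K1"
			proof
				assume "g**y : K1"
				moreover have "inv g : C0" using Q(3)[OF g] Q(1) V(2) by blast
				ultimately have "inv g**(g**y) : K'" unfolding K'_def by blast
				thus False using y gL by(simp add: m_assoc[symmetric])
			qed
			ultimately have "p y = 0" "p (g**y) = 0" using psi_supp y gL by blast+
			thus ?thesis by simp
		qed
		have d_le: "abs (p (g**y) - p y) <= (1 / real m) * r y" if g: "g : Q" and y: "y : carrier L" for g y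
		proof(cases "y : K'")
			case True
			have "(1 / real m) * 1 <= (1 / real m) * r y" using z(2)[OF True] by(intro mult_left_mono) auto
			thus ?thesis using psi_Q[OF g y] by simp
		next
			case False
			thus ?thesis using d_supp[OF g y] z0[OF y] by simp
		qed
		show "EX f. gleason_function C2 V W A c0 Q m f"
		proof(intro exI[of _ f] conjI ballI allI impI)
			show "c0 <= f \<one>"
				unfolding c0_def f_def
				by(rule I_mono[OF c0C phC]) (auto intro!: mult_right_mono psi_ge t(3))
		next
			fix x assume x: "x : carrier L" and n: "f x ~= 0"
			have "EX y:carrier L. p y * u (inv y**x) ~= 0"
			proof(rule ccontr)
				assume "~ ?thesis"
				hence "f x = I (%y. 0)" unfolding f_def by(intro I_cong[OF phC[OF x]]) auto
				also have "... = 0" using I_cmult[OF Cc_zero, of 0] by simp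
				finally show False using n by simp
			qed
			then obtain y where y: "y : carrier L" "p y ~= 0" "u (inv y**x) ~= 0" by auto
			obtain c v where cv: "y = c**v" "c : C2" "v : K" using psi_supp[OF y(1,2)] by(auto simp: K1_def)
			have "inv y**x : K" using t(7)[of "inv y**x"] y x by auto
			moreover have "x = c**v**(inv y**x)" using y x cv(1) by(simp add: m_assoc[symmetric])
			ultimately show "EX c:C2. EX v:V. EX v':V. x = c**v**v'" using cv t(6) by blast
		next
			fix g x assume g: "g : Q" and x: "x : carrier L"
			have gL: "g : carrier L" using g QL by blast
			have "abs (I (%y. (p (g**y) - p y) * u (inv y**x))) <= (1 / real m) * I r"
			proof(rule I_abs[OF dC[OF gL x] zC])
				fix y assume y: "y : carrier L"
				have "abs ((p (g**y) - p y) * u (inv y**x)) <= abs (p (g**y) - p y) * 1"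
					unfolding abs_mult using t(3,4)[of "inv y**x"] y x by(intro mult_left_mono) auto
				from order_trans[OF this[unfolded mult_1_right] d_le[OF g y]]
				show "abs ((p (g**y) - p y) * u (inv y**x)) <= (1 / real m) * r y" .
			qed
			also have "(1 / real m) * I r <= A / real m" using A m by(simp add: field_simps)
			finally show "abs (f (g**x) - f x) <= A / real m" unfolding ph_diff[OF gL x] .
		next
			fix e :: real and h x assume e: "e > 0" and h: "h : W e" and x: "x : carrier L"
			have hL: "h : carrier L" using nbD(3)[OF W[OF e] h] .
			have hx: "h**x : carrier L" using hL x by simp
			have "f (h**x) - f x = I (%y. p y * (u (inv y**(h**x)) - u (inv y**x)))"
				unfolding f_def by(subst I_diff[symmetric, OF phC[OF hx] phC[OF x]]) (simp add: right_diff_distrib)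
			moreover have "abs (I (%y. p y * (u (inv y**(h**x)) - u (inv y**x)))) <= (e / A) * I r"
			proof(rule I_abs[OF _ zC])
				show "(%y. p y * (u (inv y**(h**x)) - u (inv y**x))) : Cc"
					by(rule Cc_mult[OF psiC continuous_map_diff[OF tinv[OF hx] tinv[OF x]]])
				fix y assume y: "y : carrier L"
				show "abs (p y * (u (inv y**(h**x)) - u (inv y**x))) <= (e / A) * r y"
				proof(cases "y : K1")
					case True
					have yK: "y : K'" using True K1K' by blast
					have "abs (p y * (u (inv y**(h**x)) - u (inv y**x))) <= 1 * (e / A)"
						unfolding abs_mult using psi0[OF y] psi1[OF y] W2[OF e h yK x] by(intro mult_mono) auto
					also have "... <= (e / A) * r y" using z(2)[OF yK] e A by(simp add: divide_le_eq mult_le_cancel_left1)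
					finally show ?thesis .
				next
					case False
					hence "p y = 0" using psi_supp[OF y] by blast
					thus ?thesis using z0[OF y] e A by simp
				qed
			qed
			moreover have "(e / A) * I r <= e" using e A Iz by(simp add: field_simps)
			ultimately show "abs (f (h**x) - f x) <= e" by linarith
			fix g assume g: "g : Q"
			have gL: "g : carrier L" using g QL by blast
			have "(f (g**(h**x)) - f (h**x)) - (f (g**x) - f x) =
					I (%y. (p (g**y) - p y) * (u (inv y**(h**x)) - u (inv y**x)))"
				unfolding ph_diff[OF gL hx] ph_diff[OF gL x]
				by(subst I_diff[symmetric, OF dC[OF gL hx] dC[OF gL x]]) (simp add: right_diff_distrib)
			moreover have "abs (I (%y. (p (g**y) - p y) * (u (inv y**(h**x)) - u (inv y**x)))) <= (e / A / real m) * I r"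
			proof(rule I_abs[OF _ zC])
				show "(%y. (p (g**y) - p y) * (u (inv y**(h**x)) - u (inv y**x))) : Cc"
					by(rule Cc_mult[OF Cc_diff[OF Cc_translate[OF psiC gL] psiC] continuous_map_diff[OF tinv[OF hx] tinv[OF x]]])
				fix y assume y: "y : carrier L"
				show "abs ((p (g**y) - p y) * (u (inv y**(h**x)) - u (inv y**x))) <= (e / A / real m) * r y"
				proof(cases "y : K'")
					case True
					have "abs ((p (g**y) - p y) * (u (inv y**(h**x)) - u (inv y**x))) <= ((1 / real m) * r y) * (e / A)"
						unfolding abs_mult using d_le[OF g y] W2[OF e h True x] z0[OF y] by(intro mult_mono) auto
					thus ?thesis by(simp add: field_simps)
				next
					case False
					thus ?thesis using d_supp[OF g y] z0[OF y] e A by simp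
				qed
			qed
			moreover have "(e / A / real m) * I r <= e / real m"
			proof -
				have "(e / A) * I r <= e" using e A Iz by(simp add: field_simps)
				hence "(e / A * I r) / real m <= e / real m" by(rule divide_right_mono) simp
				thus ?thesis by simp
			qed
			ultimately show "abs ((f (g**(h**x)) - f (h**x)) - (f (g**x) - f x)) <= e / real m" by linarith
		qed
	qed
qed

end

section \<open>Compact groups have enough quotients without small subgroups\<close>

lemma discriminant_le:
	fixes a b c :: real
	assumes "!!t. 0 <= a - 2 * t * b + t * t * c" "0 <= c"
	shows "b * b <= a * c"
proof(cases "c = 0")
	case True
	have "b = 0"
	proof(rule ccontr)
		assume "b ~= 0"
		thus False using assms(1)[of "(a + 1) / (2 * b)"] True by(simp add: field_simps)
	qed
	thus ?thesis using True by simp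
next
	case False
	hence c: "c > 0" using assms(2) by simp
	have "0 <= (a - 2 * (b / c) * b + (b / c) * (b / c) * c) * c"
		using assms(1)[of "b / c"] c by(intro mult_nonneg_nonneg) auto
	also have "... = a * c - b * b" using c by(simp add: field_simps)
	finally show ?thesis by simp
qed

locale compact_grp = haar_grp +
	assumes compact: "compactin X (carrier L)"
begin

lemma cont_Cc: "cont f ==> f : Cc"
	using compact unfolding Cc_def by auto

lemma cont_bounded:
	assumes "cont f"
	obtains B where "B > 0" "!!x. x : carrier L ==> abs (f x) <= B"
	using Cc_bounded[OF cont_Cc[OF assms]] by blast

lemma cont_translate: "cont f ==> a : carrier L ==> cont (%x. f (a**x))"
	using CcD[OF Cc_translate[OF cont_Cc]] .

lemma cont_translate_inv: "cont f ==> a : carrier L ==> cont (%x. f (inv x**a))"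
	using continuous_map_compose[OF continuous_mult'[OF continuous_inv continuous_const], of a euclideanreal f]
	by(simp add: comp_def)

section \<open>Convolution operators and the square norm\<close>

definition I1 :: real where "I1 = I (%_. 1)"

lemma I1_nonneg: "0 <= I1"
	unfolding I1_def by(rule I_nonneg) (simp_all add: cont_Cc)

lemma I_bound:
	assumes "cont f" "!!x. x : carrier L ==> abs (f x) <= c"
	shows "abs (I f) <= c * I1"
	unfolding I1_def by(rule I_abs) (use assms in "auto simp: cont_Cc")

lemma I_bound_prod:
	assumes "cont f" "cont g" "!!x. x : carrier L ==> abs (f x) <= c" "!!x. x : carrier L ==> abs (g x) <= d" "0 <= c"
	shows "abs (I (%x. f x * g x)) <= c * d * I1"
proof(rule I_bound)
	show "cont (%x. f x * g x)" using assms by(intro continuous_map_real_mult)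
	show "abs (f x * g x) <= c * d" if "x : carrier L" for x
		unfolding abs_mult by(intro mult_mono assms(3,4) that) (use assms(5) in auto)
qed

lemma cauchy_schwarz:
	assumes f: "cont f" and g: "cont g"
	shows "I (%x. f x * g x) * I (%x. f x * g x) <= I (%x. f x * f x) * I (%x. g x * g x)"
proof(rule discriminant_le)
	have c: "cont (%x. f x * g x)" "cont (%x. f x * f x)" "cont (%x. g x * g x)"
		by(rule continuous_map_real_mult; fact)+
	note C = this[THEN cont_Cc]
	show "0 <= I (%x. g x * g x)" by(rule I_nonneg[OF C(3)]) simp
	fix t
	have "0 <= I (%x. (f x - t * g x) * (f x - t * g x))"
		by(rule I_nonneg) (auto intro!: cont_Cc continuous_map_real_mult continuous_map_diff f g)
	also have "(%x. (f x - t * g x) * (f x - t * g x)) = (%x. (f x * f x - (2 * t) * (f x * g x)) + (t * t) * (g x * g x))"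
		by(auto simp: algebra_simps)
	also have "I ... = I (%x. f x * f x) - 2 * t * I (%x. f x * g x) + t * t * I (%x. g x * g x)"
		by(simp add: I_add[OF Cc_diff[OF C(2) Cc_cmult[OF C(1)]] Cc_cmult[OF C(3)]] I_diff[OF C(2) Cc_cmult[OF C(1)]] I_cmult[OF C(1)] I_cmult[OF C(3)])
	finally show "0 <= ..." .
qed

text \<open>An integral operator whose kernel is invariant under simultaneous left translation of
  both variables; \<open>cconv\<close> is its transpose.\<close>

definition conv :: "('a => real) => ('a => real) => 'a => real" where
	"conv k G y = I (%x. G x * k (inv x**y))"

definition cconv :: "('a => real) => ('a => real) => 'a => real" where
	"cconv k F x = I (%y. F y * k (inv x**y))"

lemma conv_cont_in: "cont k ==> cont G ==> y : carrier L ==> cont (%x. G x * k (inv x**y))"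
	by(intro continuous_map_real_mult cont_translate_inv)

lemma cconv_cont_in: "cont k ==> cont G ==> x : carrier L ==> cont (%y. G y * k (inv x**y))"
	by(intro continuous_map_real_mult cont_translate) simp_all

lemma conv_bound:
	assumes "cont k" "cont G" "!!x. x : carrier L ==> abs (k x) <= d" "!!x. x : carrier L ==> abs (G x) <= c" "0 <= c" "y : carrier L"
	shows "abs (conv k G y) <= c * d * I1" "abs (cconv k G y) <= c * d * I1"
	unfolding conv_def cconv_def
	by(intro I_bound_prod assms cont_translate_inv cont_translate; use assms in simp)+

lemma conv_l2_bound:
	assumes k: "cont k" "!!x. x : carrier L ==> abs (k x) <= d" and G: "cont G" "I (%x. G x * G x) <= c * c" "0 <= c" and y: "y : carrier L" and d: "0 <= d"
	shows "abs (conv k G y) <= c * d * sqrt I1" "abs (cconv k G y) <= c * d * sqrt I1"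
proof -
	have *: "abs (I (%x. G x * g x)) <= c * d * sqrt I1" if g: "cont g" "!!x. x : carrier L ==> abs (g x) <= d" for g
	proof -
		have 1: "I (%x. g x * g x) <= d * d * I1"
			using I_bound_prod[OF g(1) g(1) g(2) g(2) d] by simp
		have 2: "0 <= I (%x. g x * g x)"
			by(rule I_nonneg) (auto intro!: cont_Cc continuous_map_real_mult g)
		have "I (%x. G x * g x) * I (%x. G x * g x) <= I (%x. G x * G x) * I (%x. g x * g x)"
			by(rule cauchy_schwarz[OF G(1) g(1)])
		also have "... <= (c * c) * (d * d * I1)" using 1 2 G(2) by(intro mult_mono) auto
		finally have "(I (%x. G x * g x))\<^sup>2 <= (c * d * sqrt I1)\<^sup>2"
			using I1_nonneg by(simp add: power2_eq_square algebra_simps)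
		hence "abs (I (%x. G x * g x)) <= abs (c * d * sqrt I1)" by(simp add: abs_le_square_iff)
		thus ?thesis using G(3) d I1_nonneg by simp
	qed
	show "abs (conv k G y) <= c * d * sqrt I1" "abs (cconv k G y) <= c * d * sqrt I1"
		unfolding conv_def cconv_def using k y by(intro * cont_translate_inv cont_translate; simp)+
qed

lemma conv_diff:
	assumes k: "cont k" and F: "cont F" and G: "cont G" and y: "y : carrier L"
	shows "conv k (%x. F x - G x) y = conv k F y - conv k G y" "cconv k (%x. F x - G x) y = cconv k F y - cconv k G y"
	unfolding conv_def cconv_def
	using I_diff[OF conv_cont_in[OF k F y, THEN cont_Cc] conv_cont_in[OF k G y, THEN cont_Cc]]
		I_diff[OF cconv_cont_in[OF k F y, THEN cont_Cc] cconv_cont_in[OF k G y, THEN cont_Cc]]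
	by(simp_all add: left_diff_distrib)

lemma conv_cmult:
	assumes k: "cont k" and F: "cont F" and y: "y : carrier L"
	shows "conv k (%x. c * F x) y = c * conv k F y" "cconv k (%x. c * F x) y = c * cconv k F y"
	unfolding conv_def cconv_def
	using I_cmult[OF conv_cont_in[OF k F y, THEN cont_Cc], of c] I_cmult[OF cconv_cont_in[OF k F y, THEN cont_Cc], of c]
	by(simp_all add: mult.assoc)

text \<open>The modulus of continuity of a convolution depends only on the \<open>L\<^sup>1\<close> norm of the first factor.\<close>

lemma conv_equicont:
	assumes k: "cont k" and e: "e > 0"
	obtains W where "nb W"
		"!!G c w y. cont G ==> 0 <= c ==> I (%x. abs (G x)) <= c ==> w : W ==> y : carrier L ==> abs (conv k G (y**w) - conv k G y) <= c * e"
		"!!G c w y. cont G ==> 0 <= c ==> I (%x. abs (G x)) <= c ==> w : W ==> y : carrier L ==> abs (conv k G (w**y) - conv k G y) <= c * e"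
		"!!G c w y. cont G ==> 0 <= c ==> I (%x. abs (G x)) <= c ==> w : W ==> y : carrier L ==> abs (cconv k G (y**w) - cconv k G y) <= c * e"
proof -
	obtain W1 where W1: "nb W1" "!!w x. w : W1 ==> x : carrier L ==> abs (k (w**x) - k x) < e"
		"!!w x. w : W1 ==> x : carrier L ==> abs (k (x**w) - k x) < e"
		using unif_cont[OF cont_Cc[OF k] e] by metis
	obtain W2 where W2: "nb W2" "W2 <= W1" "!!x. x : W2 ==> inv x : W2" using nb_sym[OF W1(1)] by blast
	obtain W3 where W3: "nb W3" "!!k w. k : carrier L ==> w : W3 ==> inv k**w**k : W1"
		using nb_conj[OF compact W1(1)] by metis
	have *: "abs (I (%x. G x * g x) - I (%x. G x * g' x)) <= c * e"
		if G: "cont G" "0 <= c" "I (%x. abs (G x)) <= c" and g: "cont g" "cont g'" "!!x. x : carrier L ==> abs (g x - g' x) < e" for G g g' c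
	proof -
		have aG: "cont (%x. abs (G x))" using G(1) by(rule continuous_map_real_abs)
		have "I (%x. G x * g x) - I (%x. G x * g' x) = I (%x. G x * (g x - g' x))"
			by(subst I_diff[symmetric]) (auto intro!: cont_Cc continuous_map_real_mult G g simp: right_diff_distrib)
		moreover have "abs (I (%x. G x * (g x - g' x))) <= e * I (%x. abs (G x))"
		proof(rule I_abs)
			show "(%x. G x * (g x - g' x)) : Cc" by(intro cont_Cc continuous_map_real_mult continuous_map_diff G g)
			show "abs (G x * (g x - g' x)) <= e * abs (G x)" if "x : carrier L" for x
				unfolding abs_mult using g(3)[OF that] by(subst mult.commute) (intro mult_right_mono, auto)
		qed (rule cont_Cc[OF aG])
		moreover have "e * I (%x. abs (G x)) <= e * c" using G e by(intro mult_left_mono) auto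
		ultimately show ?thesis by(simp add: mult.commute)
	qed
	show ?thesis
	proof(rule that[of "W1 Int (W2 Int W3)"])
		show "nb (W1 Int (W2 Int W3))" by(intro nb_Int W1 W2 W3)
		fix G :: "'a => real" and c w y
		assume G: "cont G" "0 <= c" "I (%x. abs (G x)) <= c" and w: "w : W1 Int (W2 Int W3)" and y: "y : carrier L"
		have wL: "w : carrier L" using w nbD(3)[OF W1(1)] by blast
		have w': "w : W1" "w : W2" "w : W3" using w by blast+
		show "abs (conv k G (y**w) - conv k G y) <= c * e"
			unfolding conv_def
		proof(rule *[OF G])
			fix x assume x: "x : carrier L"
			have "inv x**(y**w) = inv x**y**w" using x y wL by(simp add: m_assoc)
			thus "abs (k (inv x**(y**w)) - k (inv x**y)) < e" using W1(3)[OF w'(1), of "inv x**y"] x y by simp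
		qed (use k y wL in "auto intro!: cont_translate_inv")
		show "abs (conv k G (w**y) - conv k G y) <= c * e"
			unfolding conv_def
		proof(rule *[OF G])
			fix x assume x: "x : carrier L"
			have eq: "inv x**(w**y) = (inv x**w**x)**(inv x**y)" using x y wL by(simp add: m_assoc inv_cancel)
			show "abs (k (inv x**(w**y)) - k (inv x**y)) < e"
				unfolding eq by(rule W1(2)[OF W3(2)[OF x w'(3)]]) (use x y in simp)
		qed (use k y wL in "auto intro!: cont_translate_inv")
		show "abs (cconv k G (y**w) - cconv k G y) <= c * e"
			unfolding cconv_def
		proof(rule *[OF G])
			fix x assume x: "x : carrier L"
			have eq: "inv (y**w)**x = inv w**(inv y**x)" using x y wL by(simp add: inv_mult_group m_assoc)
			show "abs (k (inv (y**w)**x) - k (inv y**x)) < e"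
				unfolding eq using W2(3)[OF w'(2)] W2(2) x y by(intro W1(2)) auto
		qed (use k y wL in "auto intro!: cont_translate")
	qed
qed

lemma conv_cont:
	assumes k: "cont k" and G: "cont G"
	shows "cont (conv k G)" "cont (cconv k G)"
proof -
	define c where "c = I (%x. abs (G x))"
	have c: "0 <= c" unfolding c_def by(rule I_nonneg) (auto intro!: cont_Cc continuous_map_real_abs G)
	have *: "EX W. nb W & (ALL x:carrier L. ALL w:W. abs (conv k G (x**w) - conv k G x) < e) &
		(ALL x:carrier L. ALL w:W. abs (cconv k G (x**w) - cconv k G x) < e)" if e: "e > 0" for e
	proof -
		define d where "d = e / (c + 1)"
		have d: "d > 0" "c * d < e" using c e by(auto simp: d_def field_simps)
		obtain W where W: "nb W" "!!w y. w : W ==> y : carrier L ==> abs (conv k G (y**w) - conv k G y) <= c * d"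
			 "!!w y. w : W ==> y : carrier L ==> abs (cconv k G (y**w) - cconv k G y) <= c * d"
			using conv_equicont[OF k d(1)] G c c_def by(metis order_refl)
		show ?thesis
			by(intro exI[of _ W] conjI ballI W(1) le_less_trans[OF W(2) d(2)] le_less_trans[OF W(3) d(2)])
	qed
	show "cont (conv k G)" by(rule continuous_of_unif) (use * in meson)
	show "cont (cconv k G)" by(rule continuous_of_unif) (use * in meson)
qed

lemma cont_sum: "finite A ==> (!!i. i : A ==> cont (f i)) ==> cont (%x. SUM i:A. f i x)"
	by(rule continuous_map_sum)

lemma cont_cmult: "cont f ==> cont (%x. c * f x)"
	by(rule continuous_map_real_mult) simp_all

lemma I_sum:
	assumes "finite A" "!!i. i : A ==> cont (f i)"
	shows "I (%x. SUM i:A. f i x) = (SUM i:A. I (f i))"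
	using assms
proof(induction A)
	case empty
	show ?case using I_cmult[OF Cc_zero, of 0] by simp
next
	case (insert a A)
	have "I (%x. f a x + (SUM i:A. f i x)) = I (f a) + I (%x. SUM i:A. f i x)"
		using insert by(intro I_add cont_Cc cont_sum) auto
	thus ?case using insert by simp
qed

lemma partition_of_unity:
	assumes W: "nb W"
	obtains A p where "finite A" "A <= carrier L" "!!a. a : A ==> cont (p a)"
		"!!a x. a : A ==> x : carrier L ==> 0 <= p a x" "!!x. x : carrier L ==> (SUM a:A. p a x) = (1::real)"
		"!!a x. a : A ==> x : carrier L ==> p a x ~= 0 ==> inv a**x : W"
proof -
	obtain q where t: "q : Cpp" "q \<one> = 1" "!!x. x : carrier L ==> q x <= 1" "!!x. x : carrier L ==> q x ~= 0 ==> x : W"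
		using bump_Cpp[OF W] by blast
	have tc: "cont q" and t0: "!!x. x : carrier L ==> 0 <= q x"
		using t(1) CcD[OF Cp_Cc[OF Cpp_Cp]] Cp_nonneg[OF Cpp_Cp] by blast+
	define O' where "O' k = {x : carrier L. 1 / 2 < q (inv k**x)}" for k
	have op: "openin X (O' k)" "k : O' k" if k: "k : carrier L" for k
	proof -
		have "cont (%x. q (inv k**x))" using cont_translate[OF tc] k by simp
		from openin_continuous_map_preimage[OF this, of "{1 / 2<..}"]
		show "openin X (O' k)" by(simp add: O'_def topspace)
		show "k : O' k" using k t(2) by(simp add: O'_def)
	qed
	have "EX G. finite G & G <= O' ` carrier L & carrier L <= \<Union>G"
		using op by(intro compactinD[OF compact]) auto
	then obtain G where F: "finite G" "G <= O' ` carrier L" "carrier L <= \<Union>G" by(elim exE conjE)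
	obtain A where A': "A <= carrier L" "finite A" "G = O' ` A"
		using finite_subset_image[OF F(1,2)] by(elim exE conjE)
	define S where "S x = (SUM a:A. q (inv a**x))" for x
	have pc: "cont (%x. q (inv a**x))" if "a : A" for a using cont_translate[OF tc] A'(1) that by(simp add: subset_iff)
	have Sc: "cont S" unfolding S_def[abs_def] by(rule cont_sum[OF A'(2) pc])
	have Spos: "S x > 0" if x: "x : carrier L" for x
	proof -
		have "x : \<Union>(O' ` A)" using F(3) A'(3) x by blast
		then obtain a where a: "a : A" "x : O' a" by(elim UN_E)
		have nn: "0 <= q (inv b**x)" if "b : A" for b using t0 A'(1) that x by(simp add: subset_iff)
		have "0 < q (inv a**x)" using a(2) by(simp add: O'_def)
		also have "... <= S x" unfolding S_def using a(1) nn A'(2) by(intro member_le_sum) auto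
		finally show ?thesis .
	qed
	show ?thesis
	proof(rule that[of A "%a x. q (inv a**x) / S x", OF A'(2) A'(1)])
		show "cont (%x. q (inv a**x) / S x)" if "a : A" for a
			using Spos by(intro continuous_map_real_divide pc[OF that] Sc) (force simp: topspace)
		show "0 <= q (inv a**x) / S x" if "a : A" "x : carrier L" for a x
			using t0 A'(1) that Spos[OF that(2)] by(simp add: subset_iff)
		show "(SUM a:A. q (inv a**x) / S x) = 1" if x: "x : carrier L" for x
			using Spos[OF x] by(simp add: sum_divide_distrib[symmetric] S_def[symmetric])
		show "inv a**x : W" if "a : A" "x : carrier L" "q (inv a**x) / S x ~= 0" for a x
			using t(4)[of "inv a**x"] A'(1) that by(simp add: subset_iff)
	qed
qed

text \<open>Fubini's theorem, by approximating \<open>k (inv x \<otimes> y)\<close> uniformly by a finite sum of products.\<close>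

lemma conv_adjoint:
	assumes k: "cont k" and F: "cont F" and G: "cont G"
	shows "I (%x. G x * cconv k F x) = I (%y. F y * conv k G y)"
proof -
	obtain bF where bF: "bF > 0" "!!x. x : carrier L ==> abs (F x) <= bF" using cont_bounded[OF F] by blast
	obtain bG where bG: "bG > 0" "!!x. x : carrier L ==> abs (G x) <= bG" using cont_bounded[OF G] by blast
	have "abs (I (%x. G x * cconv k F x) - I (%y. F y * conv k G y)) <= 2 * (bF * bG * I1 * I1) * e" if e: "e > 0" for e
	proof -
		obtain W1 where W1: "nb W1" "!!w x. w : W1 ==> x : carrier L ==> abs (k (w**x) - k x) < e"
			using unif_cont[OF cont_Cc[OF k] e] by metis
		obtain W where W: "nb W" "W <= W1" "!!x. x : W ==> inv x : W" using nb_sym[OF W1(1)] by blast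
		obtain A p where A: "finite A" "A <= carrier L" and p: "!!a. a : A ==> cont (p a)"
			"!!a x. a : A ==> x : carrier L ==> 0 <= p a x" "!!x. x : carrier L ==> (SUM a:A. p a x) = (1::real)"
			"!!a x. a : A ==> x : carrier L ==> p a x ~= 0 ==> inv a**x : W"
			using partition_of_unity[OF W(1)] by blast
		define D where "D x y = (SUM a:A. p a x * k (inv a**y))" for x y
		have aL: "a : carrier L" if "a : A" for a using A(2) that by blast
		have kc: "cont (%y. k (inv a**y))" if "a : A" for a using cont_translate[OF k] aL[OF that] by simp
		have D: "abs (k (inv x**y) - D x y) <= e" if x: "x : carrier L" and y: "y : carrier L" for x y
		proof -
			have "k (inv x**y) = (SUM a:A. p a x * k (inv x**y))" using p(3)[OF x] by(simp add: sum_distrib_right[symmetric])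
			hence "k (inv x**y) - D x y = (SUM a:A. p a x * (k (inv x**y) - k (inv a**y)))"
				by(simp add: D_def right_diff_distrib sum_subtractf)
			also have "abs (...) <= (SUM a:A. p a x * e)"
			proof(rule order_trans[OF sum_abs sum_mono])
				fix a assume a: "a : A"
				show "abs (p a x * (k (inv x**y) - k (inv a**y))) <= p a x * e"
				proof(cases "p a x = 0")
					case False
					have "inv (inv a**x) : W1" using W(3)[OF p(4)[OF a x False]] W(2) by blast
					hence w: "inv x**a : W1" using aL[OF a] x by(simp add: inv_mult_group)
					have eq: "inv x**y = inv x**a**(inv a**y)" using aL[OF a] x y by(simp add: m_assoc inv_cancel)
					have "abs (k (inv x**y) - k (inv a**y)) < e"
						unfolding eq by(rule W1(2)[OF w]) (use aL[OF a] y in simp)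
					thus ?thesis unfolding abs_mult using p(2)[OF a x] by(simp add: mult_left_mono)
				qed simp
			qed
			also have "... = e" using p(3)[OF x] by(simp add: sum_distrib_right[symmetric])
			finally show ?thesis .
		qed
		have Dc1: "cont (%x. D x y)" for y unfolding D_def
			by(intro cont_sum A continuous_map_real_mult p(1)) auto
		have Dc2: "cont (%y. D x y)" for x unfolding D_def
			by(intro cont_sum A continuous_map_real_mult kc) auto
		define M where "M = (SUM a:A. I (%x. G x * p a x) * I (%y. F y * k (inv a**y)))"
		have c1: "cont (%x. G x * p a x)" "cont (%y. F y * k (inv a**y))" if "a : A" for a
			by(rule continuous_map_real_mult[OF G p(1)[OF that]] continuous_map_real_mult[OF F kc[OF that]])+
		have D1: "I (%y. F y * D x y) = (SUM a:A. p a x * I (%y. F y * k (inv a**y)))" for x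
		proof -
			have "I (%y. F y * D x y) = I (%y. SUM a:A. p a x * (F y * k (inv a**y)))"
				by(simp add: D_def sum_distrib_left algebra_simps)
			also have "... = (SUM a:A. I (%y. p a x * (F y * k (inv a**y))))"
				by(rule I_sum[OF A(1) cont_cmult[OF c1(2)]])
			also have "... = (SUM a:A. p a x * I (%y. F y * k (inv a**y)))"
				by(rule sum.cong[OF refl], rule I_cmult[OF cont_Cc[OF c1(2)]])
			finally show ?thesis .
		qed
		have D2: "I (%x. G x * D x y) = (SUM a:A. k (inv a**y) * I (%x. G x * p a x))" for y
		proof -
			have "I (%x. G x * D x y) = I (%x. SUM a:A. k (inv a**y) * (G x * p a x))"
				by(simp add: D_def sum_distrib_left algebra_simps)
			also have "... = (SUM a:A. I (%x. k (inv a**y) * (G x * p a x)))"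
				by(rule I_sum[OF A(1) cont_cmult[OF c1(1)]])
			also have "... = (SUM a:A. k (inv a**y) * I (%x. G x * p a x))"
				by(rule sum.cong[OF refl], rule I_cmult[OF cont_Cc[OF c1(1)]])
			finally show ?thesis .
		qed
		have M1: "I (%x. G x * I (%y. F y * D x y)) = M"
		proof -
			have "I (%x. G x * I (%y. F y * D x y)) = I (%x. SUM a:A. I (%y. F y * k (inv a**y)) * (G x * p a x))"
				unfolding D1 by(simp add: sum_distrib_left algebra_simps)
			also have "... = (SUM a:A. I (%x. I (%y. F y * k (inv a**y)) * (G x * p a x)))"
				by(rule I_sum[OF A(1) cont_cmult[OF c1(1)]])
			also have "... = M" unfolding M_def
				by(rule sum.cong[OF refl], subst I_cmult[OF cont_Cc[OF c1(1)]]) (simp_all add: mult.commute)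
			finally show ?thesis .
		qed
		have M2: "I (%y. F y * I (%x. G x * D x y)) = M"
		proof -
			have "I (%y. F y * I (%x. G x * D x y)) = I (%y. SUM a:A. I (%x. G x * p a x) * (F y * k (inv a**y)))"
				unfolding D2 by(simp add: sum_distrib_left algebra_simps)
			also have "... = (SUM a:A. I (%y. I (%x. G x * p a x) * (F y * k (inv a**y))))"
				by(rule I_sum[OF A(1) cont_cmult[OF c1(2)]])
			also have "... = M" unfolding M_def
				by(rule sum.cong[OF refl], rule I_cmult[OF cont_Cc[OF c1(2)]])
			finally show ?thesis .
		qed
		have cD: "cont (%x. I (%y. F y * D x y))" "cont (%y. I (%x. G x * D x y))"
			unfolding D1 D2 by(intro cont_sum A continuous_map_real_mult p(1) kc; simp)+
		have d1: "abs (cconv k F x - I (%y. F y * D x y)) <= bF * e * I1" if x: "x : carrier L" for x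
		proof -
			have kx: "cont (%y. k (inv x**y))" using cont_translate[OF k] x by simp
			have "cconv k F x - I (%y. F y * D x y) = I (%y. F y * (k (inv x**y) - D x y))"
				unfolding cconv_def
				by(subst I_diff[symmetric]) (auto intro!: cont_Cc continuous_map_real_mult F kx Dc2 simp: right_diff_distrib)
			moreover have "abs (I (%y. F y * (k (inv x**y) - D x y))) <= bF * e * I1"
				by(rule I_bound_prod[OF F continuous_map_diff[OF kx Dc2] bF(2) D[OF x]]) (use bF in auto)
			ultimately show ?thesis by simp
		qed
		have d2: "abs (conv k G y - I (%x. G x * D x y)) <= bG * e * I1" if y: "y : carrier L" for y
		proof -
			have ky: "cont (%x. k (inv x**y))" using cont_translate_inv[OF k y] .
			have "conv k G y - I (%x. G x * D x y) = I (%x. G x * (k (inv x**y) - D x y))"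
				unfolding conv_def
				by(subst I_diff[symmetric]) (auto intro!: cont_Cc continuous_map_real_mult G ky Dc1 simp: right_diff_distrib)
			moreover have "abs (I (%x. G x * (k (inv x**y) - D x y))) <= bG * e * I1"
				by(rule I_bound_prod[OF G continuous_map_diff[OF ky Dc1] bG(2) D[OF _ y]]) (use bG in auto)
			ultimately show ?thesis by simp
		qed
		have e1: "abs (I (%x. G x * cconv k F x) - M) <= bG * (bF * e * I1) * I1"
		proof -
			have "I (%x. G x * cconv k F x) - M = I (%x. G x * (cconv k F x - I (%y. F y * D x y)))"
				unfolding M1[symmetric]
				by(subst I_diff[symmetric])
					(auto intro!: cont_Cc continuous_map_real_mult G conv_cont[OF k F] cD simp: right_diff_distrib)
			moreover have "abs (I (%x. G x * (cconv k F x - I (%y. F y * D x y)))) <= bG * (bF * e * I1) * I1"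
				by(rule I_bound_prod[OF G continuous_map_diff[OF conv_cont(2)[OF k F] cD(1)] bG(2) d1]) (use bG in auto)
			ultimately show ?thesis by simp
		qed
		have e2: "abs (I (%y. F y * conv k G y) - M) <= bF * (bG * e * I1) * I1"
		proof -
			have "I (%y. F y * conv k G y) - M = I (%y. F y * (conv k G y - I (%x. G x * D x y)))"
				unfolding M2[symmetric]
				by(subst I_diff[symmetric])
					(auto intro!: cont_Cc continuous_map_real_mult F conv_cont[OF k G] cD simp: right_diff_distrib)
			moreover have "abs (I (%y. F y * (conv k G y - I (%x. G x * D x y)))) <= bF * (bG * e * I1) * I1"
				by(rule I_bound_prod[OF F continuous_map_diff[OF conv_cont(1)[OF k G] cD(2)] bF(2) d2]) (use bF in auto)
			ultimately show ?thesis by simp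
		qed
		have "2 * (bF * bG * I1 * I1) * e = bG * (bF * e * I1) * I1 + bF * (bG * e * I1) * I1" by(simp add: algebra_simps)
		thus ?thesis using e1 e2 by linarith
	qed
	note small = this
	show ?thesis
	proof(rule ccontr)
		assume ne: "~ ?thesis"
		define d where "d = abs (I (%x. G x * cconv k F x) - I (%y. F y * conv k G y))"
		define c where "c = 2 * (bF * bG * I1 * I1)"
		have d: "d > 0" using ne by(simp add: d_def)
		have c: "c >= 0" using bF bG I1_nonneg by(simp add: c_def)
		have "d <= c * (d / (2 * (c + 1)))" unfolding d_def[symmetric] c_def[symmetric]
			using small[of "d / (2 * (c + 1))"] d c by(simp add: d_def c_def)
		also have "... = d * (c / (2 * (c + 1)))" by simp
		also have "... < d * 1" using d c by(intro mult_strict_left_mono) (auto simp: field_simps)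
		finally show False by simp
	qed
qed

end

lemma ultra_nat:
	obtains U :: "nat filter" where "ultra U" "U <= sequentially"
	using ultra_exists[OF sequentially_bot] by blast

context compact_grp
begin

section \<open>An eigenfunction of a convolution operator\<close>

lemma finite_net:
	assumes W: "nb W"
	shows "EX A. finite A & A <= carrier L & (ALL y:carrier L. EX a:A. inv a**y : W)"
proof(rule partition_of_unity[OF W])
	fix A p assume A: "finite A" "A <= carrier L" and p: "!!x. x : carrier L ==> (SUM a:A. p a x) = (1::real)"
		"!!a x. a : A ==> x : carrier L ==> p a x ~= 0 ==> inv a**x : W"
	have "EX a:A. inv a**y : W" if y: "y : carrier L" for y
	proof -
		have "EX a:A. p a y ~= 0"
		proof(rule ccontr)
			assume "~ ?thesis"
			hence "(SUM a:A. p a y) = 0" by(intro sum.neutral) blast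
			thus False using p(1)[OF y] by simp
		qed
		then obtain a where "a : A" "p a y ~= 0" by(elim bexE)
		thus ?thesis using p(2)[OF _ y] by(intro bexI)
	qed
	thus ?thesis using A by blast
qed

text \<open>The operator times its transpose: positive, self-adjoint, compact, and commuting with
  left translations. Its eigenspaces take the place of finite-dimensional representations.\<close>

definition Rop :: "('a => real) => ('a => real) => 'a => real" where
	"Rop k F = conv k (cconv k F)"

lemma conv_cong:
	assumes "cont k" "cont F" "y : carrier L" "!!x. x : carrier L ==> F x = G x"
	shows "conv k F y = conv k G y" "cconv k F y = cconv k G y"
	unfolding conv_def cconv_def
	using I_cong[OF conv_cont_in[OF assms(1-3), THEN cont_Cc]] I_cong[OF cconv_cont_in[OF assms(1-3), THEN cont_Cc]]
		assms(4) by simp_all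

lemma Rop_diff:
	assumes k: "cont k" and F: "cont F" and G: "cont G" and y: "y : carrier L"
	shows "Rop k (%x. F x - G x) y = Rop k F y - Rop k G y"
	unfolding Rop_def conv_diff(1)[OF k conv_cont(2)[OF k F] conv_cont(2)[OF k G] y, symmetric]
	by(rule conv_cong[OF k _ y]) (intro conv_cont k continuous_map_diff F G, rule conv_diff[OF k F G])

lemma Rop_cmult:
	assumes k: "cont k" and F: "cont F" and y: "y : carrier L"
	shows "Rop k (%x. c * F x) y = c * Rop k F y"
	unfolding Rop_def conv_cmult(1)[OF k conv_cont(2)[OF k F] y, symmetric]
	by(rule conv_cong[OF k _ y]) (intro conv_cont k cont_cmult F, rule conv_cmult[OF k F])

lemma Rop_cont: "cont k ==> cont F ==> cont (Rop k F)"
	unfolding Rop_def by(intro conv_cont)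

lemma Rop_bound:
	assumes "cont k" "cont F" "!!x. x : carrier L ==> abs (k x) <= d" "!!x. x : carrier L ==> abs (F x) <= c" "0 <= c" "0 <= d" "y : carrier L"
	shows "abs (Rop k F y) <= c * d * I1 * d * I1"
	unfolding Rop_def using I1_nonneg assms(5,6)
	by(intro conv_bound(1)[OF assms(1) conv_cont(2)[OF assms(1,2)] assms(3) conv_bound(2)[OF assms(1-5)] _ assms(7)]) auto

lemma Rop_l2_bound:
	assumes "cont k" "cont F" "!!x. x : carrier L ==> abs (k x) <= d" "I (%x. F x * F x) <= c * c" "0 <= c" "0 <= d" "y : carrier L"
	shows "abs (Rop k F y) <= c * d * sqrt I1 * d * I1"
	unfolding Rop_def using I1_nonneg assms(5,6)
	by(intro conv_bound(1)[OF assms(1) conv_cont(2)[OF assms(1,2)] assms(3) conv_l2_bound(2)[OF assms(1,3,2,4,5)] _ assms(7)]) auto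

lemma sq_nonneg: "cont F ==> 0 <= I (%x. F x * F x)"
	by(rule I_nonneg) (auto intro!: cont_Cc continuous_map_real_mult)

text \<open>The spectral theorem for a compact positive operator, by maximising the quadratic form
  \<open>q\<close> on the unit ball. For a maximising sequence, \<open>R n - m * F n\<close> tends
  to zero in the square norm. The \<open>R n\<close> are bounded and equicontinuous, so they
  converge uniformly along an ultrafilter to a continuous \<open>G\<close>; one more application of
  the operator upgrades convergence in the square norm to pointwise convergence.\<close>

lemma eigenfunction:
	assumes k: "cont k" and ne: "a : carrier L" "k a ~= 0"
	obtains m G b where "m > 0" "cont G" "b : carrier L" "G b ~= 0" "!!y. y : carrier L ==> Rop k G y = m * G y"
proof -
	obtain d where d: "d > 0" "!!x. x : carrier L ==> abs (k x) <= d" using cont_bounded[OF k] by blast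
	have d0: "0 <= d" using d(1) by simp
	define n2 where "n2 F = I (%x. F x * F x)" for F
	define q where "q F = n2 (cconv k F)" for F
	have n2_0: "0 <= n2 F" if "cont F" for F unfolding n2_def using sq_nonneg[OF that] .
	have q_0: "0 <= q F" if "cont F" for F unfolding q_def by(intro n2_0 conv_cont k that)
	have n2_cmult: "n2 (%x. t * F x) = t * t * n2 F" if "cont F" for t F
		unfolding n2_def using I_cmult[OF cont_Cc[OF continuous_map_real_mult[OF that that]], of "t * t"]
		by(simp add: algebra_simps)
	have n2_cong: "n2 F = n2 G" if "cont F" "!!x. x : carrier L ==> F x = G x" for F G
		unfolding n2_def using that by(intro I_cong cont_Cc continuous_map_real_mult) auto
	have q_cmult: "q (%x. t * F x) = t * t * q F" if F: "cont F" for t F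
		unfolding q_def n2_cmult[OF conv_cont(2)[OF k F], symmetric]
		by(rule n2_cong) (intro conv_cont k cont_cmult F, rule conv_cmult[OF k F])
	have q_bound: "q F <= (c * d * sqrt I1) * (c * d * sqrt I1) * I1" if F: "cont F" "n2 F <= c * c" "0 <= c" for F c
	proof -
		note b = conv_l2_bound(2)[OF k d(2) F(1) F(2)[unfolded n2_def] F(3) _ d0]
		have "abs (I (%x. cconv k F x * cconv k F x)) <= (c * d * sqrt I1) * (c * d * sqrt I1) * I1"
			using F(3) d0 I1_nonneg by(intro I_bound_prod conv_cont k F b) auto
		thus ?thesis by(simp add: q_def n2_def)
	qed
	define S where "S = {q F | F. cont F & n2 F <= 1}"
	have S_mem: "q F : S" if "cont F" "n2 F <= 1" for F unfolding S_def using that by blast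
	have Sb: "bdd_above S"
	proof(rule bdd_aboveI)
		fix s assume "s : S"
		then obtain F where F: "s = q F" "cont F" "n2 F <= 1" unfolding S_def by blast
		thus "s <= (1 * d * sqrt I1) * (1 * d * sqrt I1) * I1" using q_bound[OF F(2), of 1] by simp
	qed
	define m where "m = Sup S"
	have q_le: "q F <= m * n2 F" if F: "cont F" for F
	proof(cases "n2 F = 0")
		case True
		thus ?thesis using q_bound[OF F, of 0] by simp
	next
		case False
		hence p: "n2 F > 0" using n2_0[OF F] by simp
		define t where "t = 1 / sqrt (n2 F)"
		have tt: "t * t = 1 / n2 F" using p by(simp add: t_def)
		have "q (%x. t * F x) : S" using p by(intro S_mem cont_cmult F) (simp add: n2_cmult[OF F] tt)
		hence "q (%x. t * F x) <= m" unfolding m_def by(rule cSup_upper[OF _ Sb])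
		thus ?thesis unfolding q_cmult[OF F] tt using p by(simp add: field_simps)
	qed
	have pos_n2: "n2 F > 0" if "cont F" "b : carrier L" "F b ~= 0" for F b
		unfolding n2_def
		by(rule I_pos[OF cont_Cc, of _ b]) (use that in \<open>auto intro!: continuous_map_real_mult\<close>, metis not_square_less_zero linorder_neqE_linordered_idom mult_eq_0_iff)
	\<comment> \<open>At the identity \<open>cconv k k\<close> is the square integral of
	  \<open>k\<close>, which is positive because \<open>k\<close> does not vanish identically.\<close>
	have lam: "m > 0"
	proof -
		have "cconv k k \<one> = n2 k"
			unfolding cconv_def n2_def by(rule I_cong) (auto intro!: cont_Cc continuous_map_real_mult k cont_translate)
		hence "cconv k k \<one> ~= 0" using pos_n2[OF k ne] by simp
		hence "q k > 0" unfolding q_def by(intro pos_n2[of _ \<one>] conv_cont k) simp_all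
		hence "m * n2 k > 0" using q_le[OF k] by linarith
		thus ?thesis using n2_0[OF k] by(simp add: zero_less_mult_iff)
	qed
	have q_ip: "q F = I (%x. F x * Rop k F x)" if F: "cont F" for F
		unfolding q_def n2_def Rop_def using conv_adjoint[OF k F conv_cont(2)[OF k F]] .
	\<comment> \<open>Moving the operator to the other side and applying Cauchy-Schwarz bounds the
	  square of \<open>n2 (Rop k F)\<close> by \<open>q F * m\<close> times \<open>n2 (Rop k F)\<close>
	  itself; one factor cancels.\<close>
	have R_q: "n2 (Rop k F) <= m * q F" if F: "cont F" for F
	proof -
		let ?H = "cconv k F" and ?a = "n2 (Rop k F)"
		have cH: "cont ?H" and cR: "cont (Rop k F)" by(intro conv_cont Rop_cont k F)+
		have e: "?a = I (%x. ?H x * cconv k (Rop k F) x)"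
			unfolding n2_def using conv_adjoint[OF k cR cH] by(simp add: Rop_def)
		have "?a * ?a <= n2 ?H * n2 (cconv k (Rop k F))"
			unfolding e unfolding n2_def by(rule cauchy_schwarz[OF cH conv_cont(2)[OF k cR]])
		also have "... <= q F * (m * ?a)"
			unfolding q_def[symmetric] by(intro mult_left_mono q_le cR q_0 F)
		finally have "?a * ?a <= (m * q F) * ?a" by(simp add: algebra_simps)
		thus ?thesis using n2_0[OF cR] q_0[OF F] lam by(cases "?a = 0") (auto simp: mult_le_cancel_right)
	qed
	have "EX F. cont F & n2 F <= 1 & m - 1 / real (Suc n) < q F" for n
	proof -
		have Sne: "S ~= {}"
		proof -
			have "n2 (%x. 0) = 0" unfolding n2_def using I_cmult[OF Cc_zero, of 0] by simp
			thus ?thesis using S_mem[of "%x. 0"] by auto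
		qed
		have "m - 1 / real (Suc n) < Sup S" unfolding m_def by simp
		then obtain s where "s : S" "m - 1 / real (Suc n) < s" by(rule less_cSupE[OF _ Sne])
		thus ?thesis unfolding S_def by blast
	qed
	then obtain F where F: "!!n. cont (F n)" "!!n. n2 (F n) <= 1" "!!n. m - 1 / real (Suc n) < q (F n)" by metis
	define R where "R n = Rop k (F n)" for n
	have Rc: "cont (R n)" for n unfolding R_def by(intro Rop_cont k F)
	define B1 where "B1 = 1 * d * sqrt I1"
	have B1: "0 <= B1" using d0 I1_nonneg by(simp add: B1_def)
	have cb: "abs (cconv k (F n) y) <= B1" if "y : carrier L" for n y
		unfolding B1_def by(rule conv_l2_bound(2)[OF k d(2) F(1) _ _ that d0]) (use F(2) in "simp_all add: n2_def")
	have Rb: "abs (R n y) <= B1 * d * I1" if "y : carrier L" for n y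
		unfolding R_def Rop_def by(rule conv_bound(1)[OF k conv_cont(2)[OF k F(1)] d(2) cb B1 that])
	obtain U :: "nat filter" where U: "ultra U" "U <= sequentially" using ultra_nat by blast
	have Ub: "U ~= bot" using U(1) by(simp add: ultra_def)
	have "EX l. ((%n. R n y) \<longlongrightarrow> l) U" if y: "y : carrier L" for y
	proof -
		have "eventually (%n. - (B1 * d * I1) <= R n y & R n y <= B1 * d * I1) U"
			by(rule always_eventually) (use Rb[OF y] in "simp add: abs_le_iff minus_le_iff")
		from ultra_real[OF U(1) this] show ?thesis by blast
	qed
	then obtain G where G: "!!y. y : carrier L ==> ((%n. R n y) \<longlongrightarrow> G y) U" by metis
	define c1 where "c1 = B1 * I1"
	have c1: "0 <= c1" using B1 I1_nonneg by(simp add: c1_def)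
	have cI: "I (%x. abs (cconv k (F n) x)) <= c1" for n
	proof -
		have "abs (I (%x. abs (cconv k (F n) x))) <= B1 * I1"
			by(rule I_bound) (auto intro!: continuous_map_real_abs conv_cont k F cb)
		thus ?thesis by(simp add: c1_def)
	qed
	have equi: "EX W. nb W & (ALL n. ALL y:carrier L. ALL w:W. abs (R n (y**w) - R n y) <= e) & (ALL y:carrier L. ALL w:W. abs (G (y**w) - G y) <= e)"
		if e: "e > 0" for e
	proof -
		define e' where "e' = e / (c1 + 1)"
		have e': "e' > 0" "c1 * e' <= e" using c1 e by(auto simp: e'_def field_simps)
		obtain W where W: "nb W"
			"!!G c w y. cont G ==> 0 <= c ==> I (%x. abs (G x)) <= c ==> w : W ==> y : carrier L ==> abs (conv k G (y**w) - conv k G y) <= c * e'"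
			using conv_equicont[OF k e'(1)] by metis
		have r: "abs (R n (y**w) - R n y) <= e" if "w : W" "y : carrier L" for n w y
			unfolding R_def Rop_def
			by(rule order_trans[OF W(2)[OF conv_cont(2)[OF k F(1)] c1 cI that] e'(2)])
		have g: "abs (G (y**w) - G y) <= e" if w: "w : W" and y: "y : carrier L" for w y
		proof(rule tendsto_upperbound[OF _ _ Ub])
			show "((%n. abs (R n (y**w) - R n y)) \<longlongrightarrow> abs (G (y**w) - G y)) U"
				using y nbD(3)[OF W(1) w] by(intro tendsto_intros G) auto
			show "eventually (%n. abs (R n (y**w) - R n y) <= e) U"
				by(rule always_eventually) (use r[OF w y] in blast)
		qed
		show ?thesis by(intro exI[of _ W] conjI allI ballI W(1) r g)
	qed
	have Gc: "cont G"
	proof(rule continuous_of_unif)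
		fix e :: real assume e: "e > 0"
		obtain W where W: "nb W" "ALL y:carrier L. ALL w:W. abs (G (y**w) - G y) <= e / 2" using equi[OF half_gt_zero[OF e]] by(elim exE conjE)
		have "abs (G (y**w) - G y) < e" if "y : carrier L" "w : W" for y w
		proof -
			have "abs (G (y**w) - G y) <= e / 2" using W(2) that by blast
			thus ?thesis using e by linarith
		qed
		thus "EX W. nb W & (ALL x:carrier L. ALL w:W. abs (G (x**w) - G x) < e)"
			by(intro exI[of _ W] conjI ballI W(1))
	qed
	have unif: "eventually (%n. ALL y:carrier L. abs (R n y - G y) <= e) U" if e: "e > 0" for e
	proof -
		have e3: "e / 3 > 0" using e by simp
		obtain W where W: "nb W" "ALL n. ALL y:carrier L. ALL w:W. abs (R n (y**w) - R n y) <= e / 3"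
			"ALL y:carrier L. ALL w:W. abs (G (y**w) - G y) <= e / 3" using equi[OF e3] by(elim exE conjE)
		obtain A where A: "finite A" "A <= carrier L" "ALL y:carrier L. EX a:A. inv a**y : W"
			using finite_net[OF W(1)] by(elim exE conjE)
		have "eventually (%n. ALL a:A. abs (R n a - G a) < e / 3) U"
		proof(rule eventually_ball_finite[OF A(1)], rule ballI)
			fix a assume "a : A"
			hence "((%n. R n a) \<longlongrightarrow> G a) U" using G A(2) by blast
			from tendstoD[OF this e3] show "eventually (%n. abs (R n a - G a) < e / 3) U" by(simp add: dist_real_def)
		qed
		thus ?thesis
		proof eventually_elim
			case (elim n)
			show ?case
			proof
				fix y assume y: "y : carrier L"
				obtain a where a: "a : A" "inv a**y : W" using A(3)[THEN bspec, OF y] by(elim bexE)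
				have aL: "a : carrier L" using a A(2) by blast
				note w = a(2)
				have eq: "a**(inv a**y) = y" using aL y by(simp add: inv_cancel)
				have "abs (R n (a**(inv a**y)) - R n a) <= e / 3" "abs (G (a**(inv a**y)) - G a) <= e / 3"
					by(rule W(2)[THEN spec, THEN bspec, THEN bspec, OF aL w], rule W(3)[THEN bspec, THEN bspec, OF aL w])
				moreover have "abs (R n a - G a) < e / 3" using elim a(1) by blast
				ultimately show "abs (R n y - G y) <= e" unfolding eq by linarith
			qed
		qed
	qed
	have evn: "eventually (%n. 1 / real (Suc n) < e) U" if "e > 0" for e
	proof -
		have "eventually (%n. 1 / real (Suc n) < e) sequentially"
			using LIMSEQ_Suc[OF lim_1_over_n] that by(intro order_tendstoD(2)[of _ 0]) auto
		thus ?thesis using U(2) by(rule filter_leD[rotated])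
	qed
	\<comment> \<open>With \<open>q = q (F n)\<close>, the expanded square is at most
	  \<open>m q - 2 m q + m^2 = m (m - q)\<close>, and \<open>F n\<close> nearly attains the
	  supremum.\<close>
	have Dn: "n2 (%x. R n x - m * F n x) <= m * (1 / real (Suc n))" for n
	proof -
		note c = continuous_map_real_mult[OF Rc Rc, of n n, THEN cont_Cc] continuous_map_real_mult[OF F(1) Rc, of n n, THEN cont_Cc]
			continuous_map_real_mult[OF F(1) F(1), of n n, THEN cont_Cc]
		have "n2 (%x. R n x - m * F n x) = I (%x. (R n x * R n x - (2 * m) * (F n x * R n x)) + (m * m) * (F n x * F n x))"
			unfolding n2_def by(rule arg_cong[of _ _ I]) (auto simp: algebra_simps)
		also have "... = n2 (R n) - 2 * m * q (F n) + m * m * n2 (F n)"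
			unfolding q_ip[OF F(1)] R_def[symmetric] n2_def
			by(simp add: I_add[OF Cc_diff[OF c(1) Cc_cmult[OF c(2)]] Cc_cmult[OF c(3)]] I_diff[OF c(1) Cc_cmult[OF c(2)]] I_cmult[OF c(2)] I_cmult[OF c(3)])
		also have "... <= m * q (F n) - 2 * m * q (F n) + m * m * 1"
			using R_q[OF F(1), of n] F(2)[of n] lam by(intro add_mono diff_right_mono mult_left_mono) (auto simp: R_def)
		also have "... = m * (m - q (F n))" by(simp add: algebra_simps)
		also have "... <= m * (1 / real (Suc n))" using F(3)[of n] lam by(intro mult_left_mono) auto
		finally show ?thesis .
	qed
	have eig: "Rop k G y = m * G y" if y: "y : carrier L" for y
	proof -
		have l1: "((%n. Rop k (R n) y) \<longlongrightarrow> Rop k G y) U"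
		proof(rule tendstoI)
			fix e :: real assume e: "e > 0"
			define M where "M = d * I1 * d * I1"
			have M: "0 <= M" using d0 I1_nonneg by(simp add: M_def)
			have "e / (2 * (M + 1)) > 0" using e M by simp
			from unif[OF this] show "eventually (%n. dist (Rop k (R n) y) (Rop k G y) < e) U"
			proof eventually_elim
				case (elim n)
				have "abs (Rop k (%x. R n x - G x) y) <= e / (2 * (M + 1)) * d * I1 * d * I1"
					using elim e M by(intro Rop_bound k continuous_map_diff Rc Gc d(2) d0 y) auto
				also have "... = e * (M / (2 * (M + 1)))" by(simp add: M_def)
				also have "... < e * 1" using e M by(intro mult_strict_left_mono) (auto simp: field_simps)
				finally show ?case unfolding Rop_diff[OF k Rc Gc y] by(simp add: dist_real_def)
			qed
		qed
		have l2: "((%n. Rop k (%x. R n x - m * F n x) y) \<longlongrightarrow> 0) U"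
		proof(rule tendstoI)
			fix e :: real assume e: "e > 0"
			define M where "M = d * sqrt I1 * d * I1"
			have M: "0 <= M" using d0 I1_nonneg by(simp add: M_def)
			define c where "c = e / (2 * (M + 1))"
			have c: "c > 0" using e M by(simp add: c_def)
			have "c * c / m > 0" using c lam by simp
			from evn[OF this] show "eventually (%n. dist (Rop k (%x. R n x - m * F n x) y) 0 < e) U"
			proof eventually_elim
				case (elim n)
				have "n2 (%x. R n x - m * F n x) <= c * c"
					using Dn[of n] mult_strict_left_mono[OF elim lam] lam by simp
				hence "abs (Rop k (%x. R n x - m * F n x) y) <= c * d * sqrt I1 * d * I1"
					using c by(intro Rop_l2_bound k continuous_map_diff cont_cmult Rc F d(2) d0 y) (auto simp: n2_def)
				also have "... = e * (M / (2 * (M + 1)))" by(simp add: M_def c_def)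
				also have "... < e * 1" using e M by(intro mult_strict_left_mono) (auto simp: field_simps)
				finally show ?case by(simp add: dist_real_def)
			qed
		qed
		have "((%n. Rop k (R n) y - Rop k (%x. R n x - m * F n x) y) \<longlongrightarrow> Rop k G y - 0) U"
			by(intro tendsto_diff l1 l2)
		moreover have "Rop k (R n) y - Rop k (%x. R n x - m * F n x) y = m * R n y" for n
			unfolding Rop_diff[OF k Rc cont_cmult[OF F(1)] y] Rop_cmult[OF k F(1) y] by(simp add: R_def)
		ultimately have "((%n. m * R n y) \<longlongrightarrow> Rop k G y) U" by simp
		moreover have "((%n. m * R n y) \<longlongrightarrow> m * G y) U" by(intro tendsto_intros G y)
		ultimately show ?thesis using tendsto_unique[OF Ub] by blast
	qed
	have "EX b:carrier L. G b ~= 0"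
	proof(rule ccontr)
		assume "~ ?thesis"
		hence G0: "G y = 0" if "y : carrier L" for y using that by blast
		\<comment> \<open>If \<open>G\<close> vanished, some \<open>R n\<close> would be uniformly at most
		  \<open>e\<close>, and then \<open>q (F n)^2 \<le> e^2 I1 \<le> (m / 2)^2\<close>, although
		  \<open>q (F n) > m / 2\<close>.\<close>
		define e where "e = m / (2 * (I1 + 1))"
		have e: "e > 0" using lam I1_nonneg by(simp add: e_def)
		have "eventually (%n. (ALL y:carrier L. abs (R n y - G y) <= e) & 1 / real (Suc n) < m / 2) U"
			using unif[OF e] evn[of "m / 2"] lam by(intro eventually_conj) auto
		then obtain n where n: "ALL y:carrier L. abs (R n y - G y) <= e" "1 / real (Suc n) < m / 2"
			using ultra_ex[OF U(1)] by blast
		have q2: "q (F n) > m / 2" using F(3)[of n] n(2) by linarith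
		have "n2 (R n) <= e * e * I1"
		proof -
			have "abs (I (%x. R n x * R n x)) <= e * e * I1" using n(1) G0 e by(intro I_bound_prod Rc) auto
			thus ?thesis by(simp add: n2_def)
		qed
		have "q (F n) * q (F n) <= n2 (F n) * n2 (R n)"
			unfolding q_ip[OF F(1)] R_def[symmetric] n2_def by(rule cauchy_schwarz[OF F(1) Rc])
		also have "... <= 1 * (e * e * I1)" by(intro mult_mono F(2) `n2 (R n) <= _` n2_0 Rc) simp
		also have "... <= (m / 2) * (m / 2)"
		proof -
			have "I1 + 1 ~= 0" using I1_nonneg by linarith
			hence "e * (I1 + 1) = m / 2" unfolding e_def times_divide_eq_left by(rule nonzero_mult_divide_mult_cancel_right)
			hence "(m / 2) * (m / 2) = (e * (I1 + 1)) * (e * (I1 + 1))" by(simp only:)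
			hence "(m / 2) * (m / 2) = e * e * ((I1 + 1) * (I1 + 1))" by(simp only: mult_ac)
			moreover have "I1 <= (I1 + 1) * (I1 + 1)" using I1_nonneg by(simp add: algebra_simps)
			ultimately show ?thesis using e by(simp add: mult_left_mono)
		qed
		also have "... < q (F n) * q (F n)" using q2 lam by(intro mult_strict_mono) auto
		finally show False by simp
	qed
	then obtain b where "b : carrier L" "G b ~= 0" by blast
	thus ?thesis using that[OF lam Gc _ _ eig] by blast
qed

end

lemma lch_grp_subgroup:
	assumes "lch_grp L X" and H: "subgroup H L" and cl: "closedin X H"
	shows "lch_grp (L\<lparr>carrier := H\<rparr>) (subtopology X H)"
proof -
	interpret lch_grp L X by fact
	have HL: "H <= carrier L" using H by(rule subgroup.subset)
	let ?M = "L\<lparr>carrier := H\<rparr>" and ?X = "subtopology X H"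
	have gM: "group ?M" by(rule subgroup_imp_group[OF H])
	have topM: "topspace ?X = H" using HL topspace by auto
	have mH: "x **\<^bsub>L\<^esub> y : H" if "x : H" "y : H" for x y using subgroup.m_closed[OF H that] .
	have "lch_group ?M ?X"
		unfolding lch_group_def topological_group_def
	proof(intro conjI gM)
		show "topspace ?X = carrier ?M" by(simp only: topM) simp
		have "continuous_map (prod_topology ?X ?X) X (%(x, y). x **\<^bsub>L\<^esub> y)"
			unfolding subtopology_Times[symmetric] by(rule continuous_map_from_subtopology[OF continuous_mult])
		hence "continuous_map (prod_topology ?X ?X) ?X (%(x, y). x **\<^bsub>L\<^esub> y)"
			unfolding continuous_map_in_subtopology using mH topM by(auto simp: image_subset_iff)
		thus "continuous_map (prod_topology ?X ?X) ?X (%(x, y). x **\<^bsub>?M\<^esub> y)" by simp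
		have "continuous_map ?X X (%x. inv\<^bsub>L\<^esub> x)" by(rule continuous_map_from_subtopology[OF continuous_inv])
		hence "continuous_map ?X ?X (%x. inv\<^bsub>L\<^esub> x)"
			unfolding continuous_map_in_subtopology using subgroup.m_inv_closed[OF H] topM by(auto simp: image_subset_iff)
		thus "continuous_map ?X ?X (%x. inv\<^bsub>?M\<^esub> x)"
			by(rule continuous_map_eq) (simp only: topM m_inv_consistent[OF H])
		show "locally_compact_space ?X" by(rule locally_compact_space_closed_subset[OF locally_compact cl])
		show "Hausdorff_space ?X" by(rule Hausdorff_space_subtopology[OF Hausdorff])
	qed
	thus ?thesis using gM by(simp add: lch_grp_def lch_grp_axioms_def)
qed

section \<open>Stabilisers of translation invariant function spaces\<close>

context compact_grp
begin

text \<open>What is retained of a finite-dimensional invariant space of functions is the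
  equicontinuity of its unit ball: one neighbourhood \<open>W\<close> serves all functions, with
  half of the supremum bound as error.\<close>

definition eqc_space :: "('a => real) set => 'a set => bool" where
	"eqc_space E W \<longleftrightarrow> nb W & (ALL F:E. cont F) & (ALL F:E. ALL a:carrier L. (%x. F (a**x)) : E) &
		 (ALL F:E. ALL G:E. (%x. F x - G x) : E) &
		 (ALL F:E. ALL c>=0. (ALL x:carrier L. abs (F x) <= c) --> (ALL w:W. ALL x:carrier L. abs (F (w**x) - F x) <= c / 2))"

lemma eqc_spaceD:
	assumes "eqc_space E W"
	shows "nb W" "F : E ==> cont F" "F : E ==> a : carrier L ==> (%x. F (a**x)) : E"
		"F : E ==> G : E ==> (%x. F x - G x) : E"
		"F : E ==> 0 <= c ==> (!!x. x : carrier L ==> abs (F x) <= c) ==> w : W ==> x : carrier L ==> abs (F (w**x) - F x) <= c / 2"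
	using assms unfolding eqc_space_def by simp_all

lemma closedin_carrier_INT:
	assumes "!!i. i : A ==> closedin X (f i)"
	shows "closedin X (carrier L Int (INT i:A. f i))"
proof -
	have "closedin X (\<Inter> (insert (carrier L) (f ` A)))"
		using assms closedin_topspace[of X] by(intro closedin_Inter) (auto simp: topspace)
	thus ?thesis by simp
qed

definition stab :: "('a => real) set => 'a set" where
	"stab E = {a : carrier L. ALL F:E. ALL x:carrier L. F (a**x) = F x}"

lemma Rop_translate:
	assumes k: "cont k" and F: "cont F" and a: "a : carrier L" and y: "y : carrier L"
	shows "Rop k (%x. F (a**x)) y = Rop k F (a**y)"
proof -
	have 1: "cconv k (%x. F (a**x)) x = cconv k F (a**x)" if x: "x : carrier L" for x
	proof -
		have ax: "a**x : carrier L" using a x by simp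
		have "cconv k F (a**x) = I (%y. F (a**y) * k (inv (a**x)**(a**y)))"
			unfolding cconv_def using I_trans[OF cont_Cc[OF cconv_cont_in[OF k F ax]] a] by simp
		also have "... = cconv k (%x. F (a**x)) x"
			unfolding cconv_def
			by(rule I_cong[symmetric, OF cont_Cc[OF cconv_cont_in[OF k cont_translate[OF F a] x]]])
				(use a x in "simp add: inv_mult_cancel")
		finally show ?thesis by simp
	qed
	have 2: "conv k (%x. G (a**x)) y = conv k G (a**y)" if G: "cont G" for G
	proof -
		have ay: "a**y : carrier L" using a y by simp
		have "conv k G (a**y) = I (%x. G (a**x) * k (inv (a**x)**(a**y)))"
			unfolding conv_def using I_trans[OF cont_Cc[OF conv_cont_in[OF k G ay]] a] by simp
		also have "... = conv k (%x. G (a**x)) y"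
			unfolding conv_def
			by(rule I_cong[symmetric, OF cont_Cc[OF conv_cont_in[OF k cont_translate[OF G a] y]]])
				(use a y in "simp add: inv_mult_cancel")
		finally show ?thesis by simp
	qed
	have "Rop k (%x. F (a**x)) y = conv k (%x. cconv k F (a**x)) y"
		unfolding Rop_def by(rule conv_cong[OF k conv_cont(2)[OF k cont_translate[OF F a]] y 1])
	also have "... = Rop k F (a**y)" unfolding Rop_def by(rule 2[OF conv_cont(2)[OF k F]])
	finally show ?thesis .
qed

lemma stab_subgroup:
	assumes "eqc_space E W"
	shows "subgroup (stab E) L" "closedin X (stab E)"
		"!!a g. a : stab E ==> g : carrier L ==> g**a**inv g : stab E"
proof -
	note tr = eqc_spaceD(3)[OF assms] and co = eqc_spaceD(2)[OF assms]
	have sD: "a : carrier L" "!!F x. F : E ==> x : carrier L ==> F (a**x) = F x" if "a : stab E" for a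
		using that unfolding stab_def by auto
	show "subgroup (stab E) L"
	proof(rule subgroupI)
		show "stab E <= carrier L" by(auto simp: stab_def)
		have "\<one> : stab E" by(simp add: stab_def)
		thus "stab E ~= {}" by blast
		fix a assume a: "a : stab E"
		have "F (inv a**x) = F x" if F: "F : E" and x: "x : carrier L" for F x
		proof -
			have "F (a**(inv a**x)) = F (inv a**x)" using sD[OF a] F x by simp
			thus ?thesis using sD(1)[OF a] x by(simp add: inv_cancel)
		qed
		thus "inv a : stab E" using sD(1)[OF a] by(simp add: stab_def)
		fix b assume b: "b : stab E"
		have "F (a**b**x) = F x" if F: "F : E" and x: "x : carrier L" for F x
			using sD(1)[OF a] sD(1)[OF b] sD(2)[OF a F, of "b**x"] sD(2)[OF b F x] x by(simp add: m_assoc)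
		thus "a**b : stab E" using sD(1)[OF a] sD(1)[OF b] by(simp add: stab_def)
	qed
	have "stab E = carrier L Int (INT F:E. INT x:carrier L. {a : topspace X. F (a**x) = F x})"
		by(auto simp: stab_def topspace)
	moreover have "closedin X (carrier L Int (INT F:E. INT x:carrier L. {a : topspace X. F (a**x) = F x}))"
	proof(rule closedin_carrier_INT, rule closedin_INT)
		show "carrier L ~= {}" using one_closed by blast
		fix F x assume F: "F : E" and x: "x : carrier L"
		have "cont (%a. F (a**x))"
			using continuous_map_compose[OF continuous_mult'[OF continuous_ident continuous_const[OF x]] co[OF F]]
			by(simp add: comp_def)
		from closedin_continuous_map_preimage[OF this, of "{F x}"]
		show "closedin X {a : topspace X. F (a**x) = F x}" by simp
	qed
	ultimately show "closedin X (stab E)" by simp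
	fix a g assume a: "a : stab E" and g: "g : carrier L"
	have "F (g**a**inv g**x) = F x" if F: "F : E" and x: "x : carrier L" for F x
	proof -
		have "F (g**(a**(inv g**x))) = F (g**(inv g**x))"
			using sD(2)[OF a tr[OF F g], of "inv g**x"] g x by simp
		thus ?thesis using sD(1)[OF a] g x by(simp add: m_assoc inv_cancel)
	qed
	thus "g**a**inv g : stab E" using g sD(1)[OF a] by(simp add: stab_def)
qed

text \<open>The kernel \<open>k z = f z - f (z**h)\<close> is a difference along \<open>h\<close>,
  and so is every function in the image of the operator, in particular an eigenfunction:
  \<open>G y = w y - w (y**h)\<close> with \<open>w\<close> bounded. If \<open>h\<close> stabilised
  the eigenspace, normality of the stabiliser would make \<open>G\<close> constant along
  \<open>b**h [^] n\<close>, and summation would bound \<open>n * G b\<close> independently of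
  \<open>n\<close>.\<close>

lemma separating_eqc_space:
	assumes h: "h : carrier L" "h ~= \<one>"
	obtains E W where "eqc_space E W" "h ~: stab E"
proof -
	have "EX V. nb V & h ~: V"
	proof -
		have "\<one> : topspace X" "h : topspace X" using h by(simp_all add: topspace)
		then obtain U V where "openin X U" "openin X V" "\<one> : U" "h : V" "disjnt U V"
			using Hausdorff h(2) unfolding Hausdorff_space_def by metis
		thus ?thesis by(intro exI[of _ U]) (auto simp: nb_def disjnt_iff)
	qed
	then obtain V where V: "nb V" "h ~: V" by blast
	obtain f where f: "f : Cpp" "f \<one> = 1" "!!x. x : carrier L ==> f x <= 1" "!!x. x : carrier L ==> f x ~= 0 ==> x : V"
		using bump_Cpp[OF V(1)] by blast
	have fh: "f h = 0" using f(4)[OF h(1)] V(2) by blast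
	have fc: "cont f" using CcD[OF Cp_Cc[OF Cpp_Cp[OF f(1)]]] .
	define k where "k z = f z - f (z**h)" for z
	have fhc: "cont (%z. f (z**h))"
		using continuous_map_compose[OF continuous_mult'[OF continuous_ident continuous_const[OF h(1)]] fc]
		by(simp add: comp_def)
	have kc: "cont k" unfolding k_def[abs_def] by(intro continuous_map_diff fc fhc)
	have k1: "k \<one> ~= 0" using fh f(2) h by(simp add: k_def)
	obtain m G b where mu: "m > 0" and G: "cont G" "b : carrier L" "G b ~= 0"
		"!!y. y : carrier L ==> Rop k G y = m * G y"
		using eigenfunction[OF kc one_closed k1] by metis
	define E where "E = {F. cont F & (ALL y:carrier L. Rop k F y = m * F y)}"
	have ED: "cont F" "!!y. y : carrier L ==> Rop k F y = m * F y" if "F : E" for F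
		using that unfolding E_def by auto
	obtain d where d: "d > 0" "!!x. x : carrier L ==> abs (k x) <= d" using cont_bounded[OF kc] by blast
	\<comment> \<open>If \<open>F\<close> is bounded by \<open>c\<close>, then \<open>cconv k F\<close>
	  has integral norm at most \<open>c * d * I1 * I1\<close>; this \<open>e\<close> makes the
	  variation of \<open>m * F\<close> at most \<open>m * c / 2\<close>.\<close>
	define e where "e = m / (2 * (d * I1 * I1 + 1))"
	have dI: "0 <= d * I1 * I1" using d(1) I1_nonneg by simp
	have e: "e > 0" using mu dI by(simp add: e_def)
	obtain W where W: "nb W"
		"!!G c w y. cont G ==> 0 <= c ==> I (%x. abs (G x)) <= c ==> w : W ==> y : carrier L ==> abs (conv k G (w**y) - conv k G y) <= c * e"
		using conv_equicont[OF kc e] by metis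
	have "eqc_space E W"
		unfolding eqc_space_def
	proof(intro conjI ballI allI impI)
		show "nb W" by(rule W(1))
		show "cont F" if "F : E" for F using ED(1)[OF that] .
		show "(%x. F (a**x)) : E" if F: "F : E" and a: "a : carrier L" for F a
			unfolding E_def using cont_translate[OF ED(1)[OF F] a] Rop_translate[OF kc ED(1)[OF F] a] ED(2)[OF F] a by simp
		show "(%x. F x - G x) : E" if F: "F : E" and G: "G : E" for F G
			unfolding E_def using continuous_map_diff[OF ED(1)[OF F] ED(1)[OF G]] Rop_diff[OF kc ED(1)[OF F] ED(1)[OF G]]
				ED(2)[OF F] ED(2)[OF G] by(simp add: right_diff_distrib)
	next
		fix F and c :: real and w x
		assume F: "F : E" and c: "0 <= c" and Fc: "ALL x:carrier L. abs (F x) <= c" and w: "w : W" and x: "x : carrier L"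
		have wL: "w : carrier L" using nbD(3)[OF W(1) w] .
		have Fc': "abs (F x) <= c" if "x : carrier L" for x using Fc that by blast
		have cv: "abs (cconv k F x) <= c * d * I1" if "x : carrier L" for x
			by(rule conv_bound(2)[OF kc ED(1)[OF F] d(2) Fc' c that])
		have "abs (I (%x. abs (cconv k F x))) <= c * d * I1 * I1"
			by(rule I_bound) (auto intro!: continuous_map_real_abs conv_cont kc ED(1)[OF F] cv)
		hence "abs (conv k (cconv k F) (w**x) - conv k (cconv k F) x) <= (c * d * I1 * I1) * e"
			using c d(1) I1_nonneg by(intro W(2) conv_cont kc ED(1)[OF F] w x) auto
		hence "abs (m * F (w**x) - m * F x) <= (c * d * I1 * I1) * e"
			using ED(2)[OF F] wL x unfolding Rop_def by simp
		also have "... = m * (c * ((d * I1 * I1) / (2 * (d * I1 * I1 + 1))))" by(simp add: e_def)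
		also have "... <= m * (c * (1 / 2))"
			using mu c dI by(intro mult_left_mono) (auto simp: field_simps)
		finally have "m * abs (F (w**x) - F x) <= m * (c / 2)"
			using mu by(simp add: right_diff_distrib[symmetric] abs_mult)
		thus "abs (F (w**x) - F x) <= c / 2" using mu by simp
	qed
	moreover have "h ~: stab E"
	proof
		assume hs: "h : stab E"
		have GE: "G : E" unfolding E_def using G by blast
		define w where "w y = (1 / m) * I (%x. cconv k G x * f (inv x**y))" for y
		have wc: "cont (%x. cconv k G x * f (inv x**y))" if "y : carrier L" for y
			by(intro continuous_map_real_mult conv_cont kc G cont_translate_inv fc that)
		have Gw: "G y = w y - w (y**h)" if y: "y : carrier L" for y
		proof -
			have yh: "y**h : carrier L" using y h by simp
			have "m * G y = conv k (cconv k G) y" using G(4)[OF y] by(simp add: Rop_def)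
			also have "... = I (%x. cconv k G x * f (inv x**y) - cconv k G x * f (inv x**(y**h)))"
				unfolding conv_def
				by(rule I_cong[OF cont_Cc[OF conv_cont_in[OF kc conv_cont(2)[OF kc G(1)] y]]])
					(use y h in "simp add: k_def m_assoc right_diff_distrib")
			also have "... = I (%x. cconv k G x * f (inv x**y)) - I (%x. cconv k G x * f (inv x**(y**h)))"
				by(rule I_diff[OF cont_Cc[OF wc[OF y]] cont_Cc[OF wc[OF yh]]])
			also have "... = m * (w y - w (y**h))" using mu by(simp add: w_def right_diff_distrib)
			finally show ?thesis using mu by simp
		qed
		have inv: "G (y**h [^] (n::nat)) = G y" if y: "y : carrier L" for y n
		proof(induction n)
			case (Suc n)
			let ?z = "y**h [^] n"
			have z: "?z : carrier L" using y h by simp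
			have "y**h [^] Suc n = (?z**h**inv ?z)**?z" using y h by(simp add: m_assoc)
			also have "G ... = G ?z"
				using stab_subgroup(3)[OF `eqc_space E W` hs z] GE z unfolding stab_def by blast
			finally show ?case using Suc by simp
		qed (use y in simp)
		obtain B where B: "B > 0" "!!x. x : carrier L ==> abs (cconv k G x) <= B" using cont_bounded[OF conv_cont(2)[OF kc G(1)]] by blast
		obtain B' where B': "B' > 0" "!!x. x : carrier L ==> abs (f x) <= B'" using cont_bounded[OF fc] by blast
		define M where "M = (1 / m) * (B * B' * I1)"
		have wb: "abs (w y) <= M" if y: "y : carrier L" for y
		proof -
			have "abs (I (%x. cconv k G x * f (inv x**y))) <= B * B' * I1"
				using B(1) y by(intro I_bound_prod conv_cont kc G cont_translate_inv fc B(2) B'(2)) auto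
			hence "(1 / m) * abs (I (%x. cconv k G x * f (inv x**y))) <= M"
				unfolding M_def using mu by(intro mult_left_mono) auto
			thus ?thesis using mu by(simp add: w_def abs_mult)
		qed
		have tele: "real n * G b = w b - w (b**h [^] n)" for n :: nat
		proof(induction n)
			case (Suc n)
			have "G (b**h [^] n) = w (b**h [^] n) - w (b**h [^] n**h)" using G(2) h by(intro Gw) simp
			hence "G b = w (b**h [^] n) - w (b**h [^] Suc n)" using inv[OF G(2)] G(2) h by(simp add: m_assoc)
			thus ?case using Suc by(simp add: algebra_simps)
		qed (use G(2) in simp)
		obtain n :: nat where n: "real n > 2 * M / abs (G b)" using reals_Archimedean2 by blast
		hence "2 * M < real n * abs (G b)" using G(3) by(simp add: field_simps)
		also have "... = abs (w b - w (b**h [^] n))" using tele[of n] by(metis abs_mult abs_of_nat)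
		also have "... <= M + M" using wb[OF G(2)] wb[of "b**h [^] n"] G(2) h by(intro order_trans[OF abs_triangle_ineq4] add_mono) auto
		finally show False by simp
	qed
	ultimately show ?thesis by(rule that)
qed

text \<open>Suppose that \<open>s\<close> moves \<open>F\<close>, and let \<open>z\<close> be a
  point where \<open>T x = F (s**x) - F x\<close> exceeds three quarters of its supremum
  \<open>c\<close> in absolute value. Every power of \<open>s\<close> lies in \<open>W\<close> times
  the stabiliser, so \<open>T\<close> changes by at most \<open>c / 2\<close> between
  \<open>z\<close> and its translates by powers of \<open>s\<close>. As \<open>3/4 > 1/2\<close>,
  the telescoping sum for \<open>F\<close> at the \<open>n\<close>th translate grows linearly in
  \<open>n\<close>, but \<open>F\<close> is bounded.\<close>

lemma no_small_sgs_mod_stab: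
	assumes E: "eqc_space E W" and S: "subgroup S L" "!!s. s : S ==> EX w:W. EX k:stab E. s = w**k"
	shows "S <= stab E"
proof
	fix s assume s: "s : S"
	have sL: "s : carrier L" using subgroup.subset[OF S(1)] s by blast
	note W = eqc_spaceD(1)[OF E]
	have "F (s**x) = F x" if F: "F : E" and x: "x : carrier L" for F x
	proof(rule ccontr)
		assume ne: "F (s**x) ~= F x"
		have tr: "(%x. F (s**x)) : E" by(rule eqc_spaceD(3)[OF E F sL])
		define T where "T x = F (s**x) - F x" for x
		have TE: "T : E" unfolding T_def[abs_def] by(rule eqc_spaceD(4)[OF E tr F])
		note Tc = eqc_spaceD(2)[OF E TE] and Fc = eqc_spaceD(2)[OF E F]
		obtain B where B: "B > 0" "!!x. x : carrier L ==> abs (F x) <= B" using cont_bounded[OF Fc] by blast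
		define c where "c = (SUP x\<in>carrier L. abs (T x))"
		have bdd: "bdd_above ((%x. abs (T x)) ` carrier L)"
		proof -
			obtain B where "!!x. x : carrier L ==> abs (T x) <= B" using cont_bounded[OF Tc] by blast
			thus ?thesis by(intro bdd_aboveI2)
		qed
		have Tle: "abs (T x) <= c" if "x : carrier L" for x unfolding c_def by(rule cSUP_upper[OF that bdd])
		have c: "c > 0" using Tle[OF x] ne by(simp add: T_def)
		have "(3 / 4) * c < c" using c by simp
		then obtain z where z: "z : carrier L" "(3 / 4) * c < abs (T z)"
			unfolding c_def using less_cSUP_iff[OF _ bdd] by blast
		have step: "abs (T (s [^] (j::nat)**z) - T z) <= c / 2" for j
		proof -
			have "s [^] j : S"
				by(induction j) (use S(1) s subgroup.m_closed subgroup.one_closed in auto)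
			then obtain w k where wk: "w : W" "k : stab E" "s [^] j = w**k" using S(2) by blast
			have kL: "k : carrier L" and Tk: "T (k**z) = T z" using wk(2) TE z(1) unfolding stab_def by blast+
			have wL: "w : carrier L" using nbD(3)[OF W wk(1)] .
			have kz: "k**z : carrier L" using kL z(1) by simp
			have "abs (T (w**(k**z)) - T (k**z)) <= c / 2"
				by(rule eqc_spaceD(5)[OF E TE _ Tle wk(1) kz]) (use c in simp)
			thus ?thesis unfolding wk(3) Tk using wL kL z(1) by(simp add: m_assoc)
		qed
		have tele: "abs ((F (s [^] n**z) - F z) - real n * T z) <= real n * (c / 2)" for n :: nat
		proof(induction n)
			case (Suc n)
			have "s [^] Suc n**z = s**(s [^] n**z)" using nat_pow_Suc2[OF sL, of n] sL z(1) by(simp add: m_assoc)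
			hence "F (s [^] Suc n**z) = F (s [^] n**z) + T (s [^] n**z)" by(simp add: T_def)
			hence "(F (s [^] Suc n**z) - F z) - real (Suc n) * T z =
				((F (s [^] n**z) - F z) - real n * T z) + (T (s [^] n**z) - T z)" by(simp add: algebra_simps)
			also have "abs (...) <= real n * (c / 2) + c / 2" by(rule order_trans[OF abs_triangle_ineq add_mono[OF Suc step]])
			finally show ?case by(simp add: algebra_simps)
		qed (use z(1) in simp)
		obtain n :: nat where n: "real n > 8 * B / c" using reals_Archimedean2 by blast
		hence n2: "real n * c > 8 * B" using c by(simp add: field_simps)

		have "real n * ((3 / 4) * c) <= real n * abs (T z)" using z(2) by(intro mult_left_mono) auto
		also have "... = abs (real n * T z)" by(simp add: abs_mult)
		also have "... <= abs (F (s [^] n**z) - F z) + real n * (c / 2)" using tele[of n] by linarith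
		also have "abs (F (s [^] n**z) - F z) <= B + B"
			using B(2)[OF z(1)] B(2)[of "s [^] n**z"] sL z(1) by(intro order_trans[OF abs_triangle_ineq4] add_mono) auto
		finally show False using n2 by(simp add: algebra_simps)
	qed
	thus "s : stab E" using sL by(simp add: stab_def)
qed

text \<open>The complement of \<open>V\<close> is compact and each of its points is omitted by some
  stabiliser; finitely many stabilisers therefore intersect inside \<open>V\<close>, and the
  matching neighbourhoods are intersected as well.\<close>

lemma compact_nss_quotient:
	assumes V: "nb V"
	obtains K W where "subgroup K L" "closedin X K" "K <= V" "nb W"
		"!!S. subgroup S L ==> (!!s. s : S ==> EX w:W. EX k:K. s = w**k) ==> S <= K"
proof -
	have "EX E W. eqc_space E W & h ~: stab E" if "h : carrier L - V" for h
		using separating_eqc_space[of h] that nbD(2)[OF V] by blast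
	then obtain E W where EW: "!!h. h : carrier L - V ==> eqc_space (E h) (W h) & h ~: stab (E h)" by metis
	have cl: "closedin X (carrier L - V)"
		unfolding topspace[symmetric] by(rule closedin_diff[OF closedin_topspace nbD(1)[OF V]])
	have cpt: "compactin X (carrier L - V)" by(rule closed_compactin[OF compact _ cl]) blast
	let ?O = "%h. carrier L - stab (E h)"
	have "EX G. finite G & G <= ?O ` (carrier L - V) & carrier L - V <= \<Union>G"
	proof(rule compactinD[OF cpt])
		show "openin X T" if T: "T : ?O ` (carrier L - V)" for T
		proof -
			obtain h where h: "h : carrier L - V" "T = ?O h" using T by(elim imageE)
			have "closedin X (stab (E h))" by(rule stab_subgroup(2)[OF conjunct1[OF EW[OF h(1)]]])
			thus ?thesis unfolding h(2) topspace[symmetric] by(rule openin_diff[OF openin_topspace])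
		qed
		show "carrier L - V <= \<Union> (?O ` (carrier L - V))"
		proof
			fix h assume h: "h : carrier L - V"
			hence "h : ?O h" using EW[OF h] by simp
			thus "h : \<Union> (?O ` (carrier L - V))" using h by(intro UN_I)
		qed
	qed
	then obtain G where F: "finite G" "G <= ?O ` (carrier L - V)" "carrier L - V <= \<Union>G" by(elim exE conjE)
	obtain A where A: "A <= carrier L - V" "finite A" "G = ?O ` A"
		using finite_subset_image[OF F(1,2)] by(elim exE conjE)
	define K where "K = carrier L Int (INT h:A. stab (E h))"
	define W' where "W' = carrier L Int (INT h:A. W h)"
	have EA: "eqc_space (E h) (W h)" if "h : A" for h by(rule conjunct1[OF EW[OF subsetD[OF A(1) that]]])
	have Ksub: "subgroup K L"
	proof(rule subgroupI)
		show "K <= carrier L" by(auto simp: K_def)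
		have sg: "subgroup (stab (E h)) L" if "h : A" for h by(rule stab_subgroup(1)[OF EA[OF that]])
		have "\<one> : K" unfolding K_def using subgroup.one_closed[OF sg] by blast
		thus "K ~= {}" by blast
		show "inv a : K" if "a : K" for a
			using that subgroup.m_inv_closed[OF sg] unfolding K_def by blast
		show "a**b : K" if "a : K" "b : K" for a b
			using that subgroup.m_closed[OF sg] unfolding K_def by blast
	qed
	have Kcl: "closedin X K"
		unfolding K_def by(rule closedin_carrier_INT[OF stab_subgroup(2)[OF EA]])
	have "nb (carrier L Int (INT h:B. W h))" if "finite B" "B <= A" for B
		using that
	proof(induction B)
		case empty thus ?case using nb_carrier by simp
	next
		case (insert h B)
		have "nb (W h)" by(rule eqc_spaceD(1)[OF EA]) (use insert in blast)
		moreover have "nb (carrier L Int (INT h:B. W h))" using insert by blast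
		ultimately have "nb (W h Int (carrier L Int (INT h:B. W h)))" by(rule nb_Int)
		moreover have "W h Int (carrier L Int (INT h:B. W h)) = carrier L Int (INT h:insert h B. W h)" by blast
		ultimately show ?case by simp
	qed
	hence Wnb: "nb W'" using A(2) by(simp add: W'_def)
	show ?thesis
	proof(rule that[OF Ksub Kcl _ Wnb])
		show "K <= V"
		proof
			fix x assume x: "x : K"
			show "x : V"
			proof(rule ccontr)
				assume "x ~: V"
				hence "x : \<Union>(?O ` A)" using x F(3) A(3) unfolding K_def by blast
				thus False using x unfolding K_def by blast
			qed
		qed
		fix S assume S: "subgroup S L" "!!s. s : S ==> EX w:W'. EX k:K. s = w**k"
		have "S <= stab (E h)" if h: "h : A" for h
		proof(rule no_small_sgs_mod_stab[OF EA[OF h] S(1)])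
			fix s assume "s : S"
			from S(2)[OF this] show "EX w:W h. EX k:stab (E h). s = w**k"
				using h unfolding W'_def K_def by blast
		qed
		thus "S <= K" using subgroup.subset[OF S(1)] unfolding K_def by blast
	qed
qed

end

section \<open>Small subgroups generate small subgroups\<close>

context lch_grp
begin

lemma haar_grp_exists: "EX I. haar_grp L X I"
	using haar_integral_exists lch_grp_axioms by(simp add: haar_grp_def haar_grp_axioms_def)

text \<open>The quotient theorem for the compact group \<open>H\<close>, transferred to
  \<open>L\<close>: the neighbourhood \<open>W\<close> of the identity in \<open>H\<close> is traded
  for an open set around \<open>K\<close> in \<open>L\<close>.\<close>

lemma subgroup_nss_quotient:
	assumes H: "subgroup H L" "compactin X H" and V: "nb V"
	obtains K O' where "subgroup K L" "compactin X K" "K <= V" "K <= H" "openin X O'" "K <= O'"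
		"!!S. subgroup S L ==> S <= H ==> S <= O' ==> S <= K"
proof -
	let ?M = "L\<lparr>carrier := H\<rparr>" and ?X = "subtopology X H"
	interpret M: lch_grp ?M ?X by(rule lch_grp_subgroup[OF lch_grp_axioms H(1) closed_of_compact[OF H(2)]])
	obtain I where I: "haar_grp ?M ?X I" using M.haar_grp_exists by blast
	interpret M: compact_grp ?M ?X I
		using I H(2) by(simp add: compact_grp_def compact_grp_axioms_def compactin_subtopology)
	have "M.nb (H Int V)"
		unfolding M.nb_def using nbD[OF V] subgroup.one_closed[OF H(1)] by(auto simp: openin_subtopology)
	then obtain K W where K: "subgroup K ?M" "closedin ?X K" "K <= H Int V" "M.nb W"
		"!!S. subgroup S ?M ==> (!!s. s : S ==> EX w:W. EX k:K. s = w **\<^bsub>?M\<^esub> k) ==> S <= K"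
		using M.compact_nss_quotient by metis
	have KL: "subgroup K L" by(rule incl_subgroup[OF H(1) K(1)])
	have Kc: "compactin X K"
	proof -
		have "closedin X K" using K(2) closed_of_compact[OF H(2)] closedin_closed_subtopology by blast
		thus ?thesis using closed_compactin[OF H(2)] K(3) by blast
	qed
	obtain W0 where W0: "openin X W0" "W = W0 Int H" using M.nbD(1)[OF K(4)] by(auto simp: openin_subtopology)
	have W01: "\<one> : W0" using M.nbD(2)[OF K(4)] W0(2) by simp
	define O' where "O' = (UN k:K. {x : carrier L. x**inv k : W0})"
	have Kcar: "k : carrier L" if "k : K" for k using that subgroup.subset[OF KL] by blast
	have Oo: "openin X O'" unfolding O'_def
		by(intro openin_Union) (auto intro: openin_translate(2)[OF W0(1)] Kcar)
	have KO: "K <= O'"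
	proof
		fix k assume k: "k : K"
		hence "k : {x : carrier L. x**inv k : W0}" using Kcar W01 by simp
		thus "k : O'" unfolding O'_def using k by blast
	qed
	have small: "S <= K" if S: "subgroup S L" "S <= H" "S <= O'" for S
	proof(rule K(5))
		show "subgroup S ?M" by(rule subgroup_incl[OF S(1) H(1) S(2)])
		fix s assume s: "s : S"
		obtain k where k: "k : K" "s : carrier L" "s**inv k : W0" using s S(3) unfolding O'_def by blast
		have "s : H" "k : H" using s S(2) k(1) K(3) by blast+
		hence "s**inv k : H" using subgroup.m_closed[OF H(1)] subgroup.m_inv_closed[OF H(1)] by blast
		hence "s**inv k : W" using k(3) W0(2) by blast
		moreover have "s = (s**inv k) **\<^bsub>?M\<^esub> k" using k(2) Kcar[OF k(1)] by(simp add: m_assoc)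
		ultimately show "EX w:W. EX k:K. s = w **\<^bsub>?M\<^esub> k" using k(1) by blast
	qed
	show ?thesis by(rule that[OF KL Kc _ _ Oo KO small]) (use K(3) in blast)+
qed

definition small_sgs :: "'a set => 'a set" where
	"small_sgs V = \<Union>{S. subgroup S L & S <= V}"

lemma small_sgs:
	assumes "nb V"
	shows "small_sgs V <= V" "\<one> : small_sgs V" "small_sgs V <= carrier L"
		"!!q. q : small_sgs V ==> inv q : small_sgs V"
		"!!q n. q : small_sgs V ==> q [^] (n::nat) : small_sgs V"
proof -
	show V: "small_sgs V <= V" by(auto simp: small_sgs_def)
	show "\<one> : small_sgs V"
		unfolding small_sgs_def using triv_subgroup nbD(2)[OF assms] by(intro UnionI[of "{\<one>}"]) auto
	show "small_sgs V <= carrier L" using V nbD(3)[OF assms] by blast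
	fix q assume "q : small_sgs V"
	then obtain S where S: "subgroup S L" "S <= V" "q : S" unfolding small_sgs_def by blast
	show "inv q : small_sgs V"
		unfolding small_sgs_def using S subgroup.m_inv_closed[OF S(1)] by blast
	have "q [^] n : S" for n :: nat
		by(induction n) (use S subgroup.m_closed[OF S(1)] subgroup.one_closed[OF S(1)] in auto)
	thus "q [^] (n::nat) : small_sgs V" for n unfolding small_sgs_def using S by blast
qed

text \<open>A sum of \<open>n\<close> first differences of \<open>f\<close>, each compared with the
  one at \<open>y\<close>. Read backwards, it bounds a single first difference by
  \<open>1 / n\<close> times the change of \<open>f\<close> along a whole power plus a second
  difference, which is how the estimate \<open>A / m\<close> is improved.\<close>

lemma telescope:
	assumes g: "g : carrier L" and y: "y : carrier L"
		and d: "!!i x. i < n ==> x : carrier L ==>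
			abs ((f (g**(g [^] i**x)) - f (g [^] i**x)) - (f (g**x) - f x)) <= (d::real)"
	shows "abs ((f (g [^] n**y) - f y) - real n * (f (g**y) - f y)) <= real n * d"
	using d
proof(induction n)
	case (Suc n)
	have IH: "abs ((f (g [^] n**y) - f y) - real n * (f (g**y) - f y)) <= real n * d"
		by(rule Suc.IH) (rule Suc.prems, simp_all)
	have eq: "g [^] Suc n**y = g**(g [^] n**y)" using nat_pow_Suc2[OF g, of n] g y by(simp add: m_assoc)
	have "(f (g [^] Suc n**y) - f y) - real (Suc n) * (f (g**y) - f y) =
		((f (g [^] n**y) - f y) - real n * (f (g**y) - f y)) +
		((f (g**(g [^] n**y)) - f (g [^] n**y)) - (f (g**y) - f y))"
		unfolding eq by(simp add: algebra_simps)
	also have "abs (...) <= real n * d + d"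
		by(rule order_trans[OF abs_triangle_ineq add_mono[OF IH Suc.prems[OF lessI y]]])
	finally show ?case by(simp add: algebra_simps)
qed (use y in simp)

lemma sprod_difference:
	assumes Q: "Q <= carrier L" and d: "!!g x. g : Q ==> x : carrier L ==> abs (f (g**x) - f x) <= (d::real)"
		and "z : sprod Q n"
	shows "z : carrier L & abs (f z - f \<one>) <= real n * d"
	using assms(3)
proof(induction n arbitrary: z)
	case (Suc n)
	then obtain g y where gy: "z = g**y" "g : Q" "y : sprod Q n" by auto
	have y: "y : carrier L" "abs (f y - f \<one>) <= real n * d" using Suc.IH[OF gy(3)] by auto
	have gL: "g : carrier L" using gy(2) Q by blast
	have "abs (f z - f \<one>) <= d + real n * d" using d[OF gy(2) y(1)] y(2) unfolding gy(1) by linarith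
	thus ?case using gL y(1) gy(1) by(simp add: algebra_simps)
qed simp

text \<open>If powers up to \<open>m\<close> of elements of \<open>Q\<close> are small, telescoping
  improves the differences of \<open>f\<close> along \<open>Q\<close> from \<open>A / m\<close> to
  \<open>2 * e / m\<close>. Then \<open>f\<close> loses less than \<open>c0\<close> along
  \<open>K * m\<close> factors, so the product still lies in the support of \<open>f\<close>. This
  works for every \<open>K\<close>; only the neighbourhood \<open>V'\<close> depends on it.\<close>

lemma power_growth:
	assumes C: "compactin X C" and V0: "nb V0" "V0 <= C0" "compactin X C0"
	shows "EX V'. nb V' & (ALL Q m. Q <= V0 --> \<one> : Q --> (ALL q:Q. inv q : Q) --> 0 < m --> sprod Q m <= C -->
		 (ALL q:Q. ALL i<=m. q [^] i : V') --> (ALL x:sprod Q (K * m). EX c:C. EX v:V0. EX v':V0. x = c**v**v'))"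
proof -
	obtain I where "haar_grp L X I" using haar_grp_exists by blast
	then interpret haar_grp L X I .
	obtain A c0 and W :: "real => 'a set" where gl: "A > 0" "c0 > 0" "!!e. e > 0 ==> nb (W e)"
		"!!Q m. Q <= V0 ==> \<one> : Q ==> (!!q. q : Q ==> inv q : Q) ==> 0 < m ==> sprod Q m <= C ==>
			EX f. gleason_function C V0 W A c0 Q m f"
		by(erule gleason[OF C V0])
	define e where "e = c0 / (2 * (real K + 1))"
	have e: "e > 0" using gl(2) by(simp add: e_def)
	have "real K * (2 * e) = c0 * (real K / (real K + 1))" by(simp add: e_def field_simps)
	also have "... < c0 * 1" using gl(2) by(intro mult_strict_left_mono) (auto simp: field_simps)
	finally have Ke: "real K * (2 * e) < c0" by simp
	show ?thesis
	proof(intro exI[of _ "W e"] conjI allI impI ballI)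
		show "nb (W e)" by(rule gl(3)[OF e])
		fix Q and m :: nat and x
		assume Q: "Q <= V0" "\<one> : Q" "ALL q:Q. inv q : Q" and m: "0 < m" and Qm: "sprod Q m <= C"
			and pw: "ALL q:Q. ALL i<=m. q [^] i : W e" and x: "x : sprod Q (K * m)"
		have QL: "Q <= carrier L" using Q(1) nbD(3)[OF V0(1)] by blast
		obtain f where ph': "c0 <= f \<one>" "ALL x:carrier L. f x ~= 0 --> (EX c:C. EX v:V0. EX v':V0. x = c**v**v')"
			"ALL e>0. ALL h:W e. ALL x:carrier L. abs (f (h**x) - f x) <= e"
			"ALL e>0. ALL h:W e. ALL g:Q. ALL x:carrier L. abs ((f (g**(h**x)) - f (h**x)) - (f (g**x) - f x)) <= e / real m"
			by(rule exE[OF gl(4)[OF Q(1,2) _ m Qm]], erule Q(3)[THEN bspec], elim conjE, rule that) assumption+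
		note ph = ph'(1) ph'(2)[THEN bspec, THEN mp] ph'(3)[THEN spec, THEN mp, OF e, THEN bspec, THEN bspec]
			ph'(4)[THEN spec, THEN mp, OF e, THEN bspec, THEN bspec, THEN bspec]
		have d: "abs (f (g**y) - f y) <= 2 * e / real m" if g: "g : Q" and y: "y : carrier L" for g y
		proof -
			have gL: "g : carrier L" using QL g by blast
			have pg: "g [^] i : W e" if "i <= m" for i using pw g that by blast
			have "abs ((f (g [^] m**y) - f y) - real m * (f (g**y) - f y)) <= real m * (e / real m)"
				by(rule telescope[OF gL y]) (rule ph(4)[OF pg g], simp_all)
			moreover have "abs (f (g [^] m**y) - f y) <= e" by(rule ph(3)[OF pg y]) simp
			ultimately have "abs (real m * (f (g**y) - f y)) <= 2 * e" using m by simp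
			hence "real m * abs (f (g**y) - f y) <= 2 * e" by(simp only: abs_mult abs_of_nat)
			thus ?thesis using m by(simp add: pos_le_divide_eq mult.commute)
		qed
		have "x : carrier L & abs (f x - f \<one>) <= real (K * m) * (2 * e / real m)"
			by(rule sprod_difference[OF QL d x])
		moreover have "real (K * m) * (2 * e / real m) = real K * (2 * e)" using m by simp
		ultimately have xL: "x : carrier L" and "abs (f x - f \<one>) <= real K * (2 * e)" by auto
		hence "f x ~= 0" using Ke ph(1) by linarith
		thus "EX c:C. EX v:V0. EX v':V0. x = c**v**v'" by(rule ph(2)[OF xL])
	qed
qed

text \<open>All powers of an element of a small subgroup lie in the same small set, so the condition
  on powers in \<open>power_growth\<close> is automatic.\<close>

lemma small_sgs_growth:
	assumes C: "compactin X C" and V0: "nb V0" "V0 <= C0" "compactin X C0"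
	shows "EX V'. nb V' & (ALL V m. nb V --> V <= V' --> 0 < m --> sprod (small_sgs V) m <= C -->
		 (ALL x:sprod (small_sgs V) (K * m). EX c:C. EX v:V0. EX v':V0. x = c**v**v'))"
proof -
	obtain V' where V': "nb V'" "ALL Q m. Q <= V0 --> \<one> : Q --> (ALL q:Q. inv q : Q) --> 0 < m --> sprod Q m <= C -->
		 (ALL q:Q. ALL i<=m. q [^] i : V') --> (ALL x:sprod Q (K * m). EX c:C. EX v:V0. EX v':V0. x = c**v**v')"
		using power_growth[OF assms, of K] by(elim exE conjE) (rule that)
	show ?thesis
	proof(intro exI[of _ "V0 Int V'"] conjI allI impI)
		show "nb (V0 Int V')" by(intro nb_Int V0 V'(1))
		fix V and m :: nat assume V: "nb V" "V <= V0 Int V'" and m: "0 < m" "sprod (small_sgs V) m <= C"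
		note Q = small_sgs[OF V(1)]
		show "ALL x:sprod (small_sgs V) (K * m). EX c:C. EX v:V0. EX v':V0. x = c**v**v'"
			by(rule V'(2)[rule_format, THEN ballI, OF _ Q(2,4) m]) (use Q(1,5) V(2) in blast)+
	qed
qed

lemma subgroup_closure:
	assumes "subgroup D L"
	shows "subgroup (X closure_of D) L"
proof(rule subgroupI)
	note D = assms
	have DX: "D <= topspace X" using subgroup.subset[OF D] by(simp add: topspace)
	show "X closure_of D <= carrier L" using closure_of_subset_topspace[of X D] by(simp add: topspace)
	show "X closure_of D ~= {}" using closure_of_subset[OF DX] subgroup.one_closed[OF D] by blast
	fix x assume x: "x : X closure_of D"
	have "(%x. inv x) ` D <= D" using subgroup.m_inv_closed[OF D] by blast
	hence "X closure_of ((%x. inv x) ` D) <= X closure_of D" by(rule closure_of_mono)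
	thus "inv x : X closure_of D" using continuous_map_image_closure_subset[OF continuous_inv, of D] x by blast
	fix y assume y: "y : X closure_of D"
	have "(%(x, y). x**y) ` (D \<times> D) <= D" using subgroup.m_closed[OF D] by auto
	hence c: "X closure_of ((%(x, y). x**y) ` (D \<times> D)) <= X closure_of D" by(rule closure_of_mono)
	have "(x, y) : prod_topology X X closure_of (D \<times> D)" unfolding closure_of_Times using x y by simp
	hence "x**y : (%(x, y). x**y) ` (prod_topology X X closure_of (D \<times> D))" by force
	thus "x**y : X closure_of D" using continuous_map_image_closure_subset[OF continuous_mult, of "D \<times> D"] c by blast
qed

text \<open>Allowing every fixed multiple \<open>K\<close> of the exponents is what makes this a
  subgroup.\<close>

definition limset :: "'i filter => ('i => 'a set) => ('i => nat) => 'a set" where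
	"limset U Q m = {l. EX K x. eventually (%i. x i : sprod (Q i) (K * m i)) U & limitin X x l U}"

lemma limsetI:
	"eventually (%i. x i : sprod (Q i) (K * m i)) U ==> limitin X x l U ==> l : limset U Q m"
	unfolding limset_def by(intro CollectI exI conjI)

lemma limset_subgroup:
	assumes ev: "eventually (%i. Q i <= carrier L & (ALL q:Q i. inv q : Q i)) U"
	shows "subgroup (limset U Q m) L"
proof(rule subgroupI)
	show "limset U Q m <= carrier L" unfolding limset_def using limit_carrier by blast
	have "\<one> : limset U Q m"
		unfolding limset_def by(intro CollectI exI[of _ "0::nat"] exI[of _ "%_. \<one>"]) (simp add: topspace)
	thus "limset U Q m ~= {}" by blast
	fix a assume "a : limset U Q m"
	then obtain K x where a: "eventually (%V. x V : sprod (Q V) (K * m V)) U" "limitin X x a U"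
		unfolding limset_def by blast
	have "eventually (%V. inv (x V) : sprod (Q V) (K * m V)) U"
		using a(1) ev
	proof eventually_elim
		case (elim V)
		show ?case by(rule sprod_inv[OF _ _ elim(1)]) (use elim(2) in blast)+
	qed
	thus "inv a : limset U Q m" by(rule limsetI[OF _ limit_inv[OF a(2)]])
	fix b assume "b : limset U Q m"
	then obtain K' y where b: "eventually (%V. y V : sprod (Q V) (K' * m V)) U" "limitin X y b U"
		unfolding limset_def by blast
	have "eventually (%V. x V**y V : sprod (Q V) ((K + K') * m V)) U"
		using a(1) b(1) ev
	proof eventually_elim
		case (elim V)
		show ?case using sprod_add[OF _ elim(1,2)] elim(3) by(simp add: add_mult_distrib)
	qed
	thus "a**b : limset U Q m" by(rule limsetI[OF _ limit_mult[OF a(2) b(2)]])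
qed

text \<open>Suppose that products of small subgroups always leave \<open>U0\<close>. Limits of
  products at the escape scale of \<open>C\<close> form a subgroup with compact closure
  \<open>H\<close>. Modulo a small \<open>K1\<close>, the group \<open>H\<close> has no small
  subgroups. So for a compact neighbourhood \<open>C1\<close> of \<open>K1\<close> that is small
  enough, the limits at the escape scale of \<open>C1\<close> fall into \<open>K1\<close>. But
  products with one factor more, chosen outside \<open>C1\<close>, also converge to such a limit,
  which lies in the interior of \<open>C1\<close>.\<close>

lemma trapping:
	assumes U0: "nb U0"
	shows "EX V. nb V & (ALL n. sprod (small_sgs V) n <= U0)"
proof(rule ccontr)
	assume non: "~ ?thesis"
	have exits: "EX n. ~ sprod (small_sgs V) n <= U0" if "nb V" for V using non that by blast
	obtain V1 C where V1: "nb V1" "V1 <= C" "compactin X C" "C <= U0" using nb_compact[OF U0] by blast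
	obtain U where U: "ultra U" "!!V. nb V ==> eventually (%W. nb W & W <= V) U" using ultra_nb by blast
	\<comment> \<open>One less than the first exponent at which \<open>D\<close> is left. For
	  \<open>V \<subseteq> D \<subseteq> C\<close> it is positive, because the first power is still
	  contained in \<open>V\<close>.\<close>
	define esc where "esc D V = (LEAST n. ~ sprod (small_sgs V) n <= D) - 1" for D V
	have esc: "sprod (small_sgs V) (esc D V) <= D" "0 < esc D V" "~ sprod (small_sgs V) (Suc (esc D V)) <= D"
		if V: "nb V" "V <= D" "D <= C" for V D
	proof -
		let ?P = "%n. ~ sprod (small_sgs V) n <= D"
		obtain n where n: "?P n" using exits[OF V(1)] V(3) V1(4) by blast
		define N where "N = (LEAST n. ?P n)"
		have N: "?P N" unfolding N_def using n by(rule LeastI)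
		have lt: "sprod (small_sgs V) j <= D" if "j < N" for j using not_less_Least[of j ?P] that unfolding N_def by blast
		have "sprod (small_sgs V) 0 <= D" using nbD(2)[OF V(1)] V(2) by auto
		hence "N ~= 0" using N by metis
		moreover have "sprod (small_sgs V) 1 <= D"
			using sprod_one[OF small_sgs(3)[OF V(1)]] small_sgs(1)[OF V(1)] V(2) by simp
		hence "N ~= 1" using N by metis
		ultimately have N2: "N = Suc (esc D V)" "0 < esc D V" unfolding esc_def N_def[symmetric] by auto
		show "0 < esc D V" by(rule N2(2))
		show "~ sprod (small_sgs V) (Suc (esc D V)) <= D" using N N2(1) by simp
		show "sprod (small_sgs V) (esc D V) <= D" by(rule lt) (simp add: N2(1))
	qed
	have evQ: "eventually (%V. small_sgs V <= carrier L & (ALL q:small_sgs V. inv q : small_sgs V)) U"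
		using U(2)[OF nb_carrier] by eventually_elim (use small_sgs(3,4) in blast)
	have growth: "limset U small_sgs (esc D) <= {c**v | c v. c : {c**v | c v. c : D & v : E} & v : E}"
		"!!K x. eventually (%V. x V : sprod (small_sgs V) (K * esc D V)) U ==>
			 EX l. limitin X x l U"
		if D: "compactin X D" "D <= C" "nb ND" "ND <= D" and E: "compactin X E" "nb NE" "NE <= E" for D E ND NE
	proof -
		let ?T = "{c**v | c v. c : {c**v | c v. c : D & v : E} & v : E}"
		have T: "compactin X ?T" by(intro compactin_mult D E)
		have evT: "eventually (%V. x V : ?T) U"
			if x: "eventually (%V. x V : sprod (small_sgs V) (K * esc D V)) U" for K x
		proof -
			obtain V' where V': "nb V'" "!!V m x. nb V ==> V <= V' ==> 0 < m ==> sprod (small_sgs V) m <= D ==>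
					x:sprod (small_sgs V) (K * m) ==> EX c:D. EX v:NE. EX v':NE. x = c**v**v'"
				using small_sgs_growth[OF D(1) E(2,3,1), of K] by(elim exE conjE) (rule that, assumption, blast)
			from U(2)[OF nb_Int[OF V'(1) D(3)]] x show ?thesis
			proof eventually_elim
				case (elim V)
				have V: "nb V" "V <= V'" "V <= D" using elim(1) D(4) by auto
				obtain c v v' where "c : D" "v : NE" "v' : NE" "x V = c**v**v'"
					using V'(2)[OF V(1,2) esc(2)[OF V(1,3) D(2)] esc(1)[OF V(1,3) D(2)] elim(2)] by blast
				thus ?case using E(3) by blast
			qed
		qed
		show "limset U small_sgs (esc D) <= ?T"
		proof
			fix l assume "l : limset U small_sgs (esc D)"
			then obtain K x where x: "eventually (%V. x V : sprod (small_sgs V) (K * esc D V)) U" "limitin X x l U"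
				unfolding limset_def by blast
			show "l : ?T" by(rule limitin_in_closed[OF x(2) closed_of_compact[OF T] U(1) evT[OF x(1)]])
		qed
		show "EX l. limitin X x l U" if x: "eventually (%V. x V : sprod (small_sgs V) (K * esc D V)) U" for K x
			by(rule ultra_compactin[OF U(1) T evT[OF x]]) blast
	qed
	have H0: "subgroup (limset U small_sgs (esc C)) L" by(rule limset_subgroup[OF evQ])
	define H where "H = X closure_of (limset U small_sgs (esc C))"
	have H: "subgroup H L" unfolding H_def by(rule subgroup_closure[OF H0])
	let ?T = "{c**v | c v. c : {c**v | c v. c : C & v : C} & v : C}"
	have T: "compactin X ?T" by(intro compactin_mult V1)
	have "H <= ?T"
		unfolding H_def by(rule closure_of_minimal[OF growth(1)[OF V1(3) order_refl V1(1,2) V1(3,1,2)] closed_of_compact[OF T]])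
	hence Hc: "compactin X H" by(intro closed_compactin[OF T]) (simp_all add: H_def)
	obtain K1 O' where K1: "subgroup K1 L" "compactin X K1" "K1 <= V1" "K1 <= H" "openin X O'" "K1 <= O'"
		"!!S. subgroup S L ==> S <= H ==> S <= O' ==> S <= K1"
		using subgroup_nss_quotient[OF H Hc V1(1)] by metis
	have op: "openin X (O' Int V1)" "K1 <= O' Int V1" using K1 nbD(1)[OF V1(1)] by auto
	obtain N where N: "nb N" "!!k w. k : K1 ==> w : N ==> k**w : O' Int V1"
		using nb_around[OF K1(2) op] by metis
	obtain N2 where N2: "nb N2" "!!x y. x : N2 ==> y : N2 ==> x**y : N" using nb_mult[OF N(1)] by metis
	obtain N3 where N3: "nb N3" "N3 <= N2" "!!x y. x : N3 ==> y : N3 ==> x**y : N2" using nb_mult[OF N2(1)] by metis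
	obtain N1 CN where N1: "nb N1" "N1 <= CN" "compactin X CN" "CN <= N3" using nb_compact[OF N3(1)] by blast
	have K1L: "k : carrier L" if "k : K1" for k using compactinD_carrier[OF K1(2) that] .
	have CNL: "k : carrier L" if "k : CN" for k using compactinD_carrier[OF N1(3) that] .
	have oneK: "\<one> : K1" using subgroup.one_closed[OF K1(1)] .
	define C1 where "C1 = {k**w | k w. k : K1 & w : CN}"
	have C1: "compactin X C1" unfolding C1_def by(rule compactin_mult[OF K1(2) N1(3)])
	define W1 where "W1 = (UN k:K1. {x : carrier L. inv k**x : N1})"
	have W1: "openin X W1" unfolding W1_def
		by(intro openin_Union) (auto intro: openin_translate(1)[OF nbD(1)[OF N1(1)]] K1L)
	have W1C1: "W1 <= C1"
	proof
		fix x assume "x : W1"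
		then obtain k where k: "k : K1" "x : carrier L" "inv k**x : N1" unfolding W1_def by blast
		have "x = k**(inv k**x)" using K1L[OF k(1)] k(2) by(simp add: inv_cancel)
		thus "x : C1" unfolding C1_def using k N1(2) by blast
	qed
	have K1W1: "K1 <= W1"
	proof
		fix k assume k: "k : K1"
		hence "k : {x : carrier L. inv k**x : N1}" using K1L nbD(2)[OF N1(1)] by simp
		thus "k : W1" unfolding W1_def using k by blast
	qed
	have C1sub: "{c**v | c v. c : {c**v | c v. c : C1 & v : CN} & v : CN} <= O' Int V1"
	proof
		fix x assume "x : {c**v | c v. c : {c**v | c v. c : C1 & v : CN} & v : CN}"
		then obtain k w v v' where x: "x = k**w**v**v'" "k : K1" "w : CN" "v : CN" "v' : CN" unfolding C1_def by blast
		have "w**v**v' : N" using x N1(4) N3 by(intro N2(2)) blast+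
		hence "k**(w**v**v') : O' Int V1" by(rule N(2)[OF x(2)])
		thus "x : O' Int V1" using x K1L CNL by(simp add: m_assoc)
	qed
	have oneCN: "\<one> : CN" using nbD(2)[OF N1(1)] N1(2) by blast
	have C1C: "C1 <= C"
	proof
		fix x assume x: "x : C1"
		hence "x = x**\<one>**\<one>" using compactinD_carrier[OF C1] by simp
		hence "x : {c**v | c v. c : {c**v | c v. c : C1 & v : CN} & v : CN}" using x oneCN by blast
		thus "x : C" using C1sub V1(2) by blast
	qed
	have N1C1: "N1 <= C1"
	proof
		fix x assume x: "x : N1"
		hence "x = \<one>**x" using nbD(3)[OF N1(1)] by simp
		thus "x : C1" unfolding C1_def using oneK x N1(2) by blast
	qed
	note gr = growth[OF C1 C1C N1(1) N1C1 N1(3,1,2)]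
	have S: "subgroup (limset U small_sgs (esc C1)) L" by(rule limset_subgroup[OF evQ])
	have evN: "eventually (%V. nb V & V <= N1) U" by(rule U(2)[OF N1(1)])
	\<comment> \<open>\<open>C1\<close> is left no later than \<open>C\<close>, so its escape scale
	  allows fewer factors and its limits already occur at the scale of \<open>C\<close>.\<close>
	have "limset U small_sgs (esc C1) <= limset U small_sgs (esc C)"
	proof
		fix l assume "l : limset U small_sgs (esc C1)"
		then obtain K x where x: "eventually (%V. x V : sprod (small_sgs V) (K * esc C1 V)) U" "limitin X x l U"
			unfolding limset_def by blast
		have "eventually (%V. x V : sprod (small_sgs V) (K * esc C V)) U"
			using x(1) evN
		proof eventually_elim
			case (elim V)
			have V: "nb V" "V <= C1" "V <= C" using elim(2) N1C1 C1C by auto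
			have "esc C1 V <= esc C V"
			proof(rule ccontr)
				assume "~ ?thesis"
				hence "Suc (esc C V) <= esc C1 V" by simp
				from sprod_mono[OF small_sgs(3,2)[OF V(1)] this]
				show False using esc(1)[OF V(1,2) C1C] esc(3)[OF V(1,3) order_refl] C1C by blast
			qed
			hence "K * esc C1 V <= K * esc C V" by simp
			from sprod_mono[OF small_sgs(3,2)[OF V(1)] this] show ?case using elim(1) by blast
		qed
		thus "l : limset U small_sgs (esc C)" by(rule limsetI[OF _ x(2)])
	qed
	hence SH: "limset U small_sgs (esc C1) <= H"
		unfolding H_def using closure_of_subset[of "limset U small_sgs (esc C)" X] subgroup.subset[OF H0] by(auto simp: topspace)
	have SO: "limset U small_sgs (esc C1) <= O'" using gr(1) C1sub by blast
	have SK: "limset U small_sgs (esc C1) <= K1" by(rule K1(7)[OF S SH SO])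
	have "EX x. nb V & V <= N1 --> x : sprod (small_sgs V) (Suc (esc C1 V)) & x ~: C1" for V
		using esc(3)[of V C1] N1C1 C1C by blast
	then obtain x where x: "!!V. nb V ==> V <= N1 ==> x V : sprod (small_sgs V) (Suc (esc C1 V)) & x V ~: C1" by metis
	have xe: "eventually (%V. x V : sprod (small_sgs V) (2 * esc C1 V)) U"
		using evN
	proof eventually_elim
		case (elim V)
		have V: "nb V" "V <= C1" using elim N1C1 by auto
		\<comment> \<open>One factor beyond the escape exponent is within twice that exponent, so
		  \<open>growth\<close> applies with \<open>K = 2\<close>.\<close>
		have "Suc (esc C1 V) <= 2 * esc C1 V" using esc(2)[OF V C1C] by simp
		from sprod_mono[OF small_sgs(3,2)[OF V(1)] this] show ?case using x elim by blast
	qed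
	obtain l where l: "limitin X x l U" using gr(2)[OF xe] by blast
	have "l : limset U small_sgs (esc C1)" by(rule limsetI[OF xe l])
	hence "l : W1" using SK K1W1 by blast
	hence "eventually (%V. x V : W1) U" by(rule limitinD[OF l W1])
	hence "eventually (%V. False) U" using evN
	proof eventually_elim
		case (elim V) thus ?case using x W1C1 by blast
	qed
	thus False using U(1) by(simp add: ultra_def)
qed

text \<open>The trapped small subgroups generate a subgroup \<open>D\<close> with compact closure
  \<open>H\<close>. All sufficiently small subgroups of \<open>L\<close> are then subgroups of
  \<open>H\<close>, where the compact case applies.\<close>

theorem nss_quotient:
	obtains K O' where "subgroup K L" "compactin X K" "openin X O'" "K <= O'"
		"!!S. subgroup S L ==> S <= O' ==> S <= K"
proof -
	obtain V1 C where V1: "nb V1" "V1 <= C" "compactin X C" by(rule nb_compact[OF nb_carrier]) (rule that; assumption)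
	obtain V where V: "nb V" "!!n. sprod (small_sgs V) n <= V1" using trapping[OF V1(1)] by(elim exE conjE) (rule that, assumption, erule spec)
	define D where "D = (\<Union>n. sprod (small_sgs V) n)"
	note Q = small_sgs[OF V(1)]
	have DV: "D <= V1" unfolding D_def using V(2) by blast
	have D: "subgroup D L"
	proof(rule subgroupI)
		show "D <= carrier L" unfolding D_def using sprod_carrier[OF Q(3)] by blast
		have "\<one> : sprod (small_sgs V) 0" by simp
		thus "D ~= {}" unfolding D_def by blast
		show "inv a : D" if "a : D" for a using that sprod_inv[OF Q(3,4)] unfolding D_def by blast
		show "a**b : D" if "a : D" "b : D" for a b using that sprod_add[OF Q(3)] unfolding D_def by blast
	qed
	define H where "H = X closure_of D"
	have H: "subgroup H L" unfolding H_def by(rule subgroup_closure[OF D])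
	have "H <= C" unfolding H_def using DV V1(2) by(intro closure_of_minimal closed_of_compact V1(3)) blast
	hence Hc: "compactin X H" by(intro closed_compactin[OF V1(3)]) (simp_all add: H_def)
	obtain K O' where K: "subgroup K L" "compactin X K" "K <= V" "K <= H" "openin X O'" "K <= O'"
		"!!S. subgroup S L ==> S <= H ==> S <= O' ==> S <= K"
		using subgroup_nss_quotient[OF H Hc V(1)] by metis
	show ?thesis
	proof(rule that[of K "O' Int V", OF K(1,2)])
		show "openin X (O' Int V)" using K(5) nbD(1)[OF V(1)] by blast
		show "K <= O' Int V" using K(3,6) by blast
		fix S assume S: "subgroup S L" "S <= O' Int V"
		have "S <= small_sgs V" unfolding small_sgs_def using S by blast
		also have "... = sprod (small_sgs V) 1" using sprod_one[OF Q(3)] by simp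
		also have "... <= D" unfolding D_def by blast
		also have "... <= H" unfolding H_def by(rule closure_of_subset) (use subgroup.subset[OF D] in "simp add: topspace")
		finally show "S <= K" using S(2) by(intro K(7)[OF S(1)]) auto
	qed
qed

end

section \<open>Reduction to groups without small subgroups\<close>

lemma (in lch_grp) lch_grp_quotient:
	assumes K: "K \<lhd> L" "compactin X K"
	obtains Y where "lch_grp (L Mod K) Y" "continuous_map X Y (%x. K #>\<^bsub>L\<^esub> x)" "open_map X Y (%x. K #>\<^bsub>L\<^esub> x)"
proof -
	interpret normal K L by fact
	let ?q = "%x. K #>\<^bsub>L\<^esub> x" and ?M = "L Mod K"
	have KL: "K <= carrier L" by(rule subset)
	define P where "P S = {x : carrier L. ?q x : S}" for S
	have car: "carrier ?M = ?q ` carrier L" by(rule carrier_FactGroup)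
	have top: "istopology (%S. S <= carrier ?M & openin X (P S))"
		unfolding istopology_def
	proof(intro conjI allI impI)
		show "openin X (P (S Int T))" if "S <= carrier ?M & openin X (P S)" "T <= carrier ?M & openin X (P T)" for S T
		proof -
			have "P (S Int T) = P S Int P T" by(auto simp: P_def)
			thus ?thesis using that by(simp add: openin_Int)
		qed
		show "openin X (P (\<Union>\<K>))" if "ALL S:\<K>. S <= carrier ?M & openin X (P S)" for \<K>
		proof -
			have "P (\<Union>\<K>) = \<Union>(P ` \<K>)" by(auto simp: P_def)
			thus ?thesis using that by(auto intro!: openin_Union)
		qed
	qed blast+
	define Y where "Y = topology (%S. S <= carrier ?M & openin X (P S))"
	have opY: "openin Y S \<longleftrightarrow> S <= carrier ?M & openin X (P S)" for S
		unfolding Y_def topology_inverse'[OF top] by(rule refl)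
	have "P (carrier ?M) = carrier L" by(auto simp: P_def car)
	hence "openin Y (carrier ?M)" using nbD(1)[OF nb_carrier] by(simp add: opY)
	hence tY: "topspace Y = carrier ?M" using opY by(intro equalityI openin_subset) (auto simp: topspace_def)
	have qc: "?q x : carrier ?M" if "x : carrier L" for x using that by(auto simp: car)
	have cont: "continuous_map X Y ?q"
		unfolding continuous_map_def by(auto simp: topspace tY qc opY P_def)
	have hom: "?q (x**y) = ?q x **\<^bsub>?M\<^esub> ?q y" if "x : carrier L" "y : carrier L" for x y
		using r_coset_hom_Mod that by(simp add: hom_def)
	have gM: "group ?M" by(rule factorgroup_is_group)
	interpret q: group_hom L ?M ?q
		by(intro group_hom.intro group_hom_axioms.intro is_group gM r_coset_hom_Mod)
	have qeq: "?q x = ?q y \<longleftrightarrow> (EX k:K. k**x = y)" if "x : carrier L" "y : carrier L" for x y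
	proof
		assume "?q x = ?q y"
		hence "y : ?q x" using rcos_self[OF that(2) is_subgroup] by simp
		thus "EX k:K. k**x = y" by(auto simp: r_coset_def)
	next
		assume "EX k:K. k**x = y"
		hence "y : ?q x" by(auto simp: r_coset_def)
		from repr_independence[OF this that(1) is_subgroup] show "?q x = ?q y" .
	qed
	have opm: "openin Y (?q ` V)" if V: "openin X V" for V
	proof -
		have VL: "V <= carrier L" using openin_subset[OF V] by(simp add: topspace)
		have "P (?q ` V) = (UN k:K. {x : carrier L. k**x : V})"
		proof(intro equalityI subsetI)
			fix x assume "x : P (?q ` V)"
			then obtain v where v: "x : carrier L" "v : V" "?q x = ?q v" unfolding P_def by blast
			then obtain k where "k : K" "k**x = v" using qeq[of x v] VL by blast
			thus "x : (UN k:K. {x : carrier L. k**x : V})" using v by blast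
		next
			fix x assume "x : (UN k:K. {x : carrier L. k**x : V})"
			then obtain k where k: "k : K" "x : carrier L" "k**x : V" by blast
			hence "?q x = ?q (k**x)" using qeq[of x "k**x"] VL by blast
			thus "x : P (?q ` V)" unfolding P_def using k by blast
		qed
		moreover have "openin X (UN k:K. {x : carrier L. k**x : V})"
			by(intro openin_Union) (use KL openin_translate(1)[OF V] in auto)
		ultimately show ?thesis unfolding opY using VL by(auto simp: car)
	qed
	have opP: "openin X (P S)" if "openin Y S" for S using that opY by blast
	have "lch_group ?M Y"
		unfolding lch_group_def topological_group_def
	proof(intro conjI gM tY)
		show "continuous_map (prod_topology Y Y) Y (%(x, y). x **\<^bsub>?M\<^esub> y)"
			unfolding continuous_map_alt
		proof(intro conjI allI impI)
			show "(%(x, y). x **\<^bsub>?M\<^esub> y) : topspace (prod_topology Y Y) \<rightarrow> topspace Y"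
				by(auto simp: tY intro!: group.subgroup_self[OF gM, THEN subgroup.m_closed] simp del: mult_FactGroup)
			fix S assume S: "openin Y S"
			let ?A = "(%(x, y). x **\<^bsub>?M\<^esub> y) -` S Int topspace (prod_topology Y Y)"
			have "EX A B. openin Y A & openin Y B & a : A & b : B & A \<times> B <= ?A" if h: "(a, b) : ?A" for a b
			proof -
				obtain x y where xy: "x : carrier L" "a = ?q x" "y : carrier L" "b = ?q y"
					using h by(auto simp: tY car)
				have xyP: "x**y : P S" using h xy hom[of x y] by(simp add: P_def)
				have "openin (prod_topology X X) {z : topspace (prod_topology X X). (%(x, y). x**y) z : P S}"
					by(rule openin_continuous_map_preimage[OF continuous_mult opP[OF S]])
				moreover have "(x, y) : {z : topspace (prod_topology X X). (%(x, y). x**y) z : P S}"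
					using xy xyP by(simp add: topspace)
				ultimately obtain A B where AB: "openin X A" "openin X B" "x : A" "y : B"
					"A \<times> B <= {z : topspace (prod_topology X X). (%(x, y). x**y) z : P S}"
					unfolding openin_prod_topology_alt by meson
				have sub: "u : carrier L & v : carrier L & ?q u **\<^bsub>?M\<^esub> ?q v : S" if "u : A" "v : B" for u v
				proof -
					have "(u, v) : A \<times> B" using that by simp
					from subsetD[OF AB(5) this] have "u : carrier L" "v : carrier L" "?q (u**v) : S" by(auto simp: P_def topspace)
					thus ?thesis using hom[of u v] by simp
				qed
				have "?q ` A \<times> ?q ` B <= ?A"
				proof
					fix z assume "z : ?q ` A \<times> ?q ` B"
					then obtain u v where z: "z = (?q u, ?q v)" "u : A" "v : B" by blast
					show "z : ?A" unfolding z(1) using sub[OF z(2,3)] by(simp add: tY qc del: mult_FactGroup)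
				qed
				thus ?thesis unfolding xy(2,4)
					by(intro exI[of _ "?q ` A"] exI[of _ "?q ` B"] conjI opm AB(1,2) imageI AB(3,4)) assumption
			qed
			thus "openin (prod_topology Y Y) ?A" unfolding openin_prod_topology_alt by blast
		qed
		have qm: "quotient_map X Y ?q"
			by(intro continuous_open_imp_quotient_map cont) (auto simp: open_map_def opm topspace tY car)
		have "continuous_map X Y (?q o (%x. inv x))" by(rule continuous_map_compose[OF continuous_inv cont])
		hence "continuous_map X Y ((%x. inv\<^bsub>?M\<^esub> x) o ?q)"
			by(rule continuous_map_eq) (simp add: topspace)
		thus "continuous_map Y Y (%x. inv\<^bsub>?M\<^esub> x)" by(rule continuous_compose_quotient_map[OF qm])
		show "locally_compact_space Y"
			by(rule locally_compact_space_continuous_open_map_image[OF cont _ _ locally_compact])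
				(auto simp: open_map_def opm topspace tY car)
		show "Hausdorff_space Y"
			unfolding Hausdorff_space_def
		proof(intro allI impI)
			fix a b assume ab: "a : topspace Y & b : topspace Y & a ~= b"
			then obtain x y where xy: "x : carrier L" "a = ?q x" "y : carrier L" "b = ?q y" by(auto simp: tY car)
			have nK: "inv k**(x**inv y) ~= \<one>" if "k : K" for k
			proof
				assume "inv k**(x**inv y) = \<one>"
				hence "(inv k**x)**inv y = \<one>" using that KL xy by(simp add: m_assoc subsetD)
				hence "inv k**x = y" using inv_equality[of "inv k**x" "inv y"] that KL xy by(auto simp: subsetD)
				thus False using qeq[of x y] xy ab that by blast
			qed
			have "x**inv y ~: K"
			proof
				assume "x**inv y : K"
				from nK[OF this] show False using xy by simp
			qed
			have op: "openin X (carrier L - {x**inv y})"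
				using openin_diff[OF nbD(1)[OF nb_carrier] closed_of_compact[of "{x**inv y}"]] xy by(simp add: topspace)
			\<comment> \<open>Compactness of \<open>K\<close> separates it from the point
			  \<open>x**inv y\<close> by a whole neighbourhood. If two cosets near those of \<open>x\<close>
			  and \<open>y\<close> coincided, that point would lie in \<open>W\<close> times
			  \<open>K\<close>.\<close>
			obtain W where W: "nb W" "!!k w. k : K ==> w : W ==> w**k : carrier L - {x**inv y}"
				by(rule nb_around[OF K(2) op]) (use KL `x**inv y ~: K` in blast, rule that, assumption, blast)
			obtain W2 where W2: "nb W2" "!!x. x : W2 ==> inv x : W2" "!!x y. x : W2 ==> y : W2 ==> x**y : W"
				using nb_mult[OF W(1)] by metis
			let ?T = "%x. {u : carrier L. u**inv x : W2}"
			have T: "openin X (?T x)" "x : ?T x" if "x : carrier L" for x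
				using openin_translate(2)[OF nbD(1)[OF W2(1)], of "inv x"] nbD(2)[OF W2(1)] that by auto
			have "?q ` ?T x Int ?q ` ?T y = {}"
			proof(rule ccontr)
				assume "?q ` ?T x Int ?q ` ?T y ~= {}"
				then obtain u v where uv: "u : carrier L" "u**inv x : W2" "v : carrier L" "v**inv y : W2" "?q u = ?q v" by blast
				obtain k where k: "k : K" "k**u = v" using qeq[OF uv(1,3)] uv(5) by blast
				have kL: "k : carrier L" using k KL by blast
				let ?d = "v**inv y"
				have "inv (u**inv x)**?d : W" by(intro W2(2,3) uv)
				hence w: "inv (u**inv x)**?d**(inv ?d**inv k**?d) : carrier L - {x**inv y}"
					using uv xy k inv_op_closed1[of "v**inv y" "inv k"] by(intro W(2)) auto
				have "inv (u**inv x)**?d**(inv ?d**inv k**?d) = inv (u**inv x)**(inv k**?d)"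
					using uv xy kL by(simp add: m_assoc inv_cancel)
				also have "... = x**inv y" using uv(1) xy kL by(simp add: k(2)[symmetric] m_assoc inv_mult_group inv_cancel)
				finally show False using w by simp
			qed
			thus "EX U V. openin Y U & openin Y V & a : U & b : V & disjnt U V"
				using opm[OF T(1)[OF xy(1)]] opm[OF T(1)[OF xy(3)]] T(2)[OF xy(1)] T(2)[OF xy(3)] xy
				by(intro exI[of _ "?q ` ?T x"] exI[of _ "?q ` ?T y"]) (simp add: disjnt_def)
		qed
	qed
	hence "lch_grp ?M Y" using gM by(simp add: lch_grp_def lch_grp_axioms_def)
	thus ?thesis using cont opm by(intro that) (auto simp: open_map_def)
qed

text \<open>Conjugating \<open>K\<close> by an element close to the identity gives a subgroup inside
  \<open>O'\<close>, hence inside \<open>K\<close>. So the normaliser \<open>N\<close> contains a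
  neighbourhood of the identity and is open. A small subgroup of \<open>N / K\<close> pulls back to
  a subgroup inside \<open>O'\<close>, hence inside \<open>K\<close>.\<close>

theorem (in lch_grp) nss_reduction:
	obtains N K Y U where "subgroup N L" "openin X N" "subgroup K L" "compactin X K" "K \<lhd> (L\<lparr>carrier := N\<rparr>)"
		"lch_grp (L\<lparr>carrier := N\<rparr> Mod K) Y" "continuous_map (subtopology X N) Y (%x. K #> x)"
		"lch_grp.nb (L\<lparr>carrier := N\<rparr> Mod K) Y U" "!!S. subgroup S (L\<lparr>carrier := N\<rparr> Mod K) ==> S <= U ==> S = {K}"
proof -
	obtain K O' where K: "subgroup K L" "compactin X K" "openin X O'" "K <= O'"
		"!!S. subgroup S L ==> S <= O' ==> S <= K"
		by(rule nss_quotient) (rule that, assumption+)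
	have KL: "K <= carrier L" using K(1) by(rule subgroup.subset)
	\<comment> \<open>Both directions of conjugation are demanded, which makes closure under inverses
	  immediate.\<close>
	define N where "N = {w : carrier L. ALL k:K. w**k**inv w : K & inv w**k**w : K}"
	have N: "subgroup N L"
	proof(rule subgroupI)
		show "N <= carrier L" by(auto simp: N_def)
		have "\<one> : N" using KL by(auto simp: N_def)
		thus "N ~= {}" by blast
		show "inv a : N" if "a : N" for a using that by(simp add: N_def)
		fix a b assume a: "a : N" and b: "b : N"
		have car: "a : carrier L" "b : carrier L" using a b by(auto simp: N_def)
		show "a**b : N"
			unfolding N_def
		proof(intro CollectI conjI ballI)
			fix k assume k: "k : K"
			hence kL: "k : carrier L" using KL by blast
			have "a**(b**k**inv b)**inv a : K" using a b k by(simp add: N_def)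
			also have "a**(b**k**inv b)**inv a = a**b**k**inv (a**b)" using car kL by(simp add: m_assoc inv_mult_group)
			finally show "a**b**k**inv (a**b) : K" .
			have "inv b**(inv a**k**a)**b : K" using a b k by(simp add: N_def)
			also have "inv b**(inv a**k**a)**b = inv (a**b)**k**(a**b)" using car kL by(simp add: m_assoc inv_mult_group)
			finally show "inv (a**b)**k**(a**b) : K" .
		qed (use car in simp)
	qed
	have NL: "N <= carrier L" using N by(rule subgroup.subset)
	have "continuous_map (prod_topology X X) X (%z. snd z**fst z**inv (snd z))" by(intro cont_intros)
	then obtain W0 where W0: "nb W0" "!!k w. k : K ==> w : W0 ==> w**k**inv w : O'"
		by(rule tube[OF K(2,3)]) (use K(4) KL in "auto simp: subset_iff")
	obtain W where W: "nb W" "W <= W0" "!!x. x : W ==> inv x : W" by(rule nb_sym[OF W0(1)]) (rule that; assumption)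
	have conj: "w**k**inv w : K" if w: "w : W" and k: "k : K" for w k
	proof -
		have wL: "w : carrier L" using nbD(3)[OF W(1) w] .
		let ?S = "(%k. w**k**inv w) ` K"
		have "subgroup ?S L"
		proof(rule subgroupI)
			show "?S <= carrier L" "?S ~= {}" using wL KL subgroup.one_closed[OF K(1)] by auto
			show "inv a : ?S" if h: "a : ?S" for a
			proof -
				obtain k where k: "k : K" "a = w**k**inv w" using h by blast
				have "inv a = w**inv k**inv w" using wL KL k by(auto simp: m_assoc inv_mult_group)
				thus ?thesis using subgroup.m_inv_closed[OF K(1) k(1)] by blast
			qed
			show "a**b : ?S" if h: "a : ?S" "b : ?S" for a b
			proof -
				obtain k l where k: "k : K" "a = w**k**inv w" "l : K" "b = w**l**inv w" using h by blast
				have "k : carrier L" "l : carrier L" using k KL by auto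
				hence "a**b = w**(k**l)**inv w" using wL unfolding k by(simp add: m_assoc inv_cancel)
				thus ?thesis using subgroup.m_closed[OF K(1) k(1,3)] by blast
			qed
		qed
		moreover have "?S <= O'" using W0(2) w W(2) by blast
		ultimately show ?thesis using K(5) k by blast
	qed
	have WN: "W <= N"
	proof
		fix w assume w: "w : W"
		have wL: "w : carrier L" using nbD(3)[OF W(1) w] .
		show "w : N" unfolding N_def using conj[OF w] conj[OF W(3)[OF w]] wL by simp
	qed
	have opN: "openin X N"
	proof -
		have "N = (UN a:N. {x : carrier L. inv a**x : W})"
		proof(intro equalityI subsetI)
			fix a assume "a : N"
			hence "a : {x : carrier L. inv a**x : W}" using NL nbD(2)[OF W(1)] by auto
			thus "a : (UN a:N. {x : carrier L. inv a**x : W})" using `a : N` by blast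
		next
			fix x assume "x : (UN a:N. {x : carrier L. inv a**x : W})"
			then obtain a where a: "a : N" "x : carrier L" "inv a**x : W" by blast
			hence "inv a**x : N" using WN by blast
			hence "a**(inv a**x) : N" by(rule subgroup.m_closed[OF N a(1)])
			thus "x : N" using a NL by(simp add: inv_cancel subsetD)
		qed
		moreover have "openin X (UN a:N. {x : carrier L. inv a**x : W})"
			by(intro openin_Union) (use NL openin_translate(1)[OF nbD(1)[OF W(1)]] in auto)
		ultimately show ?thesis by simp
	qed
	have clN: "closedin X N"
	proof -
		have "carrier L - N = (UN a:carrier L - N. {x : carrier L. inv a**x : N})"
		proof(intro equalityI subsetI)
			fix a assume "a : carrier L - N"
			hence "a : {x : carrier L. inv a**x : N}" using subgroup.one_closed[OF N] by auto
			thus "a : (UN a:carrier L - N. {x : carrier L. inv a**x : N})" using `a : carrier L - N` by blast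
		next
			fix x assume "x : (UN a:carrier L - N. {x : carrier L. inv a**x : N})"
			then obtain a where a: "a : carrier L" "a ~: N" "x : carrier L" "inv a**x : N" by blast
			have "x ~: N"
			proof
				assume "x : N"
				hence "x**inv (inv a**x) : N" by(rule subgroup.m_closed[OF N _ subgroup.m_inv_closed[OF N a(4)]])
				thus False using a by(simp add: inv_mult_group inv_cancel)
			qed
			thus "x : carrier L - N" using a by blast
		qed
		moreover have "openin X (UN a:carrier L - N. {x : carrier L. inv a**x : N})"
			by(intro openin_Union) (use openin_translate(1)[OF opN] in auto)
		ultimately show ?thesis unfolding closedin_def using NL by(simp add: topspace)
	qed
	let ?M = "L\<lparr>carrier := N\<rparr>"
	have KN: "K <= N"
		unfolding N_def using KL
		by(intro subsetI CollectI conjI ballI subgroup.m_closed[OF K(1)] subgroup.m_inv_closed[OF K(1)]) blast+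
	interpret M: lch_grp ?M "subtopology X N" by(rule lch_grp_subgroup[OF lch_grp_axioms N clN])
	have KM: "subgroup K ?M" by(rule subgroup_incl[OF K(1) N KN])
	have nK: "K \<lhd> ?M" unfolding M.normal_inv_iff
		using KM m_inv_consistent[OF N] by(auto simp: N_def)
	have "compactin (subtopology X N) K" using K(2) KN by(simp add: compactin_subtopology)
	then obtain Y where Y: "lch_grp (?M Mod K) Y" "continuous_map (subtopology X N) Y (%x. K #>\<^bsub>?M\<^esub> x)"
		"open_map (subtopology X N) Y (%x. K #>\<^bsub>?M\<^esub> x)"
		by(rule M.lch_grp_quotient[OF nK]) (rule that; assumption)
	interpret Q: lch_grp "?M Mod K" Y by(rule Y(1))
	have coset: "K #>\<^bsub>?M\<^esub> x = K #> x" for x by(simp add: r_coset_def)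
	obtain V where V: "nb V" "!!k w. k : K ==> w : V ==> k**w : O'"
		by(rule nb_around[OF K(2,3,4)]) (rule that; assumption)
	let ?U = "(%x. K #> x) ` (V Int N)"
	have oneN: "\<one> : N" using subgroup.one_closed[OF N] .
	have K1: "K #> \<one> = K" using coset_join2[OF one_closed K(1)] subgroup.one_closed[OF K(1)] by simp
	have "openin (subtopology X N) (V Int N)" using nbD(1)[OF V(1)] by(auto simp: openin_subtopology)
	hence "openin Y ?U" using Y(3) unfolding open_map_def coset by blast
	moreover have "K : ?U" using K1 oneN nbD(2)[OF V(1)] by(intro image_eqI[of _ _ \<one>]) auto
	ultimately have U: "Q.nb ?U" by(simp add: Q.nb_def)
	interpret q: group_hom ?M "?M Mod K" "%x. K #>\<^bsub>?M\<^esub> x"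
		by(intro group_hom.intro group_hom_axioms.intro M.is_group Q.is_group normal.r_coset_hom_Mod nK)
	have small: "S = {K}" if S: "subgroup S (?M Mod K)" "S <= ?U" for S
	proof -
		define T where "T = {x : carrier ?M. K #>\<^bsub>?M\<^esub> x : S}"
		have "subgroup T ?M"
		proof(rule M.subgroupI)
			show "T <= carrier ?M" by(auto simp: T_def)
			have "\<one> : T" using oneN K1 subgroup.one_closed[OF S(1)] by(simp add: T_def coset)
			thus "T ~= {}" by blast
			show "inv\<^bsub>?M\<^esub> a : T" if "a : T" for a
			proof -
				have a: "a : carrier ?M" "K #>\<^bsub>?M\<^esub> a : S" using that by(simp_all only: T_def mem_Collect_eq)
				show ?thesis unfolding T_def mem_Collect_eq q.hom_inv[OF a(1)]
					by(rule conjI[OF M.inv_closed[OF a(1)] subgroup.m_inv_closed[OF S(1) a(2)]])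
			qed
			show "a **\<^bsub>?M\<^esub> b : T" if "a : T" "b : T" for a b
			proof -
				have a: "a : carrier ?M" "K #>\<^bsub>?M\<^esub> a : S" and b: "b : carrier ?M" "K #>\<^bsub>?M\<^esub> b : S"
					using that by(simp_all only: T_def mem_Collect_eq)
				show ?thesis unfolding T_def mem_Collect_eq q.hom_mult[OF a(1) b(1)]
					by(rule conjI[OF M.m_closed[OF a(1) b(1)] subgroup.m_closed[OF S(1) a(2) b(2)]])
			qed
		qed
		hence "subgroup T L" by(rule incl_subgroup[OF N])
		moreover have "T <= O'"
		proof
			fix x assume "x : T"
			hence x: "x : N" "K #> x : S" by(auto simp: T_def coset)
			then obtain v where v: "v : V" "v : N" "K #> x = K #> v" using S(2) by blast
			have "x : K #> v" using rcos_self[OF _ K(1), of x] x(1) NL v(3) by blast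
			then obtain k where "k : K" "x = k**v" by(auto simp: r_coset_def)
			thus "x : O'" using V(2) v(1) by blast
		qed
		ultimately have TK: "T <= K" by(rule K(5))
		have "s = K" if "s : S" for s
		proof -
			have "s : carrier (?M Mod K)" using that subgroup.subset[OF S(1)] by blast
			then obtain x where x: "x : N" "s = K #> x" by(auto simp: carrier_FactGroup coset)
			hence "x : T" using that by(simp add: T_def coset)
			hence xK: "x : K" using TK by blast
			show ?thesis unfolding x(2) by(rule coset_join2[OF subsetD[OF KL xK] K(1) xK])
		qed
		moreover have "K : S" using subgroup.one_closed[OF S(1)] by simp
		ultimately show ?thesis by blast
	qed
	show ?thesis by(rule that[OF N opN K(1,2) nK Y(1) _ U small]) (use Y(2) in "simp_all add: coset")
qed

section \<open>Groups without small subgroups\<close>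

lemma last_true:
	assumes "P (0::nat)" "~ P n"
	obtains m where "m < n" "P m" "~ P (Suc m)"
	using assms
proof(induction n arbitrary: thesis)
	case (Suc n)
	show ?case
	proof(cases "P n")
		case True thus ?thesis using Suc.prems by blast
	next
		case False thus ?thesis using Suc.IH[OF _ Suc.prems(2)] Suc.prems(1) less_SucI by metis
	qed
qed simp

lemma (in lch_grp) limit_pow: "limitin X f l U ==> limitin X (%i. f i [^] (n::nat)) (l [^] n) U"
proof(induction n)
	case 0 show ?case unfolding nat_pow_0 by(rule limit_one) (simp add: nbD(2))
qed (simp add: limit_mult)

lemma (in lch_grp) continuous_pow: "continuous_map X X (%x. x [^] (n::nat))"
proof(induction n)
	case 0 show ?case unfolding nat_pow_0 by(rule continuous_const[OF one_closed])
next
	case (Suc n) thus ?case unfolding nat_pow_Suc by(rule continuous_mult'[OF _ continuous_ident])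
qed

locale nss_grp = lch_grp +
	fixes U
	assumes Uc: "compactin X U" and Unb: "EX N. nb N & N <= U" and Us: "!!x. x : U ==> inv x : U"
		and nss: "!!S. subgroup S L ==> S <= U ==> S = {\<one>}"
begin

lemma U_carrier: "x : U ==> x : carrier L"
	by(rule compactinD_carrier[OF Uc])

lemma one_U: "\<one> : U" using Unb nbD(2) by blast

text \<open>Plays the part of a ball of radius \<open>1 / n\<close> in Gleason's metric: the closer
  an element is to the identity, the more powers it takes to leave \<open>U\<close>.\<close>

definition Q :: "nat => 'a set" where
	"Q n = {g : carrier L. ALL i<=n. g [^] i : U}"

lemma Q_carrier: "Q n <= carrier L"
	by(auto simp: Q_def)

lemma Q_one: "\<one> : Q n"
	using one_U by(simp add: Q_def)

lemma Q_inv: "g : Q n ==> inv g : Q n"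
	using Us by(simp add: Q_def nat_pow_inv)

lemma Q_anti: "m <= n ==> Q n <= Q m"
	by(auto simp: Q_def)

lemma Q_pow:
	assumes "g : Q n" "i * k <= n"
	shows "g [^] i : Q k"
proof -
	have "i * j <= n" if "j <= k" for j using assms(2) mult_le_mono2[OF that, of i] by linarith
	thus ?thesis using assms(1) by(auto simp: Q_def nat_pow_pow)
qed

lemma Q_U: "g : Q n ==> i <= n ==> g [^] i : U"
	by(simp add: Q_def)

lemma powers_in_U:
	assumes l: "l : carrier L" "!!n::nat. l [^] n : U"
	shows "l = \<one>"
proof -
	let ?S = "range (%n::int. l [^] n)"
	have "subgroup ?S L"
	proof(rule subgroupI)
		show "?S <= carrier L" using l(1) by auto
		show "inv a : ?S" if "a : ?S" for a using that l(1) by(auto simp: int_pow_neg[symmetric])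
		show "a**b : ?S" if "a : ?S" "b : ?S" for a b using that l(1) by(auto simp: int_pow_mult[symmetric])
	qed simp
	moreover have "l [^] n : U" for n :: int
	proof(cases "n >= 0")
		case True
		then obtain k where "n = int k" using nonneg_int_cases by blast
		thus ?thesis using l(2) by(simp add: int_pow_int)
	next
		case False
		hence "n = - int (nat (- n))" by simp
		then obtain k where "n = - int k" by(rule that)
		thus ?thesis using Us[OF l(2)[of k]] l(1) by(simp add: int_pow_neg int_pow_int)
	qed
	hence "?S <= U" by blast
	ultimately have S: "?S = {\<one>}" by(rule nss)
	have "l [^] (1::int) : ?S" by(rule rangeI)
	thus ?thesis unfolding S using l(1) by simp
qed

text \<open>A limit of elements of \<open>Q (Suc k)\<close> along an ultrafilter has all its powers
  in \<open>U\<close>, so it is trivial by the absence of small subgroups. Together with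
  \<open>Q_nb\<close> this makes the \<open>Q n\<close> a countable neighbourhood base at the
  identity.\<close>

lemma Q_small:
	assumes V: "nb V"
	shows "EX k>0. Q k <= V"
proof(rule ccontr)
	assume non: "~ ?thesis"
	have "EX g. g : Q (Suc k) & g ~: V" for k using non by blast
	then obtain g where g: "!!k. g k : Q (Suc k)" "!!k. g k ~: V" by metis
	obtain W :: "nat filter" where u: "ultra W" "W <= sequentially" by(rule ultra_nat)
	have gU: "g k : U" for k
	proof -
		have "g k [^] (1::nat) : U" by(rule Q_U[OF g(1)]) simp
		thus ?thesis using subsetD[OF Q_carrier g(1)] by simp
	qed
	obtain l where l: "l : U" "limitin X g l W"
		by(rule ultra_compactin[OF u(1) Uc, of g]) (simp_all add: gU)
	have lL: "l : carrier L" by(rule U_carrier[OF l(1)])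
	have "l [^] n : U" for n :: nat
	proof(rule limitin_in_closed[OF limit_pow[OF l(2)] closed_of_compact[OF Uc] u(1)])
		have "eventually (%k. g k [^] n : U) sequentially"
			using eventually_ge_at_top[of n] by eventually_elim (rule Q_U[OF g(1)], simp)
		thus "eventually (%k. g k [^] n : U) W" by(rule filter_leD[OF u(2)])
	qed
	hence "l = \<one>" by(rule powers_in_U[OF lL])
	hence "eventually (%k. g k : V) W" using limitinD[OF l(2) nbD(1)[OF V]] nbD(2)[OF V] by simp
	from ultra_ex[OF u(1) this] show False using g(2) by blast
qed

lemma Q_nb: "EX N. nb N & N <= Q n"
proof -
	obtain N where N: "nb N" "N <= U" using Unb by blast
	have "nb {g : carrier L. g [^] i : N}" for i :: nat
	proof -
		have "openin X {g : topspace X. g [^] i : N}"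
			by(rule openin_continuous_map_preimage[OF continuous_pow nbD(1)[OF N(1)]])
		thus ?thesis using nbD(2)[OF N(1)] by(simp add: nb_def topspace)
	qed
	hence *: "openin X (INT i:{..n}. {g : carrier L. g [^] i : N})" by(intro openin_Inter) (auto simp: nb_def)
	have "\<one> : (INT i:{..n}. {g : carrier L. g [^] i : N})" using nbD(2)[OF N(1)] by simp
	moreover have "(INT i:{..n}. {g : carrier L. g [^] i : N}) <= Q n" using N(2) by(auto simp: Q_def)
	ultimately show ?thesis using * unfolding nb_def by blast
qed

lemma small_triple:
	obtains C V where "compactin X C" "nb V" "V <= C" "!!x y z. x : C ==> y : C ==> z : C ==> x**y**z : U"
proof -
	obtain N where N: "nb N" "N <= U" using Unb by blast
	obtain N2 where N2: "nb N2" "!!x y. x : N2 ==> y : N2 ==> x**y : N" using nb_mult[OF N(1)] by metis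
	obtain N4 where N4: "nb N4" "N4 <= N2" "!!x y. x : N4 ==> y : N4 ==> x**y : N2" using nb_mult[OF N2(1)] by metis
	obtain V C where V: "nb V" "V <= C" "compactin X C" "C <= N4" using nb_compact[OF N4(1)] by metis
	have "x**y**z : U" if "x : C" "y : C" "z : C" for x y z
	proof -
		have "x**y : N2" by(rule N4(3)) (use that V(4) in blast)+
		hence "x**y**z : N" by(rule N2(2)) (use that V(4) N4(2) in blast)
		thus ?thesis using N(2) by blast
	qed
	thus ?thesis using that V by blast
qed

text \<open>The product estimate of a Gleason metric. If it failed for every \<open>c\<close>, the
  limits at the exit scale \<open>m\<close> of the sets \<open>P k\<close> would form a subgroup
  inside \<open>U\<close>, which is trivial. But products with one factor more have a limit in it
  and stay outside a neighbourhood of the identity.\<close>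

lemma Q_sprod:
	assumes C: "compactin X C" "nb N" "N <= C"
	shows "EX c>0. ALL n>0. sprod (Q (c * n)) n <= C"
proof(rule ccontr)
	assume non: "~ ?thesis"
	obtain C0 V0 where V0: "compactin X C0" "nb V0" "V0 <= C0" "!!x y z. x : C0 ==> y : C0 ==> z : C0 ==> x**y**z : U"
		by(rule small_triple) (rule that; assumption)
	define D where "D = C Int C0"
	have D: "compactin X D" unfolding D_def
		by(rule closed_compactin[OF C(1)]) (use closed_of_compact[OF C(1)] closed_of_compact[OF V0(1)] in auto)
	have ND: "nb (N Int V0)" "N Int V0 <= D" using nb_Int[OF C(2) V0(2)] C(3) V0(3) by(auto simp: D_def)
	obtain k0 where k0: "Q k0 <= N Int V0" using Q_small[OF ND(1)] by blast
	\<comment> \<open>The factor tends to infinity, so powers up to \<open>m k\<close> become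
	  arbitrarily small; it is also larger than \<open>k0\<close>, so the factors themselves lie in
	  \<open>N Int V0\<close> from the start.\<close>
	have "EX n>0. ~ sprod (Q (Suc (k + k0) * n)) n <= C" for k using non zero_less_Suc by blast
	hence "EX n. 0 < n & ~ sprod (Q (Suc (k + k0) * n)) n <= D" for k unfolding D_def by blast
	then obtain n where n: "!!k. 0 < n k" "!!k. ~ sprod (Q (Suc (k + k0) * n k)) (n k) <= D" by metis
	define P where "P k = Q (Suc (k + k0) * n k)" for k
	have PQ: "P k <= Q k0" for k unfolding P_def using n(1)[of k] by(intro Q_anti) (cases "n k"; simp)
	have PV: "P k <= V0" for k using PQ[of k] k0 by blast
	have PL: "P k <= carrier L" for k unfolding P_def by(rule Q_carrier)
	have Pi: "q : P k ==> inv q : P k" for q k unfolding P_def by(rule Q_inv)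
	have P1: "\<one> : P k" for k unfolding P_def by(rule Q_one)
	have "EX m. m < n k & sprod (P k) m <= D & ~ sprod (P k) (Suc m) <= D" for k
	proof -
		have "sprod (P k) 0 <= D" using ND nbD(2) by auto
		thus ?thesis by(rule last_true[of "%m. sprod (P k) m <= D", OF _ n(2)[of k, folded P_def]]) blast
	qed
	then obtain m where m: "!!k. m k < n k" "!!k. sprod (P k) (m k) <= D" "!!k. ~ sprod (P k) (Suc (m k)) <= D"
		by metis
	have m0: "0 < m k" for k
	proof(rule ccontr)
		assume "~ 0 < m k"
		hence "sprod (P k) (Suc (m k)) = P k" using sprod_one[OF PL] by simp
		thus False using m(3)[of k] PQ[of k] k0 ND(2) by blast
	qed
	obtain W :: "nat filter" where u: "ultra W" "W <= sequentially" by(rule ultra_nat)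
	let ?T = "{c**v | c v. c : {c**v | c v. c : D & v : C0} & v : C0}"
	have T: "compactin X ?T" by(intro compactin_mult D V0(1))
	have TU: "?T <= U" using V0(4) unfolding D_def by blast
	have evT: "eventually (%k. x k : ?T) W" if x: "eventually (%k. x k : sprod (P k) (K * m k)) W" for K x
	proof -
		obtain V' where V': "nb V'" "ALL Q m. Q <= V0 --> \<one> : Q --> (ALL q:Q. inv q : Q) --> 0 < m --> sprod Q m <= D -->
		 (ALL q:Q. ALL i<=m. q [^] i : V') --> (ALL x:sprod Q (K * m). EX c:D. EX v:V0. EX v':V0. x = c**v**v')"
			using power_growth[OF D V0(2,3,1), of K] by(elim exE conjE) (rule that)
		obtain k1 where k1: "Q k1 <= V'" using Q_small[OF V'(1)] by blast
		have "eventually (%k. k >= k1) W" by(rule filter_leD[OF u(2) eventually_ge_at_top])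
		with x show ?thesis
		proof eventually_elim
			case (elim k)
			have pw: "q [^] i : V'" if "q : P k" "i <= m k" for q i
			proof -
				have "q [^] i : Q k1"
				proof(rule Q_pow[OF that(1)[unfolded P_def]])
					have "i * k1 <= n k * Suc (k + k0)" using that(2) m(1)[of k] elim(2) by(intro mult_le_mono) auto
					thus "i * k1 <= Suc (k + k0) * n k" by(simp add: mult.commute)
				qed
				thus ?thesis using k1 by blast
			qed
			have "EX c:D. EX v:V0. EX v':V0. x k = c**v**v'"
				by(rule V'(2)[rule_format, OF PV P1 _ m0 m(2) _ elim(1)]) (erule Pi, rule pw)
			thus ?case using V0(3) by blast
		qed
	qed
	have S: "subgroup (limset W P m) L"
		by(rule limset_subgroup) (use PL Pi in simp)
	have "limset W P m <= ?T"
	proof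
		fix l assume "l : limset W P m"
		then obtain K x where x: "eventually (%i. x i : sprod (P i) (K * m i)) W" "limitin X x l W"
			unfolding limset_def by blast
		show "l : ?T" by(rule limitin_in_closed[OF x(2) closed_of_compact[OF T] u(1) evT[OF x(1)]])
	qed
	hence S1: "limset W P m = {\<one>}" using TU by(intro nss[OF S]) blast
	have "EX x. x : sprod (P k) (Suc (m k)) & x ~: D" for k using m(3)[of k] by blast
	then obtain x where x: "!!k. x k : sprod (P k) (Suc (m k))" "!!k. x k ~: D" by metis
	have "x k : sprod (P k) (2 * m k)" for k
		using subsetD[OF sprod_mono[OF PL P1] x(1)[of k]] m0[of k] by simp
	hence ev: "eventually (%k. x k : sprod (P k) (2 * m k)) W" by simp
	obtain l where l: "limitin X x l W" by(rule ultra_compactin[OF u(1) T evT[OF ev]])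
	have "l : limset W P m" by(rule limsetI[OF ev l])
	hence "l = \<one>" using S1 by blast
	hence "eventually (%k. x k : N Int V0) W" using limitinD[OF l nbD(1)[OF ND(1)]] nbD(2)[OF ND(1)] by simp
	from ultra_ex[OF u(1) this] show False using x(2) ND(2) by blast
qed

text \<open>The comparison estimate of a Gleason metric. If the powers of \<open>a\<close> and
  \<open>b\<close> stay close up to exponent \<open>n\<close>, telescoping carries this back to the
  first powers: the difference of \<open>f\<close> along \<open>g = a**inv b\<close> is at most
  \<open>3 * e / m\<close>. So \<open>f\<close> is still nonzero at the first power of
  \<open>g\<close> outside \<open>U\<close>, although its support lies in \<open>U\<close>.\<close>

lemma Q_quotient:
	"EX W n0. nb W & 0 < n0 & (ALL n>=n0. ALL a:Q n. ALL b:Q n. (ALL i<=n. a [^] i**inv (b [^] i) : W) --> a**inv b : Q (B * n))"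
proof -
	obtain C V0 where V0: "compactin X C" "nb V0" "V0 <= C" "!!x y z. x : C ==> y : C ==> z : C ==> x**y**z : U"
		by(rule small_triple) (rule that; assumption)
	obtain c where c: "0 < c" "!!n. 0 < n ==> sprod (Q (c * n)) n <= C" using Q_sprod[OF V0(1-3)] by blast
	obtain I where "haar_grp L X I" using haar_grp_exists by blast
	then interpret haar_grp L X I .
	obtain A c0 and W :: "real => 'a set" where gl: "A > 0" "c0 > 0" "!!e. e > 0 ==> nb (W e)"
		"!!Q m. Q <= V0 ==> \<one> : Q ==> (!!q. q : Q ==> inv q : Q) ==> 0 < m ==> sprod Q m <= C ==>
			EX f. gleason_function C V0 W A c0 Q m f"
		by(erule gleason[OF V0(1,2,3,1)])
	define K where "K = (B + 2) * (2 * c)"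
	have K0: "K > 0" using c(1) by(simp add: K_def)
	\<comment> \<open>At most \<open>K * m\<close> steps of size \<open>3 * e / m\<close> are made, a
	  total loss of \<open>c0 / 2\<close>.\<close>
	define e where "e = c0 / (6 * real K)"
	have e: "e > 0" using gl(2) K0 by(simp add: e_def)
	obtain q where q: "q > 0" "Q q <= W e" using Q_small[OF gl(3)[OF e]] by blast
	obtain k0 where k0: "Q k0 <= V0" using Q_small[OF V0(2)] by blast
	define e' where "e' = e / (2 * real q)"
	have e': "e' > 0" using e q(1) by(simp add: e'_def)
	define n0 where "n0 = c * (q + k0)"
	have n00: "0 < n0" using c(1) q(1) by(simp add: n0_def)
	obtain N where N: "nb N" "N <= Q n0" using Q_nb by blast
	show ?thesis
	proof(intro exI[of _ "N Int W e'"] exI[of _ n0] conjI allI ballI impI)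
		show "nb (N Int W e')" by(intro nb_Int N(1) gl(3) e')
		show "0 < n0" by(rule n00)
		fix n a b assume n: "n0 <= n" and a: "a : Q n" and b: "b : Q n"
			and ab: "ALL i<=n. a [^] i**inv (b [^] i) : N Int W e'"
		have aL: "a : carrier L" and bL: "b : carrier L" using a b Q_carrier by auto
		define g where "g = a**inv b"
		have gL: "g : carrier L" using aL bL by(simp add: g_def)
		have "a [^] (1::nat)**inv (b [^] (1::nat)) : N Int W e'" using n n00 by(intro ab[THEN spec, THEN mp]) simp
		hence gn0: "g : Q n0" using N(2) aL bL by(auto simp: g_def)
		show "a**inv b : Q (B * n)"
		proof(rule ccontr)
			assume non: "a**inv b ~: Q (B * n)"
			have "g : Q 0" using gL one_U by(simp add: Q_def)
			then obtain j where j: "j < B * n" "g : Q j" "g ~: Q (Suc j)"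
				by(rule last_true[of "%j. g : Q j"]) (use non that in "auto simp: g_def")
			have jn: "n0 <= j"
			proof(rule ccontr)
				assume "~ n0 <= j"
				hence "Q n0 <= Q (Suc j)" by(intro Q_anti) simp
				thus False using j(3) gn0 by blast
			qed
			have gj: "g [^] Suc j ~: U" using j(2,3) unfolding Q_def by(auto simp del: nat_pow_Suc simp: le_Suc_eq)
			\<comment> \<open>\<open>p\<close> is an exponent valid for \<open>a\<close>, \<open>b\<close>
			  and \<open>g\<close> at once. Division by \<open>c\<close> leaves room for the product estimate
			  on \<open>P = Q (c * m)\<close>, and \<open>m\<close> remains comparable with \<open>j\<close>,
			  in the form \<open>Suc j \<le> K * m\<close>.\<close>
			define p where "p = min j n"
			define m where "m = p div c"
			have p0: "n0 <= p" using jn n by(simp add: p_def)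
			have mq: "q + k0 <= m" using div_le_mono[OF p0, of c] c(1) by(simp add: m_def n0_def)
			have m0: "0 < m" using mq q(1) by simp
			have cm: "c * m <= p" by(simp add: m_def)
			have "p < c * m + c" unfolding m_def using c(1) by(metis add.commute dividend_less_times_div)
			also have "c * m + c <= 2 * (c * m)" using m0 by simp
			finally have pm: "p <= 2 * c * m" by simp
			have "Suc j <= (B + 2) * p"
			proof(cases "j <= n")
				case True
				hence "p = j" by(simp add: p_def)
				moreover have "Suc j <= 2 * j" using jn n00 by simp
				ultimately show ?thesis by(simp add: add_mult_distrib)
			next
				case False
				hence "p = n" by(simp add: p_def)
				thus ?thesis using j(1) by(simp add: add_mult_distrib)
			qed
			also have "... <= (B + 2) * (2 * c * m)" using pm by(rule mult_le_mono2)
			finally have jK: "Suc j <= K * m" unfolding K_def by(simp only: mult.assoc)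
			define P where "P = Q (c * m)"
			have QP: "Q j <= P" "Q n <= P" unfolding P_def using cm by(auto simp: p_def intro!: Q_anti)
			have aP: "a : P" and bP: "b : P" using QP a b j(2) by auto
			have "k0 <= c * m" using mq c(1) by(cases c) auto
			hence PV: "P <= V0" unfolding P_def using Q_anti k0 by blast
			have P1: "\<one> : P" unfolding P_def by(rule Q_one)
			have Pi: "inv x : P" if "x : P" for x using that unfolding P_def by(rule Q_inv)
			obtain f where ph': "c0 <= f \<one>" "ALL x:carrier L. f x ~= 0 --> (EX c:C. EX v:V0. EX v':V0. x = c**v**v')"
				"ALL e>0. ALL h:W e. ALL x:carrier L. abs (f (h**x) - f x) <= e"
				"ALL e>0. ALL h:W e. ALL g:P. ALL x:carrier L. abs ((f (g**(h**x)) - f (h**x)) - (f (g**x) - f x)) <= e / real m"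
				by(rule exE[OF gl(4)[OF PV P1 _ m0 c(2)[OF m0, folded P_def]]], erule Pi, elim conjE, rule that) assumption+
			note ph = ph'(1) ph'(2)[THEN bspec, THEN mp] ph'(3)[THEN spec, THEN mp, OF e', THEN bspec, THEN bspec]
				ph'(4)[THEN spec, THEN mp, OF e, THEN bspec, THEN bspec, THEN bspec]
			\<comment> \<open>Powers of elements of \<open>P\<close> up to this exponent lie in
			  \<open>Q q\<close>, hence in \<open>W e\<close>, as telescoping requires, while
			  \<open>i\<close> is still at least the fraction \<open>1 / (2 * q)\<close> of
			  \<open>m\<close>.\<close>
			define i where "i = m div q"
			have i0: "0 < i" using mq q(1) by(simp add: i_def div_greater_zero_iff)
			have "m < q * i + q" unfolding i_def using q(1) by(metis add.commute dividend_less_times_div)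
			also have "q * i + q <= 2 * (q * i)" using i0 by simp
			finally have "real m <= 2 * (real q * real i)" by(simp flip: of_nat_mult)
			hence im: "e' <= real i * (e / real m)"
				using e q(1) m0 by(simp add: e'_def field_simps)
			have iq: "i * q <= m" by(simp add: i_def)
			have "m <= c * m" using c(1) by(cases c) auto
			hence in': "i <= n" using div_le_dividend[of m q] cm unfolding i_def p_def by linarith
			have tel: "abs ((f (x [^] i**y) - f y) - real i * (f (x**y) - f y)) <= real i * (e / real m)"
				if x: "x : P" and y: "y : carrier L" for x y
			proof(rule telescope)
				show "x : carrier L" using x Q_carrier P_def by auto
				show "y : carrier L" by(rule y)
				fix l z assume l: "l < i" and z: "z : carrier L"
				have "l * q <= i * q" using l by simp
				hence "l * q <= c * m" using iq `m <= c * m` by linarith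
				hence "x [^] l : Q q" using x unfolding P_def by(intro Q_pow)
				hence "x [^] l : W e" using q(2) by blast
				thus "abs ((f (x**(x [^] l**z)) - f (x [^] l**z)) - (f (x**z) - f z)) <= e / real m" by(rule ph(4)[OF _ x z])
			qed
			have d: "abs (f (g**x) - f x) <= 3 * e / real m" if x: "x : carrier L" for x
			proof -
				define y where "y = inv b**x"
				have y: "y : carrier L" "b**y = x" "a**y = g**x" using x aL bL by(simp_all add: y_def g_def inv_cancel m_assoc)
				have "a [^] i**inv (b [^] i) : W e'" using ab in' by blast
				from ph(3)[OF this, of "b [^] i**y"] have "abs (f (a [^] i**y) - f (b [^] i**y)) <= e'"
					using aL bL y(1) by(simp add: m_assoc inv_cancel)
				hence "abs (real i * (f (a**y) - f y) - real i * (f (b**y) - f y)) <= e' + 2 * (real i * (e / real m))"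
					using tel[OF aP y(1)] tel[OF bP y(1)] by linarith
				also have "real i * (f (a**y) - f y) - real i * (f (b**y) - f y) = real i * (f (g**x) - f x)"
					unfolding y(2,3) by(simp add: algebra_simps)
				also have "abs (...) = real i * abs (f (g**x) - f x)" by(simp only: abs_mult abs_of_nat)
				also have "e' + 2 * (real i * (e / real m)) <= real i * (3 * e / real m)"
				proof -
					define t where "t = real i * (e / real m)"
					have "real i * (3 * e / real m) = 3 * t" by(simp add: t_def)
					thus ?thesis using im unfolding t_def[symmetric] by simp
				qed
				finally show ?thesis by(rule mult_left_le_imp_le) (use i0 in simp)
			qed
			have sg: "sprod {g} k = {g [^] k}" for k
				by(induction k) (auto simp: nat_pow_Suc2[OF gL, symmetric])
			have "g [^] Suc j : carrier L & abs (f (g [^] Suc j) - f \<one>) <= real (Suc j) * (3 * e / real m)"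
				by(rule sprod_difference[of "{g}"]) (use gL d in "auto simp del: sprod.simps nat_pow_Suc simp: sg")
			moreover have "real (Suc j) * (3 * e / real m) <= real (K * m) * (3 * e / real m)"
				using jK e by(intro mult_right_mono) (auto simp del: of_nat_Suc of_nat_mult)
			moreover have "real (K * m) * (3 * e / real m) = c0 / 2" using m0 K0 by(simp add: e_def)
			ultimately have gg: "g [^] Suc j : carrier L" and "f (g [^] Suc j) ~= 0" using ph(1) gl(2) by linarith+
			then obtain x v w where xvw: "x : C" "v : V0" "w : V0" "g [^] Suc j = x**v**w" using ph(2)[OF gg] by blast
			have "g [^] Suc j : U" unfolding xvw(4) by(rule V0(4)) (use V0(3) xvw in blast)+
			thus False using gj by blast
		qed
	qed
qed

lemma Q_int_pow:
	assumes g: "g : Q n" and i: "abs i * int k <= int n"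
	shows "g [^] (i::int) : Q k"
proof -
	have gL: "g : carrier L" using g Q_carrier by blast
	have *: "nat \<bar>i\<bar> * k <= n"
	proof -
		have "int (nat \<bar>i\<bar> * k) <= int n" using i by simp
		thus ?thesis by(simp only: of_nat_le_iff)
	qed
	show ?thesis
	proof(cases "i >= 0")
		case True
		hence "g [^] i = g [^] nat \<bar>i\<bar>" by(metis abs_of_nonneg int_nat_eq int_pow_int)
		thus ?thesis using Q_pow[OF g *] by simp
	next
		case False
		hence "i = - int (nat \<bar>i\<bar>)" by simp
		hence "g [^] i = inv (g [^] nat \<bar>i\<bar>)" using gL by(metis int_pow_int int_pow_neg)
		thus ?thesis using Q_inv[OF Q_pow[OF g *]] by simp
	qed
qed

lemma Q_mem_U: "g : Q 1 ==> g : U"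
	using Q_U[of g 1 1] subsetD[OF Q_carrier, of g 1] by simp

text \<open>One-parameter subgroups. Staying in \<open>U\<close> for times up to one bounds the
  speed and already implies continuity, as \<open>ops_limit\<close> shows.\<close>

definition ops :: "(real => 'a) => bool" where
	"ops c \<longleftrightarrow> (ALL s. c s : carrier L) & (ALL s t. c (s + t) = c s**c t) & (ALL s. abs s <= 1 --> c s : U)"

lemma opsD: "ops c ==> c s : carrier L" "ops c ==> c (s + t) = c s**c t" "ops c ==> abs s <= 1 ==> c s : U"
	by(auto simp: ops_def)

lemma ops_zero: "ops c ==> c 0 = \<one>"
	using opsD(2)[of c 0 0] opsD(1)[of c 0] by(simp add: r_cancel_one')

lemma ops_pow: "ops c ==> c (real i * s) = c s [^] i"
	by(induction i) (simp_all add: ops_zero distrib_right opsD(2) add.commute[of s])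

lemma ops_Q:
	assumes g: "ops c" and s: "abs s * real n <= 1"
	shows "c s : Q n"
proof -
	have "c s [^] i : U" if "i <= n" for i
	proof -
		have "abs (real i * s) <= abs s * real n" using that by(simp add: abs_mult mult.commute mult_left_mono)
		thus ?thesis using opsD(3)[OF g, of "real i * s"] s by(simp add: ops_pow[OF g])
	qed
	thus ?thesis using opsD(1)[OF g] by(simp add: Q_def)
qed

lemma ops_limit:
	assumes g: "ops c" and s: "(s \<longlongrightarrow> t) F"
	shows "limitin X (%i. c (s i)) (c t) F"
proof -
	have "limitin X (%i. c (s i - t)) \<one> F"
	proof(rule limit_one)
		fix V assume "nb V"
		then obtain k where k: "k > 0" "Q k <= V" using Q_small by blast
		have "eventually (%i. dist (s i) t < 1 / real k) F" using k(1) by(intro tendstoD[OF s]) simp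
		thus "eventually (%i. c (s i - t) : V) F"
		proof eventually_elim
			case (elim i)
			hence "abs (s i - t) * real k <= 1" using k(1) by(simp add: dist_real_def field_simps)
			thus ?case using ops_Q[OF g] k(2) by blast
		qed
	qed
	hence "limitin X (%i. c t**c (s i - t)) (c t**\<one>) F"
		by(rule limit_mult[rotated]) (simp add: topspace opsD(1)[OF g])
	moreover have "c t**c (s i - t) = c (s i)" for i using opsD(2)[OF g, of t "s i - t"] by simp
	ultimately show ?thesis using opsD(1)[OF g] by simp
qed

text \<open>Each block of at most \<open>n\<close> powers contributes one factor from
  \<open>U\<close>. This keeps the rescaled powers in a compact set for any bounded time, so that
  their limits exist.\<close>

lemma powers_compact:
	"EX T. compactin X T & (ALL n g. ALL j::int. g : Q n --> abs j <= int k * int n --> g [^] j : T)"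
proof(induction k)
	case 0
	have "compactin X {\<one>}" by(simp add: topspace)
	thus ?case by(intro exI[of _ "{\<one>}"]) auto
next
	case (Suc k)
	then obtain T where T: "compactin X T" "!!n g j. g : Q n ==> abs j <= int k * int n ==> g [^] (j::int) : T" by blast
	show ?case
	proof(intro exI[of _ "{a**b | a b. a : T & b : U}"] conjI allI impI)
		show "compactin X {a**b | a b. a : T & b : U}" by(rule compactin_mult[OF T(1) Uc])
		fix n g and j :: int assume g: "g : Q n" and j: "abs j <= int (Suc k) * int n"
		define i where "i = max (- int n) (min (int n) j)"
		have "abs (j - i) <= int k * int n" using j by(auto simp: i_def algebra_simps abs_le_iff max_def min_def)
		hence "g [^] (j - i) : T" by(rule T(2)[OF g])
		moreover have "g [^] i : U" by(rule Q_mem_U[OF Q_int_pow[OF g]]) (auto simp: i_def)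
		moreover have "g [^] j = g [^] (j - i)**g [^] i" using g Q_carrier by(subst int_pow_mult[symmetric]) auto
		ultimately show "g [^] j : {a**b | a b. a : T & b : U}" by blast
	qed
qed

text \<open>If no finite set works, each pair \<open>p\<close> of a finite set and a bound has a
  counterexample \<open>r p\<close> in \<open>Q (N p)\<close>. Along an ultrafilter on the pairs,
  rescaled powers of \<open>r p\<close> converge to a one-parameter subgroup \<open>c\<close>, which
  eventually belongs to the finite set. So some exponent violates the bound for \<open>c\<close>;
  but there the power of \<open>r p\<close> and the value of \<open>c\<close> have the same
  limit.\<close>

lemma finite_ops:
	assumes W: "nb W"
	shows "EX F n0. finite F & (ALL c:F. ops c) &
		(ALL n>=n0. ALL r:Q n. EX c:F. ALL i<=n. r [^] i**inv (c (real i / real n)) : W)"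
proof(rule ccontr)
	assume non: "~ ?thesis"
	define A where "A n r F \<longleftrightarrow> (EX c:F. ALL i<=n. r [^] i**inv (c (real i / real n)) : W)" for n :: nat and r F
	have nA: "EX i<=n. r [^] i**inv (c (real i / real n)) ~: W" if "~ A n r F" "c : F" for n r F c
		using that unfolding A_def by(simp only: bex_simps not_all not_imp)
	have non': "~ (EX F n0. finite F & (ALL c:F. ops c) & (ALL n>=n0. ALL r:Q n. A n r F))"
		unfolding A_def by(rule non)
	have "EX n r. finite F & F <= Collect ops --> n0 <= n & r : Q n & ~ A n r F" for F n0
		using non' by blast
	hence "ALL p. EX nr. finite (fst p) & fst p <= Collect ops --> snd p <= fst nr & snd nr : Q (fst nr) & ~ A (fst nr) (snd nr) (fst p)"
		by simp
	from choice[OF this] obtain nr where nr: "ALL p. finite (fst p) & fst p <= Collect ops -->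
			snd p <= fst (nr p) & snd (nr p) : Q (fst (nr p)) & ~ A (fst (nr p)) (snd (nr p)) (fst p)" by(elim exE)
	define N r where "N p = fst (nr p)" and "r p = snd (nr p)" for p
	have Nr: "snd p <= N p" "r p : Q (N p)" "~ A (N p) (r p) (fst p)" if "finite (fst p) & fst p <= Collect ops" for p
		using nr[THEN spec, THEN mp, OF that] by(simp_all add: N_def r_def)
	let ?F = "finite_subsets_at_top (Collect ops) \<times>\<^sub>F (sequentially :: nat filter)"
	have "?F ~= bot" by(simp add: prod_filter_eq_bot)
	then obtain S where u: "S <= ?F" "ultra S" by(rule ultra_exists)
	have fin: "eventually (%p. finite (fst p) & fst p <= Collect ops) S"
	proof(rule filter_leD[OF u(1)])
		have "eventually (%F. finite F & F <= Collect ops) (finite_subsets_at_top (Collect ops))"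
			unfolding eventually_finite_subsets_at_top by(intro exI[of _ "{}"]) auto
		from eventually_prod1[THEN iffD2, OF _ this, of sequentially]
		show "eventually (%p. finite (fst p) & fst p <= Collect ops) ?F" by(simp add: case_prod_unfold)
	qed
	have rQ: "eventually (%p. r p : Q (N p)) S" using fin by eventually_elim (rule Nr)
	have Nk: "eventually (%p. k <= N p) S" for k
	proof -
		have "eventually (%p. k <= snd p) ?F"
			using eventually_prod2[THEN iffD2, OF _ eventually_ge_at_top[of k], of "finite_subsets_at_top (Collect ops)"]
			by(simp add: case_prod_unfold)
		hence "eventually (%p. k <= snd p) S" by(rule filter_leD[OF u(1)])
		with fin show ?thesis
		proof eventually_elim
			case (elim p) thus ?case using Nr(1)[of p] by linarith
		qed
	qed
	have pow1: "limitin X (%p. r p [^] (d p :: int)) \<one> S"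
		if d: "!!k. k > 0 ==> eventually (%p. abs (d p) * int k <= int (N p)) S" for d
	proof(rule limit_one)
		fix V assume "nb V"
		then obtain k where k: "k > 0" "Q k <= V" using Q_small by blast
		show "eventually (%p. r p [^] d p : V) S" using d[OF k(1)] rQ
			by eventually_elim (use Q_int_pow k(2) in blast)
	qed
	\<comment> \<open>Time \<open>t\<close> corresponds to about \<open>t * N p\<close> powers.
	  Rounding errors that are small compared with \<open>N p\<close> are harmless, because by
	  \<open>pow1\<close> the corresponding powers tend to the identity.\<close>
	define x where "x t p = r p [^] \<lfloor>t * real (N p)\<rfloor>" for t p
	have "EX l. limitin X (x t) l S" for t
	proof -
		obtain k :: nat where k: "abs t + 1 <= real k" using real_arch_simple by blast
		obtain T where T: "compactin X T" "!!n g j. g : Q n ==> abs j <= int k * int n ==> g [^] (j::int) : T"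
			using powers_compact[of k] by blast
		have "eventually (%p. x t p : T) S" using rQ Nk[of 1]
		proof eventually_elim
			case (elim p)
			have "abs (t * real (N p)) + 1 <= (abs t + 1) * real (N p)" using elim(2) by(simp add: abs_mult algebra_simps)
			also have "... <= real k * real (N p)" using k by(intro mult_right_mono) auto
			finally have "abs (\<lfloor>t * real (N p)\<rfloor>) <= int k * int (N p)"
			proof -
				assume *: "abs (t * real (N p)) + 1 <= real k * real (N p)"
				have "abs (real_of_int \<lfloor>t * real (N p)\<rfloor>) <= abs (t * real (N p)) + 1" by linarith
				hence "real_of_int \<bar>\<lfloor>t * real (N p)\<rfloor>\<bar> <= real_of_int (int k * int (N p))" using * by simp
				thus ?thesis by(simp only: of_int_le_iff)
			qed
			thus ?case unfolding x_def by(rule T(2)[OF elim(1)])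
		qed
		thus ?thesis using ultra_compactin[OF u(2) T(1)] by metis
	qed
	then obtain c where c: "!!t. limitin X (x t) (c t) S" by metis
	have add: "c (s + t) = c s**c t" for s t
	proof(rule limit_unique[OF u(2) c])
		define d where "d p = \<lfloor>(s + t) * real (N p)\<rfloor> - \<lfloor>s * real (N p)\<rfloor> - \<lfloor>t * real (N p)\<rfloor>" for p
		have d01: "abs (d p) <= 1" for p unfolding d_def distrib_right by linarith
		have "limitin X (%p. r p [^] d p) \<one> S"
		proof(rule pow1)
			fix k :: nat
			show "eventually (%p. abs (d p) * int k <= int (N p)) S" using Nk[of k]
			proof eventually_elim
				case (elim p)
				have "abs (d p) * int k <= 1 * int k" by(rule mult_right_mono[OF d01]) simp
				thus ?case using elim by linarith
			qed
		qed
		from limit_mult[OF limit_mult[OF c c] this]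
		have "limitin X (%p. x s p**x t p**r p [^] d p) (c s**c t) S"
			using limit_carrier[OF c] by simp
		moreover have "eventually (%p. x s p**x t p**r p [^] d p = x (s + t) p) S" using rQ
		proof eventually_elim
			case (elim p)
			hence "r p : carrier L" using Q_carrier by blast
			thus ?case by(simp add: x_def int_pow_mult[symmetric] d_def)
		qed
		ultimately show "limitin X (x (s + t)) (c s**c t) S" by(rule limitin_transform_eventually[rotated])
	qed
	have inU: "c s : U" if s: "abs s <= 1" for s
	proof(rule limitin_in_closed[OF c closed_of_compact[OF Uc] u(2)])
		show "eventually (%p. x s p : U) S" using rQ
		proof eventually_elim
			case (elim p)
			have "abs (s * real (N p)) <= 1 * real (N p)" unfolding abs_mult by(intro mult_mono) (use s in auto)
			hence "abs (\<lfloor>s * real (N p)\<rfloor>) * int 1 <= int (N p)" by linarith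
			thus ?case unfolding x_def by(rule Q_mem_U[OF Q_int_pow[OF elim]])
		qed
	qed
	have op: "ops c" unfolding ops_def using add inU limit_carrier[OF c] by blast
	have "eventually (%F. c : F) (finite_subsets_at_top (Collect ops))"
		unfolding eventually_finite_subsets_at_top using op by(intro exI[of _ "{c}"]) auto
	from eventually_prod1[THEN iffD2, OF _ this, of sequentially]
	have "eventually (%p. c : fst p) ?F" by(simp add: case_prod_unfold)
	hence "eventually (%p. c : fst p) S" by(rule filter_leD[OF u(1)])
	with fin have bad: "eventually (%p. EX i<=N p. r p [^] i**inv (c (real i / real (N p))) ~: W) S"
		by eventually_elim (rule nA[OF Nr(3)])
	have "ALL p. EX i. (EX i<=N p. r p [^] i**inv (c (real i / real (N p))) ~: W) -->
			i <= N p & r p [^] i**inv (c (real i / real (N p))) ~: W" by blast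
	from choice[OF this] obtain i where i: "ALL p. (EX i<=N p. r p [^] i**inv (c (real i / real (N p))) ~: W) -->
			i p <= N p & r p [^] i p**inv (c (real (i p) / real (N p))) ~: W" by(elim exE)
	have bad: "eventually (%p. i p <= N p & r p [^] i p**inv (c (real (i p) / real (N p))) ~: W) S"
		using bad by eventually_elim (rule i[THEN spec, THEN mp])
	define s where "s p = real (i p) / real (N p)" for p
	have "eventually (%p. 0 <= s p & s p <= 1) S" using bad
		by eventually_elim (auto simp: s_def divide_le_eq_1)
	then obtain t where t: "0 <= t" "t <= 1" "(s \<longlongrightarrow> t) S" by(rule ultra_real[OF u(2)])
	define d where "d p = int (i p) - \<lfloor>t * real (N p)\<rfloor>" for p
	have "limitin X (%p. r p [^] d p) \<one> S"
	proof(rule pow1)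
		fix k :: nat assume k: "k > 0"
		have "eventually (%p. dist (s p) t < 1 / (2 * real k)) S" using k by(intro tendstoD[OF t(3)]) simp
		with Nk[of "2 * k"] show "eventually (%p. abs (d p) * int k <= int (N p)) S"
		proof eventually_elim
			case (elim p)
			have N0: "0 < real (N p)" using elim(1) k by simp
			have "real (i p) - t * real (N p) = (s p - t) * real (N p)" using N0 by(simp add: s_def algebra_simps)
			hence "abs (real (i p) - t * real (N p)) = abs (s p - t) * real (N p)" by(simp add: abs_mult)
			also have "... <= 1 / (2 * real k) * real (N p)" using elim(2) N0 by(intro mult_right_mono) (simp_all add: dist_real_def)
			finally have "abs (real (i p) - t * real (N p)) <= real (N p) / (2 * real k)" by simp
			hence "real_of_int \<bar>d p\<bar> <= real (N p) / (2 * real k) + 1" unfolding d_def by linarith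
			hence "real_of_int \<bar>d p\<bar> * real k <= (real (N p) / (2 * real k) + 1) * real k" by(rule mult_right_mono) simp
			also have "... = real (N p) / 2 + real k" using k by(simp add: field_simps)
			also have "... <= real (N p)" using elim(1) by simp
			finally have "real_of_int (abs (d p) * int k) <= real_of_int (int (N p))" by simp
			thus ?case by(simp only: of_int_le_iff)
		qed
	qed
	from limit_mult[OF limit_mult[OF c[of t] this] limit_inv[OF ops_limit[OF op t(3)]]]
	have lim: "limitin X (%p. x t p**r p [^] d p**inv (c (s p))) \<one> S"
		using opsD(1)[OF op] by simp
	have "eventually (%p. x t p**r p [^] d p**inv (c (s p)) : W) S"
		by(rule limitinD[OF lim nbD(1,2)[OF W]])
	with bad rQ have "eventually (%p. False) S"
	proof eventually_elim
		case (elim p)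
		have "r p : carrier L" using elim(2) Q_carrier by blast
		hence "x t p**r p [^] d p = r p [^] i p" by(simp add: x_def int_pow_mult[symmetric] d_def int_pow_int)
		thus ?case using elim(1,3) by(simp add: s_def)
	qed
	from ultra_ex[OF u(2) this] show False by simp
qed

section \<open>Ordered products of one-parameter subgroups\<close>

primrec pr :: "(nat => real => 'a) => (nat => real) => nat => 'a" where
	"pr c t 0 = \<one>"
| "pr c t (Suc n) = pr c t n**c n (t n)"

lemma pr_carrier: "(!!j. j < n ==> ops (c j)) ==> pr c t n : carrier L"
	by(induction n) (simp_all add: opsD(1))

lemma pr_update: "n <= j ==> pr c (t(j := s)) n = pr c t n"
	by(induction n) simp_all

text \<open>A factor \<open>c j s\<close> in front is moved to place \<open>j\<close> past the
  prefix \<open>pr c t j\<close>, at the cost of a commutator. For a small prefix this commutator is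
  of higher order, which drives the iteration in \<open>ops_cover\<close>.\<close>

lemma pr_shift:
	assumes "!!j. j < n ==> ops (c j)" and "j < n"
	shows "c j s**pr c t n = c j s**inv (pr c t j**c j s**inv (pr c t j))**pr c (t(j := t j + s)) n"
	using assms
proof(induction n)
	case (Suc n)
	note o = Suc.prems(1)
	have car: "pr c u i : carrier L" if "i <= n" for i u using o that by(intro pr_carrier) simp
	have g: "c i u : carrier L" if "i <= n" for i u using o that by(intro opsD(1)) simp
	define u where "u = t(j := t j + s)"
	have u: "u j = t j + s" "!!i. i ~= j ==> u i = t i" "pr c u j = pr c t j"
		unfolding u_def by(simp, simp, rule pr_update[OF order_refl])
	have "c j s**pr c t (Suc n) = c j s**inv (pr c t j**c j s**inv (pr c t j))**pr c u (Suc n)"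
	proof(cases "j = n")
		case True
		have "c n (t n + s) = c n s**c n (t n)" using opsD(2)[OF o[of n], of s "t n"] by(simp add: add.commute)
		thus ?thesis using True car[of n] g[of n] u by(simp add: m_assoc inv_mult_group inv_cancel)
	next
		case False
		hence j: "j < n" using Suc.prems(2) by simp
		have "c j s**pr c t (Suc n) = (c j s**pr c t n)**c n (t n)" using j car g by(simp add: m_assoc)
		also have "c j s**pr c t n = c j s**inv (pr c t j**c j s**inv (pr c t j))**pr c u n"
			unfolding u_def by(rule Suc.IH) (use o j in auto)
		finally show ?thesis using False j car g u(2)[of n] by(simp add: m_assoc)
	qed
	thus ?case unfolding u_def .
qed simp

lemma pr_limit:
	assumes "!!j. j < n ==> ops (c j)" "!!j. j < n ==> ((%l. t l j) \<longlongrightarrow> s j) F"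
	shows "limitin X (%l. pr c (t l) n) (pr c s n) F"
	using assms
proof(induction n)
	case 0 show ?case unfolding pr.simps(1) by(rule limit_one) (simp add: nbD(2))
next
	case (Suc n)
	show ?case unfolding pr.simps by(intro limit_mult ops_limit Suc.IH Suc.prems) simp_all
qed

lemma sprod_small:
	assumes "nb V"
	shows "EX M. nb M & sprod M n <= V"
	using assms
proof(induction n arbitrary: V)
	case 0 thus ?case using nb_carrier nbD(2) by auto
next
	case (Suc n)
	obtain N where N: "nb N" "!!x y. x : N ==> y : N ==> x**y : V" using nb_mult[OF Suc.prems] by metis
	obtain M where M: "nb M" "sprod M n <= N" using Suc.IH[OF N(1)] by blast
	have "sprod (M Int N) n <= N" using sprod_subset[of "M Int N" M n] M(2) by blast
	hence "sprod (M Int N) (Suc n) <= V" using N(2) by auto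
	thus ?case using nb_Int[OF M(1) N(1)] by blast
qed

lemma pr_sprod:
	assumes "P <= carrier L" "\<one> : P" "!!j. j < n ==> c j (t j) : P"
	shows "pr c t n : sprod P n"
	using assms
proof(induction n)
	case (Suc n)
	have "pr c t n**c n (t n) : sprod P (n + 1)"
		by(rule sprod_add[OF assms(1) Suc.IH]) (use Suc.prems sprod_one[OF assms(1)] in auto)
	thus ?case by(simp del: sprod.simps)
qed simp

text \<open>Successive approximation: \<open>x = r**pr g t d\<close> with \<open>r\<close> in
  \<open>Q n\<close>, and one step replaces \<open>r\<close> by an element of
  \<open>Q (2 * n)\<close> while one time increases by \<open>1 / n\<close>. A one-parameter
  subgroup that follows the powers of \<open>r\<close> makes \<open>r**inv b\<close> small by
  \<open>Q_quotient\<close>; the commutator from \<open>pr_shift\<close> is small for the same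
  reason. In the limit the remainder disappears.\<close>

lemma ops_cover:
	"EX n0. ALL x:Q n0. EX d g t. (ALL j<d. ops (g j)) & x = pr g t d"
proof -
	obtain N0 where N0: "nb N0" "N0 <= U" using Unb by blast
	obtain N2 where N2: "nb N2" "!!x y. x : N2 ==> y : N2 ==> x**y : N0" using nb_mult[OF N0(1)] by metis
	obtain N3 where N3: "nb N3" "N3 <= N2" "!!x. x : N3 ==> inv x : N3" "!!x y. x : N3 ==> y : N3 ==> x**y : N2"
		by(rule nb_mult[OF N2(1)]) (rule that; assumption)
	have conjU: "p**u**inv p : U" if "p : N3" "u : N3" for p u
	proof -
		have "p**u : N2" "inv p : N2" using N3(2) N3(3)[OF that(1)] N3(4)[OF that] by blast+
		thus ?thesis using N2(2) N0(2) by blast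
	qed
	obtain q where q: "q > 0" "Q q <= N3" using Q_small[OF N3(1)] by blast
	obtain c where c: "0 < c" "!!n. 0 < n ==> sprod (Q (c * n)) n <= U" using Q_sprod[OF Uc N0] by blast
	\<comment> \<open>With both errors in \<open>Q (4 * c * n)\<close>, the powers of their product up
	  to \<open>2 * n\<close> are products of at most \<open>4 * n\<close> such elements and lie in
	  \<open>U\<close> by the choice of \<open>c\<close>. The factor \<open>8 * c * q\<close> below
	  makes up for replacing \<open>n\<close> by \<open>n div q\<close>, the range in which the
	  conjugated powers of \<open>b\<close> are known to stay in \<open>U\<close>.\<close>
	obtain W1 n1 where W1: "nb W1" "!!n a b. n1 <= n ==> a : Q n ==> b : Q n ==> (ALL i<=n. a [^] i**inv (b [^] i) : W1) ==> a**inv b : Q ((4 * c) * n)"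
		using Q_quotient[of "4 * c"] by(elim exE conjE) (rule that, assumption, blast)
	obtain W2 n2 where W2: "nb W2" "0 < n2" "!!n a b. n2 <= n ==> a : Q n ==> b : Q n ==> (ALL i<=n. a [^] i**inv (b [^] i) : W2) ==> a**inv b : Q ((8 * c * q) * n)"
		using Q_quotient[of "8 * c * q"] by(elim exE conjE) (rule that, assumption, assumption, blast)
	have cm: "continuous_map (prod_topology X X) X (%z. fst z**snd z**inv (fst z)**inv (snd z))" by(intro cont_intros)
	obtain N4 where N4: "nb N4" "!!k w. k : U ==> w : N4 ==> k**w**inv k**inv w : W2"
		by(rule tube[OF Uc nbD(1)[OF W2(1)] cm]) (use nbD(2)[OF W2(1)] U_carrier that in auto)
	obtain F n3 where F: "finite F" "ALL g:F. ops g"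
		"!!n r. n3 <= n ==> r : Q n ==> EX g:F. ALL i<=n. r [^] i**inv (g (real i / real n)) : W1"
		using finite_ops[OF W1(1)] by(elim exE conjE) (rule that, assumption, assumption, blast)
	obtain xs where xs: "set xs = F" using finite_list[OF F(1)] by blast
	define d where "d = length xs"
	define g where "g j = xs ! j" for j
	have op: "ops (g j)" if "j < d" for j using F(2) xs that nth_mem[of j xs] by(simp add: g_def d_def)
	have near: "EX j<d. ALL i<=n. r [^] i**inv (g j (real i / real n)) : W1" if "n3 <= n" "r : Q n" for n r
		using F(3)[OF that] unfolding xs[symmetric] g_def d_def by(metis in_set_conv_nth)
	obtain M where M: "nb M" "sprod M d <= N3 Int N4" using sprod_small[OF nb_Int[OF N3(1) N4(1)]] by blast
	obtain k where k: "k > 0" "Q k <= M" using Q_small[OF M(1)] by blast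
	define n0 where "n0 = n1 + q * n2 + n3 + 2 * k"
	have n00: "n0 > 0" using k(1) by(simp add: n0_def)
	have step: "EX j<d. EX r':Q (2 * n). r**pr g t d = r'**pr g (t(j := t j + 1 / real n)) d"
		if n: "n0 <= n" and r: "r : Q n" and t: "!!i. abs (t i) <= 2 / real n0" for n r t
	proof -
		have nn: "n1 <= n" "q * n2 <= n" "n3 <= n" "0 < n" using n k(1) by(auto simp: n0_def)
		have rL: "r : carrier L" using r Q_carrier by blast
		obtain j where j: "j < d" "ALL i<=n. r [^] i**inv (g j (real i / real n)) : W1" using near[OF nn(3) r] by blast
		define b where "b = g j (1 / real n)"
		have bi: "b [^] i = g j (real i / real n)" for i using ops_pow[OF op[OF j(1)], of i "1 / real n"] by(simp add: b_def)
		have bL: "b : carrier L" using opsD(1)[OF op[OF j(1)]] by(simp add: b_def)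
		have bQ: "b : Q n" unfolding b_def by(rule ops_Q[OF op[OF j(1)]]) (use nn(4) in simp)
		have r': "r**inv b : Q (4 * c * n)" by(rule W1(2)[OF nn(1) r bQ]) (use j(2) in "simp add: bi")
		define P where "P = pr g t j"
		have gk: "g i (t i) : Q k" if "i < d" for i
		proof(rule ops_Q[OF op[OF that]])
			have "2 / real n0 <= 2 / real (2 * k)" using k(1) n00 unfolding n0_def by(intro divide_left_mono) (simp_all del: of_nat_mult of_nat_add)
			hence "2 / real n0 <= 1 / real k" using k(1) by simp
			hence "abs (t i) <= 1 / real k" using t[of i] by linarith
			thus "abs (t i) * real k <= 1" using k(1) by(simp add: field_simps)
		qed
		have "P : sprod (Q k) j" unfolding P_def by(rule pr_sprod[OF Q_carrier Q_one]) (use gk j(1) in auto)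
		hence "P : sprod (Q k) d" using sprod_mono[OF Q_carrier Q_one, of j d] j(1) by auto
		hence PN: "P : N3" "P : N4" using sprod_subset[OF k(2)] M(2) by blast+
		have PL: "P : carrier L" using nbD(3)[OF N3(1) PN(1)] .
		define b' where "b' = P**b**inv P"
		have b'L: "b' : carrier L" using PL bL by(simp add: b'_def)
		have b'i: "b' [^] i = P**b [^] i**inv P" for i :: nat
			by(induction i) (use PL bL in "simp_all add: b'_def m_assoc inv_cancel")
		define n' where "n' = n div q"
		have n'n: "n' <= n" "n' * q <= n" by(simp_all add: n'_def)
		have n'2: "n2 <= n'" using div_le_mono[OF nn(2), of q] q(1) by(simp add: n'_def)
		have "n < q * n' + q" unfolding n'_def using q(1) by(metis add.commute dividend_less_times_div)
		also have "q * n' + q <= 2 * (q * n')" using n'2 W2(2) by simp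
		finally have "4 * c * n <= 4 * c * (2 * (q * n'))" by(intro mult_le_mono2) simp
		hence n2q: "4 * c * n <= 8 * c * q * n'" by(simp add: ac_simps)
		have b'Q: "b' : Q n'"
		proof -
			have "b' [^] i : U" if "i <= n'" for i
			proof -
				have "i * q <= n' * q" using that by simp
				hence "b [^] i : Q q" using n'n(2) by(intro Q_pow[OF bQ]) linarith
				thus ?thesis unfolding b'i using q(2) PN(1) by(intro conjU) blast+
			qed
			thus ?thesis using b'L by(simp add: Q_def)
		qed
		have "b**inv b' : Q (8 * c * q * n')"
		proof(rule W2(3)[OF n'2 _ b'Q])
			show "b : Q n'" using bQ Q_anti[OF n'n(1)] by blast
			show "ALL i<=n'. b [^] i**inv (b' [^] i) : W2"
			proof(intro allI impI)
				fix i assume "i <= n'"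
				hence "b [^] i : U" using n'n(1) by(intro Q_U[OF bQ]) simp
				from N4(2)[OF this PN(2)] show "b [^] i**inv (b' [^] i) : W2"
					unfolding b'i using PL bL by(simp add: m_assoc inv_mult_group)
			qed
		qed
		hence r'': "b**inv b' : Q (4 * c * n)" using Q_anti[OF n2q] by blast
		define Z where "Z = Q (c * (4 * n))"
		have ZL: "Z <= carrier L" unfolding Z_def by(rule Q_carrier)
		have Z: "r**inv b : Z" "b**inv b' : Z" using r' r'' by(simp_all add: Z_def mult.commute mult.left_commute)
		define w where "w = (r**inv b)**(b**inv b')"
		have wL: "w : carrier L" using Z ZL by(auto simp: w_def)
		have w2: "w : sprod Z (1 + 1)" unfolding w_def by(rule sprod_add[OF ZL]) (use Z sprod_one[OF ZL] in auto)
		have "w [^] i : sprod Z (2 * i)" for i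
		proof(induction i)
			case (Suc i)
			have "w [^] i**w : sprod Z (2 * i + (1 + 1))" by(rule sprod_add[OF ZL Suc w2])
			thus ?case by simp
		qed simp
		hence "w [^] i : sprod Z (4 * n)" if "i <= 2 * n" for i
			using sprod_mono[OF ZL, of "2 * i" "4 * n"] that Q_one by(auto simp: Z_def)
		hence wQ: "w : Q (2 * n)" using c(2)[of "4 * n"] nn(4) wL by(auto simp: Q_def Z_def)
		have "r**pr g t d = r**inv b**(b**pr g t d)"
			using rL bL pr_carrier[of d g t] op by(simp add: m_assoc inv_cancel)
		also have "b**pr g t d = b**inv b'**pr g (t(j := t j + 1 / real n)) d"
			unfolding b'_def b_def P_def by(rule pr_shift[OF op j(1)])
		finally have "r**pr g t d = w**pr g (t(j := t j + 1 / real n)) d"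
			using rL bL b'L pr_carrier[of d g] op by(simp add: w_def m_assoc)
		thus ?thesis using j(1) wQ by blast
	qed
	show ?thesis
	proof(rule exI[of _ n0], rule ballI)
		fix x assume x: "x : Q n0"
		have xL: "x : carrier L" using x Q_carrier by blast
		\<comment> \<open>At stage \<open>l\<close> one time grows by \<open>1 / (2 ^ l * n0)\<close>; the
		  bound is the partial sum of this geometric series, and the limit \<open>2 / n0\<close> keeps
		  every prefix small enough for \<open>step\<close>.\<close>
		define P where "P l rt \<longleftrightarrow> fst rt : Q (2 ^ l * n0) & (ALL i. abs (snd rt i) <= 2 / real n0 - 2 / (2 ^ l * real n0)) & x = fst rt**pr g (snd rt) d"
			for l :: nat and rt :: "'a \<times> (nat => real)"
		have "EX f. ALL l. P l (f l) & True"
		proof(rule dependent_nat_choice[where P = P and Q = "%_ _ _. True"])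
			have "pr g (%_. 0) n = \<one>" if "n <= d" for n using that by(induction n) (simp_all add: ops_zero op)
			thus "EX rt. P 0 rt" using x xL unfolding P_def by(intro exI[of _ "(x, %_. 0)"]) simp
			fix rt l assume h: "P l rt"
			obtain r t where rt: "rt = (r, t)" by(cases rt)
			have r: "r : Q (2 ^ l * n0)" and t: "!!i. abs (t i) <= 2 / real n0 - 2 / (2 ^ l * real n0)" and xr: "x = r**pr g t d"
				using h unfolding P_def rt by simp_all
			have "0 <= 2 / (2 ^ l * real n0)" by simp
			hence t2: "abs (t i) <= 2 / real n0" for i using t[of i] by linarith
			obtain j r' where j: "j < d" "r' : Q (2 * (2 ^ l * n0))" "r**pr g t d = r'**pr g (t(j := t j + 1 / real (2 ^ l * n0))) d"
				using step[of "2 ^ l * n0" r t, OF _ r t2] by(auto simp del: of_nat_mult)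
			let ?t = "t(j := t j + 1 / real (2 ^ l * n0))"
			have "abs (?t i) <= 2 / real n0 - 2 / (2 ^ Suc l * real n0)" for i
			proof -
				have "abs (?t i) <= abs (t i) + 1 / (2 ^ l * real n0)" by(simp add: abs_triangle_ineq[THEN order_trans])
				moreover have "2 / (2 ^ l * real n0) = 2 * (1 / (2 ^ l * real n0))" "2 / (2 ^ Suc l * real n0) = 1 / (2 ^ l * real n0)"
					using n00 by simp_all
				ultimately show ?thesis using t[of i] by linarith
			qed
			thus "EX rt'. P (Suc l) rt' & True" unfolding P_def
				by(intro exI[of _ "(r', ?t)"]) (use j xr in "simp add: mult.assoc del: of_nat_mult")
		qed
		then obtain f where f: "!!l. P l (f l)" by blast
		define r t where "r l = fst (f l)" and "t l = snd (f l)" for l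
		have r: "r l : Q (2 ^ l * n0)" and t: "abs (t l i) <= 2 / real n0 - 2 / (2 ^ l * real n0)" and xr: "x = r l**pr g (t l) d" for l i
			using f[of l] unfolding P_def r_def t_def by simp_all
		obtain W :: "nat filter" where u: "ultra W" "W <= sequentially" by(rule ultra_nat)
		have "EX s. ((%l. t l i) \<longlongrightarrow> s) W" for i
		proof -
			have "- (2 / real n0) <= t l i & t l i <= 2 / real n0" for l
			proof -
				have "0 <= 2 / (2 ^ l * real n0)" by simp
				thus ?thesis using t[of l i] by linarith
			qed
			hence "eventually (%l. - (2 / real n0) <= t l i & t l i <= 2 / real n0) W" by simp
			thus ?thesis by(rule ultra_real[OF u(1)]) blast
		qed
		then obtain v where v: "!!i. ((%l. t l i) \<longlongrightarrow> v i) W" by metis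
		have "limitin X r \<one> W"
		proof(rule limit_one)
			fix V assume "nb V"
			then obtain m where m: "Q m <= V" using Q_small by blast
			have "eventually (%l. r l : V) sequentially" using eventually_ge_at_top[of m]
			proof eventually_elim
				case (elim l)
				have "m <= 2 ^ l" using elim less_exp[of l] by linarith
				also have "... <= 2 ^ l * n0" using n00 by simp
				finally show ?case using r[of l] Q_anti m by blast
			qed
			thus "eventually (%l. r l : V) W" by(rule filter_leD[OF u(2)])
		qed
		from limit_mult[OF this pr_limit[of d g t v, OF op v]]
		have "limitin X (%l. x) (\<one>**pr g v d) W" unfolding xr[symmetric] .
		moreover have "limitin X (%l. x) x W" using xL by(simp add: topspace)
		ultimately have "\<one>**pr g v d = x" by(rule limit_unique[OF u(1)])
		hence "x = pr g v d" using pr_carrier[of d g v] op by simp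
		thus "EX d g t. (ALL j<d. ops (g j)) & x = pr g t d" using op by blast
	qed
qed

theorem nss_kernel:
	assumes G: "group G" and f: "f : hom L G" and kill: "!!c s. ops c ==> f (c s) = one G"
	shows "EX N. nb N & (ALL x:N. f x = one G)"
proof -
	interpret f: group_hom L G f
		using G f is_group by(intro group_homI)
	obtain n0 where n0: "ALL x:Q n0. EX d c t. (ALL j<d. ops (c j)) & x = pr c t d" using ops_cover by blast
	have k: "f (pr c t d) = one G" if "!!j. j < d ==> ops (c j)" for d c t
		using that by(induction d) (simp_all add: kill pr_carrier opsD(1))
	have "f x = one G" if h: "x : Q n0" for x
	proof -
		obtain d c t where "ALL j<d. ops (c j)" "x = pr c t d" using n0[THEN bspec, OF h] by(elim exE conjE)
		thus ?thesis using k[of d c t] by simp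
	qed
	thus ?thesis using Q_nb[of n0] by blast
qed

end

section \<open>Slender groups are lch-slender\<close>

abbreviation int_seq :: "(nat => int) monoid" where
	"int_seq \<equiv> product_group UNIV (%_. integer_group)"

lemma int_seq [simp]:
	"group int_seq" "carrier int_seq = UNIV" "one int_seq = (%_. 0)"
	"x **\<^bsub>int_seq\<^esub> y = (%i. x i + y i)"
	by(auto simp: PiE_UNIV_domain)

declare restrict_UNIV [simp]

lemma slender_iff:
	"slender G \<longleftrightarrow> group G & (ALL f:hom int_seq G. EX n. ALL x. (ALL i<n. x i = 0) --> f x = one G)"
proof(intro iffI conjI ballI)
	assume G: "slender G"
	show g: "group G" using G by(simp add: slender_def)
	fix f assume f: "f : hom int_seq G"
	interpret f: group_hom int_seq G f using f g by(auto intro: group_homI)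
	obtain n h where n: "!!x. f x = h (restrict x {..<n})"
		using conjunct2[OF G[unfolded slender_def], THEN bspec, OF f] unfolding int_seq(2)
		by(elim exE bexE) (rule that, erule bspec, rule UNIV_I)
	have "f x = one G" if "ALL i<n. x i = 0" for x
	proof -
		have "restrict x {..<n} = restrict (%_. 0) {..<n}" using that by(auto simp: restrict_def)
		hence "f x = f (%_. 0)" by(simp only: n)
		thus ?thesis using f.hom_one by simp
	qed
	thus "EX n. ALL x. (ALL i<n. x i = 0) --> f x = one G" by blast
next
	assume R: "group G & (ALL f:hom int_seq G. EX n. ALL x. (ALL i<n. x i = 0) --> f x = one G)"
	show "slender G"
		unfolding slender_def
	proof(intro conjI ballI)
		show g: "group G" using R by blast
		fix f assume f: "f : hom int_seq G"
		interpret f: group_hom int_seq G f using f g by(auto intro: group_homI)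
		obtain n where n: "!!x. (ALL i<n. x i = 0) ==> f x = one G"
			using conjunct2[OF R, THEN bspec, OF f] by(elim exE) (rule that, blast)
		define e where "e y = (%i. if i < n then y i else 0)" for y :: "nat => int"
		show "EX n. EX h:hom (product_group {..<n} (%_. integer_group)) G.
				ALL x:carrier int_seq. f x = h (restrict x {..<n})"
		proof(intro exI[of _ n] bexI[of _ "%y. f (e y)"] ballI)
			fix x :: "nat => int"
			have "f (%i. e (restrict x {..<n}) i + (x i - e (restrict x {..<n}) i)) = f (e (restrict x {..<n})) **\<^bsub>G\<^esub> f (%i. x i - e (restrict x {..<n}) i)"
				using f.hom_mult[of "e (restrict x {..<n})" "%i. x i - e (restrict x {..<n}) i"] by simp
			moreover have "f (%i. x i - e (restrict x {..<n}) i) = one G" by(rule n) (simp add: e_def)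
			ultimately show "f x = f (e (restrict x {..<n}))" using f.hom_closed by simp
		next
			show "(%y. f (e y)) : hom (product_group {..<n} (%_. integer_group)) G"
			proof(rule homI)
				fix x y :: "nat => int"
				show "f (e x) : carrier G" using f.hom_closed by simp
				have "e (\<lambda>i\<in>{..<n}. x i + y i) = (%i. e x i + e y i)" by(auto simp: e_def)
				thus "f (e (x **\<^bsub>product_group {..<n} (%_. integer_group)\<^esub> y)) = f (e x) **\<^bsub>G\<^esub> f (e y)"
					using f.hom_mult[of "e x" "e y"] by simp
			qed
		qed
	qed
qed

definition int_unit :: "nat => nat => int" where
	"int_unit n = (%i. if i = n then 1 else 0)"

lemma slender_unit:
	assumes "slender G" "f : hom int_seq G"
	obtains n where "f (int_unit n) = one G"
proof -
	obtain n where "ALL x. (ALL i<n. x i = 0) --> f x = one G"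
		using conjunct2[OF assms(1)[unfolded slender_iff], THEN bspec, OF assms(2)] by(elim exE)
	from this[THEN spec, of "int_unit n"] show ?thesis by(intro that[of n]) (simp add: int_unit_def)
qed

lemma (in lch_grp) compact_int_seq_hom:
	assumes K: "subgroup K L" "compactin X K" and x: "x : K"
	obtains F where "F : hom int_seq L" "!!n. F (int_unit n) = x"
proof -
	obtain U :: "nat filter" where u: "ultra U" "U <= sequentially" by(rule ultra_nat)
	have xL: "x : carrier L" by(rule compactinD_carrier[OF K(2) x])
	have "EX l. limitin X (%n. x [^] (\<Sum>i<n. a i)) l U" for a :: "nat => int"
		by(rule ultra_compactin[OF u(1) K(2), of "%n. x [^] (\<Sum>i<n. a i)"])
			(use subgroup_int_pow_closed[OF K(1) x] in auto)
	then obtain F where F: "!!a :: nat => int. limitin X (%n. x [^] (\<Sum>i<n. a i)) (F a) U" by metis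
	have "F : hom int_seq L"
	proof(rule homI)
		fix a b
		show "F a : carrier L" by(rule limit_carrier[OF F])
		have "limitin X (%n. x [^] (\<Sum>i<n. a i + b i)) (F a**F b) U"
			using limit_mult[OF F[of a] F[of b]] by(simp add: int_pow_mult[OF xL, symmetric] sum.distrib)
		thus "F (a **\<^bsub>int_seq\<^esub> b) = F a**F b"
			using limit_unique[OF u(1) F[of "%i. a i + b i"]] by simp
	qed
	moreover have "F (int_unit m) = x" for m
	proof(rule limit_unique[OF u(1) F])
		have "eventually (%n. x = x [^] (\<Sum>i<n. int_unit m i)) sequentially"
			using eventually_gt_at_top[of m] by eventually_elim (simp add: int_unit_def xL)
		hence "eventually (%n. x = x [^] (\<Sum>i<n. int_unit m i)) U" by(rule filter_leD[OF u(2)])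
		moreover have "limitin X (%n. x) x U" using xL by(simp add: topspace)
		ultimately show "limitin X (%n. x [^] (\<Sum>i<n. int_unit m i)) x U" by(rule limitin_transform_eventually)
	qed
	ultimately show ?thesis by(rule that)
qed

text \<open>Such a chain is the same as a homomorphism from the rationals, the direct limit of the
  integers under multiplication by \<open>n + 1\<close>; in a reduced group every such homomorphism
  is trivial.\<close>

definition reduced :: "'g monoid => bool" where
	"reduced G \<longleftrightarrow> (ALL w. (ALL n::nat. w n : carrier G & w n = w (Suc n) [^]\<^bsub>G\<^esub> Suc n) --> w 0 = one G)"

text \<open>The unit vectors are linearly independent in the space of rational sequences, so a
  linear functional may take any values on them. Formal power series serve as that space, with
  \<open>fps_X ^ n\<close> as unit vectors.\<close>

lemma rational_functional:
	obtains h :: "(nat => int) => rat" where "!!x y. h (%i. x i + y i) = h x + h y" "!!n. h (int_unit n) = 1"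
proof -
	interpret s: vector_space "%c f. fps_const c * f :: rat fps"
		by standard (simp_all add: algebra_simps flip: fps_const_mult fps_const_add)
	interpret r: vector_space "(*) :: rat => rat => rat"
		by standard (simp_all add: algebra_simps)
	interpret p: vector_space_pair "%c f. fps_const c * f :: rat fps" "(*) :: rat => rat => rat" ..
	have "s.independent (range (%n. fps_X ^ n))"
		unfolding s.independent_explicit_module
	proof(intro allI impI)
		fix t u v assume t: "finite t" "t <= range (%n. fps_X ^ n)" "(SUM v:t. fps_const (u v) * v) = (0 :: rat fps)" "v : t"
		then obtain n where n: "v = fps_X ^ n" by blast
		have "0 = fps_nth (SUM v:t. fps_const (u v) * v) n" using t(3) by simp
		also have "... = (SUM w:t. if w = v then u v else 0)"
			unfolding fps_sum_nth
		proof(rule sum.cong)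
			fix w assume "w : t"
			then obtain m where "w = fps_X ^ m" using t(2) by blast
			thus "fps_nth (fps_const (u w) * w) n = (if w = v then u v else 0)" by(auto simp: n)
		qed simp
		also have "... = u v" using t(1,4) by simp
		finally show "u v = 0" by simp
	qed
	then obtain g where g: "Vector_Spaces.linear (%c f. fps_const c * f) (*) g" "ALL v:range (%n. fps_X ^ n). g v = (1::rat)"
		using p.linear_independent_extend[of _ "%_. 1"] by metis
	show ?thesis
	proof(rule that[of "%x. g (Abs_fps (%i. of_int (x i)))"])
		fix x y :: "nat => int"
		have "Abs_fps (%i. of_int (x i + y i)) = Abs_fps (%i. of_int (x i)) + (Abs_fps (%i. of_int (y i)) :: rat fps)"
			by(rule fps_ext) simp
		thus "g (Abs_fps (%i. of_int (x i + y i))) = g (Abs_fps (%i. of_int (x i))) + g (Abs_fps (%i. of_int (y i)))"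
			using p.linear_add[OF g(1)] by simp
		fix n
		have "Abs_fps (%i. of_int (int_unit n i)) = (fps_X ^ n :: rat fps)"
			by(rule fps_ext) (simp add: int_unit_def)
		thus "g (Abs_fps (%i. of_int (int_unit n i))) = 1" using g(2) by simp
	qed
qed

text \<open>The chain defines a map \<open>p\<close> on the rationals that sends
  \<open>a / n!\<close> to the \<open>a\<close>th power of \<open>w n\<close>. Composed with the
  functional it sends every unit vector to \<open>w 0\<close>, and slenderness kills one of
  them.\<close>

lemma slender_reduced:
	assumes G: "slender G"
	shows "reduced G"
	unfolding reduced_def
proof(intro allI impI)
	fix w assume w: "ALL n::nat. w n : carrier G & w n = w (Suc n) [^]\<^bsub>G\<^esub> Suc n"
	interpret group G using G by(simp add: slender_def)
	have wG: "w n : carrier G" for n using w by blast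
	obtain f :: "(nat => int) => rat" where f: "!!x y. f (%i. x i + y i) = f x + f y" "!!n. f (int_unit n) = 1"
		by(erule rational_functional)
	define P where "P q n x \<longleftrightarrow> (EX a::int. q * fact n = of_int a & x = w n [^]\<^bsub>G\<^esub> a)" for q :: rat and n x
	have step: "P q (Suc n) x" if P: "P q n x" for q n x
	proof -
		obtain a :: int where a: "q * fact n = of_int a" "x = w n [^]\<^bsub>G\<^esub> a" using P by(auto simp: P_def)
		have "q * fact (Suc n) = of_int (int (Suc n) * a)" by(simp add: algebra_simps flip: a(1))
		moreover have "x = w (Suc n) [^]\<^bsub>G\<^esub> (int (Suc n) * a)"
			unfolding a(2) using w[THEN spec, of n] wG by(simp only: int_pow_pow[symmetric] int_pow_int)
		ultimately show ?thesis unfolding P_def by blast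
	qed
	have mono: "P q m x" if "P q n x" "n <= m" for q n m x
		using that(2,1) by(induction rule: dec_induct) (auto intro: step)
	have uniq: "x = y" if "P q n x" "P q n y" for q n x y using that by(auto simp: P_def)
	have ex: "EX n x. P q n x" for q
	proof -
		obtain a b where ab: "quotient_of q = (a, b)" by(cases "quotient_of q")
		have b: "b > 0" "q = of_int a / of_int b" using quotient_of_denom_pos[OF ab] quotient_of_div[OF ab] by auto
		have "nat b dvd fact (nat b)" using b(1) by(intro dvd_fact) auto
		then obtain c where c: "fact (nat b) = nat b * c" by blast
		have "(fact (nat b) :: rat) = of_nat (nat b * c)" unfolding c[symmetric] by simp
		hence "q * fact (nat b) = of_int (a * int c)" using b by simp
		thus ?thesis unfolding P_def by blast
	qed
	define p where "p q = (THE x. EX n. P q n x)" for q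
	have pP: "p q = x" if "P q n x" for q n x
		unfolding p_def
	proof(rule the_equality)
		show "EX n. P q n x" using that by blast
		fix y assume "EX n. P q n y"
		then obtain m where "P q m y" by blast
		thus "y = x" using that mono[of q n x "max m n"] mono[of q m y "max m n"] uniq by simp
	qed
	have pG: "p q : carrier G" for q
	proof -
		obtain n x where nx: "P q n x" using ex[of q] by blast
		then obtain a :: int where "x = w n [^]\<^bsub>G\<^esub> a" unfolding P_def by blast
		thus ?thesis unfolding pP[OF nx] by(simp add: wG)
	qed
	have h: "(%x. p (f x)) : hom int_seq G"
	proof(rule homI)
		fix x y
		obtain m n where mn: "P (f x) m (p (f x))" "P (f y) n (p (f y))" using ex pP by metis
		have "P (f x) (max m n) (p (f x))" "P (f y) (max m n) (p (f y))" using mn by(auto intro: mono)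
		then obtain a b :: int where "f x * fact (max m n) = of_int a" "p (f x) = w (max m n) [^]\<^bsub>G\<^esub> a"
			"f y * fact (max m n) = of_int b" "p (f y) = w (max m n) [^]\<^bsub>G\<^esub> b" unfolding P_def by blast
		hence "P (f x + f y) (max m n) (p (f x) **\<^bsub>G\<^esub> p (f y))"
			unfolding P_def using wG by(intro exI[of _ "a + b"]) (simp add: distrib_right int_pow_mult)
		thus "p (f (x **\<^bsub>int_seq\<^esub> y)) = p (f x) **\<^bsub>G\<^esub> p (f y)" by(simp add: f(1) pP)
	qed (rule pG)
	obtain n where "p (f (int_unit n)) = one G" by(rule slender_unit[OF G h])
	moreover have "P 1 0 (w 0)" unfolding P_def using wG by(intro exI[of _ 1]) simp
	ultimately show "w 0 = one G" using pP by(simp add: f(2))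
qed

lemma (in lch_grp) open_kernelI:
	assumes G: "group G" and f: "f : hom L G" and N: "nb N" "!!x. x : N ==> f x = one G"
	shows "openin X (kernel L G f)"
proof -
	interpret f: group_hom L G f using G f is_group by(intro group_homI)
	have "kernel L G f = (UN a:kernel L G f. {x : carrier L. inv a**x : N})"
	proof(intro equalityI subsetI)
		fix a assume a: "a : kernel L G f"
		hence "a : {x : carrier L. inv a**x : N}" using nbD(2)[OF N(1)] by(simp add: kernel_def)
		thus "a : (UN a:kernel L G f. {x : carrier L. inv a**x : N})" using a by blast
	next
		fix x assume "x : (UN a:kernel L G f. {x : carrier L. inv a**x : N})"
		then obtain a where a: "a : carrier L" "f a = one G" "x : carrier L" "inv a**x : N" by(auto simp: kernel_def)
		have "f x = one G" using N(2)[OF a(4)] a by simp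
		thus "x : kernel L G f" using a(3) by(simp add: kernel_def)
	qed
	moreover have "openin X (UN a:kernel L G f. {x : carrier L. inv a**x : N})"
		by(intro openin_Union) (use openin_translate(1)[OF nbD(1)[OF N(1)]] in "auto simp: kernel_def")
	ultimately show ?thesis by simp
qed

text \<open>Of slenderness only two consequences enter, and both are inherited by products, so the
  theorem also covers integer sequences as a target. A one-parameter subgroup is killed because the
  images of its values at \<open>s / n!\<close> form a chain as in \<open>reduced\<close>.\<close>

theorem (in lch_grp) open_kernel:
	fixes G :: "'g monoid"
	assumes G: "group G" and f: "f : hom L G" and red: "reduced G"
		and comp: "!!K x. subgroup K L ==> compactin X K ==> x : K ==> f x = one G"
	shows "openin X (kernel L G f)"
proof -
	obtain N K Y U where r: "subgroup N L" "openin X N" "subgroup K L" "compactin X K" "K \<lhd> (L\<lparr>carrier := N\<rparr>)"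
		"lch_grp (L\<lparr>carrier := N\<rparr> Mod K) Y" "continuous_map (subtopology X N) Y (%x. K #> x)"
		"lch_grp.nb (L\<lparr>carrier := N\<rparr> Mod K) Y U"
		and small: "!!S. subgroup S (L\<lparr>carrier := N\<rparr> Mod K) ==> S <= U ==> S = {K}"
		by(erule nss_reduction)
	let ?M = "L\<lparr>carrier := N\<rparr>"
	let ?Q = "?M Mod K"
	interpret f: group_hom L G f using G f is_group by(intro group_homI)
	interpret Q: lch_grp ?Q Y by(rule r(6))
	have NL: "N <= carrier L" by(rule subgroup.subset[OF r(1)])
	have coset: "K #>\<^bsub>?M\<^esub> x = K #> x" for x by(simp add: r_coset_def)
	have fM: "f : hom ?M G" using NL by(intro homI) (auto simp: subset_iff)
	obtain g where g: "g : hom ?Q G" "!!x. x : N ==> g (K #> x) = f x"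
	proof(rule FactGroup_universal[OF fM r(5)])
		fix x y assume xy: "x : carrier ?M" "y : carrier ?M" "K #>\<^bsub>?M\<^esub> x = K #>\<^bsub>?M\<^esub> y"
		have "x : K #> x" using xy(1) NL rcos_self[OF _ r(3)] by auto
		hence "x : K #> y" using xy(3) unfolding coset by simp
		then obtain k where k: "k : K" "x = k**y" by(auto simp: r_coset_def)
		have "k : carrier L" "y : carrier L" using k(1) subgroup.subset[OF r(3)] xy(2) NL by auto
		thus "f x = f y" using comp[OF r(3,4) k(1)] k(2) by simp
	next
		fix g assume "g : hom ?Q G" "!!x. x : carrier ?M ==> g (K #>\<^bsub>?M\<^esub> x) = f x"
		thus thesis by(intro that[of g]) (simp_all add: coset)
	qed
	interpret g: group_hom ?Q G g using G g(1) Q.is_group by(intro group_homI)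
	obtain W where W: "Q.nb W" "W <= U" "!!x. x : W ==> inv\<^bsub>?Q\<^esub> x : W" by(rule Q.nb_sym[OF r(8)]) (rule that; assumption)
	obtain V C where V: "Q.nb V" "V <= C" "compactin Y C" "C <= W" by(rule Q.nb_compact[OF W(1)]) (rule that; assumption)
	obtain V' where V': "Q.nb V'" "V' <= V" "!!x. x : V' ==> inv\<^bsub>?Q\<^esub> x : V'" by(rule Q.nb_sym[OF V(1)]) (rule that; assumption)
	define D where "D = C Int (%x. inv\<^bsub>?Q\<^esub> x) ` C"
	have CQ: "x : carrier ?Q" if "x : C" for x by(rule Q.compactinD_carrier[OF V(3) that])
	interpret nss_grp ?Q Y D
	proof
		show "compactin Y D" unfolding D_def
			by(rule closed_compactin[OF V(3)])
				(use Q.closed_of_compact[OF V(3)] Q.closed_of_compact[OF Q.compactin_inv[OF V(3)]] in auto)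
		have "V' <= D"
		proof
			fix x assume x: "x : V'"
			have "x : C" "inv\<^bsub>?Q\<^esub> x : C" using x V'(2) V'(3)[OF x] V(2) by blast+
			moreover have "x = inv\<^bsub>?Q\<^esub> (inv\<^bsub>?Q\<^esub> x)" using CQ `x : C` by(simp only: Q.inv_inv)
			ultimately show "x : D" unfolding D_def by blast
		qed
		thus "EX N. Q.nb N & N <= D" using V'(1) by blast
		show "inv\<^bsub>?Q\<^esub> x : D" if h: "x : D" for x
		proof -
			obtain y where y: "x : C" "y : C" "x = inv\<^bsub>?Q\<^esub> y" using h unfolding D_def by blast
			have "inv\<^bsub>?Q\<^esub> x = y" using y(3) CQ[OF y(2)] by(simp only: Q.inv_inv)
			thus ?thesis unfolding D_def using y by blast
		qed
		show "S = {one ?Q}" if "subgroup S ?Q" "S <= D" for S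
		proof -
			have "S <= U" using that(2) V(4) W(2) unfolding D_def by blast
			thus ?thesis using small[OF that(1)] by simp
		qed
	qed
	have "g (c s) = one G" if c: "ops c" for c s
	proof -
		define w where "w n = g (c (s / fact n))" for n
		have "w n = w (Suc n) [^]\<^bsub>G\<^esub> Suc n" for n
		proof -
			have "s / fact n = real (Suc n) * (s / fact (Suc n))" by(simp del: of_nat_Suc)
			hence "w n = g (c (s / fact (Suc n)) [^]\<^bsub>?Q\<^esub> Suc n)" by(simp only: w_def ops_pow[OF c])
			also have "... = w (Suc n) [^]\<^bsub>G\<^esub> Suc n" unfolding w_def by(rule g.hom_nat_pow[OF opsD(1)[OF c]])
			finally show ?thesis .
		qed
		moreover have "w n : carrier G" for n unfolding w_def by(intro g.hom_closed opsD(1)[OF c])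
		ultimately have "w 0 = one G" using red unfolding reduced_def by blast
		thus ?thesis by(simp add: w_def)
	qed
	then obtain E where E: "Q.nb E" "ALL x:E. g x = one G" using nss_kernel[OF G g(1)] by blast
	define P where "P = {x : topspace (subtopology X N). K #> x : E}"
	have "openin (subtopology X N) P" unfolding P_def
		by(rule openin_continuous_map_preimage[OF r(7) Q.nbD(1)[OF E(1)]])
	hence "openin X P" using r(2) by(simp add: openin_open_subtopology)
	moreover have "\<one> : P"
	proof -
		have "K #> \<one> = K" by(rule coset_join2[OF one_closed r(3) subgroup.one_closed[OF r(3)]])
		thus ?thesis using Q.nbD(2)[OF E(1)] subgroup.one_closed[OF r(1)] by(simp add: P_def topspace)
	qed
	ultimately have P: "nb P" by(simp add: nb_def)
	show ?thesis
	proof(rule open_kernelI[OF G f P])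
		fix x assume x: "x : P"
		hence "x : N" "K #> x : E" unfolding P_def by auto
		thus "f x = one G" using g(2)[of x] E(2) by force
	qed
qed

lemma (in lch_grp) slender_kills_compact:
	assumes G: "slender G" and f: "f : hom L G" and K: "subgroup K L" "compactin X K" "x : K"
	shows "f x = one G"
proof -
	obtain F where F: "F : hom int_seq L" "!!n. F (int_unit n) = x" by(erule compact_int_seq_hom[OF K])
	have h: "(%a. f (F a)) : hom int_seq G" using F(1) f by(simp add: hom_def Pi_iff)
	obtain n where "f (F (int_unit n)) = one G" by(rule slender_unit[OF G h])
	thus ?thesis by(simp only: F(2))
qed

theorem slender_imp_lch_slender:
	assumes G: "slender G"
	shows "lch_slender TYPE('l) G"
	unfolding lch_slender_def
proof(intro conjI allI impI ballI)
	show gG: "group G" using G by(simp add: slender_def)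
	fix L :: "'l monoid" and X f assume L: "lch_group L X" and f: "f : hom L G"
	interpret lch_grp L X
		using L by(simp add: lch_grp_def lch_grp_axioms_def lch_group_def topological_group_def)
	show "openin X (kernel L G f)"
		by(rule open_kernel[OF gG f slender_reduced[OF G] slender_kills_compact[OF G f]])
qed

section \<open>Inverse limit slender groups\<close>

text \<open>An element of \<open>H j\<close> need not lift to the limit, but for suitable
  \<open>j\<close> its image in \<open>H i\<close> does, by the Mittag-Leffler condition. Two lifts
  agree at \<open>i\<close>, so \<open>f\<close> has the same value on them, and the value of
  \<open>f\<close> on a lift is a homomorphism on \<open>H j\<close>.\<close>

lemma mittag_leffler_factor:
	assumes H: "inverse_sequence H p" "mittag_leffler H p" and G: "group G"
		and f: "f : hom (inverse_limit H p) G"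
		and 1: "!!x. x : carrier (inverse_limit H p) ==> x i = one (H i) ==> f x = one G"
	shows "EX j. EX g:hom (H j) G. ALL x:carrier (inverse_limit H p). f x = g (x j)"
proof -
	let ?I = "inverse_limit H p"
	interpret I: group ?I by(rule group_inverse_limit[OF H(1)])
	interpret f: group_hom ?I G f using f G I.is_group by(intro group_homI)
	have gH: "group (H k)" for k using H(1) by(simp add: inverse_sequence_def)
	obtain j where j: "i < j" "!!y. y : carrier (H j) ==> EX x:carrier ?I. x i = p i j y"
		using mittag_leffler_lift[OF H] by metis
	have pj: "p i j : hom (H j) (H i)" using H(1) j(1) by(simp add: inverse_sequence_def)
	have eq: "f x = f y" if x: "x : carrier ?I" and y: "y : carrier ?I" and xy: "x i = y i" for x y
	proof -
		have iy: "inv\<^bsub>?I\<^esub> y : carrier ?I" using y by(rule I.inv_closed)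
		have "(inv\<^bsub>?I\<^esub> y **\<^bsub>?I\<^esub> y) i = one ?I i" by(simp only: I.l_inv[OF y])
		hence "(x **\<^bsub>?I\<^esub> inv\<^bsub>?I\<^esub> y) i = one (H i)"
			using xy y iy gH[of i] by(simp add: carrier_inverse_limit group.inv_comm)
		hence "f (x **\<^bsub>?I\<^esub> inv\<^bsub>?I\<^esub> y) = one G" by(rule 1[OF I.m_closed[OF x iy]])
		hence "f x **\<^bsub>G\<^esub> inv\<^bsub>G\<^esub> f y = one G" by(simp only: f.hom_mult[OF x iy] f.hom_inv[OF y])
		thus ?thesis using group.inv_equality[OF G, of "f x" "inv\<^bsub>G\<^esub> f y"] x y G by(simp add: group.inv_inv)
	qed
	obtain L where L: "!!y. y : carrier (H j) ==> L y : carrier ?I & L y i = p i j y" using j(2) by metis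
	have "(%y. f (L y)) : hom (H j) G"
	proof(rule homI)
		fix a b assume a: "a : carrier (H j)" and b: "b : carrier (H j)"
		have ab: "a **\<^bsub>H j\<^esub> b : carrier (H j)" using gH[of j] a b by(simp add: group.is_monoid monoid.m_closed)
		have "f (L (a **\<^bsub>H j\<^esub> b)) = f (L a **\<^bsub>?I\<^esub> L b)"
			by(rule eq) (use L[OF ab] L[OF a] L[OF b] I.m_closed[of "L a" "L b"] hom_mult[OF pj a b] in auto)
		thus "f (L (a **\<^bsub>H j\<^esub> b)) = f (L a) **\<^bsub>G\<^esub> f (L b)" using L[OF a] L[OF b] f.hom_mult by simp
	qed (use L in auto)
	moreover have "f x = f (L (x j))" if x: "x : carrier ?I" for x
	proof -
		have xj: "x j : carrier (H j)" "p i j (x j) = x i" using x j(1) by(auto simp: carrier_inverse_limit)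
		show ?thesis by(rule eq[OF x]) (use L[OF xj(1)] xj(2) in auto)
	qed
	ultimately show ?thesis by(intro exI[of _ j] bexI[of _ "%y. f (L y)"]) auto
qed

theorem inverse_limit_slender_imp_slender:
	assumes inf: "infinite (UNIV :: 'h set)" and G: "inverse_limit_slender TYPE('h) G"
	shows "slender G"
	unfolding slender_def
proof(intro conjI ballI)
	show gG: "group G" using G by(simp add: inverse_limit_slender_def)
	have G': "inverse_limit_slender TYPE(nat => int) G" by(rule inverse_limit_slender_type_independent[OF inf G])
	fix f assume f: "f : hom int_seq G"
	define H where "H n = product_group {..<n} (%_. integer_group)" for n :: nat
	define p where "p i (j::nat) x = restrict x {..<i}" for i j and x :: "nat => int"
	have cH: "carrier (H n) = extensional {..<n}" for n by(simp add: H_def PiE_def)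
	have mH: "x **\<^bsub>H n\<^esub> y = (\<lambda>i\<in>{..<n}. x i + y i)" for x y n by(simp add: H_def)
	have seq: "inverse_sequence H p"
		unfolding inverse_sequence_def
	proof(intro conjI allI impI ballI)
		show "p i j : hom (H j) (H i)" if "i < j" for i j
			using that by(intro homI) (auto simp: cH mH p_def restrict_def fun_eq_iff extensional_def)
	qed (auto simp: H_def p_def restrict_def fun_eq_iff)
	have im: "p i k ` carrier (H k) = carrier (H i)" if "i < k" for i k
	proof(intro equalityI subsetI)
		fix x assume x: "x : carrier (H i)"
		hence "x = p i k (restrict x {..<k})"
			using that by(auto simp: cH p_def restrict_def fun_eq_iff extensional_def)
		thus "x : p i k ` carrier (H k)" by(intro image_eqI[of _ _ "restrict x {..<k}"]) (simp_all add: cH)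
	qed (auto simp: cH p_def)
	have ml: "mittag_leffler H p"
		unfolding mittag_leffler_def
	proof(intro allI)
		show "EX j>i. ALL k>=j. p i k ` carrier (H k) = p i j ` carrier (H j)" for i
			by(rule exI[of _ "Suc i"]) (simp add: im)
	qed
	\<comment> \<open>A compatible family of finite sequences is read as one infinite sequence: entry
	  \<open>i\<close> is taken from the first stage that contains it.\<close>
	have "(%t. f (%i. t (Suc i) i)) : hom (inverse_limit H p) G"
	proof(rule homI)
		fix s t
		show "f (%i. t (Suc i) i) : carrier G" using f by(simp add: hom_def Pi_def)
		have "(%i. (s **\<^bsub>inverse_limit H p\<^esub> t) (Suc i) i) = (%i. s (Suc i) i + t (Suc i) i)" by(simp add: mH)
		thus "f (%i. (s **\<^bsub>inverse_limit H p\<^esub> t) (Suc i) i) = f (%i. s (Suc i) i) **\<^bsub>G\<^esub> f (%i. t (Suc i) i)"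
			using hom_mult[OF f, of "%i. s (Suc i) i" "%i. t (Suc i) i"] by simp
	qed
	then obtain n g where n: "g : hom (H n) G"
		"!!t. t : carrier (inverse_limit H p) ==> f (%i. t (Suc i) i) = g (t n)"
		using inverse_limit_slenderD[OF G' seq ml] by meson
	have "f x = g (restrict x {..<n})" for x
	proof -
		have "(%k. restrict x {..<k}) : carrier (inverse_limit H p)"
			by(auto simp: carrier_inverse_limit cH p_def restrict_def fun_eq_iff extensional_def)
		from n(2)[OF this] show ?thesis by simp
	qed
	thus "EX n. EX g:hom (product_group {..<n} (%_. integer_group)) G.
			ALL x:carrier int_seq. f x = g (restrict x {..<n})"
		using n(1) unfolding H_def by blast
qed

text \<open>Common to the absolute value on the integers and word length in free groups: the
  exponent exceeds the length of \<open>c\<close>, so \<open>c\<close> cannot cancel the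
  power.\<close>

definition length_group :: "'g monoid => ('g => nat) => bool" where
	"length_group G l \<longleftrightarrow> group G & l (one G) = 0 &
		 (ALL c:carrier G. ALL x:carrier G. x ~= one G --> l x < l (c **\<^bsub>G\<^esub> x [^]\<^bsub>G\<^esub> (l c + 2)))"

text \<open>The equations \<open>y n = s n \<otimes> y (n + 1) [^] k n\<close> have a solution in the inverse limit when
  \<open>s n\<close> is trivial in the first \<open>n\<close> coordinates; for rapidly growing \<open>k\<close> the lengths of the images
  of \<open>y n\<close> would decrease forever.\<close>

theorem length_group_inverse_limit_slender:
	assumes G: "length_group G l"
	shows "inverse_limit_slender TYPE('h) G"
	unfolding inverse_limit_slender_def
proof(intro conjI allI impI ballI)
	show gG: "group G" using G by(simp add: length_group_def)
	fix H :: "nat => 'h monoid" and p f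
	assume H: "inverse_sequence H p" "mittag_leffler H p" and f: "f : hom (inverse_limit H p) G"
	let ?I = "inverse_limit H p"
	interpret I: group ?I by(rule group_inverse_limit[OF H(1)])
	interpret f: group_hom ?I G f using f gG I.is_group by(intro group_homI)
	have gH: "group (H k)" for k using H(1) by(simp add: inverse_sequence_def)
	have ph: "group_hom (H j) (H i) (p i j)" if "i < j" for i j
		using H(1) that by(auto simp: inverse_sequence_def intro: group_homI)
	have "EX i. ALL x:carrier ?I. x i = one (H i) --> f x = one G"
	proof(rule ccontr)
		assume "~ ?thesis"
		then obtain s where s: "!!n. s n : carrier ?I" "!!n. s n n = one (H n)" "!!n. f (s n) ~= one G" by metis
		have sc: "s n i : carrier (H i)" "i < j ==> p i j (s n j) = s n i" for n i j
			using s(1)[of n] by(auto simp: carrier_inverse_limit)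
		have s1: "s n i = one (H i)" if "i <= n" for n i
			using that s(2)[of n] sc(2)[of i n n] group_hom.hom_one[OF ph[of i n]] by(cases "i = n") auto
		define k where "k n = l (f (s n)) + 2" for n
		\<comment> \<open>At stage \<open>i\<close> the equations are trivial from index \<open>i\<close>
		  on, so they are solved by downward recursion; the recursion argument counts the steps down from
		  \<open>i\<close>.\<close>
		define y where "y i = rec_nat (one (H i)) (%m a. s (i - Suc m) i **\<^bsub>H i\<^esub> a [^]\<^bsub>H i\<^esub> k (i - Suc m))" for i
		define Y where "Y n i = y i (i - n)" for n i
		have Y1: "Y n i = one (H i)" if "i <= n" for n i using that by(simp add: Y_def y_def)
		have Yrec: "Y n i = s n i **\<^bsub>H i\<^esub> Y (Suc n) i [^]\<^bsub>H i\<^esub> k n" for n i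
		proof(cases "i <= n")
			case True
			thus ?thesis using gH[of i] by(simp add: Y1 s1 group.is_monoid monoid.nat_pow_one)
		next
			case False
			hence "i - n = Suc (i - Suc n)" "i - Suc (i - Suc n) = n" by auto
			thus ?thesis by(simp add: Y_def y_def)
		qed
		have Yc: "Y n i : carrier (H i)" for n i
		proof(induction "i - n" arbitrary: n)
			case 0 thus ?case using gH[of i] by(simp add: Y1 group.is_monoid)
		next
			case (Suc m)
			have "Y (Suc n) i : carrier (H i)" by(rule Suc.hyps) (use Suc.hyps(2) in simp)
			thus ?case using gH[of i] sc(1) by(subst Yrec) (simp add: group.is_monoid monoid.m_closed monoid.nat_pow_closed)
		qed
		have Yp: "p i j (Y n j) = Y n i" if ij: "i < j" for i j n
		proof(induction "j - n" arbitrary: n)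
			case 0 thus ?case using ij group_hom.hom_one[OF ph[OF ij]] by(simp add: Y1)
		next
			case (Suc m)
			interpret q: group_hom "H j" "H i" "p i j" by(rule ph[OF ij])
			have IH: "p i j (Y (Suc n) j) = Y (Suc n) i" by(rule Suc.hyps) (use Suc.hyps(2) in simp)
			have "p i j (Y n j) = p i j (s n j) **\<^bsub>H i\<^esub> p i j (Y (Suc n) j) [^]\<^bsub>H i\<^esub> k n"
				using sc(1) Yc by(subst Yrec) (simp add: q.hom_nat_pow)
			thus ?case using IH sc(2)[OF ij] by(simp add: Yrec[of n i])
		qed
		have YI: "Y n : carrier ?I" for n using Yc Yp by(simp add: carrier_inverse_limit)
		have powI: "(x [^]\<^bsub>?I\<^esub> m) i = x i [^]\<^bsub>H i\<^esub> m" for x i and m :: nat by(induction m) simp_all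
		have "Y n = s n **\<^bsub>?I\<^esub> Y (Suc n) [^]\<^bsub>?I\<^esub> k n" for n
			by(rule ext) (simp add: powI Yrec[of n])
		hence fY: "f (Y n) = f (s n) **\<^bsub>G\<^esub> f (Y (Suc n)) [^]\<^bsub>G\<^esub> k n" for n
			using s(1) YI by(metis f.hom_mult f.hom_nat_pow I.nat_pow_closed)
		have cG: "f (Y n) : carrier G" "f (s n) : carrier G" for n using YI s(1) by auto
		have less: "l (f (Y (Suc n))) < l (f (Y n))" if "f (Y (Suc n)) ~= one G" for n
			using G that cG unfolding length_group_def fY[of n] k_def by blast
		have ne: "f (Y n) ~= one G" for n
		proof(cases "f (Y (Suc n)) = one G")
			case True
			have "f (Y n) = f (s n)" using fY[of n] True cG(2)[of n] f.H.nat_pow_one f.H.r_one by simp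
			thus ?thesis using s(3) by simp
		next
			case False
			from less[OF this] show ?thesis using G by(auto simp: length_group_def)
		qed
		have "l (f (Y n)) + n <= l (f (Y 0))" for n
		proof(induction n)
			case (Suc n) thus ?case using less[OF ne, of n] by linarith
		qed simp
		from this[of "Suc (l (f (Y 0)))"] show False by simp
	qed
	then obtain i where "!!x. x : carrier ?I ==> x i = one (H i) ==> f x = one G" by blast
	thus "EX i. EX g:hom (H i) G. ALL x:carrier ?I. f x = g (x i)"
		by(rule mittag_leffler_factor[OF H gG f])
qed

lemma slender_integer_group: "slender integer_group"
proof -
	have "length_group integer_group (%z. nat \<bar>z\<bar>)"
		unfolding length_group_def
	proof(intro conjI ballI impI)
		fix c x :: int assume x: "x ~= one integer_group"
		have "abs ((abs c + 2) * x) = (abs c + 2) * abs x" by(simp add: abs_mult)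
		also have "... = abs c * abs x + 2 * abs x" by(simp add: algebra_simps)
		finally have "abs ((abs c + 2) * x) = abs c * abs x + 2 * abs x" .
		moreover have "abs c * 1 <= abs c * abs x" by(rule mult_left_mono) (use x in auto)
		ultimately have "abs x < abs (c + (abs c + 2) * x)" using x by simp linarith
		moreover have "c **\<^bsub>integer_group\<^esub> x [^]\<^bsub>integer_group\<^esub> (nat \<bar>c\<bar> + 2) = c + (\<bar>c\<bar> + 2) * x" by(simp add: algebra_simps)
		ultimately show "nat \<bar>x\<bar> < nat \<bar>c **\<^bsub>integer_group\<^esub> x [^]\<^bsub>integer_group\<^esub> (nat \<bar>c\<bar> + 2)\<bar>"
			by(simp only: nat_less_eq_zless abs_ge_zero)
	qed simp_all
	hence "inverse_limit_slender TYPE(nat) integer_group" by(rule length_group_inverse_limit_slender)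
	thus ?thesis by(rule inverse_limit_slender_imp_slender[rotated]) simp
qed

lemma not_slender_int_seq: "~ slender int_seq"
proof
	assume "slender int_seq"
	moreover have "(%x. x) : hom int_seq int_seq" by(rule homI) auto
	ultimately obtain n where "int_unit n = one int_seq" by(rule slender_unit)
	hence "int_unit n n = 0" by simp
	thus False by(simp add: int_unit_def)
qed

text \<open>Both conditions of \<open>open_kernel\<close> hold coordinate by coordinate, because the
  integers are slender.\<close>

lemma lch_slender_int_seq: "lch_slender TYPE('l) int_seq"
	unfolding lch_slender_def
proof(intro conjI allI impI ballI)
	show gG: "group int_seq" by simp
	fix L :: "'l monoid" and X f assume L: "lch_group L X" and f: "f : hom L int_seq"
	interpret lch_grp L X
		using L by(simp add: lch_grp_def lch_grp_axioms_def lch_group_def topological_group_def)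
	show "openin X (kernel L int_seq f)"
	proof(rule open_kernel[OF gG f])
		show "reduced int_seq"
			unfolding reduced_def
		proof(intro allI impI)
			fix w assume w: "ALL n::nat. w n : carrier int_seq & w n = w (Suc n) [^]\<^bsub>int_seq\<^esub> Suc n"
			have pow: "(x [^]\<^bsub>int_seq\<^esub> m) i = x i [^]\<^bsub>integer_group\<^esub> m" for x i and m :: nat
				by(induction m) simp_all
			have "w 0 i = one integer_group" for i
				using slender_reduced[OF slender_integer_group, unfolded reduced_def, rule_format, of "%n. w n i"]
					w pow by(metis UNIV_I carrier_integer_group)
			thus "w 0 = one int_seq" by(simp add: fun_eq_iff)
		qed
		fix K x assume K: "subgroup K L" "compactin X K" "x : K"
		have "f x i = 0" for i
		proof -
			have "(%y. f y i) : hom L integer_group" using f by(auto simp: hom_def)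
			from slender_kills_compact[OF slender_integer_group this K] show ?thesis by simp
		qed
		thus "f x = one int_seq" by(simp add: fun_eq_iff)
	qed
qed

section \<open>Homomorphisms from the earring group\<close>

abbreviation earring :: "complex set" where "earring \<equiv> hawaiian_earring"

text \<open>In the coordinate \<open>1 / z\<close> the \<open>k\<close>th circle is the vertical
  line with real part \<open>(k + 1) / 2\<close>, from which the index is recovered.\<close>

definition circle_index :: "complex => nat" where
	"circle_index z = nat (\<lfloor>2 * Re z / (norm z)\<^sup>2\<rfloor> - 1)"

definition antipode :: "nat => complex" where
	"antipode k = of_real (2 / (real k + 1))"

lemma antipode_nonzero: "antipode k ~= 0"
	unfolding antipode_def of_real_eq_0_iff by simp

lemma circle_quotient: "z : earring_circle k ==> z ~= 0 ==> 2 * Re z / (norm z)\<^sup>2 = real k + 1"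
	by(simp add: mem_earring_circle field_simps)

lemma circle_index: "z : earring_circle k ==> z ~= 0 ==> circle_index z = k"
	by(simp add: circle_index_def circle_quotient)

lemma earring_circleE:
	assumes "z : earring"
	obtains k where "z : earring_circle k"
	using assms by(auto simp: hawaiian_earring_def)

lemma real_earring:
	assumes "z : earring_circle k" "z ~= 0" "Im z = 0"
	shows "z = antipode k"
proof -
	have z: "z = of_real (Re z)" "Re z ~= 0" using assms(2,3) by(auto simp: complex_eq_iff)
	have "(norm z)\<^sup>2 = (Re z)\<^sup>2" using assms(3) by(simp add: cmod_power2)
	hence "(real k + 1) * Re z = 2" using assms(1) z(2) by(simp add: mem_earring_circle power2_eq_square)
	hence "Re z = 2 / (real k + 1)" by(simp add: field_simps)
	thus ?thesis using z(1) by(simp add: antipode_def)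
qed

lemma circle_index_const:
	assumes z: "z : earring_circle k" "z ~= 0"
	shows "eventually (%y. y ~= 0 & (y : earring --> y : earring_circle k)) (nhds z)"
proof -
	let ?l = "%y. 2 * Re y / (norm y)\<^sup>2"
	have "isCont ?l z" using z(2) by(intro continuous_intros) auto
	hence "(?l \<longlongrightarrow> ?l z) (nhds z)" by(simp only: isCont_def tendsto_at_iff_tendsto_nhds[of ?l z])
	hence "eventually (%y. dist (?l y) (?l z) < 1) (nhds z)" by(rule tendstoD) simp
	moreover have "eventually (%y. y ~= 0) (nhds z)" using z(2) by(intro t1_space_nhds) auto
	ultimately show ?thesis
	proof eventually_elim
		case (elim y)
		have "y : earring_circle k" if "y : earring_circle j" for j
		proof -
			have "abs (real j - real k) < 1" using elim circle_quotient[OF z] circle_quotient[OF that] by(simp add: dist_real_def)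
			hence "j = k" by linarith
			thus ?thesis using that by simp
		qed
		thus ?case using elim(2) by(auto simp: hawaiian_earring_def)
	qed
qed

lemma eventually_comp:
	assumes "continuous_on D f" "f ` D <= D'" "x : D" "eventually (%y. y : D' --> R y) (nhds (f x))"
	shows "eventually (%y. y : D --> R (f y)) (nhds x)"
proof -
	obtain S where S: "open S" "f x : S" "ALL y:S. y : D' --> R y" using assms(4) unfolding eventually_nhds by blast
	obtain A where "open A" "x : A" "ALL y:D. y : A --> f y : S"
		using assms(1,3) S(1,2) unfolding continuous_on_topological by blast
	thus ?thesis unfolding eventually_nhds using S(3) assms(2) by blast
qed

text \<open>Data for a homomorphism on the earring group that sends the \<open>k\<close>th circle to
  \<open>h k\<close>. It is read off from the covering with fibre the group \<open>K\<close>, which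
  makes sense since only finitely many circles are unwrapped.\<close>

locale lifting = group K for K (structure) +
	fixes h :: "nat => 'a"
	assumes h: "h k : carrier K" and fin: "finite {k. h k ~= \<one>}"
begin

text \<open>Along the \<open>k\<close>th circle the value jumps by \<open>h k\<close> at the
  antipode, as intended, and again at the base point, which is not wanted; hence the separate
  treatment of 0 in \<open>lift\<close>.\<close>

definition chi :: "complex => 'a" where
	"chi z = (if Im z < 0 then h (circle_index z) else \<one>)"

lemma chi_closed [simp]: "chi z : carrier K"
	using h by(simp add: chi_def)

definition V :: "complex set" where
	"V = - antipode ` {k. h k ~= \<one>}"

lemma open_V: "open V"
	unfolding V_def using fin by(intro open_Compl finite_imp_closed finite_imageI)

lemma chi_const:
	assumes z: "z : earring" "z ~= 0" "z : V"
	shows "eventually (%y. y : earring --> chi y = chi z) (nhds z)"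
proof -
	obtain k where k: "z : earring_circle k" using z(1) by(rule earring_circleE)
	note ev = circle_index_const[OF k z(2)]
	show ?thesis
	proof(cases "Im z = 0")
		case True
		hence "h k = \<one>" using real_earring[OF k z(2)] z(3) by(auto simp: V_def)
		from ev show ?thesis by eventually_elim (use `h k = \<one>` True in "auto simp: chi_def circle_index")
	next
		case False
		have "((%y. Im y * Im z) \<longlongrightarrow> Im z * Im z) (nhds z)" by(intro tendsto_intros filterlim_ident)
		hence "eventually (%y. Im y * Im z > 0) (nhds z)" by(rule order_tendstoD) (use False in "simp add: zero_less_mult_iff, linarith")
		with ev show ?thesis
		proof eventually_elim
			case (elim y)
			thus ?case using circle_index[OF k z(2)] by(auto simp: chi_def circle_index zero_less_mult_iff)
		qed
	qed
qed

text \<open>Away from the base point \<open>g\<close> is locally a constant times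
  \<open>chi\<close>: crossing the \<open>k\<close>th antipode from the upper to the lower half
  multiplies it on the right by \<open>h k\<close>.\<close>

definition lift :: "'d::topological_space set => ('d => complex) => ('d => 'a) => bool" where
	"lift D P g \<longleftrightarrow> (ALL x:D. g x : carrier K &
		 (P x = 0 --> eventually (%y. y : D --> g y = g x) (nhds x)) &
		 (P x ~= 0 --> eventually (%y. y : D --> g y**inv (chi (P y)) = g x**inv (chi (P x))) (nhds x)))"

lemma liftD:
	assumes "lift D P g" "x : D"
	shows "g x : carrier K" "P x = 0 ==> eventually (%y. y : D --> g y = g x) (nhds x)"
		"P x ~= 0 ==> eventually (%y. y : D --> g y**inv (chi (P y)) = g x**inv (chi (P x))) (nhds x)"
	using assms by(simp_all add: lift_def)

lemma lift_unique:
	assumes D: "connected D" and g: "lift D P g" "lift D P g'" and ab: "a : D" "b : D" "g a = g' a"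
	shows "g b = g' b"
proof -
	have "(g a = g' a) = (g b = g' b)"
	proof(rule connected_local_const[OF D ab(1,2)], intro ballI)
		fix x assume x: "x : D"
		show "eventually (%y. (g x = g' x) = (g y = g' y)) (at x within D)"
			unfolding eventually_at_filter
		proof(cases "P x = 0")
			case True
			show "eventually (%y. y ~= x --> y : D --> (g x = g' x) = (g y = g' y)) (nhds x)"
				using liftD(2)[OF g(1) x True] liftD(2)[OF g(2) x True] by eventually_elim simp
		next
			case False
			show "eventually (%y. y ~= x --> y : D --> (g x = g' x) = (g y = g' y)) (nhds x)"
				using liftD(3)[OF g(1) x False] liftD(3)[OF g(2) x False]
			proof eventually_elim
				case (elim y)
				show ?case
				proof(intro impI)
					assume y: "y : D"
					have "(g x = g' x) = (g x**inv (chi (P x)) = g' x**inv (chi (P x)))"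
						using liftD(1)[OF g(1) x] liftD(1)[OF g(2) x] by simp
					also have "... = (g y**inv (chi (P y)) = g' y**inv (chi (P y)))" using elim y by simp
					also have "... = (g y = g' y)" using liftD(1)[OF g(1) y] liftD(1)[OF g(2) y] by simp
					finally show "(g x = g' x) = (g y = g' y)" .
				qed
			qed
		qed
	qed
	thus ?thesis using ab(3) by simp
qed

lemma lift_left_mult:
	assumes g: "lift D P g" and c: "c : carrier K"
	shows "lift D P (%x. c**g x)"
	unfolding lift_def
proof(intro ballI conjI impI)
	fix x assume x: "x : D"
	show "c**g x : carrier K" using liftD(1)[OF g x] c by simp
	show "eventually (%y. y : D --> c**g y = c**g x) (nhds x)" if "P x = 0"
		using liftD(2)[OF g x that] by eventually_elim simp
	show "eventually (%y. y : D --> c**g y**inv (chi (P y)) = c**g x**inv (chi (P x))) (nhds x)" if "P x ~= 0"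
		using liftD(3)[OF g x that] by eventually_elim (use liftD(1)[OF g] x c in "simp add: m_assoc")
qed

lemma lift_compose:
	assumes g: "lift D' P g" and f: "continuous_on D f" "f ` D <= D'"
	shows "lift D (%x. P (f x)) (%x. g (f x))"
	unfolding lift_def
proof(intro ballI conjI impI)
	fix x assume x: "x : D"
	have fx: "f x : D'" using x f(2) by blast
	show "g (f x) : carrier K" by(rule liftD(1)[OF g fx])
	show "eventually (%y. y : D --> g (f y) = g (f x)) (nhds x)" if "P (f x) = 0"
		by(rule eventually_comp[OF f x liftD(2)[OF g fx that]])
	show "eventually (%y. y : D --> g (f y)**inv (chi (P (f y))) = g (f x)**inv (chi (P (f x)))) (nhds x)"
		if "P (f x) ~= 0"
		by(rule eventually_comp[OF f x liftD(3)[OF g fx that]])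
qed

lemma lift_glue:
	fixes D1 D2 :: "'d::topological_space set"
	assumes D: "closed D1" "closed D2" and g: "lift D1 P g1" "lift D2 P g2"
		and eq: "!!x. x : D1 ==> x : D2 ==> g1 x = g2 x"
	shows "lift (D1 Un D2) P (%x. if x : D1 then g1 x else g2 x)"
proof -
	define G where "G x = (if x : D1 then g1 x else g2 x)" for x
	have G: "G x = g1 x" if "x : D1" for x using that by(simp add: G_def)
	have G': "G x = g2 x" if "x : D2" for x using that eq by(simp add: G_def)
	have out: "eventually (%y. y ~: D) (nhds x)" if "closed D" "x ~: D" for D and x :: 'd
		using that by(auto simp: eventually_nhds closed_def)
	have both: "eventually (%y. y : D1 Un D2 --> R (G y) y) (nhds x)"
		if "x : D1 ==> eventually (%y. y : D1 --> R (g1 y) y) (nhds x)"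
			"x : D2 ==> eventually (%y. y : D2 --> R (g2 y) y) (nhds x)" for R x
	proof -
		have "eventually (%y. y : D1 --> R (G y) y) (nhds x)"
			using that(1) out[OF D(1), of x] by(cases "x : D1") (auto simp: G elim: eventually_mono)
		moreover have "eventually (%y. y : D2 --> R (G y) y) (nhds x)"
			using that(2) out[OF D(2), of x] by(cases "x : D2") (auto simp: G' elim: eventually_mono)
		ultimately show ?thesis by eventually_elim blast
	qed
	have "lift (D1 Un D2) P G"
		unfolding lift_def
	proof(intro ballI conjI impI)
		fix x assume x: "x : D1 Un D2"
		show "G x : carrier K" using x liftD(1)[OF g(1), of x] liftD(1)[OF g(2), of x] G[of x] G'[of x] by auto
		show "eventually (%y. y : D1 Un D2 --> G y = G x) (nhds x)" if "P x = 0"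
			by(rule both) (use liftD(2)[OF g(1), of x] liftD(2)[OF g(2), of x] G[of x] G'[of x] that in auto)
		show "eventually (%y. y : D1 Un D2 --> G y**inv (chi (P y)) = G x**inv (chi (P x))) (nhds x)" if "P x ~= 0"
			by(rule both) (use liftD(3)[OF g(1), of x] liftD(3)[OF g(2), of x] G[of x] G'[of x] that in auto)
	qed
	thus ?thesis unfolding G_def .
qed

lemma lift_glue_exists:
	assumes D: "closed D1" "closed D2" "connected (D1 Int D2)" "a : D1" "a : D2" and g: "lift D1 P g1" "lift D2 P g2"
	shows "EX g. lift (D1 Un D2) P g"
proof -
	define c where "c = g1 a**inv (g2 a)"
	have ga: "g1 a : carrier K" "g2 a : carrier K" using liftD(1)[OF g(1) D(4)] liftD(1)[OF g(2) D(5)] by auto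
	have g3: "lift D2 P (%x. c**g2 x)" using ga by(intro lift_left_mult g(2)) (simp add: c_def)
	have sub: "lift (D1 Int D2) P g1" "lift (D1 Int D2) P (%x. c**g2 x)"
		using lift_compose[OF g(1), of "D1 Int D2" "%x. x"] lift_compose[OF g3, of "D1 Int D2" "%x. x"] by auto
	have "g1 x = c**g2 x" if "x : D1" "x : D2" for x
		by(rule lift_unique[OF D(3) sub, of a]) (use D(4,5) that ga in "simp_all add: c_def m_assoc")
	from lift_glue[OF D(1,2) g(1) g3 this] show ?thesis by blast
qed

text \<open>Away from 0 the function \<open>chi\<close> is itself a lift; away from the antipodes
  with nontrivial jump the constant one is. As no antipode is 0, these two open sets cover the
  earring.\<close>

lemma lift_exists_local:
	assumes P: "continuous_on D P" "P ` D <= earring" and D: "P ` D <= V | P ` D <= - {0}"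
	shows "EX g. lift D P g"
	using D
proof
	assume V: "P ` D <= V"
	have "lift D P (%_. \<one>)"
		unfolding lift_def
	proof(intro ballI conjI impI)
		fix x assume x: "x : D" "P x ~= 0"
		have "eventually (%y. y : earring --> chi y = chi (P x)) (nhds (P x))"
			using x P(2) V by(intro chi_const) auto
		from eventually_comp[OF P x(1) this]
		show "eventually (%y. y : D --> \<one>**inv (chi (P y)) = \<one>**inv (chi (P x))) (nhds x)"
			by eventually_elim simp
	qed auto
	thus ?thesis by blast
next
	assume "P ` D <= - {0}"
	hence "lift D P (%x. chi (P x))" unfolding lift_def by(auto simp: image_subset_iff)
	thus ?thesis by blast
qed

text \<open>Bolzano's subdivision principle in each of the two directions: local lifts on small
  rectangles are glued along segments, whose connectedness lets a single left factor match
  them.\<close>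

lemma lift_exists_square:
	fixes P :: "real \<times> real => complex"
	assumes P: "continuous_on ({0..1} \<times> {0..1}) P" "P ` ({0..1} \<times> {0..1}) <= earring"
	shows "EX g. lift ({0..1} \<times> {0..1}) P g"
proof -
	define E where "E a b c d \<longleftrightarrow> (EX g. lift ({a..b} \<times> {c..d}) P g)" for a b c d :: real
	have local: "EX e>0. ALL a b c d. 0 <= a & a <= s & s <= b & b <= 1 & 0 <= c & c <= t & t <= d & d <= 1 & b - a < e & d - c < e --> E a b c d"
		if st: "s : {0..1}" "t : {0..1}" for s t
	proof -
		define O' where "O' = (if P (s, t) : V then V else - {0})"
		have "open O'" unfolding O'_def using open_V by(auto intro: open_Compl)
		moreover have "P (s, t) : O'"
		proof -
			have "0 : V" using antipode_nonzero by(force simp: V_def)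
			thus ?thesis by(auto simp: O'_def)
		qed
		ultimately obtain A where A: "open A" "(s, t) : A" "ALL y:{0..1} \<times> {0..1}. y : A --> P y : O'"
			using P(1) st unfolding continuous_on_topological by(metis SigmaI)
		obtain e where e: "e > 0" "ball (s, t) e <= A" using A(1,2) open_contains_ball by blast
		show ?thesis
		proof(intro exI[of _ "e / 2"] conjI allI impI)
			fix a b c d
			assume h: "0 <= a & a <= s & s <= b & b <= 1 & 0 <= c & c <= t & t <= d & d <= 1 & b - a < e / 2 & d - c < e / 2"
			have "P (x, y) : O'" if xy: "x : {a..b}" "y : {c..d}" for x y
			proof -
				have "dist (s, t) (x, y) <= abs (s - x) + abs (t - y)"
					by(simp add: dist_Pair_Pair dist_real_def sqrt_sum_squares_le_sum_abs)
				also have "... < e" using h xy by auto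
				finally have "(x, y) : A" using e(2) by auto
				thus ?thesis using A(3) h xy by auto
			qed
			hence sub: "P ` ({a..b} \<times> {c..d}) <= O'" by blast
			have "{a..b} \<times> {c..d} <= {0..1} \<times> {0..1}" using h by auto
			thus "E a b c d" unfolding E_def
				by(intro lift_exists_local continuous_on_subset[OF P(1)]) (use P(2) sub in "auto simp: O'_def split: if_splits")
		qed (use e in simp)
	qed
	have transy: "E a b c e" if E: "E a b c d" "E a b d e" and that: "a <= b" "c <= d" "d <= e" for a b c d e
	proof -
		obtain g1 g2 where g: "lift ({a..b} \<times> {c..d}) P g1" "lift ({a..b} \<times> {d..e}) P g2" using E unfolding E_def by blast
		have i: "({a..b} \<times> {c..d}) Int ({a..b} \<times> {d..e}) = {a..b} \<times> {d}" using that by auto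
		have u: "({a..b} \<times> {c..d}) Un ({a..b} \<times> {d..e}) = {a..b} \<times> {c..e}" using that by auto
		have "connected ({a..b} \<times> {d})" by(intro connected_Times) auto
		from lift_glue_exists[OF _ _ this[folded i] _ _ g, of "(a, d)"] show ?thesis
			unfolding E_def u using that by(auto intro: closed_Times)
	qed
	have transx: "E a e c d" if E: "E a b c d" "E b e c d" and that: "a <= b" "b <= e" "c <= d" for a b c d e
	proof -
		obtain g1 g2 where g: "lift ({a..b} \<times> {c..d}) P g1" "lift ({b..e} \<times> {c..d}) P g2" using E unfolding E_def by blast
		have i: "({a..b} \<times> {c..d}) Int ({b..e} \<times> {c..d}) = {b} \<times> {c..d}" using that by auto
		have u: "({a..b} \<times> {c..d}) Un ({b..e} \<times> {c..d}) = {a..e} \<times> {c..d}" using that by auto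
		have "connected ({b} \<times> {c..d})" by(intro connected_Times) auto
		from lift_glue_exists[OF _ _ this[folded i] _ _ g, of "(b, c)"] show ?thesis
			unfolding E_def u using that by(auto intro: closed_Times)
	qed
	have strip: "EX e>0. ALL a b. 0 <= a & a <= s & s <= b & b <= 1 & b - a < e --> E a b 0 1" if s: "s : {0..1}" for s
	proof -
		define R where "R c d \<longleftrightarrow> 0 <= c --> d <= 1 --> (EX e>0. ALL a b. 0 <= a & a <= s & s <= b & b <= 1 & b - a < e --> E a b c d)" for c d :: real
		have "R 0 1"
		proof(rule Bolzano)
			show "R a c" if r: "R a b" "R b c" "a <= b" "b <= c" for a b c
				unfolding R_def
			proof(intro impI)
				assume ac: "0 <= a" "c <= 1"
				obtain e1 where e1: "e1 > 0" "!!x y. 0 <= x & x <= s & s <= y & y <= 1 & y - x < e1 ==> E x y a b"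
					using r(1) ac r(3,4) unfolding R_def by auto
				obtain e2 where e2: "e2 > 0" "!!x y. 0 <= x & x <= s & s <= y & y <= 1 & y - x < e2 ==> E x y b c"
					using r(2) ac r(3,4) unfolding R_def by auto
				show "EX e>0. ALL x y. 0 <= x & x <= s & s <= y & y <= 1 & y - x < e --> E x y a c"
				proof(intro exI[of _ "min e1 e2"] conjI allI impI)
					fix x y assume xy: "0 <= x & x <= s & s <= y & y <= 1 & y - x < min e1 e2"
					have 1: "E x y a b" by(rule e1(2)) (use xy in simp)
					have 2: "E x y b c" by(rule e2(2)) (use xy in simp)
					show "E x y a c" by(rule transy[OF 1 2]) (use xy r(3,4) in linarith)+
				qed (use e1 e2 in simp)
			qed
			show "EX d>0. ALL a b. a <= x & x <= b & b - a < d --> R a b" if x: "0 <= x" "x <= 1" for x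
			proof -
				have "x : {0..1}" using x by simp
				from local[OF s this] obtain e where e: "e > 0"
					"!!a b c d. 0 <= a & a <= s & s <= b & b <= 1 & 0 <= c & c <= x & x <= d & d <= 1 & b - a < e & d - c < e ==> E a b c d"
					by(elim exE conjE) (rule that, assumption, elim allE impE)
				show ?thesis
				proof(intro exI[of _ e] conjI allI impI e(1))
					fix c d assume cd: "c <= x & x <= d & d - c < e"
					show "R c d" unfolding R_def
						by(intro impI exI[of _ e] conjI allI e) (use cd e(1) in auto)
				qed
			qed
		qed simp
		thus ?thesis unfolding R_def by simp
	qed
	define R where "R a b \<longleftrightarrow> 0 <= a --> b <= 1 --> E a b 0 1" for a b :: real
	have "R 0 1"
	proof(rule Bolzano)
		show "R a c" if r: "R a b" "R b c" "a <= b" "b <= c" for a b c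
			unfolding R_def
		proof(intro impI)
			assume ac: "0 <= a" "c <= 1"
			have "E a b 0 1" "E b c 0 1" using r ac unfolding R_def by auto
			thus "E a c 0 1" by(rule transx) (use r in auto)
		qed
		show "EX d>0. ALL a b. a <= x & x <= b & b - a < d --> R a b" if x: "0 <= x" "x <= 1" for x
		proof -
			have "x : {0..1}" using x by simp
			from strip[OF this] obtain e where e: "e > 0" "ALL a b. 0 <= a & a <= x & x <= b & b <= 1 & b - a < e --> E a b 0 1"
				by(elim exE conjE)
			show ?thesis
			proof(intro exI[of _ e] conjI allI impI e(1))
				fix a b assume ab: "a <= x & x <= b & b - a < e"
				show "R a b" unfolding R_def by(intro impI e(2)[THEN spec, THEN spec, THEN mp]) (use ab in simp)
			qed
		qed
	qed simp
	thus ?thesis unfolding R_def E_def by simp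
qed

lemma lift_exists_path:
	assumes p: "continuous_on {0..1} p" "p ` {0..1} <= earring"
	obtains g where "lift {0..1::real} p g" "g 0 = \<one>"
proof -
	have "EX g. lift ({0..1} \<times> {0..1}) (%z :: real \<times> real. p (snd z)) g"
	proof(rule lift_exists_square)
		show "continuous_on ({0..1} \<times> {0..1}) (%z. p (snd z))"
			by(rule continuous_on_compose2[OF p(1) continuous_on_snd]) (auto intro: continuous_intros)
	qed (use p(2) in auto)
	then obtain g where g: "lift ({0..1} \<times> {0..1}) (%z :: real \<times> real. p (snd z)) g" by blast
	have "lift {0..1} (%x. p (snd (0::real, x))) (%x. g (0, x))"
		by(rule lift_compose[OF g, of "{0..1}" "%t. (0, t)"]) (auto intro!: continuous_intros)
	hence g': "lift {0..1} p (%t. g (0, t))" by simp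
	have g0: "g (0, 0) : carrier K" using liftD(1)[OF g'] by simp
	show ?thesis by(rule that[OF lift_left_mult[OF g', of "inv (g (0, 0))"]]) (use g0 in simp_all)
qed

definition endpoint :: "(real => complex) => 'a" where
	"endpoint p = (SOME x. EX g. lift {0..1} p g & g 0 = \<one> & g 1 = x)"

lemma endpoint_eq:
	assumes "lift {0..1} p g"
	shows "endpoint p = inv (g 0)**g 1"
proof -
	have g0: "g 0 : carrier K" using liftD(1)[OF assms] by simp
	have l: "lift {0..1} p (%t. inv (g 0)**g t)" by(rule lift_left_mult[OF assms]) (use g0 in simp)
	show ?thesis unfolding endpoint_def
	proof(rule some_equality)
		show "EX g'. lift {0..1} p g' & g' 0 = \<one> & g' 1 = inv (g 0)**g 1" using l g0 by(intro exI conjI) auto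
		fix x assume "EX g. lift {0..1} p g & g 0 = \<one> & g 1 = x"
		then obtain g' where g': "lift {0..1} p g'" "g' 0 = \<one>" "g' 1 = x" by blast
		show "x = inv (g 0)**g 1"
			using lift_unique[OF _ g'(1) l, of 0 1] g'(2,3) g0 by simp
	qed
qed

lemma loops_earring:
	assumes "p : loops earring 0"
	shows "continuous_on {0..1} p" "p ` {0..1} <= earring" "p 0 = 0" "p 1 = 0"
	using loopsD[OF assms] by(auto simp: path_def path_image_def pathstart_def pathfinish_def)

lemma endpoint_closed: "p : loops earring 0 ==> endpoint p : carrier K"
	using lift_exists_path[OF loops_earring(1,2)] endpoint_eq liftD(1)
	by(metis atLeastAtMost_iff inv_closed m_closed order_refl zero_le_one)

text \<open>A lift of the homotopy is constant along the two sides that are mapped to the base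
  point, so its restrictions to the other two sides, which lift \<open>p\<close> and
  \<open>q\<close>, have the same ends.\<close>

lemma endpoint_homotopic:
	assumes "homotopic_paths earring p q" and p: "p : loops earring 0"
	shows "endpoint p = endpoint q"
proof -
	obtain H where H: "continuous_on ({0..1} \<times> {0..1}) H" "H : ({0..1} \<times> {0..1}) \<rightarrow> earring"
		"ALL x:{0..1}. H (0, x) = p x" "ALL x:{0..1}. H (1, x) = q x"
		"ALL t:{0..1::real}. pathstart (H o Pair t) = pathstart p & pathfinish (H o Pair t) = pathfinish p"
		using assms(1) unfolding homotopic_paths by(elim exE conjE)
	have "EX g. lift ({0..1} \<times> {0..1}) H g" by(rule lift_exists_square[OF H(1)]) (use H(2) in auto)
	then obtain g where g: "lift ({0..1} \<times> {0..1}) H g" by blast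
	have H0: "H (t, 0) = 0" "H (t, 1) = 0" if "t : {0..1}" for t
		using H(5) that loopsD(3,4)[OF p] by(auto simp: pathstart_def pathfinish_def)
	have sec: "lift {0..1} (%t. H (f t)) (%t. g (f t))" if "continuous_on {0..1} f" "f ` {0..1} <= {0..1} \<times> {0..1}" for f
		by(rule lift_compose[OF g that])
	have edge: "g (0, i) = g (1, i)" if "i = 0 | i = 1" for i
	proof -
		have l: "lift {0..1} (%t. H (t, i)) (%t. g (t, i))" by(rule sec) (use that in "auto intro!: continuous_intros")
		have "lift {0..1} (%t. H (t, i)) (%t. g (0, i))"
			unfolding lift_def using H0 that liftD(1)[OF l, of 0] by auto
		from lift_unique[OF _ this l, of 0 1] show ?thesis by simp
	qed
	have cong: "lift {0..1} r u" if "lift {0..1} r' u" "!!t. t : {0..1} ==> r t = r' t" for r r' :: "real => complex" and u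
		using that(1) unfolding lift_def by(auto simp: that(2) elim!: eventually_mono)
	have "lift {0..1} p (%t. g (0, t))"
		by(rule cong[OF sec[of "%t. (0, t)"]]) (use H(3) in "auto intro!: continuous_intros")
	moreover have "lift {0..1} q (%t. g (1, t))"
		by(rule cong[OF sec[of "%t. (1, t)"]]) (use H(4) in "auto intro!: continuous_intros")
	ultimately show ?thesis using edge by(simp add: endpoint_eq)
qed

lemma endpoint_join:
	assumes p: "p : loops earring 0" and q: "q : loops earring 0"
	shows "endpoint (p +++ q) = endpoint p**endpoint q"
proof -
	obtain g where g: "lift {0..1} (p +++ q) g" "g 0 = \<one>"
		by(rule lift_exists_path[OF loops_earring(1,2)[OF loops_join[OF p q]]])
	have gc: "g t : carrier K" if "t : {0..1}" for t by(rule liftD(1)[OF g(1) that])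
	have cong: "lift {0..1} r u" if "lift {0..1} r' u" "!!t. t : {0..1} ==> r t = r' t" for r r' :: "real => complex" and u
		using that(1) unfolding lift_def by(auto simp: that(2) elim!: eventually_mono)
	have 1: "lift {0..1} p (%t. g (t / 2))"
		by(rule cong[OF lift_compose[OF g(1), of _ "%t. t / 2"]]) (auto intro!: continuous_intros simp: joinpaths_def)
	have 2: "lift {0..1} q (%t. g ((t + 1) / 2))"
		by(rule cong[OF lift_compose[OF g(1), of _ "%t. (t + 1) / 2"]])
			(use loops_earring(3,4)[OF p] loops_earring(3,4)[OF q] in "auto intro!: continuous_intros simp: joinpaths_def add_divide_distrib")
	show ?thesis using endpoint_eq[OF g(1)] endpoint_eq[OF 1] endpoint_eq[OF 2] gc[of "1/2"] gc[of 1] g(2)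
		by(simp add: m_assoc[symmetric])
qed

definition earring_hom :: "(real => complex) set => 'a" where
	"earring_hom A = endpoint (SOME p. p : A)"

lemma earring_hom_class:
	assumes p: "p : loops earring 0"
	shows "earring_hom (path_class earring p) = endpoint p"
proof -
	have "(SOME q. q : path_class earring p) : path_class earring p"
		by(rule someI[of _ p]) (use loopsD(5)[OF p] in "simp add: path_class_def")
	thus ?thesis unfolding earring_hom_def using endpoint_homotopic[OF _ p] by(simp add: path_class_def)
qed

lemma earring_hom: "earring_hom : hom earring_group K"
proof(rule homI)
	have c: "carrier earring_group = path_class earring ` loops earring 0" by(simp add: fundamental_group_def)
	fix A assume "A : carrier earring_group"
	then obtain p where p: "p : loops earring 0" "A = path_class earring p" by(auto simp: c)
	show "earring_hom A : carrier K" by(simp add: p earring_hom_class endpoint_closed)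
	fix B assume "B : carrier earring_group"
	then obtain q where q: "q : loops earring 0" "B = path_class earring q" by(auto simp: c)
	show "earring_hom (A **\<^bsub>earring_group\<^esub> B) = earring_hom A**earring_hom B"
		by(simp add: p q fundamental_group_mult earring_hom_class loops_join endpoint_join)
qed

end

lemma lift_hom:
	assumes "lifting K h" "lifting K' (%k. f (h k))" and f: "f : hom K K'" and g: "lifting.lift K h D P g"
	shows "lifting.lift K' (%k. f (h k)) D P (%x. f (g x))"
proof -
	interpret k: lifting K h by fact
	interpret k': lifting K' "%k. f (h k)" by fact
	interpret f: group_hom K K' f using f k.is_group k'.is_group by(intro group_homI)
	have chi: "k'.chi z = f (k.chi z)" for z by(simp add: k'.chi_def k.chi_def)
	show ?thesis
		unfolding k'.lift_def chi
	proof(intro ballI conjI impI)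
		fix x assume x: "x : D"
		note gc = k.liftD(1)[OF g]
		show "f (g x) : carrier K'" using gc[OF x] by simp
		show "eventually (%y. y : D --> f (g y) = f (g x)) (nhds x)" if "P x = 0"
			using k.liftD(2)[OF g x that] by eventually_elim simp
		show "eventually (%y. y : D --> f (g y) **\<^bsub>K'\<^esub> inv\<^bsub>K'\<^esub> f (k.chi (P y)) = f (g x) **\<^bsub>K'\<^esub> inv\<^bsub>K'\<^esub> f (k.chi (P x))) (nhds x)"
			if "P x ~= 0"
			using k.liftD(3)[OF g x that]
		proof eventually_elim
			case (elim y)
			show ?case
			proof
				assume y: "y : D"
				have "f (g y **\<^bsub>K\<^esub> inv\<^bsub>K\<^esub> k.chi (P y)) = f (g x **\<^bsub>K\<^esub> inv\<^bsub>K\<^esub> k.chi (P x))" using elim y by simp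
				thus "f (g y) **\<^bsub>K'\<^esub> inv\<^bsub>K'\<^esub> f (k.chi (P y)) = f (g x) **\<^bsub>K'\<^esub> inv\<^bsub>K'\<^esub> f (k.chi (P x))"
					using gc[OF x] gc[OF y] by simp
			qed
		qed
	qed
qed

lemma endpoint_hom:
	assumes K: "lifting K h" "lifting K' (%k. f (h k))" and f: "f : hom K K'" and p: "p : loops earring 0"
	shows "lifting.endpoint K' (%k. f (h k)) p = f (lifting.endpoint K h p)"
proof -
	interpret k: lifting K h by fact
	interpret k': lifting K' "%k. f (h k)" by fact
	interpret f: group_hom K K' f using f k.is_group k'.is_group by(intro group_homI)
	obtain g where g: "k.lift {0..1} p g" "g 0 = one K" by(rule k.lift_exists_path[OF k.loops_earring(1,2)[OF p]])
	have "g 0 : carrier K" "g 1 : carrier K" using k.liftD(1)[OF g(1)] by auto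
	thus ?thesis using k.endpoint_eq[OF g(1)] k'.endpoint_eq[OF lift_hom[OF K f g(1)]] by simp
qed

text \<open>The minus sign makes the loop run through the upper half first, so that the antipode is
  crossed towards the lower half and the endpoint is \<open>h k\<close> rather than its
  inverse.\<close>

definition circle_loop :: "nat => real => complex" where
	"circle_loop k t = of_real (1 / (real k + 1)) * (1 - cis (- 2 * pi * t))"

lemma circle_loop_mem: "circle_loop k t : earring_circle k"
proof -
	define r where "r = 1 / (real k + 1)"
	have "r >= 0" by(simp add: r_def)
	have "dist (of_real r) (of_real r * (1 - cis (- 2 * pi * t))) = norm (of_real r * cis (- 2 * pi * t))"
		by(simp add: dist_norm algebra_simps)
	also have "... = r" using `r >= 0` by(simp add: norm_mult)
	finally show ?thesis unfolding earring_circle_def circle_loop_def r_def[symmetric] by simp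
qed

lemma circle_loop_zero: "circle_loop k t = 0 \<longleftrightarrow> cis (- 2 * pi * t) = 1"
proof -
	have "1 / (real k + 1) ~= 0" by simp
	thus ?thesis unfolding circle_loop_def mult_eq_0_iff of_real_eq_0_iff by auto
qed

lemma circle_loop: "circle_loop k : loops earring 0"
proof -
	have "continuous_on {0..1} (circle_loop k)" unfolding circle_loop_def by(intro continuous_intros)
	moreover have "path_image (circle_loop k) <= earring"
		using circle_loop_mem by(auto simp: path_image_def hawaiian_earring_def)
	moreover have "cis (- (2 * pi)) = 1" by(simp add: complex_eq_iff)
	ultimately show ?thesis by(simp add: loops_def path_def pathstart_def pathfinish_def circle_loop_def)
qed

lemma circle_loop_proj: "earring_proj k (path_class earring (circle_loop k)) = one (bouquet_group k)"
proof -
	have "collapse k (circle_loop k t) = 0" for t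
	proof(cases "circle_loop k t = 0")
		case False
		have "circle_loop k t ~: bouquet k"
			using circle_index[OF circle_loop_mem False] circle_index[OF _ False] False by(auto simp: bouquet_def)
		thus ?thesis by(simp add: collapse_def)
	qed (simp add: collapse_def)
	hence "collapse k o circle_loop k = (%_. 0)" by(simp add: fun_eq_iff)
	moreover have "earring_proj k (path_class earring (circle_loop k)) = path_class (bouquet k) (collapse k o circle_loop k)"
		by(rule induced_map_path_class[OF continuous_collapse _ circle_loop]) (auto simp: collapse_def bouquet_def)
	ultimately show ?thesis by(simp add: fundamental_group_def)
qed

lemma (in lifting) endpoint_circle_loop: "endpoint (circle_loop k) = h k"
proof -
	define g where "g t = (if t <= 1 / 2 then \<one> else h k)" for t :: real
	have Im: "Im (circle_loop k t) = 1 / (real k + 1) * sin (2 * pi * t)" for t by(simp add: circle_loop_def)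
	have zero: "circle_loop k t = 0 \<longleftrightarrow> t = 0 | t = 1" if "t : {0..1}" for t
	proof
		assume "circle_loop k t = 0"
		hence "cis (- 2 * pi * t) = 1" by(simp only: circle_loop_zero)
		hence "cos (2 * pi * t) = 1" by(simp add: complex_eq_iff)
		then obtain n :: int where "2 * pi * t = n * 2 * pi" by(auto simp: cos_one_2pi_int)
		hence "t = n" by simp
		thus "t = 0 | t = 1" using that by auto
	next
		assume "t = 0 | t = 1"
		moreover have "cis (- (2 * pi)) = 1" by(simp add: complex_eq_iff)
		ultimately show "circle_loop k t = 0" by(auto simp: circle_loop_zero)
	qed
	have sgn: "0 <= sin (2 * pi * t)" if "0 <= t" "t <= 1 / 2" for t by(rule sin_ge_zero) (use that in auto)
	have sgn': "sin (2 * pi * t) < 0" if "1 / 2 < t" "t < 1" for t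
		by(rule sin_lt_zero) (use that in "auto simp: field_simps")
	have chi: "g t**inv (chi (circle_loop k t)) = \<one>" if t: "0 < t" "t < 1" for t
	proof(cases "t <= 1 / 2")
		case True
		hence "~ Im (circle_loop k t) < 0" using sgn[of t] t unfolding Im by(simp add: mult_less_0_iff not_less)
		thus ?thesis using True by(simp add: g_def chi_def)
	next
		case False
		hence "Im (circle_loop k t) < 0" using sgn'[of t] t unfolding Im by(simp add: mult_less_0_iff field_simps)
		moreover have "circle_index (circle_loop k t) = k" by(rule circle_index[OF circle_loop_mem]) (use zero[of t] t in auto)
		ultimately show ?thesis using False h by(simp add: g_def chi_def)
	qed
	have "lift {0..1} (circle_loop k) g"
		unfolding lift_def
	proof(intro ballI conjI impI)
		fix t :: real assume t: "t : {0..1}"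
		show "g t : carrier K" using h by(simp add: g_def)
		show "eventually (%y. y : {0..1} --> g y = g t) (nhds t)" if "circle_loop k t = 0"
		proof -
			have "t = 0 | t = 1" using zero[OF t] that by simp
			hence "eventually (%y. dist y t < 1 / 2) (nhds t)" unfolding eventually_nhds_metric by(intro exI[of _ "1 / 2"]) simp
			thus ?thesis by eventually_elim (use `t = 0 | t = 1` in "auto simp: g_def dist_real_def abs_if split: if_splits")
		qed
		show "eventually (%y. y : {0..1} --> g y**inv (chi (circle_loop k y)) = g t**inv (chi (circle_loop k t))) (nhds t)"
			if "circle_loop k t ~= 0"
		proof -
			have t01: "0 < t" "t < 1" using zero[OF t] that t by auto
			have "eventually (%y. y : {0<..<1}) (nhds t)" using t01 by(intro eventually_nhds_in_open) auto
			thus ?thesis by eventually_elim (use chi t01 in simp)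
		qed
	qed
	from endpoint_eq[OF this] show ?thesis using h by(simp add: g_def)
qed

text \<open>At stage \<open>i\<close> only circles below \<open>i\<close> contribute, since
  \<open>s k i\<close> is trivial for \<open>k \<ge> i\<close>. So every coordinate is a lifting
  problem with finitely many jumps, and \<open>endpoint_hom\<close> makes the coordinates
  compatible.\<close>

lemma earring_inverse_limit_hom:
	fixes s :: "nat => nat => 'h"
	assumes H: "inverse_sequence H p" and s: "!!n. s n : carrier (inverse_limit H p)" "!!n. s n n = one (H n)"
	defines "F \<equiv> %A i. lifting.earring_hom (H i) (%k. s k i) A"
	shows "lifting (H i) (%k. s k i)" "F : hom earring_group (inverse_limit H p)"
		"F (path_class earring (circle_loop n)) = s n"
proof -
	let ?I = "inverse_limit H p"
	have gH: "group (H k)" for k using H by(simp add: inverse_sequence_def)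
	have ph: "p i j : hom (H j) (H i)" if "i < j" for i j using H that by(simp add: inverse_sequence_def)
	have sc: "s n i : carrier (H i)" "i < j ==> p i j (s n j) = s n i" for n i j
		using s(1)[of n] by(auto simp: carrier_inverse_limit)
	have s1: "s n i = one (H i)" if "i <= n" for n i
		using that s(2)[of n] sc(2)[of i n n] hom_one[OF ph[of i n] gH gH] by(cases "i = n") auto
	have l: "lifting (H i) (%k. s k i)" for i
	proof -
		have "finite {k. s k i ~= one (H i)}" by(rule finite_subset[of _ "{..<i}"]) (use s1 in "auto simp: not_less[symmetric]")
		thus ?thesis using gH[of i] sc(1) by(simp add: lifting_def lifting_axioms_def)
	qed
	thus "lifting (H i) (%k. s k i)" .
	have Fp: "F (path_class earring q) i = lifting.endpoint (H i) (%k. s k i) q" if "q : loops earring 0" for q i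
		unfolding F_def by(rule lifting.earring_hom_class[OF l that])
	show "F (path_class earring (circle_loop n)) = s n"
		by(rule ext) (simp only: Fp[OF circle_loop] lifting.endpoint_circle_loop[OF l])
	show "F : hom earring_group ?I"
	proof(rule homI)
		fix A assume A: "A : carrier earring_group"
		then obtain q where q: "q : loops earring 0" "A = path_class earring q" by(auto simp: fundamental_group_def)
		have "p i j (F A j) = F A i" if ij: "i < j" for i j
		proof -
			have "(%k. p i j (s k j)) = (%k. s k i)" using sc(2)[OF ij] by simp
			thus ?thesis using endpoint_hom[OF l[of j] _ ph[OF ij] q(1)] l[of i] unfolding q(2) Fp[OF q(1)] by simp
		qed
		moreover have "F A i : carrier (H i)" for i
			unfolding q(2) Fp[OF q(1)] by(rule lifting.endpoint_closed[OF l q(1)])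
		ultimately show "F A : carrier ?I" by(simp add: carrier_inverse_limit)
		fix B assume B: "B : carrier earring_group"
		show "F (A **\<^bsub>earring_group\<^esub> B) = F A **\<^bsub>?I\<^esub> F B"
			unfolding F_def by(simp add: fun_eq_iff hom_mult[OF lifting.earring_hom[OF l] A B])
	qed
qed

lemma n_slender_circle_loop:
	assumes G: "n_slender G" and f: "f : hom earring_group G"
	shows "EX n. f (path_class earring (circle_loop n)) = one G"
proof -
	obtain n g where n: "g : hom (bouquet_group n) G" "!!x. x : carrier earring_group ==> f x = g (earring_proj n x)"
		using conjunct2[OF G[unfolded n_slender_def], THEN bspec, OF f] by(elim exE bexE) (rule that, assumption, erule bspec)
	have gG: "group G" using G by(simp add: n_slender_def)
	have "path_class earring (circle_loop n) : carrier earring_group" using circle_loop by(simp add: fundamental_group_def)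
	from n(2)[OF this] have "f (path_class earring (circle_loop n)) = g (one (bouquet_group n))" by(simp only: circle_loop_proj)
	also have "... = one G" by(rule hom_one[OF n(1) group_fundamental_group gG]) (simp add: bouquet_def)
	finally show ?thesis by blast
qed

theorem n_slender_imp_inverse_limit_slender:
	assumes G: "n_slender G"
	shows "inverse_limit_slender TYPE('h) G"
	unfolding inverse_limit_slender_def
proof(intro conjI allI impI ballI)
	show gG: "group G" using G by(simp add: n_slender_def)
	fix H :: "nat => 'h monoid" and p f
	assume H: "inverse_sequence H p" "mittag_leffler H p" and f: "f : hom (inverse_limit H p) G"
	let ?I = "inverse_limit H p"
	have "EX i. ALL x:carrier ?I. x i = one (H i) --> f x = one G"
	proof(rule ccontr)
		assume "~ ?thesis"
		then obtain s where s: "!!n. s n : carrier ?I" "!!n. s n n = one (H n)" "!!n. f (s n) ~= one G" by metis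
		define F where "F = (%A i. lifting.earring_hom (H i) (%k. s k i) A)"
		note F = earring_inverse_limit_hom[OF H(1) s(1,2), folded F_def]
		have "(%A. f (F A)) : hom earring_group G" using f F(2) by(simp add: hom_def Pi_def)
		from n_slender_circle_loop[OF G this] obtain n where n: "f (F (path_class earring (circle_loop n))) = one G" by(elim exE)
		have "F (path_class earring (circle_loop n)) = s n"
			unfolding F_def by(rule earring_inverse_limit_hom(3)[OF H(1) s(1,2)])
		thus False using n s(3) by simp
	qed
	then obtain i where "!!x. x : carrier ?I ==> x i = one (H i) ==> f x = one G" by blast
	thus "EX i. EX g:hom (H i) G. ALL x:carrier ?I. f x = g (x i)"
		by(rule mittag_leffler_factor[OF H gG f])
qed

section \<open>Free groups as reduced words\<close>

type_synonym letter = "nat \<times> bool"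

definition letter_inv :: "letter => letter" where
	"letter_inv a = (fst a, ~ snd a)"

lemma letter_inv [simp]: "letter_inv (letter_inv a) = a" "fst (letter_inv a) = fst a" "letter_inv a ~= a" "a ~= letter_inv a"
	by(cases a; simp add: letter_inv_def)+

fun red :: "letter list => bool" where
	"red (a # b # w) \<longleftrightarrow> b ~= letter_inv a & red (b # w)"
| "red _ \<longleftrightarrow> True"

definition push :: "letter => letter list => letter list" where
	"push a w = (if w ~= [] & hd w = letter_inv a then tl w else a # w)"

text \<open>Van der Waerden's trick: letters act on reduced words by \<open>push\<close>, and
  associativity is inherited from the composition of maps.\<close>

definition wmult :: "letter list => letter list => letter list" where
	"wmult u v = foldr push u v"

lemma red_Cons: "red (a # w) \<longleftrightarrow> red w & (w = [] | hd w ~= letter_inv a)"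
	by(cases w) auto

lemma red_append: "red (u @ v) \<longleftrightarrow> red u & red v & (u = [] | v = [] | hd v ~= letter_inv (last u))"
	by(induction u) (auto simp: red_Cons hd_append)

lemma red_push: "red w ==> red (push a w)"
	by(cases w) (auto simp: push_def red_Cons)

lemma push_push: "red w ==> push a (push (letter_inv a) w) = w"
	by(cases w) (auto simp: push_def red_Cons)

lemma push_red: "red (a # w) ==> push a w = a # w"
	by(cases w) (auto simp: push_def)

lemma foldr_closed: "(!!a x. x : S ==> T a x : S) ==> x : S ==> foldr T w x : S"
	by(induction w) auto

lemma foldr_push:
	assumes T: "!!a x. x : S ==> T a x : S" "!!a x. x : S ==> T a (T (letter_inv a) x) = x" and x: "x : S"
	shows "foldr T (push a v) x = T a (foldr T v x)"
	using T foldr_closed[of S T, OF T(1) x, of "tl v"] by(cases v) (auto simp: push_def)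

text \<open>An action of letters in which \<open>a\<close> undoes \<open>letter_inv a\<close> on
  \<open>S\<close> extends to the whole group. Associativity, the projections and the action in
  \<open>conj_growth\<close> are instances with different \<open>T\<close>.\<close>

lemma foldr_wmult:
	assumes T: "!!a x. x : S ==> T a x : S" "!!a x. x : S ==> T a (T (letter_inv a) x) = x" and x: "x : S"
	shows "foldr T (wmult u v) x = foldr T u (foldr T v x)"
	unfolding wmult_def by(induction u) (simp_all add: foldr_push[of S T, OF T x])

definition free_grp :: "nat set => letter list monoid" where
	"free_grp A = \<lparr>carrier = {w. red w & fst ` set w <= A}, mult = wmult, one = []\<rparr>"

lemma free_grp [simp]: "w : carrier (free_grp A) \<longleftrightarrow> red w & fst ` set w <= A"
	"u **\<^bsub>free_grp A\<^esub> v = wmult u v" "one (free_grp A) = []"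
	by(auto simp: free_grp_def)

lemma red_wmult: "red v ==> red (wmult u v)"
	unfolding wmult_def by(induction u) (simp_all add: red_push)

lemma set_push: "set (push a w) <= insert a (set w)"
	by(cases w) (auto simp: push_def)

lemma set_wmult: "set (wmult u v) <= set u Un set v"
	unfolding wmult_def
proof(induction u)
	case (Cons a u) thus ?case using set_push[of a "foldr push u v"] by auto
qed simp

lemma letters_wmult: "fst ` set (wmult u v) <= fst ` set u Un fst ` set v"
	using image_mono[OF set_wmult, of fst u v] by(simp add: image_Un)

lemma wmult_assoc: "red w ==> wmult (wmult u v) w = wmult u (wmult v w)"
	using foldr_wmult[of "Collect red" push w u v] red_push push_push by(simp add: wmult_def)

lemma wmult_append: "red (u @ v) ==> wmult u v = u @ v"
	unfolding wmult_def by(induction u) (simp_all add: push_red red_Cons)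

lemma wmult_Nil [simp]: "red u ==> wmult u [] = u" "wmult [] v = v"
	using wmult_append[of u "[]"] by(simp_all add: wmult_def)

definition formal_inv :: "letter list => letter list" where
	"formal_inv u = map letter_inv (rev u)"

lemma foldr_formal_inv:
	assumes T: "!!a x. x : S ==> T a x : S" "!!a x. x : S ==> T a (T (letter_inv a) x) = x" and x: "x : S"
	shows "foldr T (formal_inv u) (foldr T u x) = x"
proof(induction u)
	case (Cons a u)
	have "T (letter_inv a) (T (letter_inv (letter_inv a)) (foldr T u x)) = foldr T u x"
		by(rule T(2)[OF foldr_closed[of S T, OF T(1) x]])
	thus ?case using Cons by(simp add: formal_inv_def)
qed (simp add: formal_inv_def)

lemma formal_inv_mult:
	assumes "red u"
	shows "wmult (wmult (formal_inv u) []) u = []"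
proof -
	have "foldr push (formal_inv u) (foldr push u []) = []"
		by(rule foldr_formal_inv[of "Collect red"]) (auto simp: red_push push_push)
	moreover have "foldr push u [] = u" using wmult_Nil(1)[OF assms] by(simp add: wmult_def)
	ultimately show ?thesis using assms by(simp add: wmult_assoc) (simp add: wmult_def)
qed

lemma group_free_grp: "group (free_grp A)"
proof(rule groupI)
	fix u v w assume u: "u : carrier (free_grp A)" and v: "v : carrier (free_grp A)" and w: "w : carrier (free_grp A)"
	show "u **\<^bsub>free_grp A\<^esub> v : carrier (free_grp A)" using u v letters_wmult[of u v] by(simp add: red_wmult) blast
	show "u **\<^bsub>free_grp A\<^esub> v **\<^bsub>free_grp A\<^esub> w = u **\<^bsub>free_grp A\<^esub> (v **\<^bsub>free_grp A\<^esub> w)" using w by(simp add: wmult_assoc)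
next
	fix u assume u: "u : carrier (free_grp A)"
	\<comment> \<open>Multiplication with \<open>[]\<close> produces a reduced word whatever
	  \<open>formal_inv u\<close> looks like.\<close>
	let ?y = "wmult (formal_inv u) []"
	have "fst ` set (formal_inv u) = fst ` set u" by(simp add: formal_inv_def image_image)
	hence "fst ` set ?y <= A" using u letters_wmult[of "formal_inv u" "[]"] by(simp add: subset_trans)
	moreover have "wmult ?y u = []" using u by(simp add: formal_inv_mult)
	ultimately show "EX y:carrier (free_grp A). y **\<^bsub>free_grp A\<^esub> u = one (free_grp A)"
		by(intro bexI[of _ ?y]) (auto simp: red_wmult)
qed simp_all

abbreviation FF :: "letter list monoid" where "FF \<equiv> free_grp UNIV"

interpretation FF: group FF by(rule group_free_grp)

abbreviation winv :: "letter list => letter list" where "winv u \<equiv> inv\<^bsub>FF\<^esub> u"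

abbreviation word_pow :: "letter list => nat => letter list" (infixr "\<up>" 75) where "u \<up> k \<equiv> u [^]\<^bsub>FF\<^esub> k"

lemma free_grp_pow: "x [^]\<^bsub>free_grp A\<^esub> (k::nat) = x \<up> k"
	by(induction k) simp_all

lemma free_grp_inv: "x : carrier (free_grp A) ==> inv\<^bsub>free_grp A\<^esub> x = winv x"
	using group.l_inv[OF group_free_grp, of x A] group.inv_closed[OF group_free_grp, of x A]
		FF.inv_equality[of "inv\<^bsub>free_grp A\<^esub> x" x] by simp

definition lcount :: "nat => letter list => nat" where
	"lcount m w = length (filter (%a. fst a < m) w)"

lemma lcount_mult: "lcount m (wmult u v) <= lcount m u + lcount m v"
proof -
	have "lcount m (push a w) <= lcount m [a] + lcount m w" for a w
		by(cases w) (auto simp: push_def lcount_def)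
	note p = this
	show ?thesis unfolding wmult_def
	proof(induction u)
		case (Cons a u)
		thus ?case using p[of a "foldr push u v"] by(simp add: lcount_def split: if_splits)
	qed (simp add: lcount_def)
qed

lemma length_wmult: "length (wmult u v) <= length u + length v"
proof -
	have p: "length (push a w) <= Suc (length w)" for a w by(cases w) (auto simp: push_def)
	show ?thesis unfolding wmult_def
	proof(induction u)
		case (Cons a u) thus ?case using p[of a "foldr push u v"] by simp
	qed simp
qed

lemma FF_inv: "red u ==> winv u = wmult (formal_inv u) []"
	by(rule FF.inv_equality) (simp_all add: formal_inv_mult red_wmult)

lemma red_inv: "red w ==> red (winv w)"
	using FF.inv_closed[of w] by simp

lemma winv_cancel:
	assumes "red w" "red x"
	shows "wmult w (wmult (winv w) x) = x" "wmult (winv w) (wmult w x) = x"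
	using FF.r_inv[of w] FF.l_inv[of w] assms by(simp_all add: wmult_assoc[symmetric])

lemma lcount_inv: "red u ==> lcount m (winv u) <= lcount m u"
	using lcount_mult[of m "formal_inv u" "[]"]
	by(simp add: FF_inv) (simp add: lcount_def formal_inv_def rev_filter[symmetric] filter_map comp_def)

lemma length_inv: "red u ==> length (winv u) <= length u"
	using length_wmult[of "formal_inv u" "[]"] by(simp add: FF_inv) (simp add: formal_inv_def)

text \<open>Induction by cyclic reduction. If \<open>x\<close> does not cancel against itself, its
  powers are concatenations; otherwise it has the form \<open>a y b\<close> with mutually inverse
  letters \<open>a\<close> and \<open>b\<close>, and the power is that of \<open>y\<close> between
  \<open>a\<close> and \<open>b\<close>. First and last letters are carried along to see that the
  outer letters still do not cancel.\<close>

lemma word_power: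
	assumes "red x" "x ~= []"
	shows "red (x \<up> Suc k) & x \<up> Suc k ~= [] & hd (x \<up> Suc k) = hd x &
		last (x \<up> Suc k) = last x & length x + k <= length (x \<up> Suc k)"
	using assms
proof(induction "length x" arbitrary: x rule: less_induct)
	case less
	show ?case
	proof(cases "hd x = letter_inv (last x)")
		case False
		show ?thesis
		proof(induction k)
			case 0 thus ?case using less.prems by simp
		next
			case (Suc k)
			let ?y = "x \<up> Suc k"
			have "red (?y @ x)" using Suc less.prems False by(simp add: red_append del: FF.nat_pow_Suc nat_pow_Suc)
			hence "x \<up> Suc (Suc k) = ?y @ x"
				using wmult_append by(metis FF.nat_pow_Suc free_grp(2))
			moreover have "1 <= length x" using less.prems(2) by(cases x) auto
			ultimately show ?case using Suc `red (?y @ x)` less.prems(2) by(simp del: FF.nat_pow_Suc)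
		qed
	next
		case True
		obtain a r where x1: "x = a # r" using less.prems(2) by(cases x) auto
		have "r ~= []" using True x1 by auto
		then obtain y b where x2: "x = a # y @ [b]" using x1 by(metis append_butlast_last_id)
		have ab: "a = letter_inv b" using True x2 by simp
		have y0: "y ~= []" using less.prems(1) x2 ab by auto
		have ry: "red y" "hd y ~= letter_inv a" "b ~= letter_inv (last y)"
			using less.prems(1) y0 unfolding x2 by(auto simp: red_Cons red_append hd_append)
		have sandwich: "wmult (wmult [a] z) [b] = a # z @ [b]" "red (a # z @ [b])"
			if "red z" "z ~= []" "hd z = hd y" "last z = last y" for z
		proof -
			show r: "red (a # z @ [b])" using that ry by(auto simp: red_Cons red_append hd_append)
			hence "red ([a] @ z)" using red_append[of "a # z" "[b]"] by simp
			hence "wmult [a] z = a # z" using wmult_append[of "[a]" z] by simp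
			thus "wmult (wmult [a] z) [b] = a # z @ [b]" using wmult_append[of "a # z" "[b]"] r by simp
		qed
		have xe: "x = wmult (wmult [a] y) [b]" using sandwich(1)[OF ry(1) y0] x2 by simp
		have inv: "wmult [b] [a] = []" using ab by(simp add: wmult_def push_def)
		have pw: "x \<up> Suc j = wmult (wmult [a] (y \<up> Suc j)) [b]" for j
		proof(induction j)
			case 0 thus ?case using xe less.prems(1) ry(1) by simp
		next
			case (Suc j)
			have yr: "red (y \<up> Suc j)" using FF.nat_pow_closed[of y "Suc j"] ry(1) by simp
			have "x \<up> Suc (Suc j) = wmult (x \<up> Suc j) x" by simp
			also have "... = wmult (wmult (wmult [a] (y \<up> Suc j)) [b]) (wmult (wmult [a] y) [b])"
				using Suc xe by metis
			also have "... = wmult [a] (wmult (y \<up> Suc j) (wmult (wmult [b] [a]) (wmult y [b])))"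
				using yr ry(1) by(simp add: wmult_assoc red_wmult del: FF.nat_pow_Suc nat_pow_Suc)
			also have "... = wmult (wmult [a] (wmult (y \<up> Suc j) y)) [b]"
				using yr ry(1) by(simp add: inv wmult_assoc red_wmult del: FF.nat_pow_Suc nat_pow_Suc)
			finally show ?case by simp
		qed
		have "length y < length x" using x2 by simp
		from less.hyps[OF this ry(1) y0] have z: "red (y \<up> Suc k)" "y \<up> Suc k ~= []" "hd (y \<up> Suc k) = hd y"
			"last (y \<up> Suc k) = last y" "length y + k <= length (y \<up> Suc k)" by blast+
		have px: "x \<up> Suc k = a # y \<up> Suc k @ [b]" unfolding pw by(rule sandwich(1)[OF z(1-4)])
		show ?thesis unfolding px using sandwich(2)[OF z(1-4)] z(5) by(simp add: x2 del: FF.nat_pow_Suc)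
	qed
qed

text \<open>By \<open>word_power\<close> the power is longer than \<open>x\<close> by more than the
  length of \<open>c\<close>, and multiplication by \<open>c\<close> removes at most that many
  letters.\<close>

lemma length_group_free_grp: "length_group (free_grp A) length"
	unfolding length_group_def
proof(intro conjI ballI impI)
	show "group (free_grp A)" by(rule group_free_grp)
	fix c x assume "c : carrier (free_grp A)" "x : carrier (free_grp A)" "x ~= one (free_grp A)"
	hence c: "red c" and x: "red x" "x ~= []" by auto
	define y where "y = x \<up> (length c + 2)"
	have y: "red y" "length x + Suc (length c) <= length y" using word_power[OF x, of "Suc (length c)"] by(simp_all add: y_def)
	have "y = wmult (winv c) (wmult c y)" using winv_cancel(2)[OF c y(1)] by simp
	hence "length y <= length (winv c) + length (wmult c y)" using length_wmult by metis
	hence "length x < length (wmult c y)" using length_inv[OF c] y(2) by simp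
	thus "length x < length (c **\<^bsub>free_grp A\<^esub> x [^]\<^bsub>free_grp A\<^esub> (length c + 2))" by(simp only: free_grp(2) free_grp_pow[of A] y_def)
qed simp

section \<open>Projections that delete letters\<close>

definition wproj :: "nat => letter list => letter list" where
	"wproj n w = foldr (%a. if fst a < n then push a else id) w []"

lemma wproj_Cons: "wproj n (a # w) = (if fst a < n then push a (wproj n w) else wproj n w)"
	by(simp add: wproj_def)

lemma foldr_proj: "red x ==> foldr (%a. if fst a < n then push a else id) w x = wmult (wproj n w) x"
proof(induction w)
	case (Cons a w)
	thus ?case using foldr_push[of "Collect red" push x a "wproj n w"] red_push push_push
		by(simp add: wproj_def wmult_def)
qed (simp add: wproj_def)

lemma red_wproj: "red (wproj n w)"
	unfolding wproj_def by(induction w) (simp_all add: red_push)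

lemma set_wproj: "fst ` set (wproj n w) <= fst ` set w Int {..<n}"
	unfolding wproj_def
proof(induction w)
	case (Cons a w)
	let ?r = "foldr (%a. if fst a < n then push a else id) w []"
	have "fst ` set (push a ?r) <= insert (fst a) (fst ` set ?r)" using image_mono[OF set_push, of fst a ?r] by simp
	also have "... <= insert (fst a) (fst ` set w Int {..<n})" using Cons by(rule insert_mono)
	finally have p: "fst ` set (push a ?r) <= insert (fst a) (fst ` set w Int {..<n})" .
	show ?case
	proof(cases "fst a < n")
		case True
		hence "insert (fst a) (fst ` set w Int {..<n}) = fst ` set (a # w) Int {..<n}" by auto
		thus ?thesis using p True by simp
	next
		case False
		have "fst ` set w Int {..<n} <= fst ` set (a # w) Int {..<n}" by auto
		thus ?thesis using subset_trans[OF Cons] False by simp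
	qed
qed simp

lemma wproj_mult: "wproj n (wmult u v) = wmult (wproj n u) (wproj n v)"
proof -
	let ?T = "%a. if fst a < n then push a else id"
	have "foldr ?T (wmult u v) [] = foldr ?T u (foldr ?T v [])"
		by(rule foldr_wmult[of "Collect red"]) (auto simp: red_push push_push)
	also have "... = wmult (wproj n u) (wproj n v)"
		using foldr_proj[OF red_wproj] by(simp add: wproj_def)
	finally show ?thesis by(simp add: wproj_def)
qed

lemma wproj_id: "red w ==> fst ` set w <= {..<n} ==> wproj n w = w"
	unfolding wproj_def by(induction w) (auto simp: push_red red_Cons)

lemma wproj_proj: "m <= n ==> wproj m (wproj n w) = wproj m w"
proof(induction w)
	case (Cons a w)
	have *: "wproj m (push a x) = wmult (wproj m [a]) (wproj m x)" if "red x" for a x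
		using wproj_mult[of m "[a]" x] by(simp add: wmult_def)
	show ?case using Cons *[OF red_wproj, of a n w] by(auto simp: wproj_Cons wproj_def[of m "[]"] wmult_def push_def[of a "[]"])
qed (simp add: wproj_def)

lemma wproj_hom: "wproj n : hom (free_grp A) (free_grp (A Int {..<n}))"
proof(rule homI)
	fix x assume "x : carrier (free_grp A)"
	hence "fst ` set x Int {..<n} <= A Int {..<n}" by(intro Int_mono) simp_all
	from subset_trans[OF set_wproj this] show "wproj n x : carrier (free_grp (A Int {..<n}))"
		by(simp only: free_grp red_wproj simp_thms)
qed (simp only: free_grp wproj_mult)

lemma length_wproj: "length (wproj m w) <= lcount m w"
proof(induction w)
	case (Cons a w)
	have "length (push a (wproj m w)) <= Suc (length (wproj m w))" by(cases "wproj m w") (auto simp: push_def)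
	thus ?case using Cons by(simp add: wproj_def lcount_def)
qed (simp add: wproj_def)

text \<open>On pairs \<open>(\<alpha>, \<omega>)\<close> the letters below \<open>m\<close> act on \<open>\<alpha>\<close>; a letter \<open>x\<close> above \<open>m\<close> multiplies \<open>\<omega>\<close> by \<open>\<alpha>\<inverse> x \<alpha>\<close>, but only
  while \<open>\<alpha>\<close> is short. So \<open>v\<close> acts nontrivially near \<open>\<alpha> = 1\<close>, whereas words that cannot
  shorten \<open>\<alpha>\<close> act through their projection.\<close>

lemma conj_growth:
	assumes u: "red u" "wproj m u ~= []" and v: "red v" "wproj m v = []" "v ~= []"
	shows "a <= lcount m (wmult (wmult (u \<up> a) v) (winv (u \<up> a))) + lcount m v"
proof -
	define R where "R = lcount m v"
	define T where "T x z = (if fst x < m then (push x (fst z), snd z) else if length (fst z) <= R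
		 then (fst z, wmult (winv (fst z)) (push x (wmult (fst z) (snd z)))) else z)" for x and z :: "letter list \<times> letter list"
	have TP: "T x (c, \<omega>) = (if fst x < m then (push x c, \<omega>) else if length c <= R
		 then (c, wmult (winv c) (push x (wmult c \<omega>))) else (c, \<omega>))" for x c \<omega> by(simp add: T_def)
	define S where "S = {z :: letter list \<times> letter list. red (fst z) & red (snd z)}"
	note ri = red_inv and ci = winv_cancel
	have TS: "T x z : S" if "z : S" for x z using that by(auto simp: T_def S_def red_push red_wmult)
	have TT: "T x (T (letter_inv x) z) = z" if "z : S" for x z
		using that by(auto simp: T_def S_def red_push push_push red_wmult ci prod_eq_iff)
	have fm: "foldr T (wmult u v) x = foldr T u (foldr T v x)" if "x : S" for u v x
		by(rule foldr_wmult[of S T, OF _ _ that]) (simp_all add: TS TT)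
	have fc: "foldr T w x : S" if "x : S" for w x
		by(rule foldr_closed[of S T, OF _ that]) (rule TS)
	have fst_T: "fst (foldr T w z) = wmult (wproj m w) (fst z)" if "z : S" for w z
	proof -
		have "fst (foldr T w z) = foldr (%a. if fst a < m then push a else id) w (fst z)"
			by(induction w) (auto simp: T_def)
		thus ?thesis using foldr_proj that by(simp add: S_def)
	qed
	\<comment> \<open>With at most \<open>R\<close> letters below \<open>m\<close>, the component
	  \<open>\<alpha>\<close> never becomes too long, every letter acts fully, and the action is
	  ordinary left multiplication in other coordinates.\<close>
	have near: "foldr T w ([], \<omega>) = (wproj m w, wmult (winv (wproj m w)) (foldr push w \<omega>))"
		if "lcount m w <= R" "red \<omega>" for w \<omega>
		using that(1)
	proof(induction w)
		case Nil thus ?case using FF.inv_one that(2) by(simp add: wproj_def)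
	next
		case (Cons x w)
		define c where "c = wproj m w"
		have IH: "foldr T w ([], \<omega>) = (c, wmult (winv c) (foldr push w \<omega>))"
			using Cons by(simp add: lcount_def c_def split: if_splits)
		have rw: "red (foldr push w \<omega>)" using red_wmult[OF that(2)] by(simp add: wmult_def)
		have ra: "red c" by(simp add: c_def red_wproj)
		show ?case
		proof(cases "fst x < m")
			case True
			have p: "push x y = wmult [x] y" for y by(simp add: wmult_def)
			have "wmult (winv (wmult [x] c)) (wmult [x] (foldr push w \<omega>)) = wmult (winv c) (foldr push w \<omega>)"
				using FF.inv_mult_group[of "[x]" c] ra rw ci(2)[of "[x]"] by(simp add: wmult_assoc red_wmult)
			thus ?thesis using True IH by(simp add: TP wproj_Cons p flip: c_def)
		next
			case False
			have "length c <= R" using length_wproj[of m w] Cons.prems False by(simp add: c_def lcount_def)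
			thus ?thesis using False IH ra rw by(simp add: TP wproj_Cons ci flip: c_def)
		qed
	qed
	\<comment> \<open>A component \<open>\<alpha>\<close> that starts this long stays longer than
	  \<open>R\<close> while \<open>w\<close> is read, so the letters from \<open>m\<close> on do
	  nothing.\<close>
	have far: "snd (foldr T w z) = snd z" if z: "z : S" and "lcount m w + R < length (fst z)" for w z
		using that(2)
	proof(induction w)
		case (Cons x w)
		have IH: "snd (foldr T w z) = snd z" using Cons by(simp add: lcount_def split: if_splits)
		have "fst z = wmult (winv (wproj m w)) (wmult (wproj m w) (fst z))"
			using ci(2)[of "wproj m w" "fst z"] z by(simp add: S_def red_wproj)
		hence "length (fst z) <= length (winv (wproj m w)) + length (fst (foldr T w z))"
			unfolding fst_T[OF z] using length_wmult by metis
		moreover have "length (winv (wproj m w)) <= lcount m w"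
			using length_inv[OF red_wproj[of m w]] length_wproj[of m w] by linarith
		moreover have "lcount m w <= lcount m (x # w)" by(simp add: lcount_def)
		ultimately have "R < length (fst (foldr T w z))" using Cons.prems by linarith
		thus ?case using IH by(simp add: T_def[of x "foldr T w z"])
	qed simp
	show ?thesis
	proof(cases a)
		case (Suc b)
		define U where "U = u \<up> a"
		define X where "X = wmult (wmult U v) (winv U)"
		define c where "c = wproj m U"
		have rU: "red U" using FF.nat_pow_closed[of u a] u(1) by(simp add: U_def)
		have ra: "red c" by(simp add: c_def red_wproj)
		interpret p: group_hom FF "free_grp ({} Un {..<m})" "wproj m"
			using wproj_hom[of m UNIV] group_free_grp by(simp add: group_hom_def group_hom_axioms_def)
		have "c = wproj m u \<up> Suc b" using p.hom_nat_pow[of u a] u(1) Suc by(simp add: c_def U_def free_grp_pow[of "{..<m}"] del: FF.nat_pow_Suc)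
		hence la: "a <= length c" using word_power[OF red_wproj u(2), of b] Suc u(2) by(cases "wproj m u") auto
		have "length c <= lcount m X + R"
		proof(rule ccontr)
			assume "~ ?thesis"
			\<comment> \<open>With so few letters below \<open>m\<close>, the word \<open>X\<close> would fix
			  the point \<open>(c, [])\<close>. Undoing \<open>U\<close> moves this point to one with
			  \<open>\<alpha> = []\<close>, where \<open>v\<close> would then act trivially; but there it
			  multiplies \<open>\<omega>\<close> by \<open>v\<close>.\<close>
			hence big: "lcount m X + R < length (fst (c, [] :: letter list))" by simp
			have zS: "(c, []) : S" using ra by(simp add: S_def)
			have pX: "wproj m X = []"
				unfolding X_def wproj_mult v(2) using p.hom_inv[of U] rU group.r_inv[OF group_free_grp, of c "{..<m}"] ra set_wproj[of m U]
				by(simp add: c_def)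
			have X1: "foldr T X (c, []) = (c, [])" using far[OF zS big] fst_T[OF zS, of X] pX by(simp add: prod_eq_iff)
			define z where "z = foldr T (winv U) (c, [])"
			have z: "z : S" unfolding z_def by(rule fc[OF zS])
			have inv: "foldr T (winv U) (foldr T U x) = x" if "x : S" for x
				using fm[OF that, of "winv U" U] FF.l_inv[of U] rU by simp
			have "fst z = []"
				unfolding z_def fst_T[OF zS] using p.hom_inv[of U] rU group.l_inv[OF group_free_grp, of c "{..<m}"] ra set_wproj[of m U]
				by(simp add: c_def)
			hence ze: "z = ([], snd z)" "red (snd z)" using z by(auto simp: prod_eq_iff S_def)
			have "foldr T X (c, []) = foldr T U (foldr T v z)"
				unfolding X_def z_def using fm[OF zS] fm[OF z[unfolded z_def]] by simp
			hence "foldr T (winv U) (c, []) = foldr T v z"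
				using X1 inv[OF fc[OF z]] by simp
			hence "foldr T v z = z" by(simp add: z_def)
			moreover have "foldr T v z = ([], foldr push v (snd z))"
				using near[of v "snd z"] ze v(2) R_def FF.inv_one by(simp add: wmult_def)
			ultimately have "wmult v (snd z) = snd z" using ze(1) by(metis snd_conv wmult_def)
			thus False using FF.r_cancel_one[of "snd z" v] ze(2) v(1,3) by simp
		qed
		thus ?thesis using la unfolding X_def U_def R_def by linarith
	qed simp
qed

section \<open>The witnesses\<close>

text \<open>Applied to isomorphisms in both directions, this and the next two lemmas move the
  witnesses to the type \<open>nat \<Rightarrow> int\<close>.\<close>

lemma inverse_limit_slender_retract:
	assumes G: "inverse_limit_slender TYPE('h) G" and G': "group G'"
		and e: "e : hom G' G" and d: "d : hom G G'" and de: "!!x. x : carrier G' ==> d (e x) = x"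
	shows "inverse_limit_slender TYPE('h) G'"
	unfolding inverse_limit_slender_def
proof(intro conjI allI impI ballI G')
	fix H :: "nat => 'h monoid" and p f
	assume H: "inverse_sequence H p" "mittag_leffler H p" and f: "f : hom (inverse_limit H p) G'"
	have "(%x. e (f x)) : hom (inverse_limit H p) G" using f e by(simp add: hom_def Pi_def)
	from inverse_limit_slenderD[OF G H this] obtain i g where i: "g : hom (H i) G"
		"ALL x:carrier (inverse_limit H p). e (f x) = g (x i)" by blast
	have "(%x. d (g x)) : hom (H i) G'" using i(1) d by(simp add: hom_def Pi_def)
	moreover have "f x = d (g (x i))" if "x : carrier (inverse_limit H p)" for x
		using i(2) that de[of "f x"] f by(simp add: hom_def Pi_def)
	ultimately show "EX i. EX g:hom (H i) G'. ALL x:carrier (inverse_limit H p). f x = g (x i)"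
		by(intro exI[of _ i] bexI[of _ "%x. d (g x)"]) simp_all
qed

lemma slender_retract:
	assumes G: "slender G" and G': "group G'"
		and e: "e : hom G' G" and d: "d : hom G G'" and de: "!!x. x : carrier G' ==> d (e x) = x"
	shows "slender G'"
	unfolding slender_iff
proof(intro conjI ballI G')
	fix f assume f: "f : hom int_seq G'"
	have "(%x. e (f x)) : hom int_seq G" using f e by(simp add: hom_def Pi_def)
	from conjunct2[OF G[unfolded slender_iff], THEN bspec, OF this] obtain n where n: "ALL x. (ALL i<n. x i = 0) --> e (f x) = one G"
		by(elim exE)
	have "f x = one G'" if "ALL i<n. x i = 0" for x
	proof -
		have "f x = d (e (f x))" using de[of "f x"] f by(simp add: hom_def Pi_def)
		also have "... = d (one G)" using n[THEN spec, THEN mp, OF that] by simp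
		also have "... = one G'" by(rule hom_one[OF d conjunct1[OF G[unfolded slender_iff]] G'])
		finally show ?thesis .
	qed
	thus "EX n. ALL x. (ALL i<n. x i = 0) --> f x = one G'" by blast
qed

lemma n_slender_retract:
	assumes G: "n_slender G" and G': "group G'"
		and e: "e : hom G' G" and d: "d : hom G G'" and de: "!!x. x : carrier G' ==> d (e x) = x"
	shows "n_slender G'"
	unfolding n_slender_def
proof(intro conjI ballI G')
	fix f assume f: "f : hom earring_group G'"
	have "(%x. e (f x)) : hom earring_group G" using f e by(simp add: hom_def Pi_def)
	from conjunct2[OF G[unfolded n_slender_def], THEN bspec, OF this] obtain n g where n: "g : hom (bouquet_group n) G"
		"ALL x:carrier earring_group. e (f x) = g (earring_proj n x)" by(elim exE bexE)
	have "(%x. d (g x)) : hom (bouquet_group n) G'" using n(1) d by(simp add: hom_def Pi_def)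
	moreover have "f x = d (g (earring_proj n x))" if "x : carrier earring_group" for x
		using n(2)[THEN bspec, OF that] de[of "f x"] f that by(simp add: hom_def Pi_def)
	ultimately show "EX n. EX g:hom (bouquet_group n) G'. ALL x:carrier earring_group. f x = g (earring_proj n x)"
		by(intro exI[of _ n] bexI[of _ "%x. d (g x)"]) simp_all
qed

section \<open>The inverse limit of the free groups\<close>

abbreviation free_limit :: "(nat => letter list) monoid" where
	"free_limit \<equiv> inverse_limit (%i. free_grp {..<i}) (%i j. wproj i)"

lemma carrier_free_limit:
	"x : carrier free_limit \<longleftrightarrow> (ALL i. red (x i) & fst ` set (x i) <= {..<i}) & (ALL i j. i < j --> wproj i (x j) = x i)"
	by(simp only: carrier_inverse_limit free_grp)

lemma free_sequence: "inverse_sequence (%i. free_grp {..<i}) (%i j. wproj i)"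
	unfolding inverse_sequence_def
proof(intro conjI allI impI ballI)
	show "wproj i : hom (free_grp {..<j}) (free_grp {..<i})" if "i < j" for i j
	proof -
		have "{..<j} Int {..<i} = {..<i}" using that by auto
		thus ?thesis using wproj_hom[of i "{..<j}"] by simp
	qed
qed (simp_all add: group_free_grp wproj_proj)

lemma free_mittag_leffler: "mittag_leffler (%i. free_grp {..<i}) (%i j. wproj i)"
	unfolding mittag_leffler_def
proof(intro allI exI conjI impI)
	have "wproj i ` carrier (free_grp {..<k}) = carrier (free_grp {..<i})" if k: "i < k" for i k
	proof(intro equalityI subsetI)
		fix x assume x: "x : carrier (free_grp {..<i})"
		hence "fst ` set x <= {..<k}" using k by(simp add: subset_trans[of _ "{..<i}" "{..<k}"])
		thus "x : wproj i ` carrier (free_grp {..<k})" using x wproj_id[of x i] by(intro image_eqI[of _ _ x]) simp_all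
	next
		fix x assume "x : wproj i ` carrier (free_grp {..<k})"
		thus "x : carrier (free_grp {..<i})" using set_wproj[of i] by(auto simp: red_wproj simp del: image_subset_iff)
	qed
	thus "wproj i ` carrier (free_grp {..<k}) = wproj i ` carrier (free_grp {..<Suc i})" if "Suc i <= k" for i k
		using that by simp
qed simp

lemma group_free_limit: "group free_limit"
	by(rule group_inverse_limit[OF free_sequence])

lemma free_limit_nontrivial: "x : carrier free_limit ==> x ~= one free_limit ==> EX i. x i ~= []"
	by(auto simp: fun_eq_iff)

lemma free_limit_below:
	assumes "x : carrier free_limit" "x m = []" "x M ~= []"
	shows "m < M"
proof(rule ccontr)
	assume "~ m < M"
	hence "M < m" using assms(2,3) by(cases "M = m") auto
	hence "x M = wproj M (x m)" using assms(1) by(simp add: carrier_free_limit)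
	thus False using assms(2,3) by(simp add: wproj_def)
qed

definition generator :: "nat => nat => letter list" where
	"generator k i = (if k < i then [(k, True)] else [])"

lemma generator: "generator k : carrier free_limit" "generator k k = []" "generator k (Suc k) ~= []"
	unfolding carrier_free_limit by(auto simp: generator_def wproj_def push_def)

text \<open>The images of two sequences commute. One of them is nontrivial in the letters below some
  \<open>m\<close>; the other is nontrivial but trivial in those letters, which is possible by
  slenderness of the free group on them. Conjugating the second by powers of the first then changes
  nothing, against the growth in \<open>conj_growth\<close>.\<close>

lemma slender_free_limit: "slender free_limit"
	unfolding slender_iff
proof(intro conjI ballI group_free_limit)
	fix f assume f: "f : hom int_seq free_limit"
	have fc: "f x : carrier free_limit" for x using f by(simp add: hom_def Pi_def)
	have mult: "f (%i. x i + y i) = f x **\<^bsub>free_limit\<^esub> f y" for x y using hom_mult[OF f, of x y] by simp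
	show "EX n. ALL x. (ALL i<n. x i = 0) --> f x = one free_limit"
	proof(rule ccontr)
		assume "~ ?thesis"
		hence "EX x. (ALL i<n. x i = 0) & f x ~= one free_limit" for n by blast
		then obtain s where s: "!!n. ALL i<n. s n i = 0" "!!n. f (s n) ~= one free_limit" by metis
		obtain m where m: "f (s 0) m ~= []" using free_limit_nontrivial[OF fc s(2)] by blast
		have "(%x. f x m) : hom int_seq (free_grp {..<m})"
			by(rule homI) (use fc mult in "simp_all add: carrier_free_limit")
		moreover have "slender (free_grp {..<m})"
			by(rule inverse_limit_slender_imp_slender[OF _ length_group_inverse_limit_slender[OF length_group_free_grp], where 'h = nat]) simp
		ultimately obtain n where n: "ALL x. (ALL i<n. x i = 0) --> f x m = []" unfolding slender_iff by auto
		define v where "v = f (s n)"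
		have vm: "v m = []" using n s(1)[of n] by(simp add: v_def)
		obtain M where M: "v M ~= []" using free_limit_nontrivial[OF fc s(2)] unfolding v_def by blast
		have mM: "m < M" by(rule free_limit_below[OF _ vm M]) (simp add: v_def fc)
		define U V where "U = f (s 0) M" and "V = v M"
		have U: "red U" "wproj m U ~= []" and V: "red V" "wproj m V = []" "V ~= []"
			using fc[of "s 0"] fc[of "s n"] m M vm mM unfolding carrier_free_limit U_def V_def v_def by auto
		have "(%i. s 0 i + s n i) = (%i. s n i + s 0 i)" by(simp add: add.commute)
		hence "f (s 0) **\<^bsub>free_limit\<^esub> v = v **\<^bsub>free_limit\<^esub> f (s 0)" using mult unfolding v_def by metis
		hence comm: "wmult U V = wmult V U" by(simp add: fun_eq_iff U_def V_def)
		\<comment> \<open>One more than \<open>conj_growth\<close> permits when the conjugate is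
		  \<open>V\<close> itself.\<close>
		define a where "a = Suc (2 * lcount m V)"
		have rU: "red (U \<up> k)" for k :: nat using FF.nat_pow_closed[of U k] U(1) by simp
		have "wmult (U \<up> k) V = wmult V (U \<up> k)" for k :: nat
		proof(induction k)
			case (Suc k)
			have "wmult (U \<up> Suc k) V = wmult (U \<up> k) (wmult V U)"
				using V(1) U(1) by(simp add: wmult_assoc comm)
			also have "... = wmult V (U \<up> Suc k)"
				using U(1) rU[of k] by(simp add: wmult_assoc[symmetric] Suc)
			finally show ?case .
		qed (use V in simp)
		hence "wmult (wmult (U \<up> a) V) (winv (U \<up> a)) = wmult V (wmult (U \<up> a) (winv (U \<up> a)))"
			using red_inv[OF rU[of a]] by(simp add: wmult_assoc)
		also have "... = V" using FF.r_inv[of "U \<up> a"] rU[of a] V(1) by simp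
		finally show False using conj_growth[OF U V, of a] by(simp add: a_def)
	qed
qed

text \<open>The identity would factor through a single free group, but the generator with index
  \<open>i\<close> is nontrivial and vanishes at stage \<open>i\<close>.\<close>

lemma not_inverse_limit_slender_free_limit:
	assumes inf: "infinite (UNIV :: 'h set)"
	shows "~ inverse_limit_slender TYPE('h) free_limit"
proof
	assume "inverse_limit_slender TYPE('h) free_limit"
	hence L: "inverse_limit_slender TYPE(letter list) free_limit" by(rule inverse_limit_slender_type_independent[OF inf])
	have "(%x. x) : hom free_limit free_limit" by(rule homI) auto
	from inverse_limit_slenderD[OF L free_sequence free_mittag_leffler this]
	obtain i g where i: "g : hom (free_grp {..<i}) free_limit" "!!x. x : carrier free_limit ==> x = g (x i)"
		by(elim exE bexE) (rule that, assumption, erule bspec)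
	have "generator i = g []" using i(2)[OF generator(1)] generator(2) by metis
	also have "... = one free_limit" using hom_one[OF i(1) group_free_grp group_free_limit] by simp
	finally show False using generator(3)[of i] by simp
qed

section \<open>The subgroup in which every letter occurs boundedly often\<close>

definition bounded_words :: "(nat => letter list) set" where
	"bounded_words = {w : carrier free_limit. ALL m. EX b. ALL n. lcount m (w n) <= b}"

lemma subgroup_bounded_words: "subgroup bounded_words free_limit"
proof -
	interpret L: group free_limit by(rule group_free_limit)
	have invL: "(inv\<^bsub>free_limit\<^esub> x) n = winv (x n)" if x: "x : carrier free_limit" for x n
	proof -
		have "(inv\<^bsub>free_limit\<^esub> x **\<^bsub>free_limit\<^esub> x) n = []" by(simp only: L.l_inv[OF x]) simp
		moreover have "red (x n)" "red ((inv\<^bsub>free_limit\<^esub> x) n)" using x L.inv_closed[OF x] unfolding carrier_free_limit by blast+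
		ultimately show ?thesis using FF.inv_equality[of "(inv\<^bsub>free_limit\<^esub> x) n" "x n"] by simp
	qed
	show ?thesis
	proof(rule L.subgroupI)
		show "bounded_words <= carrier free_limit" by(auto simp: bounded_words_def)
		have "one free_limit : bounded_words" unfolding bounded_words_def using L.one_closed by(simp add: lcount_def)
		thus "bounded_words ~= {}" by blast
		fix x assume x: "x : bounded_words"
		hence xc: "x : carrier free_limit" and xb: "!!m. EX b. ALL n. lcount m (x n) <= b" by(auto simp: bounded_words_def)
		have "lcount m ((inv\<^bsub>free_limit\<^esub> x) n) <= lcount m (x n)" for m n
			unfolding invL[OF xc] by(rule lcount_inv) (use xc in "simp add: carrier_free_limit")
		hence "EX b. ALL n. lcount m ((inv\<^bsub>free_limit\<^esub> x) n) <= b" for m using xb[of m] le_trans by blast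
		thus "inv\<^bsub>free_limit\<^esub> x : bounded_words" using L.inv_closed[OF xc] by(simp add: bounded_words_def)
		fix y assume y: "y : bounded_words"
		have "EX b. ALL n. lcount m ((x **\<^bsub>free_limit\<^esub> y) n) <= b" for m
		proof -
			obtain b b' where b: "!!n. lcount m (x n) <= b" "!!n. lcount m (y n) <= b'" using xb y by(auto simp: bounded_words_def) metis
			have "lcount m ((x **\<^bsub>free_limit\<^esub> y) n) <= b + b'" for n
				using lcount_mult[of m "x n" "y n"] b[of n] by simp
			thus ?thesis by blast
		qed
		moreover have "x **\<^bsub>free_limit\<^esub> y : carrier free_limit" using xc y by(intro L.m_closed) (auto simp: bounded_words_def)
		ultimately show "x **\<^bsub>free_limit\<^esub> y : bounded_words" by(simp add: bounded_words_def)
	qed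
qed

abbreviation bounded_grp :: "(nat => letter list) monoid" where
	"bounded_grp \<equiv> free_limit\<lparr>carrier := bounded_words\<rparr>"

lemma group_bounded_grp: "group bounded_grp"
	by(rule group.subgroup_imp_group[OF group_free_limit subgroup_bounded_words])

text \<open>If \<open>u = g (s 0)\<close> is nontrivial in the letters below \<open>m\<close>, the image of an infinite product of
  suitable conjugates of the \<open>s n\<close> by powers of \<open>s 0\<close> contains infinitely many of these letters.\<close>

lemma inverse_limit_slender_bounded_grp: "inverse_limit_slender TYPE('h) bounded_grp"
	unfolding inverse_limit_slender_def
proof(intro conjI allI impI ballI)
	show gG: "group bounded_grp" by(rule group_bounded_grp)
	fix H :: "nat => 'h monoid" and p g
	assume H: "inverse_sequence H p" "mittag_leffler H p" and g: "g : hom (inverse_limit H p) bounded_grp"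
	let ?I = "inverse_limit H p"
	interpret I: group ?I by(rule group_inverse_limit[OF H(1)])
	have gH: "group (H k)" for k using H(1) by(simp add: inverse_sequence_def)
	have ph: "p i j : hom (H j) (H i)" if "i < j" for i j using H(1) that by(simp add: inverse_sequence_def)
	have gb: "g x : bounded_words" if "x : carrier ?I" for x using g that by(simp add: hom_def Pi_def)
	have gc: "g x : carrier free_limit" if "x : carrier ?I" for x using gb[OF that] by(simp add: bounded_words_def)
	have gr: "red (g x i)" if "x : carrier ?I" for x i using gc[OF that] by(simp add: carrier_free_limit)
	have mult: "g (x **\<^bsub>?I\<^esub> y) i = wmult (g x i) (g y i)" if "x : carrier ?I" "y : carrier ?I" for x y i
		using hom_mult[OF g that] by simp
	have gi: "group_hom ?I FF (%x. g x i)" for i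
		using mult gr I.is_group FF.is_group by(auto simp: group_hom_def group_hom_axioms_def intro!: homI)
	have "EX k. ALL x:carrier ?I. x k = one (H k) --> g x i = []" for i
	proof -
		have "(%x. g x i) : hom ?I FF" using gi[of i] by(simp add: group_hom_def group_hom_axioms_def)
		then obtain k q where k: "q : hom (H k) FF" "ALL x:carrier ?I. g x i = q (x k)"
			using inverse_limit_slenderD[OF length_group_inverse_limit_slender[OF length_group_free_grp] H] by blast
		have "q (one (H k)) = []" using hom_one[OF k(1) gH FF.is_group] by simp
		thus ?thesis using k(2) by(intro exI[of _ k]) simp
	qed
	then obtain N where N: "!!i x. x : carrier ?I ==> x (N i) = one (H (N i)) ==> g x i = []" by metis
	have low: "x i = one (H i)" if "x : carrier ?I" "x j = one (H j)" "i <= j" for x i j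
	proof(cases "i = j")
		case False
		hence ij: "i < j" using that(3) by simp
		have "p i j (x j) = x i" using that(1) ij by(simp add: carrier_inverse_limit)
		thus ?thesis using that(2) hom_one[OF ph[OF ij] gH gH] by simp
	qed (use that in simp)
	have "EX i. ALL x:carrier ?I. x i = one (H i) --> g x = one bounded_grp"
	proof(rule ccontr)
		assume "~ ?thesis"
		then obtain s where s: "!!n. s n : carrier ?I" "!!n. s n n = one (H n)" "!!n. g (s n) ~= one bounded_grp" by metis
		have nt: "EX i. g (s n) i ~= []" for n using free_limit_nontrivial[OF gc[OF s(1)]] s(3) by simp
		obtain m where m: "g (s 0) m ~= []" using nt by blast
		define P where "P tn \<longleftrightarrow> fst tn : carrier ?I" for tn :: "(nat => 'h) \<times> nat"
		\<comment> \<open>A state is a partial product with a stage up to which it is final. A step keeps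
		  the coordinates up to that stage, forces at least \<open>n\<close> letters below
		  \<open>m\<close> into some coordinate \<open>M\<close> of the image, and moves the stage beyond
		  \<open>N M\<close>, so that later factors leave this coordinate of the image unchanged.\<close>
		define Q where "Q tn tn' \<longleftrightarrow> snd tn < snd tn' & (ALL i<=snd tn. fst tn' i = fst tn i) &
			(EX M. N M <= snd tn' & snd tn <= lcount m (g (fst tn') M))" for tn tn' :: "(nat => 'h) \<times> nat"
		have "EX f. ALL j::nat. P (f j) & Q (f j) (f (Suc j))"
		proof(rule dependent_nat_choice)
			show "EX x. P x" using I.one_closed by(intro exI[of _ "(one ?I, 0)"]) (simp add: P_def)
			fix tn assume tn: "P tn"
			obtain t n where e: "tn = (t, n)" by(cases tn)
			have t: "t : carrier ?I" using tn by(simp add: P_def e)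
			define n1 where "n1 = max n (N m)"
			define v where "v = g (s n1)"
			have vm: "v m = []" unfolding v_def by(rule N[OF s(1)]) (rule low[OF s(1,2)], simp add: n1_def)
			obtain M where M: "v M ~= []" using nt unfolding v_def by blast
			have mM: "m < M" by(rule free_limit_below[OF _ vm M]) (simp add: v_def gc s(1))
			define U where "U = g (s 0) M"
			have U: "red U" "wproj m U ~= []" and V: "red (v M)" "wproj m (v M) = []"
				using gc[OF s(1)[of 0]] gc[OF s(1)[of n1]] m vm mM unfolding carrier_free_limit U_def v_def by auto
			\<comment> \<open>Pays for the loss in \<open>conj_growth\<close> and for the letters that the
			  image of the previous partial product can cancel.\<close>
			define a where "a = n + lcount m (v M) + lcount m (g t M)"
			define c where "c = s 0 [^]\<^bsub>?I\<^esub> a **\<^bsub>?I\<^esub> s n1 **\<^bsub>?I\<^esub> inv\<^bsub>?I\<^esub> (s 0 [^]\<^bsub>?I\<^esub> a)"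
			have c: "c : carrier ?I" using s(1) by(simp add: c_def del: mult_inverse_limit)
			define n' where "n' = max (Suc n) (N M)"
			have c1: "c i = one (H i)" if "i <= n" for i
			proof -
				let ?a = "s 0 [^]\<^bsub>?I\<^esub> a"
				have ac: "?a : carrier ?I" "inv\<^bsub>?I\<^esub> ?a : carrier ?I" using s(1) by simp_all
				have "s n1 i = one (H i)" by(rule low[OF s(1,2)]) (use that in "simp add: n1_def")
				hence "c i = (?a **\<^bsub>?I\<^esub> inv\<^bsub>?I\<^esub> ?a) i" using ac gH[of i] by(simp add: c_def carrier_inverse_limit group.is_monoid monoid.r_one)
				also have "... = one (H i)" by(simp only: I.r_inv[OF ac(1)]) simp
				finally show ?thesis .
			qed
			interpret f: group_hom ?I FF "%x. g x M" by(rule gi)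
			have fc: "g c M = wmult (wmult (U \<up> a) (v M)) (winv (U \<up> a))"
				using f.hom_mult[of "s 0 [^]\<^bsub>?I\<^esub> a **\<^bsub>?I\<^esub> s n1" "inv\<^bsub>?I\<^esub> (s 0 [^]\<^bsub>?I\<^esub> a)"] f.hom_mult[of "s 0 [^]\<^bsub>?I\<^esub> a" "s n1"]
					f.hom_inv[of "s 0 [^]\<^bsub>?I\<^esub> a"] f.hom_nat_pow[of "s 0" a] s(1)
				by(simp add: c_def U_def v_def del: mult_inverse_limit)
			have "a <= lcount m (g c M) + lcount m (v M)" unfolding fc by(rule conj_growth[OF U V M])
			moreover have ce: "g c M = wmult (winv (g t M)) (g (t **\<^bsub>?I\<^esub> c) M)"
				unfolding mult[OF t c] by(simp add: winv_cancel(2)[OF gr[OF t] gr[OF c]])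
			have "lcount m (g c M) <= lcount m (g t M) + lcount m (g (t **\<^bsub>?I\<^esub> c) M)"
				unfolding ce using lcount_mult[of m "winv (g t M)" "g (t **\<^bsub>?I\<^esub> c) M"] lcount_inv[OF gr[OF t, of M], of m] by linarith
			ultimately have big: "n <= lcount m (g (t **\<^bsub>?I\<^esub> c) M)" by(simp add: a_def)
			have "Q tn (t **\<^bsub>?I\<^esub> c, n')"
				unfolding Q_def e fst_conv snd_conv
			proof(intro conjI allI impI exI[of _ M] big)
				show "n < n'" "N M <= n'" by(simp_all add: n'_def)
				show "(t **\<^bsub>?I\<^esub> c) i = t i" if "i <= n" for i
					using c1[OF that] t gH[of i] by(simp add: carrier_inverse_limit group.is_monoid monoid.r_one)
			qed
			thus "EX y. P y & Q tn y" using I.m_closed[OF t c] by(intro exI[of _ "(t **\<^bsub>?I\<^esub> c, n')"]) (simp add: P_def)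
		qed
		then obtain f where f: "!!j. P (f j)" "!!j. Q (f j) (f (Suc j))" by blast
		define t n where "t j = fst (f j)" and "n j = snd (f j)" for j
		have t: "t j : carrier ?I" for j using f(1)[of j] by(simp add: P_def t_def)
		have n: "n j < n (Suc j)" and tS: "!!i. i <= n j ==> t (Suc j) i = t j i"
			and M: "EX M. N M <= n (Suc j) & n j <= lcount m (g (t (Suc j)) M)" for j
			using f(2)[of j] by(auto simp: Q_def t_def n_def)
		have nj: "j <= n j" for j by(induction j) (use n le_trans Suc_leI le_less_trans in "simp, metis Suc_leI le_less_trans")
		have nm: "n j <= n k" if "j <= k" for j k using that by(rule lift_Suc_mono_le[rotated]) (use n in "simp add: less_imp_le")
		have stable: "t k i = t j i" if "j <= k" "i <= n j" for i j k
			using that(1)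
		proof(induction rule: dec_induct)
			case (step k) thus ?case using tS[of i k] nm[of j k] that(2) by simp
		qed simp
		define y where "y i = t i i" for i
		have yt: "y i = t j i" if "i <= n j" for i j
			using stable[of i j i] stable[of j i i] nj[of i] that by(cases "i <= j") (auto simp: y_def)
		have y: "y : carrier ?I"
			unfolding carrier_inverse_limit
		proof(intro conjI allI impI)
			show "y i : carrier (H i)" for i using t[of i] by(simp add: y_def carrier_inverse_limit)
			fix i j :: nat assume ij: "i < j"
			have "p i j (y j) = t j i" using t[of j] ij by(simp add: y_def carrier_inverse_limit)
			also have "... = y i" using yt[of i j] nj[of j] ij by simp
			finally show "p i j (y j) = y i" .
		qed
		have "EX i. j <= lcount m (g y i)" for j
		proof -
			obtain M where M: "N M <= n (Suc j)" "n j <= lcount m (g (t (Suc j)) M)" using M by blast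
			let ?d = "inv\<^bsub>?I\<^esub> t (Suc j) **\<^bsub>?I\<^esub> y"
			have tj: "inv\<^bsub>?I\<^esub> t (Suc j) : carrier ?I" using t by(rule I.inv_closed)
			have d: "?d : carrier ?I" by(rule I.m_closed[OF tj y])
			have "?d (N M) = (inv\<^bsub>?I\<^esub> t (Suc j) **\<^bsub>?I\<^esub> t (Suc j)) (N M)" using yt[OF M(1)] by simp
			also have "... = one (H (N M))" by(simp only: I.l_inv[OF t]) simp
			finally have "g ?d M = []" by(rule N[OF d])
			moreover have "y = t (Suc j) **\<^bsub>?I\<^esub> ?d" using I.inv_solve_left[OF d t y, THEN iffD1, OF refl] by simp
			hence "g y M = wmult (g (t (Suc j)) M) (g ?d M)" using mult[OF t d] by metis
			ultimately have "g y M = g (t (Suc j)) M" using gr[OF t] by simp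
			thus ?thesis using M(2) nj[of j] by(intro exI[of _ M]) simp
		qed
		moreover obtain b where "!!i. lcount m (g y i) <= b" using gb[OF y] by(auto simp: bounded_words_def)
		ultimately show False by(meson not_less_eq_eq le_trans)
	qed
	then obtain i where "!!x. x : carrier ?I ==> x i = one (H i) ==> g x = one bounded_grp" by blast
	thus "EX i. EX q:hom (H i) bounded_grp. ALL x:carrier ?I. g x = q (x i)"
		by(rule mittag_leffler_factor[OF H gG g])
qed

section \<open>Letters read along a loop\<close>

lemma lifting_generator: "lifting (free_grp {..<i}) (%k. generator k i)"
	by(rule earring_inverse_limit_hom(1)[OF free_sequence]) (simp_all add: generator)

abbreviation generator_lift :: "nat => real set => (real => complex) => (real => letter list) => bool" where
	"generator_lift i \<equiv> lifting.lift (free_grp {..<i}) (%k. generator k i)"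

lemma generator_lift_red: "generator_lift i D p g ==> x : D ==> red (g x)"
	using lifting.liftD(1)[OF lifting_generator] by fastforce

lemma antipode_mem: "antipode k : earring_circle k"
proof -
	define r where "r = 2 / (real k + 1)"
	have "(real k + 1) * r = 2" unfolding r_def times_divide_eq_right by(rule nonzero_mult_div_cancel_left) simp
	moreover have "(norm (complex_of_real r))\<^sup>2 = r * r" by(simp add: power2_eq_square)
	ultimately show ?thesis
		unfolding mem_earring_circle antipode_def r_def[symmetric] by(simp add: mult.assoc[symmetric])
qed

text \<open>On a stretch that misses the first \<open>m\<close> antipodes, a lift for the generators
  is also a lift for the family in which the first \<open>m\<close> of them are replaced by the
  identity, up to a left factor; that family takes values in the free group on the other
  letters.\<close>

lemma lcount_avoiding:
	assumes p: "continuous_on {0..1} p" "p ` {0..1} <= earring" and ab: "0 <= a" "a <= b" "b <= 1"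
		and avoid: "p ` {a..b} Int antipode ` {..<m} = {}" and g: "generator_lift i {a..b} p g"
	shows "lcount m (wmult (winv (g a)) (g b)) = 0"
proof -
	let ?h = "%k. if k < m then [] else generator k i" and ?F = "free_grp {..<i}" and ?E = "free_grp ({..<i} - {..<m})"
	interpret l: lifting ?F "%k. generator k i" by(rule lifting_generator)
	have fin: "finite {k. ?h k ~= []}" by(rule finite_subset[of _ "{..<i}"]) (auto simp: generator_def)
	have L0: "lifting ?E ?h"
		using group_free_grp fin by(auto simp: lifting_def lifting_axioms_def generator_def)
	have L1: "lifting ?F ?h"
		using group_free_grp fin by(auto simp: lifting_def lifting_axioms_def generator_def)
	interpret l0: lifting ?E ?h by(rule L0)
	let ?lift = "lifting.lift ?F ?h" and ?chi = "lifting.chi ?F ?h"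
	note V_def = lifting.V_def[OF L1] and chi_def = lifting.chi_def[OF L1]
	obtain g0 where g0: "l0.lift {0..1} p g0" by(rule l0.lift_exists_path[OF p])
	have "(%x. x) : hom ?E ?F" by(rule homI) auto
	from lift_hom[where f = "%x. x", OF L0 L1 this g0] have "?lift {0..1} p g0" .
	from lifting.lift_compose[OF L1 this, of "{a..b}" "%x. x"] have g1: "?lift {a..b} p g0" using ab by auto
	have pe: "p x : earring" if "x : {a..b}" for x using p(2) that ab by auto
	have pc: "continuous_on {a..b} p" by(rule continuous_on_subset[OF p(1)]) (use ab in auto)
	have "l.lift {a..b} p g0"
		unfolding l.lift_def
	proof(intro ballI conjI impI)
		fix x assume x: "x : {a..b}"
		note gc = lifting.liftD(1)[OF L1 g1]
		show "g0 x : carrier ?F" by(rule gc[OF x])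
		show "eventually (%y. y : {a..b} --> g0 y = g0 x) (nhds x)" if "p x = 0" by(rule lifting.liftD(2)[OF L1 g1 x that])
		assume px: "p x ~= 0"
		obtain k where k: "p x : earring_circle k" by(rule earring_circleE[OF pe[OF x]])
		note ev = lifting.liftD(3)[OF L1 g1 x px]
		show "eventually (%y. y : {a..b} --> g0 y **\<^bsub>?F\<^esub> inv\<^bsub>?F\<^esub> l.chi (p y) = g0 x **\<^bsub>?F\<^esub> inv\<^bsub>?F\<^esub> l.chi (p x)) (nhds x)"
		proof(cases "k < m")
			case True
			have na: "p x ~= antipode j" for j
			proof
				assume j: "p x = antipode j"
				have "antipode j : earring_circle j" by(rule antipode_mem)
				hence "j = k" using circle_index[OF _ px, of j] circle_index[OF k px] j by simp
				hence "p x : antipode ` {..<m}" using j True by blast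
				thus False using avoid x by blast
			qed
			have "p x : l.V" "p x : lifting.V ?F ?h" using na by(auto simp: l.V_def V_def)
			note c = l.chi_const[OF pe[OF x] px this(1)] lifting.chi_const[OF L1 pe[OF x] px this(2)]
			have sub: "p ` {a..b} <= earring" using pe by blast
			from eventually_comp[OF pc sub x c(1)] eventually_comp[OF pc sub x c(2)] ev
			show ?thesis
			proof eventually_elim
				case (elim y)
				show ?case
				proof
					assume y: "y : {a..b}"
					have "g0 y = g0 x" using elim y gc[OF x] gc[OF y] lifting.chi_closed[OF L1, of "p x"] by(simp del: free_grp)
					thus "g0 y **\<^bsub>?F\<^esub> inv\<^bsub>?F\<^esub> l.chi (p y) = g0 x **\<^bsub>?F\<^esub> inv\<^bsub>?F\<^esub> l.chi (p x)" using elim y by simp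
				qed
			qed
		next
			case False
			have eq: "l.chi z = ?chi z" if "z : earring_circle k" "z ~= 0" for z
				using False by(simp add: l.chi_def chi_def circle_index[OF that])
			have "eventually (%y. y : {a..b} --> p y ~= 0 & p y : earring_circle k) (nhds x)"
				by(rule eventually_comp[OF pc _ x, of earring]) (use pe circle_index_const[OF k px] in "auto elim: eventually_mono")
			with ev show ?thesis by eventually_elim (use eq eq[OF k px] in auto)
		qed
	qed
	from l.lift_left_mult[OF this, of "g a **\<^bsub>?F\<^esub> inv\<^bsub>?F\<^esub> g0 a"]
	have g2: "l.lift {a..b} p (%x. g a **\<^bsub>?F\<^esub> inv\<^bsub>?F\<^esub> g0 a **\<^bsub>?F\<^esub> g0 x)"
		using l.liftD(1)[OF g, of a] lifting.liftD(1)[OF L1 g1, of a] ab by(simp del: free_grp)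
	have c: "g a : carrier ?F" "g0 a : carrier ?F" "g0 b : carrier ?F"
		using l.liftD(1)[OF g, of a] lifting.liftD(1)[OF L1 g1, of a] lifting.liftD(1)[OF L1 g1, of b] ab by(simp_all del: free_grp)
	have "g b = g a **\<^bsub>?F\<^esub> inv\<^bsub>?F\<^esub> g0 a **\<^bsub>?F\<^esub> g0 b"
		by(rule l.lift_unique[OF _ g g2, of a]) (use ab c in "simp_all add: l.m_assoc del: free_grp")
	hence "inv\<^bsub>?F\<^esub> g a **\<^bsub>?F\<^esub> g b = inv\<^bsub>?F\<^esub> g0 a **\<^bsub>?F\<^esub> g0 b" using c by(simp add: l.m_assoc[symmetric] del: free_grp)
	hence "wmult (winv (g a)) (g b) = wmult (winv (g0 a)) (g0 b)"
		using c by(simp add: free_grp_inv del: free_grp(1))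
	moreover have "inv\<^bsub>?E\<^esub> g0 a **\<^bsub>?E\<^esub> g0 b : carrier ?E"
		using l0.liftD(1)[OF g0, of a] l0.liftD(1)[OF g0, of b] ab by(intro l0.m_closed l0.inv_closed) auto
	hence "wmult (winv (g0 a)) (g0 b) : carrier ?E"
		using l0.liftD(1)[OF g0, of a] ab by(simp add: free_grp_inv del: free_grp(1))
	hence "fst ` set (wmult (winv (g0 a)) (g0 b)) <= {..<i} - {..<m}" by simp
	hence "lcount m (wmult (winv (g0 a)) (g0 b)) = 0"
		unfolding lcount_def length_0_conv filter_empty_conv by fastforce
	ultimately show ?thesis by simp
qed

text \<open>Away from 0 a lift is a constant times \<open>chi\<close>, so only the values of
  \<open>chi\<close> at the two ends enter, and each has at most one letter.\<close>

lemma lcount_nonzero: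
	assumes ab: "a <= b" and nz: "0 ~: p ` {a..b}" and g: "generator_lift i {a..b} p g"
	shows "lcount m (wmult (winv (g a)) (g b)) <= 2"
proof -
	let ?F = "free_grp {..<i}"
	interpret l: lifting ?F "%k. generator k i" by(rule lifting_generator)
	have gc: "g x : carrier ?F" if "x : {a..b}" for x by(rule l.liftD(1)[OF g that])
	have "g a **\<^bsub>?F\<^esub> inv\<^bsub>?F\<^esub> l.chi (p a) = g b **\<^bsub>?F\<^esub> inv\<^bsub>?F\<^esub> l.chi (p b)"
	proof(rule connected_local_const[of "{a..b}" _ _ "%x. g x **\<^bsub>?F\<^esub> inv\<^bsub>?F\<^esub> l.chi (p x)"])
		show "ALL x:{a..b}. eventually (%y. g x **\<^bsub>?F\<^esub> inv\<^bsub>?F\<^esub> l.chi (p x) = g y **\<^bsub>?F\<^esub> inv\<^bsub>?F\<^esub> l.chi (p y)) (at x within {a..b})"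
		proof
			fix x assume x: "x : {a..b}"
			hence "p x ~= 0" using nz by force
			from l.liftD(3)[OF g x this]
			show "eventually (%y. g x **\<^bsub>?F\<^esub> inv\<^bsub>?F\<^esub> l.chi (p x) = g y **\<^bsub>?F\<^esub> inv\<^bsub>?F\<^esub> l.chi (p y)) (at x within {a..b})"
				unfolding eventually_at_filter by eventually_elim simp
		qed
	qed (use ab in auto)
	moreover have c: "g a : carrier ?F" "g b : carrier ?F" using gc ab by(simp_all del: free_grp)
	ultimately have "g b = g a **\<^bsub>?F\<^esub> inv\<^bsub>?F\<^esub> l.chi (p a) **\<^bsub>?F\<^esub> l.chi (p b)"
		by(simp add: l.m_assoc del: free_grp)
	hence "inv\<^bsub>?F\<^esub> g a **\<^bsub>?F\<^esub> g b = inv\<^bsub>?F\<^esub> l.chi (p a) **\<^bsub>?F\<^esub> l.chi (p b)"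
		using c by(simp add: l.m_assoc[symmetric] del: free_grp)
	hence e: "wmult (winv (g a)) (g b) = wmult (winv (l.chi (p a))) (l.chi (p b))"
		using c l.chi_closed[of "p a"] by(simp add: free_grp_inv del: free_grp(1) l.chi_closed)
	have chi: "lcount m (l.chi z) <= 1" "red (l.chi z)" for z
		unfolding l.chi_def by(auto simp: generator_def lcount_def)
	show ?thesis unfolding e
		using lcount_mult[of m "winv (l.chi (p a))" "l.chi (p b)"] lcount_inv[OF chi(2), of m "p a"] chi(1)[of "p a"] chi(1)[of "p b"]
		by linarith
qed

text \<open>Near each time the path misses 0 or misses the first \<open>m\<close> antipodes.
  Finitely many such stretches cover the loop, and they are chosen before the stage
  \<open>i\<close>.\<close>

lemma lcount_bounded:
	assumes p: "continuous_on {0..1} p" "p ` {0..1} <= earring"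
	shows "EX N. ALL i g. generator_lift i {0..1} p g --> lcount m (wmult (winv (g 0)) (g 1)) <= N"
proof -
	define R where "R a b \<longleftrightarrow> 0 <= a --> a <= b --> b <= 1 -->
		(EX N. ALL i g. generator_lift i {a..b} p g --> lcount m (wmult (winv (g a)) (g b)) <= N)" for a b :: real
	have "R 0 1"
	proof(rule Bolzano)
		show "R a c" if r: "R a b" "R b c" "a <= b" "b <= c" for a b c
			unfolding R_def
		proof(intro impI)
			assume ac: "0 <= a" "a <= c" "c <= 1"
			obtain N1 where N1: "!!i g. generator_lift i {a..b} p g ==> lcount m (wmult (winv (g a)) (g b)) <= N1"
				using r(1,3,4) ac unfolding R_def by auto
			obtain N2 where N2: "!!i g. generator_lift i {b..c} p g ==> lcount m (wmult (winv (g b)) (g c)) <= N2"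
				using r(2,3,4) ac unfolding R_def by auto
			have "lcount m (wmult (winv (g a)) (g c)) <= N1 + N2" if g: "generator_lift i {a..c} p g" for i g
			proof -
				have sub: "generator_lift i D p g" if "D <= {a..c}" for D
					using lifting.lift_compose[OF lifting_generator g, of D "%x. x"] that by auto
				have 1: "lcount m (wmult (winv (g a)) (g b)) <= N1" by(rule N1[OF sub]) (use r in auto)
				have 2: "lcount m (wmult (winv (g b)) (g c)) <= N2" by(rule N2[OF sub]) (use r in auto)
				have rd: "red (g a)" "red (g b)" "red (g c)" using r(3,4) by(auto intro!: generator_lift_red[OF g])
				have "wmult (winv (g a)) (g c) = wmult (wmult (winv (g a)) (g b)) (wmult (winv (g b)) (g c))"
					using rd red_wmult[OF rd(3), of "winv (g b)"] by(simp add: wmult_assoc winv_cancel)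
				thus ?thesis using 1 2 lcount_mult[of m "wmult (winv (g a)) (g b)" "wmult (winv (g b)) (g c)"] by simp
			qed
			thus "EX N. ALL i g. generator_lift i {a..c} p g --> lcount m (wmult (winv (g a)) (g c)) <= N" by blast
		qed
		show "EX d>0. ALL a b. a <= x & x <= b & b - a < d --> R a b" if x: "0 <= x" "x <= 1" for x
		proof -
			define O' where "O' = (if p x : antipode ` {..<m} then - {0} else - antipode ` {..<m})"
			have "open O'" unfolding O'_def by(auto intro!: open_Compl finite_imp_closed)
			moreover have "p x : O'" using antipode_nonzero by(auto simp: O'_def)
			ultimately obtain A where A: "open A" "x : A" "ALL y:{0..1}. y : A --> p y : O'"
				using p(1) x unfolding continuous_on_topological by(metis atLeastAtMost_iff)
			obtain e where e: "e > 0" "ball x e <= A" using A(1,2) open_contains_ball by blast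
			show ?thesis
			proof(intro exI[of _ e] conjI allI impI e(1))
				fix a b assume ab: "a <= x & x <= b & b - a < e"
				show "R a b"
					unfolding R_def
				proof(intro impI)
					assume h: "0 <= a" "a <= b" "b <= 1"
					have sub: "p ` {a..b} <= O'"
					proof
						fix z assume "z : p ` {a..b}"
						then obtain y where y: "y : {a..b}" "z = p y" by blast
						hence "y : ball x e" using ab by(auto simp: dist_real_def)
						thus "z : O'" using A(3) e(2) y h by auto
					qed
					have "lcount m (wmult (winv (g a)) (g b)) <= 2" if g: "generator_lift i {a..b} p g" for i g
					proof(cases "p x : antipode ` {..<m}")
						case True
						show ?thesis by(rule lcount_nonzero[OF h(2) _ g]) (use sub True in "auto simp: O'_def")
					next
						case False
						have "lcount m (wmult (winv (g a)) (g b)) = 0"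
							by(rule lcount_avoiding[OF p h _ g]) (use sub False in "auto simp: O'_def")
						thus ?thesis by simp
					qed
					thus "EX N. ALL i g. generator_lift i {a..b} p g --> lcount m (wmult (winv (g a)) (g b)) <= N" by blast
				qed
			qed
		qed
	qed simp
	thus ?thesis unfolding R_def by simp
qed

text \<open>By \<open>lcount_bounded\<close> the homomorphism with the generators as images of the
  circles takes values in the bounded words, and n-slenderness would make one generator
  trivial.\<close>

lemma not_n_slender_bounded_grp: "~ n_slender bounded_grp"
proof
	assume n: "n_slender bounded_grp"
	define F where "F = (%A i. lifting.earring_hom (free_grp {..<i}) (%k. generator k i) A)"
	have g: "generator n n = \<one>\<^bsub>free_grp {..<n}\<^esub>" for n by(simp add: generator)
	have hom: "F : hom earring_group free_limit"
		unfolding F_def by(rule earring_inverse_limit_hom(2)[OF free_sequence generator(1) g])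
	have loop: "F (path_class earring (circle_loop n)) = generator n" for n
		unfolding F_def by(rule earring_inverse_limit_hom(3)[OF free_sequence generator(1) g])
	have b: "F A : bounded_words" if A: "A : carrier earring_group" for A
		unfolding bounded_words_def
	proof(intro CollectI conjI allI)
		show c: "F A : carrier free_limit" using hom A by(simp add: hom_def Pi_def)
		fix m
		obtain p where p: "p : loops earring 0" "A = path_class earring p" using A by(auto simp: fundamental_group_def)
		note pc = lifting.loops_earring(1,2)[OF lifting_generator[of 0] p(1)]
		obtain N where N: "ALL i g. generator_lift i {0..1} p g --> lcount m (wmult (winv (g 0)) (g 1)) <= N"
			using lcount_bounded[OF pc] by blast
		have "lcount m (F A i) <= N" for i
		proof -
			interpret l: lifting "free_grp {..<i}" "%k. generator k i" by(rule lifting_generator)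
			obtain g where g: "l.lift {0..1} p g" "g 0 = \<one>\<^bsub>free_grp {..<i}\<^esub>" by(rule l.lift_exists_path[OF pc])
			have "F A i = l.endpoint p" unfolding F_def p(2) by(rule l.earring_hom_class[OF p(1)])
			also have "... = wmult (winv (g 0)) (g 1)"
				using l.endpoint_eq[OF g(1)] l.liftD(1)[OF g(1), of 0] free_grp_inv[of "g 0" "{..<i}"] by simp
			finally show ?thesis using N g(1) by simp
		qed
		thus "EX b. ALL n. lcount m (F A n) <= b" by blast
	qed
	have "F : hom earring_group bounded_grp"
		by(rule homI) (use b hom_mult[OF hom] in "simp_all")
	from n_slender_circle_loop[OF n this] obtain k where "generator k = one bounded_grp" unfolding loop by(elim exE)
	thus False using generator(3)[of k] by simp
qed

text \<open>Words are countable, so the elements of the limit embed into the type in which the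
  strictness statements ask for a group.\<close>

definition encode :: "(nat => letter list) => nat => int" where
	"encode x = (%i. int (to_nat (x i)))"

lemma inj_encode: "inj_on encode A"
	by(rule inj_onI) (simp add: encode_def fun_eq_iff)

lemma transport_encode:
	assumes "group L"
	shows "group (transport_group encode L)" "encode : hom L (transport_group encode L)"
		"inv_into (carrier L) encode : hom (transport_group encode L) L"
		"!!x. x : carrier (transport_group encode L) ==> encode (inv_into (carrier L) encode x) = x"
		"!!x. x : carrier L ==> inv_into (carrier L) encode (encode x) = x"
	using transport_group[OF assms inj_encode] by(simp_all add: f_inv_into_f inv_into_f_f inj_encode)

theorem inverse_limit_slender_not_n_slender:
	"EX G :: (nat => int) monoid. inverse_limit_slender TYPE('h) G & ~ n_slender G"
proof -
	note t = transport_encode[OF group_bounded_grp]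
	have "inverse_limit_slender TYPE('h) (transport_group encode bounded_grp)"
		by(rule inverse_limit_slender_retract[OF inverse_limit_slender_bounded_grp t(1,3,2)]) (rule t(4))
	moreover have "~ n_slender (transport_group encode bounded_grp)"
	proof
		assume "n_slender (transport_group encode bounded_grp)"
		from n_slender_retract[OF this group_bounded_grp t(2,3)] t(5) not_n_slender_bounded_grp show False by metis
	qed
	ultimately show ?thesis by blast
qed

theorem slender_not_inverse_limit_slender:
	assumes inf: "infinite (UNIV :: 'h set)"
	shows "EX G :: (nat => int) monoid. slender G & ~ inverse_limit_slender TYPE('h) G"
proof -
	note t = transport_encode[OF group_free_limit]
	have "slender (transport_group encode free_limit)" by(rule slender_retract[OF slender_free_limit t(1,3,2)]) (rule t(4))
	moreover have "~ inverse_limit_slender TYPE('h) (transport_group encode free_limit)"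
	proof
		assume "inverse_limit_slender TYPE('h) (transport_group encode free_limit)"
		from inverse_limit_slender_retract[OF this group_free_limit t(2,3)] t(5) not_inverse_limit_slender_free_limit[OF inf] show False by metis
	qed
	ultimately show ?thesis by blast
qed

section \<open>Abelian slender groups are n-slender\<close>

definition tail :: "nat => complex set" where
	"tail n = insert 0 (UN k:{n..}. earring_circle k)"

text \<open>As \<open>collapse n z\<close> is \<open>z\<close> or 0, so is the difference, with the
  roles of the first \<open>n\<close> circles and the others exchanged; the subtraction makes
  continuity immediate.\<close>

definition tail_map :: "nat => complex => complex" where
	"tail_map n z = z - collapse n z"

lemma zero_earring: "0 : earring_circle k" "0 : earring" "0 : bouquet n" "0 : tail n"
	by(auto simp: mem_earring_circle hawaiian_earring_def bouquet_def tail_def)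

lemma tail_subset: "tail n <= earring" "m <= n ==> tail n <= tail m"
	using zero_earring(1) by(auto simp: tail_def hawaiian_earring_def)

lemma circle_bouquet: "z : earring_circle k ==> z ~= 0 ==> z : bouquet n \<longleftrightarrow> k < n"
	using circle_index[of z k] circle_index[of z] by(auto simp: bouquet_def)

lemma circle_maps:
	assumes "z : earring_circle k"
	shows "collapse n z = (if k < n then z else 0)" "tail_map n z = (if k < n then 0 else z)"
	using circle_bouquet[OF assms, of n] by(cases "z = 0"; auto simp: collapse_def tail_map_def)+

lemma earring_maps:
	assumes "z : earring"
	shows "collapse n z : earring" "tail_map n z : tail n"
proof -
	obtain k where k: "z : earring_circle k" using assms by(rule earring_circleE)
	show "collapse n z : earring" "tail_map n z : tail n"
		using k zero_earring by(auto simp: circle_maps[OF k] hawaiian_earring_def tail_def)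
qed

lemma continuous_tail_map: "continuous_on earring (tail_map n)"
	unfolding tail_map_def by(intro continuous_intros continuous_collapse)

lemma loops_compose:
	assumes "p : loops S 0" "continuous_on S f" "f ` S <= T" "f 0 = 0"
	shows "f o p : loops T 0"
	using loopsD[OF assms(1)] assms(2-4) path_continuous_image[of p f] continuous_on_subset[of S f "path_image p"]
	by(auto simp: loops_def pathstart_compose pathfinish_compose path_image_compose)

lemma norm_circle: "z : earring_circle k ==> norm z <= 2 / (real k + 1)"
proof -
	assume "z : earring_circle k"
	hence "(real k + 1) * (norm z)\<^sup>2 <= 2 * norm z" using complex_Re_le_cmod[of z] by(simp add: mem_earring_circle)
	hence "z ~= 0 ==> (real k + 1) * norm z <= 2" by(simp add: power2_eq_square)
	thus ?thesis by(cases "z = 0") (simp_all add: pos_le_divide_eq mult.commute)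
qed

lemma norm_tail: "z : tail n ==> norm z <= 2 / (real n + 1)"
proof -
	assume "z : tail n"
	then consider "z = 0" | k where "n <= k" "z : earring_circle k" by(auto simp: tail_def)
	thus ?thesis
	proof cases
		case 2
		have "2 / (real k + 1) <= 2 / (real n + 1)" using 2(1) by(intro divide_left_mono) auto
		thus ?thesis using norm_circle[OF 2(2)] by linarith
	qed simp
qed

text \<open>The circles from \<open>K\<close> on lie in a disc of radius \<open>2 / (K + 1)\<close>,
  so the tail is an intersection of sets made of finitely many circles and a disc.\<close>

lemma closed_tail: "closed (tail n)"
proof -
	have "tail n = (\<Inter>K. (UN k:{n..<K}. earring_circle k) Un cball 0 (2 / (real K + 1)))"
	proof(intro equalityI subsetI INT_I)
		fix z K assume z: "z : tail n"
		show "z : (UN k:{n..<K}. earring_circle k) Un cball 0 (2 / (real K + 1))"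
		proof(cases "z : (UN k:{n..<K}. earring_circle k)")
			case False
			hence "z : tail K" using z by(auto simp: tail_def not_less)
			thus ?thesis using norm_tail by simp
		qed simp
	next
		fix z assume z: "z : (\<Inter>K. (UN k:{n..<K}. earring_circle k) Un cball 0 (2 / (real K + 1)))"
		show "z : tail n"
		proof(cases "z = 0")
			case False
			obtain K :: nat where K: "2 / norm z < real K" using reals_Archimedean2 by blast
			hence "2 < (real K + 1) * norm z" using False by(simp add: divide_less_eq algebra_simps) (meson add_strict_increasing norm_ge_zero less_imp_le order_less_le_trans zero_less_norm_iff)
			hence "~ norm z <= 2 / (real K + 1)" by(simp add: pos_le_divide_eq mult.commute)
			moreover have "z : (UN k:{n..<K}. earring_circle k) Un cball 0 (2 / (real K + 1))" using z by blast
			ultimately show ?thesis by(auto simp: tail_def)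
		qed (simp add: zero_earring)
	qed
	moreover have "closed ((UN k:{n..<K}. earring_circle k) Un cball 0 (2 / (real K + 1)))" for K
		by(intro closed_Un closed_UN) (auto simp: earring_circle_def)
	hence "closed (\<Inter>K. (UN k:{n..<K}. earring_circle k) Un cball 0 (2 / (real K + 1)))" by(intro closed_INT ballI)
	ultimately show ?thesis by(simp only:)
qed

text \<open>In the coordinate \<open>1 / z\<close> a circle is a vertical line, the antipode its real point, and the
  homotopy pushes each half line to infinity.\<close>

lemma homotopic_tail_map:
	assumes q: "q : loops earring 0" and avoid: "path_image q Int antipode ` {..<n} = {}"
	shows "homotopic_paths earring q (tail_map n o q)"
proof -
	\<comment> \<open>In complex notation \<open>d s z = (1 - s) - i s sgn (Im z) z\<close>, hence
	  \<open>1 / D0 s z = 1 / z - i (s / (1 - s)) sgn (Im z)\<close> for \<open>s < 1\<close>: the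
	  imaginary part of \<open>1 / z\<close> is pushed away from zero, to infinity as \<open>s\<close>
	  tends to 1.\<close>
	define d where "d s z = Complex ((1 - s) + s * abs (Im z)) (- (s * sgn (Im z) * Re z))" for s :: real and z
	define D0 where "D0 s z = of_real (1 - s) * z / d s z" for s z
	define D where "D s z = (if z : bouquet n & z ~= 0 then D0 s z else z)" for s z
	define A where "A = {a :: real \<times> complex. fst a : {0..1} & snd a : earring - antipode ` {..<n}}"
	have d: "d s z ~= 0" "1 - s <= norm (d s z)" if s: "s : {0..1}" and z: "Im z ~= 0" for s z
	proof -
		have "0 < (1 - s) + s * abs (Im z)" using s z by(cases "s = 1") (auto intro: add_pos_nonneg)
		thus "d s z ~= 0" by(auto simp: d_def complex_eq_iff)
		have "1 - s <= Re (d s z)" using s by(simp add: d_def)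
		thus "1 - s <= norm (d s z)" using complex_Re_le_cmod[of "d s z"] by linarith
	qed
	have Im: "Im z ~= 0" if "z : earring_circle k" "z ~= 0" "k < n" "z ~: antipode ` {..<n}" for z k
		using real_earring[OF that(1,2)] that(3,4) by auto
	have D_circle: "D s z = (if k < n & z ~= 0 then D0 s z else z)" if "z : earring_circle k" for s z k
		using circle_bouquet[OF that, of n] by(auto simp: D_def)
	have norm_D: "norm (D s z) <= norm z" if a: "(s, z) : A" for s z
	proof -
		have s: "s : {0..1}" and z: "z : earring" "z ~: antipode ` {..<n}" using a by(auto simp: A_def)
		obtain k where k: "z : earring_circle k" using z(1) by(rule earring_circleE)
		show ?thesis
		proof(cases "k < n & z ~= 0")
			case True
			note dz = d[OF s Im[OF k _ _ z(2)]]
			have "norm (D0 s z) = (1 - s) / norm (d s z) * norm z" using s norm_of_real[of "1 - s", where 'a = complex] by(simp add: D0_def norm_mult norm_divide)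
			also have "... <= 1 * norm z" using dz True s by(intro mult_right_mono) (auto simp: divide_le_eq_1)
			finally show ?thesis using True by(simp add: D_circle[OF k])
		qed (auto simp: D_circle[OF k])
	qed
	have D_mem: "D s z : earring_circle k" if s: "s : {0..1}" and k: "z : earring_circle k" and z: "z ~: antipode ` {..<n}" for s z k
	proof(cases "k < n & z ~= 0")
		case True
		note dz = d(1)[OF s Im[OF k _ _ z]]
		have "(norm (D0 s z))\<^sup>2 = (1 - s)\<^sup>2 * (norm z)\<^sup>2 / (norm (d s z))\<^sup>2"
			using s norm_of_real[of "1 - s", where 'a = complex]
			by(simp add: D0_def norm_mult norm_divide power_mult_distrib power_divide)
		moreover have "Re (D0 s z) = (1 - s)\<^sup>2 * Re z / (norm (d s z))\<^sup>2"
		proof -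
			have "Re (D0 s z) = Re (of_real (1 - s) * z * cnj (d s z)) / (norm (d s z))\<^sup>2"
				unfolding D0_def by(simp add: Re_divide cmod_power2 algebra_simps)
			also have "Re (of_real (1 - s) * z * cnj (d s z)) = (1 - s)\<^sup>2 * Re z"
				by(simp add: d_def power2_eq_square algebra_simps abs_sgn sgn_if)
			finally show ?thesis .
		qed
		moreover have "(real k + 1) * (norm z)\<^sup>2 = 2 * Re z" using k by(simp add: mem_earring_circle)
		hence "((real k + 1) * (norm z)\<^sup>2) * ((1 - s)\<^sup>2 / (norm (d s z))\<^sup>2) = 2 * Re z * ((1 - s)\<^sup>2 / (norm (d s z))\<^sup>2)" by simp
		ultimately have "(real k + 1) * (norm (D0 s z))\<^sup>2 = 2 * Re (D0 s z)" by(simp only: times_divide_eq_left times_divide_eq_right mult_ac)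
		thus ?thesis using True by(simp add: D_circle[OF k] mem_earring_circle)
	qed (use k D_circle[OF k] in auto)
	have cont: "continuous_on A (%a. D (fst a) (snd a))"
		unfolding continuous_on_def
	proof
		fix a assume a: "a : A"
		obtain s z where e: "a = (s, z)" by(cases a)
		have s: "s : {0..1}" and z: "z : earring" "z ~: antipode ` {..<n}" using a by(auto simp: A_def e)
		have l: "((%a. snd a) \<longlongrightarrow> z) (at a within A)" "((%a. fst a) \<longlongrightarrow> s) (at a within A)"
			by(auto intro!: tendsto_eq_intros simp: e)
		have inA: "eventually (%a. a : A) (at a within A)" by(simp add: eventually_at_topological) blast
		show "((%a. D (fst a) (snd a)) \<longlongrightarrow> D (fst a) (snd a)) (at a within A)"
		proof(cases "z = 0")
			case True
			have "((%a. D (fst a) (snd a)) \<longlongrightarrow> 0) (at a within A)"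
			proof(rule Lim_null_comparison)
				show "eventually (%a. norm (D (fst a) (snd a)) <= norm (snd a)) (at a within A)"
					using inA by eventually_elim (simp add: norm_D)
				show "((%a. norm (snd a)) \<longlongrightarrow> 0) (at a within A)" using tendsto_norm[OF l(1)] True by simp
			qed
			thus ?thesis using True by(simp add: e D_def)
		next
			case False
			obtain k where k: "z : earring_circle k" using z(1) by(rule earring_circleE)
			have "eventually (%a. snd a ~= 0 & (snd a : earring --> snd a : earring_circle k)) (at a within A)"
				using circle_index_const[OF k False] l(1) by(rule eventually_compose_filterlim)
			with inA have ev: "eventually (%a. snd a ~= 0 & snd a : earring_circle k) (at a within A)"
				by eventually_elim (auto simp: A_def)
			show ?thesis
			proof(cases "k < n")
				case True
				have "d s z ~= 0" by(rule d(1)[OF s Im[OF k False True z(2)]])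
				have "((%a. D0 (fst a) (snd a)) \<longlongrightarrow> D0 s z) (at a within A)"
					unfolding D0_def d_def
					by(intro tendsto_intros l) (use Im[OF k False True z(2)] `d s z ~= 0` in "auto simp: d_def")
				moreover have "eventually (%a. D0 (fst a) (snd a) = D (fst a) (snd a)) (at a within A)"
					using ev by eventually_elim (simp add: D_circle[of _ k] True)
				ultimately show ?thesis using True False by(simp add: e D_circle[OF k] Lim_transform_eventually)
			next
				case False
				have "eventually (%a. snd a = D (fst a) (snd a)) (at a within A)"
					using ev by eventually_elim (simp add: D_circle[of _ k] False)
				from Lim_transform_eventually[OF l(1) this] show ?thesis using False by(simp add: e D_circle[OF k])
			qed
		qed
	qed
	have qt: "q t : earring - antipode ` {..<n}" if "t : {0..1}" for t
		using that avoid loopsD(2)[OF q] unfolding path_image_def by blast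
	show ?thesis
		unfolding homotopic_paths
	proof(intro exI[of _ "%a. D (fst a) (q (snd a))"] conjI ballI)
		have "continuous_on ({0..1} \<times> {0..1}) (%a :: real \<times> real. (fst a, q (snd a)))"
			by(intro continuous_on_Pair continuous_on_compose2[OF loopsD(1)[OF q, unfolded path_def]]
				continuous_on_fst continuous_on_snd continuous_on_id) auto
		moreover have "(fst a, q (snd a)) : A" if "a : {0..1} \<times> {0..1}" for a :: "real \<times> real"
			using qt[of "snd a"] that by(auto simp: A_def)
		hence "(%a. (fst a, q (snd a))) ` ({0..1} \<times> {0..1}) <= A" by(rule image_subsetI)
		ultimately have "continuous_on ({0..1} \<times> {0..1}) (%a. D (fst (fst a, q (snd a))) (snd (fst a, q (snd a))))"
			by(rule continuous_on_compose2[OF cont])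
		thus "continuous_on ({0..1} \<times> {0..1}) (%a. D (fst a) (q (snd a)))" by simp
		show "(%a. D (fst a) (q (snd a))) : {0..1} \<times> {0..1} \<rightarrow> earring"
		proof
			fix a :: "real \<times> real" assume a: "a : {0..1} \<times> {0..1}"
			hence m: "q (snd a) : earring - antipode ` {..<n}" by(intro qt) auto
			then obtain k where k: "q (snd a) : earring_circle k" using earring_circleE by blast
			have "D (fst a) (q (snd a)) : earring_circle k" by(rule D_mem[OF _ k]) (use a m in auto)
			thus "D (fst a) (q (snd a)) : earring" by(auto simp: hawaiian_earring_def)
		qed
		have d0: "d 0 z = 1" for z by(simp add: d_def complex_eq_iff)
		show "D (fst (0, t)) (q (snd (0::real, t))) = q t" for t by(simp add: D_def D0_def d0)
		show "D (fst (1, t)) (q (snd (1::real, t))) = (tail_map n o q) t" for t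
			by(simp add: D_def D0_def tail_map_def collapse_def)
		show "pathstart ((%a. D (fst a) (q (snd a))) o Pair s) = pathstart q" "pathfinish ((%a. D (fst a) (q (snd a))) o Pair s) = pathfinish q"
			for s using loopsD(3,4)[OF q] by(simp_all add: pathstart_def pathfinish_def D_def)
	qed
qed

section \<open>Values of loops in an abelian group\<close>

locale earring_abelian = comm_group G for G :: "'a monoid" (structure) +
	fixes \<phi>
	assumes \<phi>: "\<phi> : hom earring_group G"
begin

definition val :: "(real => complex) => 'a" where
	"val p = \<phi> (path_class earring p)"

lemma val_closed: "p : loops earring 0 ==> val p : carrier G"
	using \<phi> by(auto simp: val_def hom_def fundamental_group_def)

lemma val_join:
	assumes "p : loops earring 0" "q : loops earring 0"
	shows "val (p +++ q) = val p**val q"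
	unfolding val_def fundamental_group_mult[OF assms, symmetric]
	by(rule hom_mult[OF \<phi>]) (use assms in "auto simp: fundamental_group_def")

lemma val_homotopic: "homotopic_paths earring p q ==> val p = val q"
	by(simp add: val_def path_class_eq)

lemma val_const: "val (%_. 0) = \<one>"
	using hom_one[OF \<phi> group_fundamental_group[OF zero_earring(2)] is_group] by(simp add: val_def fundamental_group_def)

lemma val_reverse:
	assumes p: "p : loops earring 0"
	shows "val (reversepath p) = inv (val p)"
proof -
	have "val (reversepath p +++ p) = val (linepath 0 0)"
		using homotopic_paths_linv[of p earring] loopsD[OF p] by(intro val_homotopic) simp
	hence "val (reversepath p)**val p = \<one>" using val_join[OF loops_reverse[OF p] p] val_const by(simp add: linepath_refl)
	thus ?thesis using val_closed[OF p] val_closed[OF loops_reverse[OF p]] inv_equality by metis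
qed

text \<open>Factors may be sorted in an abelian group, but a loop can return to 0 infinitely often.
  The identity is proved between any two zeros: directly if the stretch stays on one circle, by
  \<open>homotopic_tail_map\<close> if it misses the first \<open>n\<close> antipodes. Subdivision
  reduces to these cases, since near a time at such an antipode there is no zero at all.\<close>

lemma val_split:
	assumes p: "p : loops earring 0"
	shows "val p = val (collapse n o p)**val (tail_map n o p)"
proof -
	note lp = loopsD[OF p]
	have col: "continuous_on earring (collapse n)" "collapse n ` earring <= earring" "collapse n 0 = 0"
		by(rule continuous_collapse image_subsetI earring_maps(1) | assumption | simp add: collapse_def)+
	have tm: "continuous_on earring (tail_map n)" "tail_map n ` earring <= earring" "tail_map n 0 = 0"
		by(rule continuous_tail_map image_subsetI subsetD[OF tail_subset(1) earring_maps(2)] | assumption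
			| simp add: tail_map_def collapse_def)+
	have sl: "subpath u v p : loops earring 0" if "u : {0..1}" "v : {0..1}" "p u = 0" "p v = 0" for u v
		using path_subpath[OF lp(1) that(1,2)] path_image_subpath_subset[OF that(1,2), of p] lp(2) that(3,4)
		by(auto simp: loops_def)
	define E where "E u v \<longleftrightarrow> val (subpath u v p) = val (collapse n o subpath u v p)**val (tail_map n o subpath u v p)" for u v
	have add: "val (f o subpath u w p) = val (f o subpath u v p)**val (f o subpath v w p)"
		if f: "continuous_on earring f" "f ` earring <= earring" "f 0 = 0"
			and u: "u : {0..1}" "v : {0..1}" "w : {0..1}" "u <= v" "v <= w" "p u = 0" "p v = 0" "p w = 0" for f u v w
	proof -
		have "homotopic_paths earring (subpath u v p +++ subpath v w p) (subpath u w p)"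
			by(rule homotopic_join_subpaths1[OF lp(1,2) u(1-5)])
		from val_homotopic[OF homotopic_paths_continuous_image[OF this f(1)]] f(2)
		have "val (f o (subpath u v p +++ subpath v w p)) = val (f o subpath u w p)" by auto
		moreover have "val (f o (subpath u v p +++ subpath v w p)) = val (f o subpath u v p)**val (f o subpath v w p)"
			unfolding path_compose_join by(intro val_join loops_compose[OF sl f] u)
		ultimately show ?thesis by simp
	qed
	have E_trans: "E u w" if e: "E u v" "E v w"
		and u: "u : {0..1}" "v : {0..1}" "w : {0..1}" "u <= v" "v <= w" "p u = 0" "p v = 0" "p w = 0" for u v w
	proof -
		note c = val_closed[OF loops_compose[OF sl col]] val_closed[OF loops_compose[OF sl tm]]
		have "val (subpath u w p) = val (subpath u v p)**val (subpath v w p)"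
			using add[of "%z. z", OF _ _ _ u] by(auto simp: comp_def)
		also have "... = (val (collapse n o subpath u v p)**val (collapse n o subpath v w p)) **
			(val (tail_map n o subpath u v p)**val (tail_map n o subpath v w p))"
			using e[unfolded E_def] u c by(simp add: m_ac)
		also have "... = val (collapse n o subpath u w p)**val (tail_map n o subpath u w p)"
			using add[OF col u] add[OF tm u] by simp
		finally show ?thesis by(simp add: E_def)
	qed
	have E_circle: "E u v" if u: "u : {0..1}" "v : {0..1}" "u <= v" "p u = 0" "p v = 0"
		and k: "!!t. t : {u..v} ==> p t : earring_circle k" for u v k
	proof -
		have m: "subpath u v p t : earring_circle k" if "t : {0..1}" for t
		proof -
			have "(v - u) * t <= (v - u) * 1" "0 <= (v - u) * t" using that u(3) by(intro mult_left_mono mult_nonneg_nonneg; simp)+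
			thus ?thesis unfolding subpath_def by(intro k) simp
		qed
		note s = sl[OF u(1,2,4,5)]
		have h: "val (f o subpath u v p) = val r" if "!!t. t : {0..1} ==> f (subpath u v p t) = r t"
			and "continuous_on earring f" "f ` earring <= earring" "f 0 = 0" for f r
			using loopsD[OF loops_compose[OF s that(2-4)]] that(1) by(intro val_homotopic homotopic_paths_eq) auto
		show ?thesis
		proof(cases "k < n")
			case True
			have "val (collapse n o subpath u v p) = val (subpath u v p)" by(rule h[OF _ col]) (simp add: circle_maps[OF m] True)
			moreover have "val (tail_map n o subpath u v p) = val (%_. 0)" by(rule h[OF _ tm]) (simp add: circle_maps[OF m] True)
			ultimately show ?thesis using val_closed[OF s] by(simp add: E_def val_const)
		next
			case False
			have "val (collapse n o subpath u v p) = val (%_. 0)" by(rule h[OF _ col]) (simp add: circle_maps[OF m] False)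
			moreover have "val (tail_map n o subpath u v p) = val (subpath u v p)" by(rule h[OF _ tm]) (simp add: circle_maps[OF m] False)
			ultimately show ?thesis using val_closed[OF s] by(simp add: E_def val_const)
		qed
	qed
	have E_single: "E u v" if u: "u : {0..1}" "v : {0..1}" "u <= v" "p u = 0" "p v = 0"
		and nz: "!!t. u < t ==> t < v ==> p t ~= 0" for u v
	proof -
		have "EX k. ALL t:{u<..<v}. p t : earring_circle k"
		proof(cases "u < v")
			case True
			let ?m = "(u + v) / 2"
			have pe: "p t : earring" if "t : {u<..<v}" for t using lp(2) that u(1,2) by(auto simp: path_image_def)
			have m: "?m : {u<..<v}" using True by auto
			have "circle_index (p ?m) = circle_index (p t)" if t: "t : {u<..<v}" for t
			proof(rule connected_local_const[OF _ m t, of "%t. circle_index (p t)"])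
				show "ALL x:{u<..<v}. eventually (%y. circle_index (p x) = circle_index (p y)) (at x within {u<..<v})"
				proof
					fix x assume x: "x : {u<..<v}"
					obtain k where k: "p x : earring_circle k" by(rule earring_circleE[OF pe[OF x]])
					have px: "p x ~= 0" using nz x by auto
					have "continuous_on {u<..<v} p"            by(rule continuous_on_subset[OF lp(1)[unfolded path_def]]) (use u(1,2) in auto)
					moreover have "p ` {u<..<v} <= earring" using pe by(rule image_subsetI)
					moreover have "eventually (%y. y : earring --> y ~= 0 & y : earring_circle k) (nhds (p x))"
						using circle_index_const[OF k px] by eventually_elim simp
					ultimately have "eventually (%y. y : {u<..<v} --> p y ~= 0 & p y : earring_circle k) (nhds x)"
						by(rule eventually_comp[OF _ _ x])
					thus "eventually (%y. circle_index (p x) = circle_index (p y)) (at x within {u<..<v})"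
						unfolding eventually_at_filter by eventually_elim (use circle_index[OF k px] circle_index in auto)
				qed
			qed simp
			hence "p t : earring_circle (circle_index (p ?m))" if t: "t : {u<..<v}" for t
				using that earring_circleE[OF pe[OF t]] circle_index nz by(metis greaterThanLessThan_iff)
			thus ?thesis by blast
		qed auto
		then obtain k where k: "ALL t:{u<..<v}. p t : earring_circle k" by blast
		show ?thesis
		proof(rule E_circle[OF u, of k])
			fix t assume t: "t : {u..v}"
			show "p t : earring_circle k"
				using k t u(4,5) zero_earring(1) by(cases "t = u | t = v") auto
		qed
	qed
	have E_small: "E u v" if u: "u : {0..1}" "v : {0..1}" "p u = 0" "p v = 0"
		and av: "path_image (subpath u v p) Int antipode ` {..<n} = {}" for u v
	proof -
		note s = sl[OF u]
		have "val (subpath u v p) = val (tail_map n o subpath u v p)" by(rule val_homotopic[OF homotopic_tail_map[OF s av]])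
		moreover have "val (collapse n o subpath u v p) = \<one>"
		proof -
			have "path_image (collapse n o subpath u v p) <= insert 0 (path_image (subpath u v p))"
				by(auto simp: path_image_def collapse_def)
			hence "path_image (collapse n o subpath u v p) Int antipode ` {..<n} = {}" using av antipode_nonzero by force
			from val_homotopic[OF homotopic_tail_map[OF loops_compose[OF s col] this]]
			have "val (collapse n o subpath u v p) = val (tail_map n o (collapse n o subpath u v p))" .
			also have "tail_map n o (collapse n o subpath u v p) = (%_. 0)"
				by(auto simp: fun_eq_iff tail_map_def collapse_def zero_earring)
			finally show ?thesis by(simp only: val_const)
		qed
		ultimately show ?thesis using val_closed[OF loops_compose[OF s tm]] by(simp add: E_def)
	qed
	define R where "R a b \<longleftrightarrow> 0 <= a --> b <= 1 --> (ALL u v. a <= u --> u <= v --> v <= b --> p u = 0 --> p v = 0 --> E u v)" for a b :: real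
	have cp: "continuous_on {0..1} p" using lp(1) by(simp add: path_def)
	have zeros: "compact {t : {x..y}. p t = 0}" if "0 <= x" "y <= 1" for x y
	proof -
		have "continuous_on {x..y} p" by(rule continuous_on_subset[OF cp]) (use that in auto)
		hence "closedin (top_of_set {x..y}) ({x..y} Int p -` {0})" by(rule continuous_closedin_preimage) simp
		moreover have "{x..y} Int p -` {0} = {t : {x..y}. p t = 0}" by auto
		ultimately show ?thesis using closedin_compact[of "{x..y}"] by simp
	qed
	have "R 0 1"
	proof(rule Bolzano)
		show "R a c" if r: "R a b" "R b c" "a <= b" "b <= c" for a b c
			unfolding R_def
		proof(intro impI allI)
			fix u v assume h: "0 <= a" "c <= 1" "a <= u" "u <= v" "v <= c" "p u = 0" "p v = 0"
			consider "v <= b" | "b <= u" | "u <= b" "b <= v" by linarith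
			thus "E u v"
			proof cases
				case 1 thus ?thesis using r h unfolding R_def by auto
			next
				case 2 thus ?thesis using r h unfolding R_def by auto
			next
				case 3
				\<comment> \<open>The last zero up to \<open>b\<close> and the first one from \<open>b\<close>
				  on cut the stretch into three. The outer two lie in the given intervals; the middle one has no
				  zero inside and so stays on one circle.\<close>
				have "{t : {u..b}. p t = 0} ~= {}" using 3 h by auto
				from compact_attains_sup[OF zeros this] obtain u1 where u1: "u1 : {u..b}" "p u1 = 0" "!!t. t : {u..b} ==> p t = 0 ==> t <= u1"
					using h r by auto
				have "{t : {b..v}. p t = 0} ~= {}" using 3 h by auto
				from compact_attains_inf[OF zeros this] obtain v1 where v1: "v1 : {b..v}" "p v1 = 0" "!!t. t : {b..v} ==> p t = 0 ==> v1 <= t"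
					using h r by auto
				have 1: "E u u1" using r(1) h u1 r(3,4) unfolding R_def by auto
				have 2: "E v1 v" using r(2) h v1 r(3,4) unfolding R_def by auto
				have 3: "E u1 v1"
				proof(rule E_single)
					fix t assume t: "u1 < t" "t < v1"
					show "p t ~= 0"
					proof
						assume "p t = 0"
						thus False using u1(3)[of t] v1(3)[of t] t u1(1) v1(1) by(cases "t <= b") auto
					qed
				qed (use u1 v1 h in auto)
				have 4: "E u v1" by(rule E_trans[OF 1 3]) (use u1 v1 h in auto)
				show "E u v" by(rule E_trans[OF 4 2]) (use u1 v1 h in auto)
			qed
		qed
		show "EX d>0. ALL a b. a <= x & x <= b & b - a < d --> R a b" if x: "0 <= x" "x <= 1" for x
		proof -
			define O' where "O' = (if p x : antipode ` {..<n} then - {0} else - antipode ` {..<n})"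
			have "open O'" unfolding O'_def by(auto intro!: open_Compl finite_imp_closed)
			moreover have "p x : O'" using antipode_nonzero by(auto simp: O'_def)
			moreover have "x : {0..1}" using x by simp
			ultimately have "EX B. open B & x : B & (ALL y:{0..1}. y : B --> p y : O')"
				using cp[unfolded continuous_on_topological, THEN bspec, of x] by blast
			then obtain B where B: "open B" "x : B" "ALL y:{0..1}. y : B --> p y : O'" by(elim exE conjE)
			obtain e where e: "e > 0" "ball x e <= B" using B(1,2) open_contains_ball by blast
			show ?thesis
			proof(intro exI[of _ e] conjI allI impI e(1))
				fix a b assume ab: "a <= x & x <= b & b - a < e"
				show "R a b"
					unfolding R_def
				proof(intro impI allI)
					fix u v assume h: "0 <= a" "b <= 1" "a <= u" "u <= v" "v <= b" "p u = 0" "p v = 0"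
					have pO: "p y : O'" if "y : {u..v}" for y
					proof -
						have "y : ball x e" using that ab h by(auto simp: dist_real_def)
						thus ?thesis using B(3) e(2) that h by auto
					qed
					have "p x ~: antipode ` {..<n}" using pO[of u] h by(auto simp: O'_def split: if_splits)
					hence O': "O' = - antipode ` {..<n}" by(simp add: O'_def)
					have "p ` {u..v} <= O'" using pO by(rule image_subsetI)
					moreover have "path_image (subpath u v p) = p ` {u..v}" using h by(simp add: path_image_subpath)
					ultimately have "path_image (subpath u v p) Int antipode ` {..<n} = {}" unfolding O' by blast
					thus "E u v" using h by(intro E_small) auto
				qed
			qed
		qed
	qed simp
	hence "E 0 1" using lp(3,4) unfolding R_def by(simp add: pathstart_def pathfinish_def)
	thus ?thesis by(simp add: E_def subpath_trivial)
qed

section \<open>Infinite concatenations of loops\<close>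

primrec loop_pow :: "nat => (real => complex) => real => complex" where
	"loop_pow 0 q = (%_. 0)"
| "loop_pow (Suc k) q = q +++ loop_pow k q"

lemma loop_pow_loops: "q : loops S 0 ==> 0 : S ==> loop_pow k q : loops S 0"
	by(induction k) (simp_all add: loops_const loops_join)

lemma val_loop_pow: "q : loops earring 0 ==> val (loop_pow k q) = val q [^] k"
	by(induction k) (simp_all add: val_const val_join loop_pow_loops zero_earring val_closed m_comm)

lemma loop_pow_limit:
	assumes "!!t. t : {0..1} ==> (%m. q m t) \<longlonglongrightarrow> q' t" "t : {0..1}"
	shows "(%m. loop_pow k (q m) t) \<longlonglongrightarrow> loop_pow k q' t"
	using assms(2) by(induction k arbitrary: t) (auto simp: joinpaths_def intro!: assms(1))

lemma loop_pow_dist: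
	assumes "!!t. t : {0..1} ==> dist (q t) (q' t) <= e" "0 <= e" "t : {0..1}"
	shows "dist (loop_pow k q t) (loop_pow k q' t) <= e"
	using assms(3) by(induction k arbitrary: t) (auto simp: joinpaths_def assms(2) intro!: assms(1))

lemma loops_tail: "q : loops (tail n) 0 ==> q : loops earring 0"
	using tail_subset(1) by(auto simp: loops_def)

text \<open>\<open>Z m n\<close> is the recursion cut off after \<open>m\<close> levels. Further
  levels change it only inside the tail from \<open>n + m\<close> on, whose points have norm at most
  \<open>2 / (n + m + 1)\<close>; so the truncations converge uniformly, and the recursion passes to
  the limit pointwise.\<close>

lemma infinite_loops:
	assumes B: "!!n. B n : loops (tail n) 0"
	obtains z where "!!n. z n : loops (tail n) 0" "!!n. val (z n) = val (B n)**val (z (Suc n)) [^] Suc n"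
proof -
	define Z where "Z = rec_nat (%n _. 0) (%m Z n. B n +++ loop_pow (Suc n) (Z (Suc n)))"
	have Z0: "Z 0 n = (%_. 0)" and ZS: "Z (Suc m) n = B n +++ loop_pow (Suc n) (Z m (Suc n))" for m n by(simp_all add: Z_def)
	have Zl: "Z m n : loops (tail n) 0" for m n
	proof(induction m arbitrary: n)
		case 0 show ?case unfolding Z0 by(rule loops_const[OF zero_earring(4)])
	next
		case (Suc m)
		have "Z m (Suc n) : loops (tail n) 0" using Suc[of "Suc n"] tail_subset(2)[of n "Suc n"] by(auto simp: loops_def)
		thus ?case unfolding ZS by(intro loops_join B loop_pow_loops zero_earring)
	qed
	have dist: "dist (Z m n t) (Z m' n t) <= 2 / (real n + real m + 1)" if "m <= m'" "t : {0..1}" for m m' n t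
		using that
	proof(induction m arbitrary: n m' t)
		case 0
		have "Z m' n t : tail n" using loopsD(2)[OF Zl[of m' n]] 0 by(auto simp: path_image_def)
		thus ?case using norm_tail by(simp add: Z0)
	next
		case (Suc m)
		then obtain m'' where m': "m' = Suc m''" "m <= m''" by(cases m') auto
		have IH: "dist (Z m (Suc n) t) (Z m'' (Suc n) t) <= 2 / (real n + real (Suc m) + 1)" if "t : {0..1}" for t
			using Suc.IH[OF m'(2) that, of "Suc n"] by(simp add: add.assoc add.commute add.left_commute)
		have "dist (loop_pow (Suc n) (Z m (Suc n)) t) (loop_pow (Suc n) (Z m'' (Suc n)) t) <= 2 / (real n + real (Suc m) + 1)"
			if "t : {0..1}" for t by(rule loop_pow_dist[OF IH _ that]) simp_all
		thus ?case unfolding m' ZS using Suc.prems(2) by(auto simp: joinpaths_def simp del: loop_pow.simps)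
	qed
	have conv: "convergent (%m. Z m n t)" if "t : {0..1}" for n t
	proof(rule Cauchy_convergent, rule metric_CauchyI)
		fix e :: real assume e: "e > 0"
		obtain M :: nat where M: "2 / e < real M" using reals_Archimedean2 by blast
		have "dist (Z m n t) (Z m' n t) < e" if mm: "M <= m" "m <= m'" for m m'
		proof -
			have "2 < e * real M" using M e by(simp add: divide_less_eq mult.commute)
			also have "... <= e * (real n + real m + 1)" using mm e by(intro mult_left_mono) auto
			finally have "2 / (real n + real m + 1) < e" by(simp add: divide_less_eq)
			thus ?thesis using dist[OF mm(2) `t : {0..1}`, of n] by linarith
		qed
		note small = this
		have "dist (Z m n t) (Z m' n t) < e" if "M <= m" "M <= m'" for m m'
		proof(cases "m <= m'")
			case False
			hence "dist (Z m' n t) (Z m n t) < e" using that(2) by(intro small) auto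
			thus ?thesis by(simp add: dist_commute)
		qed (rule small[OF that(1)])
		thus "EX M. ALL m>=M. ALL m'>=M. dist (Z m n t) (Z m' n t) < e" by(intro exI[of _ M]) simp
	qed
	define z where "z n t = lim (%m. Z m n t)" for n t
	have lim: "(%m. Z m n t) \<longlonglongrightarrow> z n t" if "t : {0..1}" for n t
		using conv[OF that] by(simp add: z_def convergent_LIMSEQ_iff)
	have zl: "z n : loops (tail n) 0" for n
	proof -
		have "continuous_on {0..1} (z n)"
		proof(rule uniform_limit_theorem)
			show "eventually (%m. continuous_on {0..1} (Z m n)) sequentially" using loopsD(1)[OF Zl] by(simp add: path_def)
			show "uniform_limit {0..1} (%m. Z m n) (z n) sequentially"
			proof(rule uniform_limitI)
				fix e :: real assume e: "e > 0"
				obtain M :: nat where M: "2 / e < real M" using reals_Archimedean2 by blast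
				show "eventually (%m. ALL t:{0..1}. dist (Z m n t) (z n t) < e) sequentially"
					using eventually_ge_at_top[of M]
				proof eventually_elim
					case (elim m)
					show ?case
					proof
						fix t :: real assume t: "t : {0..1}"
						have "dist (Z m n t) (z n t) <= 2 / (real n + real m + 1)"
						proof(rule tendsto_upperbound)
							show "(%m'. dist (Z m n t) (Z m' n t)) \<longlonglongrightarrow> dist (Z m n t) (z n t)" by(intro tendsto_intros lim t)
							show "eventually (%m'. dist (Z m n t) (Z m' n t) <= 2 / (real n + real m + 1)) sequentially"
								using eventually_ge_at_top[of m] by eventually_elim (rule dist[OF _ t])
						qed simp
						also have "... < e"
						proof -
							have "2 < e * real M" using M e by(simp add: divide_less_eq mult.commute)
							also have "... <= e * (real n + real m + 1)" using elim e by(intro mult_left_mono) auto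
							finally show ?thesis by(simp add: divide_less_eq)
						qed
						finally show "dist (Z m n t) (z n t) < e" .
					qed
				qed
			qed
		qed simp
		moreover have "z n t : tail n" if "t : {0..1}" for t
		proof(rule closed_sequentially[OF closed_tail _ lim[OF that]])
			show "Z m n t : tail n" for m using loopsD(2)[OF Zl[of m n]] that by(auto simp: path_image_def)
		qed
		moreover have "z n i = 0" if "i = 0 | i = 1" for i
		proof(rule LIMSEQ_unique[OF lim])
			have "Z m n i = 0" for m using loopsD(3,4)[OF Zl[of m n]] that by(auto simp: pathstart_def pathfinish_def)
			thus "(%m. Z m n i) \<longlonglongrightarrow> 0" by simp
		qed (use that in auto)
		ultimately show ?thesis by(auto simp: loops_def path_def path_image_def pathstart_def pathfinish_def)
	qed
	have "val (z n) = val (B n)**val (z (Suc n)) [^] Suc n" for n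
	proof -
		note l = loops_tail[OF B[of n]] loop_pow_loops[OF loops_tail[OF zl[of "Suc n"]] zero_earring(2), of "Suc n"]
		have "z n t = (B n +++ loop_pow (Suc n) (z (Suc n))) t" if t: "t : {0..1}" for t
		proof(rule LIMSEQ_unique)
			show "(%m. Z (Suc m) n t) \<longlonglongrightarrow> z n t" using lim[OF t] by(rule LIMSEQ_Suc)
			have "(%m. loop_pow (Suc n) (Z m (Suc n)) t) \<longlonglongrightarrow> loop_pow (Suc n) (z (Suc n)) t" if "t : {0..1}" for t
				by(rule loop_pow_limit[OF lim that])
			thus "(%m. Z (Suc m) n t) \<longlonglongrightarrow> (B n +++ loop_pow (Suc n) (z (Suc n))) t"
				unfolding ZS using t by(auto simp: joinpaths_def simp del: loop_pow.simps)
		qed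
		hence "val (z n) = val (B n +++ loop_pow (Suc n) (z (Suc n)))"
			using loopsD(1,2)[OF loops_tail[OF zl[of n]]] by(intro val_homotopic homotopic_paths_eq) auto
		thus ?thesis using val_join[OF l] val_loop_pow[OF loops_tail[OF zl[of "Suc n"]], of "Suc n"] by simp
	qed
	with zl show ?thesis by(rule that)
qed

lemma val_int_pow:
	assumes q: "q : loops (tail n) 0"
	shows "EX r:loops (tail n) 0. val r = val q [^] (a::int)"
proof(cases "a >= 0")
	case True
	have "val (loop_pow (nat a) q) = val q [^] a"
		using val_loop_pow[OF loops_tail[OF q], of "nat a"] True by(simp flip: int_pow_int)
	thus ?thesis using loop_pow_loops[OF q zero_earring(4)] by blast
next
	case False
	have r: "reversepath q : loops (tail n) 0" by(rule loops_reverse[OF q])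
	have "val q [^] a = inv (val q [^] nat (- a))"
		using False val_closed[OF loops_tail[OF q]] int_pow_neg[of "val q" "int (nat (- a))"] by(simp add: int_pow_int)
	hence "val (loop_pow (nat (- a)) (reversepath q)) = val q [^] a"
		using val_loop_pow[OF loops_tail[OF r], of "nat (- a)"] val_reverse[OF loops_tail[OF q]] val_closed[OF loops_tail[OF q]]
		by(simp add: nat_pow_inv)
	thus ?thesis using loop_pow_loops[OF r zero_earring(4)] by blast
qed

text \<open>The quotient of two solutions is a chain as in \<open>reduced\<close>, so the solution
  is unique and its initial value is additive in \<open>a\<close>. For the unit vector
  \<open>m\<close> a solution can be written down, with initial value \<open>y m\<close> to the
  power \<open>m!\<close>. If slenderness kills it, \<open>y m\<close> generates a finite subgroup,
  which has to be trivial.\<close>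

lemma tail_killed:
	assumes G: "slender G"
	shows "EX n. ALL q:loops (tail n) 0. val q = \<one>"
proof(rule ccontr)
	assume "~ ?thesis"
	then obtain \<beta> where \<beta>: "!!n. \<beta> n : loops (tail n) 0" "!!n. val (\<beta> n) ~= \<one>" by metis
	define y where "y n = val (\<beta> n)" for n
	have yc: "y n : carrier G" for n unfolding y_def by(rule val_closed[OF loops_tail[OF \<beta>(1)]])
	define S where "S a x \<longleftrightarrow> (EX z. (ALL n. z n : carrier G & z n = y n [^] (a n)**z (Suc n) [^] Suc n) & z 0 = x)" for a :: "nat => int" and x
	have ex: "EX x. S a x" for a
	proof -
		have "EX r. r : loops (tail n) 0 & val r = y n [^] a n" for n using val_int_pow[OF \<beta>(1)[of n], of "a n"] by(auto simp: y_def)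
		then obtain B where B: "!!n. B n : loops (tail n) 0" "!!n. val (B n) = y n [^] a n" by metis
		obtain d where d: "!!n. d n : loops (tail n) 0" "!!n. val (d n) = val (B n)**val (d (Suc n)) [^] Suc n"
			by(erule infinite_loops[of B, OF B(1)])
		show ?thesis unfolding S_def
			by(intro exI[of _ "val (d 0)"] exI[of _ "%n. val (d n)"] conjI allI refl val_closed loops_tail d(1))
				(rule d(1), rule d(2)[unfolded B(2)])
	qed
	have uniq: "x = x'" if xs: "S a x" "S a x'" for a x x'
	proof -
		obtain z where z: "!!n. z n : carrier G" "!!n. z n = y n [^] (a n)**z (Suc n) [^] Suc n" "z 0 = x" using xs(1) unfolding S_def by metis
		obtain z' where z': "!!n. z' n : carrier G" "!!n. z' n = y n [^] (a n)**z' (Suc n) [^] Suc n" "z' 0 = x'" using xs(2) unfolding S_def by metis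
		define w where "w n = z n**inv (z' n)" for n
		have "w n = w (Suc n) [^] Suc n" for n
		proof -
			let ?c = "y n [^] a n" and ?u = "z (Suc n) [^] Suc n" and ?v = "z' (Suc n) [^] Suc n"
			have c: "?c : carrier G" "?u : carrier G" "?v : carrier G" using yc z(1) z'(1) by(simp_all del: nat_pow_Suc)
			have "w n = (?c**?u)**inv (?c**?v)" unfolding w_def using z(2)[of n] z'(2)[of n] by metis
			also have "... = ?u**inv ?v" using c by(simp add: inv_mult m_ac del: nat_pow_Suc) (simp add: m_assoc[symmetric] del: nat_pow_Suc)
			also have "... = w (Suc n) [^] Suc n" by(simp only: w_def nat_pow_distrib[OF z(1) inv_closed[OF z'(1)]] nat_pow_inv[OF z'(1)])
			finally show ?thesis .
		qed
		moreover have "w n : carrier G" for n using z(1) z'(1) by(simp add: w_def)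
		ultimately have "w 0 = \<one>" using slender_reduced[OF G] unfolding reduced_def by blast
		hence "z 0 = z' 0" using inv_equality[of "z 0" "inv (z' 0)"] z(1) z'(1) by(simp add: w_def)
		thus ?thesis using z(3) z'(3) by simp
	qed
	define F where "F a = (THE x. S a x)" for a
	have F: "F a = x" if "S a x" for a x unfolding F_def using that uniq by blast
	have SF: "S a (F a)" for a using ex[of a] F by metis
	have "F : hom int_seq G"
	proof(rule homI)
		fix a b
		show "F a : carrier G" using SF[of a] unfolding S_def by metis
		obtain z where z: "!!n. z n : carrier G" "!!n. z n = y n [^] (a n)**z (Suc n) [^] Suc n" "z 0 = F a" using SF[of a] unfolding S_def by metis
		obtain z' where z': "!!n. z' n : carrier G" "!!n. z' n = y n [^] (b n)**z' (Suc n) [^] Suc n" "z' 0 = F b" using SF[of b] unfolding S_def by metis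
		have "z n**z' n = y n [^] (a n + b n)**(z (Suc n)**z' (Suc n)) [^] Suc n" for n
		proof -
			let ?u = "z (Suc n) [^] Suc n" and ?v = "z' (Suc n) [^] Suc n"
			have c: "?u : carrier G" "?v : carrier G" using z(1) z'(1) by(simp_all del: nat_pow_Suc)
			have "z n**z' n = (y n [^] (a n)**?u)**(y n [^] (b n)**?v)" using z(2)[of n] z'(2)[of n] by metis
			also have "... = y n [^] (a n + b n)**(?u**?v)" using c yc by(simp add: int_pow_mult m_ac del: nat_pow_Suc)
			also have "?u**?v = (z (Suc n)**z' (Suc n)) [^] Suc n" by(simp only: nat_pow_distrib[OF z(1) z'(1)])
			finally show ?thesis .
		qed
		note eq = this
		have "S (%i. a i + b i) (F a**F b)"
			unfolding S_def
		proof(intro exI[of _ "%n. z n**z' n"] conjI allI)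
			show "z n**z' n : carrier G" for n using z(1) z'(1) by(rule m_closed)
			show "z 0**z' 0 = F a**F b" by(simp only: z(3) z'(3))
		qed (rule eq)
		from F[OF this] show "F (a **\<^bsub>int_seq\<^esub> b) = F a**F b" by simp
	qed
	then obtain m where m: "F (int_unit m) = \<one>" by(rule slender_unit[OF G])
	\<comment> \<open>This is \<open>m! / n!\<close> for \<open>n \<le> m\<close>, the exponent
	  produced by substituting the equations from \<open>m\<close> down to \<open>n\<close>.\<close>
	define e where "e n = \<Prod>{Suc n..m}" for n :: nat
	have e: "e n = e (Suc n) * Suc n" if "n < m" for n
		unfolding e_def using that by(subst prod.atLeast_Suc_atMost) (auto simp: mult.commute)
	define z where "z n = (if n <= m then y m [^] e n else \<one>)" for n
	have "z n = y n [^] (int_unit m n)**z (Suc n) [^] Suc n" for n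
	proof -
		consider "n < m" | "n = m" | "m < n" by linarith
		thus ?thesis
		proof cases
			case 1
			have "y m [^] e n = (y m [^] e (Suc n)) [^] Suc n" by(simp only: nat_pow_pow[OF yc] e[OF 1])
			thus ?thesis using 1 yc by(simp add: z_def int_unit_def del: nat_pow_Suc)
		next
			case 2 thus ?thesis using yc by(simp add: z_def int_unit_def e_def)
		next
			case 3 thus ?thesis by(simp add: z_def int_unit_def)
		qed
	qed
	note eq = this
	have "S (int_unit m) (y m [^] e 0)"
		unfolding S_def
	proof(intro exI[of _ z] conjI allI)
		show "z n : carrier G" for n using yc by(simp add: z_def)
		show "z 0 = y m [^] e 0" by(simp add: z_def)
	qed (rule eq)
	hence ye: "y m [^] e 0 = \<one>" using F m by simp
	have e0: "e 0 > 0" unfolding e_def by(intro prod_pos) auto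
	let ?T = "range (%i::int. y m [^] i)"
	have "subgroup ?T G"
	proof(rule subgroupI)
		show "?T <= carrier G" using yc by auto
		show "inv a : ?T" if "a : ?T" for a using that yc by(auto simp: int_pow_neg[symmetric])
		show "a**b : ?T" if "a : ?T" "b : ?T" for a b using that yc by(auto simp: int_pow_mult[symmetric])
	qed simp
	moreover have "y m [^] i : (%i. y m [^] i) ` {0..<int (e 0)}" for i :: int
	proof -
		have "y m [^] i = y m [^] (int (e 0) * (i div int (e 0)) + i mod int (e 0))" by simp
		also have "... = y m [^] (i mod int (e 0))"
			using yc ye by(simp only: int_pow_mult int_pow_pow[symmetric] int_pow_int int_pow_one l_one int_pow_closed)
		finally show ?thesis using e0 by auto
	qed
	hence "finite ?T" by(intro finite_subset[of ?T "(%i. y m [^] i) ` {0..<int (e 0)}"]) auto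
	ultimately have "?T = {\<one>}" by(rule lch_slender_no_finite_subgroup[OF slender_imp_lch_slender[OF G]])
	moreover have "y m [^] (1::int) : ?T" by(rule rangeI)
	ultimately have "y m [^] (1::int) = \<one>" by(simp only: singleton_iff)
	thus False using yc \<beta>(2)[of m] by(simp add: y_def)
qed

end

text \<open>Once the tail is killed, \<open>val p\<close> equals the value of the collapsed loop, so
  the factor on the bouquet group is \<phi> after the map induced by the inclusion of the
  bouquet.\<close>

theorem slender_imp_n_slender:
	assumes G: "slender G" and comm: "comm_group G"
	shows "n_slender G"
	unfolding n_slender_def
proof(intro conjI ballI)
	show gG: "group G" using G by(simp add: slender_def)
	fix \<phi> assume \<phi>: "\<phi> : hom earring_group G"
	interpret earring_abelian G \<phi> using comm \<phi> by(simp add: earring_abelian_def earring_abelian_axioms_def)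
	obtain n where n: "ALL q:loops (tail n) 0. val q = one G" using tail_killed[OF G] by blast
	have sub: "bouquet n <= earring" using zero_earring(2) by(auto simp: bouquet_def hawaiian_earring_def)
	have "induced_map earring (%z. z) : hom (bouquet_group n) (fundamental_group earring ((%z. z) 0))"
		by(rule induced_map_hom) (use sub in auto)
	hence "(%A. \<phi> (induced_map earring (%z. z) A)) : hom (bouquet_group n) G" using \<phi> by(simp add: hom_def Pi_def)
	moreover have "\<phi> x = \<phi> (induced_map earring (%z. z) (earring_proj n x))" if x: "x : carrier earring_group" for x
	proof -
		obtain p where p: "p : loops earring 0" "x = path_class earring p" using x by(auto simp: fundamental_group_def)
		have col: "continuous_on earring (collapse n)" "collapse n ` earring <= bouquet n" "collapse n 0 = 0"
			by(rule continuous_collapse) (auto simp: collapse_def zero_earring)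
		have "tail_map n o p : loops (tail n) 0"
			by(rule loops_compose[OF p(1) continuous_tail_map]) (use earring_maps(2) in "auto simp: tail_map_def collapse_def")
		hence "val (tail_map n o p) = one G" using n by blast
		moreover have "val (collapse n o p) : carrier G"
			by(rule val_closed[OF loops_compose[OF p(1) col(1) _ col(3)]]) (use col(2) sub in blast)
		ultimately have "val p = val (collapse n o p)" using val_split[OF p(1), of n] by simp
		also have "path_class earring (collapse n o p) = induced_map earring (%z. z) (path_class (bouquet n) (collapse n o p))"
			using induced_map_path_class[OF _ _ loops_compose[OF p(1) col], of "%z. z" earring] sub by(simp add: comp_def)
		hence "val (collapse n o p) = \<phi> (induced_map earring (%z. z) (path_class (bouquet n) (collapse n o p)))" by(simp add: val_def)
		also have "path_class (bouquet n) (collapse n o p) = earring_proj n x"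
			unfolding p(2) by(rule induced_map_path_class[OF col(1,2) p(1), symmetric])
		finally show ?thesis by(simp add: val_def p(2))
	qed
	ultimately show "EX n. EX g:hom (bouquet_group n) G. ALL x:carrier earring_group. \<phi> x = g (earring_proj n x)"
		by(intro exI[of _ n] bexI[of _ "%A. \<phi> (induced_map earring (%z. z) A)"]) simp_all
qed


theorem theorem2:
  assumes "infinite (UNIV :: 'h set)"
  shows
    "(\<forall>G :: 'g monoid. n_slender G \<longrightarrow> inverse_limit_slender TYPE('h) G) \<and>
     (\<forall>G :: 'g monoid. inverse_limit_slender TYPE('h) G \<longrightarrow> slender G) \<and>
     (\<forall>G :: 'g monoid. slender G \<longrightarrow> lch_slender TYPE('l) G) \<and>
     (\<exists>G :: (nat \<Rightarrow> int) monoid. inverse_limit_slender TYPE('h) G \<and> \<not> n_slender G) \<and>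
     (\<exists>G :: (nat \<Rightarrow> int) monoid. slender G \<and> \<not> inverse_limit_slender TYPE('h) G) \<and>
     (\<exists>G :: (nat \<Rightarrow> int) monoid. lch_slender TYPE('l) G \<and> \<not> slender G) \<and>
     (\<forall>G :: 'g monoid. comm_group G \<longrightarrow>
        (n_slender G \<longleftrightarrow> inverse_limit_slender TYPE('h) G) \<and>
        (inverse_limit_slender TYPE('h) G \<longleftrightarrow> slender G))"
  using n_slender_imp_inverse_limit_slender inverse_limit_slender_imp_slender[OF assms] slender_imp_lch_slender
    inverse_limit_slender_not_n_slender slender_not_inverse_limit_slender[OF assms]
    lch_slender_int_seq not_slender_int_seq slender_imp_n_slender
  by (intro conjI allI impI iffI) blast+

end
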